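(* Let $K$ be a $\mathrm{GL}$-field over $k$ and let $M$ be a finitely generated $K$-module. Then there exist $n \ge 0$ and partitions $\lambda_1, \ldots, \lambda_r$ such that $\mathrm{Sh}_n(M)$ is isomorphic to $\bigoplus_{i=1}^r \mathrm{Sh}_n(K)^{\oplus \lambda_i}$ as a $\mathrm{Sh}_n(K)$-module.
   Context: Let $k$ be a field of characteristic $0$, $\mathrm{GL}=\bigcup_{n\ge 1}\mathrm{GL}_n(k)$ (a discrete group), and $\mathbf V=\bigcup_{n\ge1}k^n$ its standard representation. A $k$-linear representation of $\mathrm{GL}$ is polynomial if it is a subquotient of a (possibly infinite) direct sum of tensor powers of $\mathbf V$. For a $k$-linear representation $W$, $W^{\mathrm{pol}}$ denotes its maximal polynomial subrepresentation. For a partition $\lambda$, $\mathbf S_\lambda$ is the Schur functor, $k^{\oplus\lambda}:=\mathbf S_\lambda(\mathbf V)$, and $U^{\oplus\lambda}:=U\otimes_k k^{\oplus\lambda}$ for a $k$-vector space $U$. A $\mathrm{GL}$-field over $k$ is a field extension $K/k$ with an action of $\mathrm{GL}$ by $k$-automorphisms such that every element of $K$ has the form $a/b$ with $a,b\in K^{\mathrm{pol}}$. A $K$-module is a semi-linear representation $M$ of $\mathrm{GL}$ over $K$ (a $K$-vector space with an additive $\mathrm{GL}$-action satisfying $g(am)=(ga)(gm)$) such that every element of $M$ has the form $ax$ with $a\in K$, $x\in M^{\mathrm{pol}}$; morphisms are $K$-linear $\mathrm{GL}$-equivariant maps. $K^{\oplus\lambda}$ is a $K$-module with the diagonal $\mathrm{GL}$-action.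 $M$ is finitely generated if it is spanned over $K$ by the $\mathrm{GL}$-orbits of finitely many elements. Let $G(n)\subset\mathrm{GL}$ be the subgroup of block matrices $\begin{pmatrix}1&0\\0&*\end{pmatrix}$ with top left block the $n\times n$ identity; $A\mapsto\begin{pmatrix}1&0\\0&A\end{pmatrix}$ is an isomorphism $\mathrm{GL}\cong G(n)$. For an object $X$ with a $\mathrm{GL}$-action, $\mathrm{Sh}_n(X)$ is $X$ with $\mathrm{GL}$ acting through $\mathrm{GL}\cong G(n)\subset\mathrm{GL}$. Then $\mathrm{Sh}_n(K)$ is a $\mathrm{GL}$-field and $\mathrm{Sh}_n(M)$ is a $\mathrm{Sh}_n(K)$-module. *)

theory Defs
  imports
    Complex_Main
    "HOL-Library.Poly_Mapping"
    "HOL-Combinatorics.Permutations"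
begin

subsection \<open>The infinite general linear group\<close>

text \<open>
  Elements of \<open>GL = \<Union>n. GL_n(k)\<close> are infinite matrices, indexed by pairs of naturals, that agree
  with the identity outside some invertible \<open>n \<times> n\<close> block in the top left corner.
\<close>

type_synonym 'k mtx = "nat \<Rightarrow> nat \<Rightarrow> 'k"

definition mtx_one :: "'k::field mtx" where
  "mtx_one i j = (if i = j then 1 else 0)"

text \<open>The sum below is finite as soon as the rows of \<open>A\<close> have finite support.\<close>

definition mtx_mult :: "'k::field mtx \<Rightarrow> 'k mtx \<Rightarrow> 'k mtx" where
  "mtx_mult A B i j = (\<Sum>l | A i l \<noteq> 0. A i l * B l j)"

definition mtx_block :: "nat \<Rightarrow> 'k::field mtx set" where
  "mtx_block n = {A. \<forall>i j. n \<le> i \<or> n \<le> j \<longrightarrow> A i j = mtx_one i j}"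

definition GLn :: "nat \<Rightarrow> 'k::field mtx set" where
  "GLn n = {A \<in> mtx_block n. \<exists>B \<in> mtx_block n. mtx_mult A B = mtx_one \<and> mtx_mult B A = mtx_one}"

definition GL :: "'k::field mtx set" where
  "GL = (\<Union>n\<in>{1..}. GLn n)"

text \<open>The isomorphism of \<open>GL\<close> with \<open>G(n)\<close>, and the shift of an action along it.\<close>

definition block_shift :: "nat \<Rightarrow> 'k::field mtx \<Rightarrow> 'k mtx" where
  "block_shift n A i j = (if i < n \<or> j < n then mtx_one i j else A (i - n) (j - n))"

definition Sh :: "nat \<Rightarrow> ('k::field mtx \<Rightarrow> 'x \<Rightarrow> 'x) \<Rightarrow> 'k mtx \<Rightarrow> 'x \<Rightarrow> 'x" where
  "Sh n \<rho> g = \<rho> (block_shift n g)"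

definition GL_action :: "('k::field mtx \<Rightarrow> 'x \<Rightarrow> 'x) \<Rightarrow> bool" where
  "GL_action \<rho> \<longleftrightarrow> (\<forall>x. \<rho> mtx_one x = x) \<and>
     (\<forall>g\<in>GL. \<forall>h\<in>GL. \<forall>x. \<rho> (mtx_mult g h) x = \<rho> g (\<rho> h x))"

subsection \<open>Tensor powers of the standard representation\<close>

text \<open>
  \<open>V\<close> has basis \<open>e_0, e_1, ...\<close>, with \<open>g e_j = \<Sum>i. g_{ij} e_i\<close>. Hence \<open>V^{\<otimes>d}\<close> has basis
  \<open>e_js = e_{js_1} \<otimes> ... \<otimes> e_{js_d}\<close> for the lists \<open>js\<close> of length \<open>d\<close>, and an element of
  \<open>L \<otimes>_k V^{\<otimes>d}\<close>, for a field extension \<open>L\<close> of \<open>k\<close>, is a finitely supported \<open>L\<close>-valued function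
  on these lists.
\<close>

definition smul :: "'l::field \<Rightarrow> ('x \<Rightarrow>\<^sub>0 'l) \<Rightarrow> ('x \<Rightarrow>\<^sub>0 'l)" where
  "smul a = Poly_Mapping.map ((*) a)"

definition tensor_power :: "nat \<Rightarrow> (nat list \<Rightarrow>\<^sub>0 'l::field) set" where
  "tensor_power d = {t. \<forall>js \<in> Poly_Mapping.keys t. length js = d}"

definition tensor_coeff :: "'k::field mtx \<Rightarrow> nat list \<Rightarrow> nat list \<Rightarrow> 'k" where
  "tensor_coeff g is js = (\<Prod>p<length js. g (is ! p) (js ! p))"

text \<open>
  The diagonal action \<open>a \<otimes> e_js \<mapsto> \<tau>(a) \<otimes> g e_js\<close>, where \<open>\<tau>\<close> is the way \<open>g\<close> acts on \<open>L\<close> and \<open>\<iota>\<close> is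
  the embedding of \<open>k\<close> in \<open>L\<close>. For \<open>L = k\<close> and \<open>\<iota> = \<tau> = id\<close> this is the action on tensor powers of \<open>V\<close>.
  The inner sum is finite because the columns of \<open>g\<close> have finite support.
\<close>

definition tensor_act ::
  "('k::field \<Rightarrow> 'l::field) \<Rightarrow> ('l \<Rightarrow> 'l) \<Rightarrow> 'k mtx \<Rightarrow> (nat list \<Rightarrow>\<^sub>0 'l) \<Rightarrow> (nat list \<Rightarrow>\<^sub>0 'l)" where
  "tensor_act \<iota> \<tau> g t =
     (\<Sum>js \<in> Poly_Mapping.keys t. \<Sum>is | length is = length js \<and> tensor_coeff g is js \<noteq> 0.
        Poly_Mapping.single is (\<iota> (tensor_coeff g is js) * \<tau> (Poly_Mapping.lookup t js)))"

text \<open>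
  An element of a direct sum is a finitely supported family of tensors; scalars and group elements
  act componentwise.
\<close>

definition sum_smul :: "'l::field \<Rightarrow> ('i \<Rightarrow>\<^sub>0 (nat list \<Rightarrow>\<^sub>0 'l)) \<Rightarrow> ('i \<Rightarrow>\<^sub>0 (nat list \<Rightarrow>\<^sub>0 'l))" where
  "sum_smul a = Poly_Mapping.map (smul a)"

definition sum_act ::
  "('k::field \<Rightarrow> 'l::field) \<Rightarrow> ('k mtx \<Rightarrow> 'l \<Rightarrow> 'l) \<Rightarrow> 'k mtx \<Rightarrow>
     ('i \<Rightarrow>\<^sub>0 (nat list \<Rightarrow>\<^sub>0 'l)) \<Rightarrow> ('i \<Rightarrow>\<^sub>0 (nat list \<Rightarrow>\<^sub>0 'l))" where
  "sum_act \<iota> \<sigma> g = Poly_Mapping.map (tensor_act \<iota> (\<sigma> g) g)"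

definition tensor_sum :: "('i \<Rightarrow> nat) \<Rightarrow> ('i \<Rightarrow>\<^sub>0 (nat list \<Rightarrow>\<^sub>0 'l::field)) set" where
  "tensor_sum d = {t. \<forall>i. Poly_Mapping.lookup t i \<in> tensor_power (d i)}"

subsection \<open>Polynomial representations\<close>

text \<open>
  A representation is given by scalar multiplication \<open>s\<close> and action \<open>\<rho>\<close> on a type; \<open>is_subrep s \<rho> U\<close>
  means that \<open>U\<close> is a subrepresentation.
\<close>

definition is_subrep ::
  "('k::field \<Rightarrow> 'w::ab_group_add \<Rightarrow> 'w) \<Rightarrow> ('k mtx \<Rightarrow> 'w \<Rightarrow> 'w) \<Rightarrow> 'w set \<Rightarrow> bool" where
  "is_subrep s \<rho> U \<longleftrightarrow> module.subspace s U \<and> (\<forall>g\<in>GL. \<forall>u\<in>U. \<rho> g u \<in> U)"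

definition hom_on ::
  "('l \<Rightarrow> 'v::ab_group_add \<Rightarrow> 'v) \<Rightarrow> ('k::field mtx \<Rightarrow> 'v \<Rightarrow> 'v) \<Rightarrow> 'v set \<Rightarrow>
     ('l \<Rightarrow> 'w::ab_group_add \<Rightarrow> 'w) \<Rightarrow> ('k mtx \<Rightarrow> 'w \<Rightarrow> 'w) \<Rightarrow> ('v \<Rightarrow> 'w) \<Rightarrow> bool" where
  "hom_on s \<rho> X s' \<rho>' \<phi> \<longleftrightarrow>
     (\<forall>x\<in>X. \<forall>y\<in>X. \<phi> (x + y) = \<phi> x + \<phi> y) \<and>
     (\<forall>a. \<forall>x\<in>X. \<phi> (s a x) = s' a (\<phi> x)) \<and>
     (\<forall>g\<in>GL. \<forall>x\<in>X. \<phi> (\<rho> g x) = \<rho>' g (\<phi> x))"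

text \<open>
  \<open>U\<close> is polynomial if it is a quotient of a subrepresentation \<open>X\<close> of a direct sum of tensor powers,
  i.e. the image of such an \<open>X\<close> under a \<open>GL\<close>-equivariant \<open>k\<close>-linear map. Taking the index set of the
  direct sum to be \<open>'w \<times> nat\<close> is no restriction: choose for each \<open>u \<in> U\<close> one preimage; each preimage
  meets only finitely many summands, so at most \<open>card U * \<aleph>_0\<close> summands are needed, and summands that
  are not needed do no harm.
\<close>

definition is_polynomial_subrep ::
  "('k::field \<Rightarrow> 'w::ab_group_add \<Rightarrow> 'w) \<Rightarrow> ('k mtx \<Rightarrow> 'w \<Rightarrow> 'w) \<Rightarrow> 'w set \<Rightarrow> bool" where
  "is_polynomial_subrep s \<rho> U \<longleftrightarrow> is_subrep s \<rho> U \<and>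
     (\<exists>(d :: 'w \<times> nat \<Rightarrow> nat) X \<phi>.
        X \<subseteq> tensor_sum d \<and>
        is_subrep sum_smul (sum_act id (\<lambda>_. id)) X \<and>
        hom_on sum_smul (sum_act id (\<lambda>_. id)) X s \<rho> \<phi> \<and>
        \<phi> ` X = U)"

text \<open>
  The largest polynomial subrepresentation. A sum of polynomial subrepresentations is a quotient of
  their direct sum, hence polynomial; so the union of all of them is itself one of them.
\<close>

definition pol_part ::
  "('k::field \<Rightarrow> 'w::ab_group_add \<Rightarrow> 'w) \<Rightarrow> ('k mtx \<Rightarrow> 'w \<Rightarrow> 'w) \<Rightarrow> 'w set" where
  "pol_part s \<rho> = \<Union>{U. is_polynomial_subrep s \<rho> U}"

subsection \<open>GL-fields and their modules\<close>

locale GL_field =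
  fixes \<iota> :: "'k::field_char_0 \<Rightarrow> 'K::field"
    and \<sigma> :: "'k mtx \<Rightarrow> 'K \<Rightarrow> 'K"
  assumes embed_one: "\<iota> 1 = 1"
    and embed_add: "\<iota> (c + c') = \<iota> c + \<iota> c'"
    and embed_mult: "\<iota> (c * c') = \<iota> c * \<iota> c'"
    and field_action: "GL_action \<sigma>"
    and act_add: "g \<in> GL \<Longrightarrow> \<sigma> g (a + b) = \<sigma> g a + \<sigma> g b"
    and act_mult: "g \<in> GL \<Longrightarrow> \<sigma> g (a * b) = \<sigma> g a * \<sigma> g b"
    and act_embed: "g \<in> GL \<Longrightarrow> \<sigma> g (\<iota> c) = \<iota> c"
    and fraction_pol:
      "\<exists>a \<in> pol_part (\<lambda>c x. \<iota> c * x) \<sigma>. \<exists>b \<in> pol_part (\<lambda>c x. \<iota> c * x) \<sigma>. b \<noteq> 0 \<and> x = a / b"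

locale GL_module = GL_field \<iota> \<sigma> + vector_space scale
  for \<iota> :: "'k::field_char_0 \<Rightarrow> 'K::field"
    and \<sigma> :: "'k mtx \<Rightarrow> 'K \<Rightarrow> 'K"
    and scale :: "'K \<Rightarrow> 'm::ab_group_add \<Rightarrow> 'm" +
  fixes \<rho> :: "'k mtx \<Rightarrow> 'm \<Rightarrow> 'm"
  assumes module_action: "GL_action \<rho>"
    and module_act_add: "g \<in> GL \<Longrightarrow> \<rho> g (x + y) = \<rho> g x + \<rho> g y"
    and module_act_scale: "g \<in> GL \<Longrightarrow> \<rho> g (scale a x) = scale (\<sigma> g a) (\<rho> g x)"
    and multiple_pol: "\<exists>a. \<exists>y \<in> pol_part (\<lambda>c. scale (\<iota> c)) \<rho>. x = scale a y"

definition finitely_generated ::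
  "('K::field \<Rightarrow> 'm::ab_group_add \<Rightarrow> 'm) \<Rightarrow> ('k::field mtx \<Rightarrow> 'm \<Rightarrow> 'm) \<Rightarrow> bool" where
  "finitely_generated scale \<rho> \<longleftrightarrow>
     (\<exists>F. finite F \<and> module.span scale {\<rho> g x | g x. g \<in> GL \<and> x \<in> F} = UNIV)"

subsection \<open>Schur functors\<close>

definition is_partition :: "nat list \<Rightarrow> bool" where
  "is_partition \<mu> \<longleftrightarrow> sorted_wrt (\<ge>) \<mu> \<and> 0 \<notin> set \<mu>"

text \<open>
  The boxes (row, column) of the Young diagram in reading order; the \<open>p\<close>-th one carries the label
  \<open>p\<close> in the standard tableau used for the Young symmetrizer.
\<close>

definition boxes :: "nat list \<Rightarrow> (nat \<times> nat) list" where
  "boxes \<mu> = concat (map (\<lambda>r. map (\<lambda>c. (r, c)) [0..<\<mu> ! r]) [0..<length \<mu>])"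

definition row_group :: "nat list \<Rightarrow> (nat \<Rightarrow> nat) set" where
  "row_group \<mu> = {p. p permutes {..<sum_list \<mu>} \<and>
     (\<forall>i<sum_list \<mu>. fst (boxes \<mu> ! p i) = fst (boxes \<mu> ! i))}"

definition column_group :: "nat list \<Rightarrow> (nat \<Rightarrow> nat) set" where
  "column_group \<mu> = {q. q permutes {..<sum_list \<mu>} \<and>
     (\<forall>i<sum_list \<mu>. snd (boxes \<mu> ! q i) = snd (boxes \<mu> ! i))}"

text \<open>
  Right multiplication of \<open>V^{\<otimes>d}\<close> by \<open>c = (\<Sum>p\<in>row_group. p) * (\<Sum>q\<in>column_group. sign q * q)\<close>, where
  permutations act by \<open>(v_1 \<otimes> ... \<otimes> v_d) p = v_{p(1)} \<otimes> ... \<otimes> v_{p(d)}\<close>. The Schur functor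
  evaluated at \<open>V\<close> is the image.
\<close>

definition young_symmetrizer :: "nat list \<Rightarrow> (nat list \<Rightarrow>\<^sub>0 'k::field) \<Rightarrow> (nat list \<Rightarrow>\<^sub>0 'k)" where
  "young_symmetrizer \<mu> t =
     (\<Sum>p \<in> row_group \<mu>. \<Sum>q \<in> column_group \<mu>. \<Sum>js \<in> Poly_Mapping.keys t.
        Poly_Mapping.single (permute_list (p \<circ> q) js) (of_int (sign q) * Poly_Mapping.lookup t js))"

definition schur :: "nat list \<Rightarrow> (nat list \<Rightarrow>\<^sub>0 'k::field) set" where
  "schur \<mu> = young_symmetrizer \<mu> ` tensor_power (sum_list \<mu>)"

text \<open>
  \<open>K \<otimes>_k W\<close> for a \<open>k\<close>-subspace \<open>W\<close> of \<open>V^{\<otimes>d}\<close>: since \<open>K\<close> is flat over \<open>k\<close>, it is the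
  \<open>K\<close>-span of \<open>W\<close> inside \<open>K \<otimes>_k V^{\<otimes>d}\<close>.
\<close>

definition base_change ::
  "('k::field \<Rightarrow> 'K::field) \<Rightarrow> (nat list \<Rightarrow>\<^sub>0 'k) set \<Rightarrow> (nat list \<Rightarrow>\<^sub>0 'K) set" where
  "base_change \<iota> W = module.span smul (Poly_Mapping.map \<iota> ` W)"

text \<open>
  The carrier of the direct sum of the \<open>K \<otimes>_k S_\<mu>(V)\<close> for \<open>\<mu>\<close> in the list \<open>\<mu>s\<close>; it is equipped with
  \<open>sum_smul\<close> and with the diagonal action \<open>sum_act\<close>.
\<close>

definition schur_sum ::
  "('k::field \<Rightarrow> 'K::field) \<Rightarrow> nat list list \<Rightarrow> (nat \<Rightarrow>\<^sub>0 (nat list \<Rightarrow>\<^sub>0 'K)) set" where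
  "schur_sum \<iota> \<mu>s = {t. Poly_Mapping.keys t \<subseteq> {..<length \<mu>s} \<and>
     (\<forall>i<length \<mu>s. Poly_Mapping.lookup t i \<in> base_change \<iota> (schur (\<mu>s ! i)))}"

end

theory Submission
  imports
    Defs
    "HOL-Computational_Algebra.Polynomial"
begin

text \<open>
  A map \<open>V\<^sup>\<otimes>\<^sup>d \<rightarrow> M\<close> is polarizable: if some polynomial expression in values of such maps lies in a
  stable subspace, so does its multilinearization. By finite generation and the theory of Young
  symmetrizers over \<open>k\<close>, the module \<open>M\<close> is spanned over \<open>K\<close> by the values of finitely many maps
  \<open>S\<^sub>\<mu>(V) \<rightarrow> M\<close>. Let \<open>D\<close> be the largest degree that occurs. Clear denominators in a relation that involves
  a generator of degree \<open>D\<close>, polarize it, and insert the basis vectors that become invariant after a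
  shift by \<open>n\<close> into the coefficients; what remains is, modulo maps of degree less than \<open>D\<close>, a relation
  between the generators of degree \<open>D\<close> with coefficients that no longer depend on the arguments.
  Then the group algebra eliminates one of them. Hence, after a shift that minimizes their number,
  the generators of degree \<open>D\<close> are independent modulo the span of those of lower degree. This splits them
  off; the lower part becomes free after a further shift by induction on \<open>D\<close>, and the split part
  stays free because a shift of \<open>S\<^sub>\<mu>(V)\<close> is again a sum of Schur functors over \<open>k\<close>.
\<close>

subsection \<open>Young symmetrizers in the group algebra\<close>

text \<open>Polynomiality only provides quotients of subrepresentations of sums of tensor powers,
  and the quotient map is not given on the tensors outside. Polarization removes this obstacle: for
  an element of a stable subspace it produces maps from whole tensor powers into that subspace whose
  values span the element. The coefficients of a relation over \<open>K\<close> move under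
  \<open>GL\<close> as well. Once denominators are cleared they are themselves values of maps from
  tensor powers to \<open>K\<close>, so a coefficient times a generator is the value of one map on a
  longer word, and the relation is polarized as a whole. A polarized relation might be trivial,
  because a generator sees its coefficients only up to right multiplication by its Young
  symmetrizer; nontriviality is therefore always measured after this multiplication. The group
  algebra serves twice, over \<open>k\<close> to decompose tensor powers and over \<open>K\<close>
  to eliminate generators. The bridge between the two is that Young symmetrizers have integral
  coefficients.\<close>

typedef bijn = "{f :: nat \<Rightarrow> nat. bij f}" morphisms app Abs_bijn
  by (blast intro: bij_id)

setup_lifting type_definition_bijn

text \<open>Composition is written additively because the product of \<open>Poly_Mapping\<close>
  convolves along the addition of its exponents. So \<open>bijn \<Rightarrow>\<^sub>0 'f\<close> is
  a group algebra as it stands, and those of all \<open>Sym d\<close> lie in the same one.\<close>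

instantiation bijn :: group_add
begin

lift_definition zero_bijn :: bijn is id by (rule bij_id)
lift_definition plus_bijn :: "bijn \<Rightarrow> bijn \<Rightarrow> bijn" is "(\<circ>)" by (rule bij_comp)
lift_definition uminus_bijn :: "bijn \<Rightarrow> bijn" is inv by (rule bij_imp_bij_inv)
definition minus_bijn :: "bijn \<Rightarrow> bijn \<Rightarrow> bijn" where "minus_bijn g h = g + - h"

instance
proof
  fix a b c :: bijn
  show "a + b + c = a + (b + c)" by transfer (simp add: comp_assoc)
  show "0 + a = a" by transfer simp
  show "a + 0 = a" by transfer simp
  show "- a + a = 0" by transfer (simp add: bij_is_inj)
  show "a + - b = a - b" by (simp add: minus_bijn_def)
qed

end

lemma app_zero [simp]: "app 0 = id" by transfer simp
lemma app_plus [simp]: "app (g + h) = app g \<circ> app h" by transfer simp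
lemma app_uminus [simp]: "app (- g) = inv (app g)" by transfer simp
lemma app_minus [simp]: "app (g - h) = app g \<circ> inv (app h)"
  by (simp only: minus_bijn_def app_plus app_uminus)
lemma bij_app: "bij (app g)" using app by auto
lemma app_inv_app [simp]: "inv (app g) (app g i) = i"
  by (simp add: bij_app bij_is_inj)
lemma app_app_inv [simp]: "app g (inv (app g) i) = i"
  by (simp add: bij_app bij_is_surj surj_f_inv_f)
lemma app_eq_iff [simp]: "app g i = app g j \<longleftrightarrow> i = j"
  by (metis app_inv_app)
lemma bijn_eqI: "(\<And>i. app g i = app h i) \<Longrightarrow> g = h"
  by (metis app_inject ext)

section \<open>Finite symmetric groups inside the bijections of the naturals\<close>

definition Sym :: "nat \<Rightarrow> bijn set" where
  "Sym d = {g. app g permutes {..<d}}"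

definition of_perm :: "(nat \<Rightarrow> nat) \<Rightarrow> bijn" where "of_perm = Abs_bijn"

lemma app_of_perm: "p permutes {..<d} \<Longrightarrow> app (of_perm p) = p"
  by (simp add: of_perm_def Abs_bijn_inverse permutes_bij)

lemma of_perm_app [simp]: "of_perm (app g) = g"
  by (simp add: of_perm_def app_inverse)

lemma of_perm_Sym: "p permutes {..<d} \<Longrightarrow> of_perm p \<in> Sym d"
  by (simp add: Sym_def app_of_perm)

lemma Sym_image: "app ` Sym d = {p. p permutes {..<d}}"
  using app_of_perm of_perm_Sym by (auto simp: Sym_def image_iff) metis

lemma finite_Sym [simp]: "finite (Sym d)"
proof -
  have "finite (app ` Sym d)" by (simp add: Sym_image finite_permutations)
  moreover have "inj_on app (Sym d)" by (simp add: inj_on_def app_inject)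
  ultimately show ?thesis using finite_imageD by blast
qed

lemma Sym_zero [simp]: "0 \<in> Sym d" by (simp add: Sym_def permutes_id)
lemma Sym_plus [simp]: "g \<in> Sym d \<Longrightarrow> h \<in> Sym d \<Longrightarrow> g + h \<in> Sym d"
  by (simp add: Sym_def permutes_compose)
lemma Sym_uminus [simp]: "g \<in> Sym d \<Longrightarrow> - g \<in> Sym d"
  by (simp add: Sym_def permutes_inv)
lemma Sym_minus [simp]: "g \<in> Sym d \<Longrightarrow> h \<in> Sym d \<Longrightarrow> g - h \<in> Sym d"
  by (metis Sym_plus Sym_uminus add_uminus_conv_diff)

lemma Sym_less [simp]: "g \<in> Sym d \<Longrightarrow> app g i < d \<longleftrightarrow> i < d"
  using permutes_in_image[of "app g" "{..<d}" i] by (simp add: Sym_def)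
lemma Sym_inv_less [simp]: "g \<in> Sym d \<Longrightarrow> inv (app g) i < d \<longleftrightarrow> i < d"
  using Sym_less[OF Sym_uminus, of g d i] by simp
lemma Sym_outside: "g \<in> Sym d \<Longrightarrow> d \<le> i \<Longrightarrow> app g i = i"
  by (simp add: Sym_def permutes_def)

lemma Sym_eqI: "g \<in> Sym d \<Longrightarrow> h \<in> Sym d \<Longrightarrow> (\<And>i. i < d \<Longrightarrow> app g i = app h i) \<Longrightarrow> g = h"
  by (rule bijn_eqI) (metis Sym_outside not_less)

definition sgn_of :: "bijn \<Rightarrow> 'f::comm_ring_1" where
  "sgn_of g = of_int (sign (app g))"

lemma Sym_permutation: "g \<in> Sym d \<Longrightarrow> permutation (app g)"
  by (auto simp: Sym_def permutation_permutes)

lemma sgn_of_zero [simp]: "sgn_of 0 = 1" by (simp add: sgn_of_def sign_id)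
lemma sgn_of_plus: "g \<in> Sym d \<Longrightarrow> h \<in> Sym d \<Longrightarrow> sgn_of (g + h) = sgn_of g * sgn_of h"
  by (simp add: sgn_of_def sign_compose Sym_permutation)
lemma sgn_of_uminus: "g \<in> Sym d \<Longrightarrow> sgn_of (- g) = sgn_of g"
  by (simp add: sgn_of_def sign_inverse Sym_permutation)
lemma sgn_of_sq [simp]: "sgn_of g * sgn_of g = 1"
  by (simp add: sgn_of_def sign_idempotent flip: of_int_mult)

definition tr :: "nat \<Rightarrow> nat \<Rightarrow> bijn" where "tr i j = of_perm (transpose i j)"

lemma app_tr: "app (tr i j) = transpose i j"
  by (simp add: tr_def of_perm_def Abs_bijn_inverse)
lemma tr_Sym: "i < d \<Longrightarrow> j < d \<Longrightarrow> tr i j \<in> Sym d"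
  by (simp add: Sym_def app_tr permutes_swap_id)
lemma sgn_of_tr: "i \<noteq> j \<Longrightarrow> sgn_of (tr i j) = - 1"
  by (simp add: sgn_of_def app_tr sign_swap_id)

section \<open>Group algebras of symmetric groups\<close>

type_synonym 'f galg = "bijn \<Rightarrow>\<^sub>0 'f"

abbreviation gr :: "bijn \<Rightarrow> 'f::comm_ring_1 galg" where "gr g \<equiv> Poly_Mapping.single g 1"
abbreviation sc :: "'f \<Rightarrow> 'f::comm_ring_1 galg" where "sc c \<equiv> Poly_Mapping.single 0 c"

lemma lookup_galg_mult_superset:
  fixes x y :: "'f::comm_ring_1 galg"
  assumes "finite A" "Poly_Mapping.keys x \<subseteq> A"
  shows "Poly_Mapping.lookup (x * y) k =
    (\<Sum>g\<in>A. Poly_Mapping.lookup x g * Poly_Mapping.lookup y (- g + k))"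
proof -
  have eq: "(k = l + q) = (q = - l + k)" for l q :: bijn
    by (metis add.assoc add.left_neutral left_minus right_minus)
  have "Poly_Mapping.lookup (x * y) k =
      (\<Sum>l. Poly_Mapping.lookup x l * Poly_Mapping.lookup y (- l + k))"
    by (simp add: lookup_mult prod_fun_def eq)
  also have "\<dots> = (\<Sum>g\<in>A. Poly_Mapping.lookup x g * Poly_Mapping.lookup y (- g + k))"
    proof (rule Sum_any.expand_superset)
    show "{a. Poly_Mapping.lookup x a * Poly_Mapping.lookup y (- a + k) \<noteq> 0} \<subseteq> A"
      using assms(2) by (metis (mono_tags, lifting) in_keys_iff mem_Collect_eq mult_zero_left subset_iff)
  qed (rule assms)
  finally show ?thesis .
qed

lemmas lookup_galg_mult = lookup_galg_mult_superset[OF finite_keys order_refl]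

lemma lookup_single_mult:
  fixes x :: "'f::comm_ring_1 galg"
  shows "Poly_Mapping.lookup (Poly_Mapping.single g c * x) k = c * Poly_Mapping.lookup x (- g + k)"
  by (subst lookup_galg_mult_superset[where A = "{g}"]) auto

lemma galg_eq_sum:
  fixes x :: "'f::comm_ring_1 galg"
  assumes "finite A" "Poly_Mapping.keys x \<subseteq> A"
  shows "x = (\<Sum>g\<in>A. Poly_Mapping.single g (Poly_Mapping.lookup x g))"
proof (rule poly_mapping_eqI)
  fix k
  show "Poly_Mapping.lookup x k =
    Poly_Mapping.lookup (\<Sum>g\<in>A. Poly_Mapping.single g (Poly_Mapping.lookup x g)) k"
    using assms by (auto simp: lookup_sum lookup_single when_def in_keys_iff)
qed

lemma lookup_mult_single:
  fixes x :: "'f::comm_ring_1 galg"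
  shows "Poly_Mapping.lookup (x * Poly_Mapping.single g c) k = Poly_Mapping.lookup x (k - g) * c"
proof -
  let ?A = "insert (k - g) (Poly_Mapping.keys x)"
  have eq: "(g = - h + k) = (h = k - g)" for h
    by (metis add.assoc add_uminus_conv_diff diff_add_cancel left_minus add.left_neutral minus_diff_eq add.right_neutral)
  have "Poly_Mapping.lookup (x * Poly_Mapping.single g c) k =
    (\<Sum>h\<in>?A. Poly_Mapping.lookup x h * Poly_Mapping.lookup (Poly_Mapping.single g c) (- h + k))"
    by (rule lookup_galg_mult_superset) auto
  also have "\<dots> = (\<Sum>h\<in>?A. if h = k - g then Poly_Mapping.lookup x h * c else 0)"
    by (intro sum.cong refl) (simp add: lookup_single eq when_def)
  also have "\<dots> = Poly_Mapping.lookup x (k - g) * c"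
    by (subst sum.delta) auto
  finally show ?thesis .
qed

lemma sc_commute: "sc c * x = x * (sc c :: 'f::comm_ring_1 galg)"
  by (rule poly_mapping_eqI) (simp add: lookup_single_mult lookup_mult_single mult.commute)

lemma lookup_sc_mult [simp]:
  "Poly_Mapping.lookup (sc c * x) k = c * Poly_Mapping.lookup (x :: 'f::comm_ring_1 galg) k"
  by (simp add: lookup_single_mult)

lemma sc_mult_sc: "sc a * sc b = sc (a * b)"
  by (simp add: mult_single)

lemma sc_inverse: "c \<noteq> 0 \<Longrightarrow> sc (inverse c) * (sc (c::'f::field) * x) = x"
  by (simp add: sc_mult_sc flip: mult.assoc)

lemma gr_plus: "gr (g + h) = gr g * gr h"
  by (simp add: mult_single)

lemma single_eq_sc_gr: "Poly_Mapping.single g c = sc c * gr g"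
  by (simp add: mult_single)

definition GA :: "nat \<Rightarrow> 'f::comm_ring_1 galg set" where
  "GA d = {x. Poly_Mapping.keys x \<subseteq> Sym d}"

lemma GA_zero [simp]: "0 \<in> GA d" by (simp add: GA_def)
lemma GA_single [simp]: "g \<in> Sym d \<Longrightarrow> Poly_Mapping.single g c \<in> GA d"
  by (auto simp: GA_def)
lemma GA_one [simp]: "1 \<in> GA d" by (simp add: GA_def)
lemma GA_plus [simp]: "x \<in> GA d \<Longrightarrow> y \<in> GA d \<Longrightarrow> x + y \<in> GA d"
  using keys_add[of x y] by (auto simp: GA_def)
lemma GA_sum: "(\<And>i. i \<in> A \<Longrightarrow> x i \<in> GA d) \<Longrightarrow> (\<Sum>i\<in>A. x i) \<in> GA d"
  by (induction A rule: infinite_finite_induct) auto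
lemma GA_mult [simp]: "x \<in> GA d \<Longrightarrow> y \<in> GA d \<Longrightarrow> x * y \<in> GA d"
  using keys_mult[of x y] by (fastforce simp: GA_def)
lemma GA_lookup: "x \<in> GA d \<Longrightarrow> g \<notin> Sym d \<Longrightarrow> Poly_Mapping.lookup x g = 0"
  by (auto simp: GA_def in_keys_iff)

lemma lookup_GA_mult:
  assumes "x \<in> GA d"
  shows "Poly_Mapping.lookup (x * y) k =
    (\<Sum>g\<in>Sym d. Poly_Mapping.lookup x g * Poly_Mapping.lookup y (- g + k))"
  using assms by (intro lookup_galg_mult_superset) (auto simp: GA_def)

text \<open>The coefficient at the identity is a trace, because \<open>g + h = 0\<close> is
  symmetric in \<open>g\<close> and \<open>h\<close>. It lets \<open>csum \<mu>\<close> be moved to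
  the other end of a product.\<close>

lemma lookup_mult_zero_commute:
  fixes x y :: "'f::comm_ring_1 galg"
  assumes "x \<in> GA d" "y \<in> GA d"
  shows "Poly_Mapping.lookup (x * y) 0 = Poly_Mapping.lookup (y * x) 0"
proof -
  have "(\<Sum>g\<in>Sym d. Poly_Mapping.lookup x g * Poly_Mapping.lookup y (- g)) =
    (\<Sum>g\<in>Sym d. Poly_Mapping.lookup y g * Poly_Mapping.lookup x (- g))"
    by (rule sum.reindex_bij_witness[where i = uminus and j = uminus]) (auto simp: mult.commute)
  then show ?thesis using assms by (simp add: lookup_GA_mult)
qed

section \<open>Young subgroups, their symmetrizers and antisymmetrizers\<close>

definition stab :: "nat \<Rightarrow> (nat \<Rightarrow> nat) \<Rightarrow> bijn set" where
  "stab d w = {g \<in> Sym d. \<forall>i<d. w (app g i) = w i}"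

lemma stab_Sym: "g \<in> stab d w \<Longrightarrow> g \<in> Sym d" by (simp add: stab_def)
lemma stab_subset: "stab d w \<subseteq> Sym d" by (auto simp: stab_def)
lemma finite_stab [simp]: "finite (stab d w)"
  using finite_subset[OF stab_subset] by simp
lemma stab_zero [simp]: "0 \<in> stab d w" by (simp add: stab_def)
lemma stab_plus: "g \<in> stab d w \<Longrightarrow> h \<in> stab d w \<Longrightarrow> g + h \<in> stab d w"
  by (simp add: stab_def)
lemma stab_uminus: "g \<in> stab d w \<Longrightarrow> - g \<in> stab d w"
  unfolding stab_def by (auto dest: Sym_inv_less)
lemma tr_stab: "i < d \<Longrightarrow> j < d \<Longrightarrow> w i = w j \<Longrightarrow> tr i j \<in> stab d w"
  by (auto simp: stab_def tr_Sym app_tr transpose_def)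

lemma stab_plus_iff: "g \<in> stab d w \<Longrightarrow> g + h \<in> stab d w \<longleftrightarrow> h \<in> stab d w"
  by (metis add.assoc add.left_neutral left_minus stab_plus stab_uminus)
lemma stab_plus_iff': "g \<in> stab d w \<Longrightarrow> h + g \<in> stab d w \<longleftrightarrow> h \<in> stab d w"
  by (metis add.assoc add.right_neutral right_minus stab_plus stab_uminus)

text \<open>Symmetrizers are formed for every filling \<open>w\<close>, not only for rows and
  columns, since the induction in \<open>asum_in_ideal\<close> runs over all Young
  subgroups.\<close>

definition asum :: "nat \<Rightarrow> (nat \<Rightarrow> nat) \<Rightarrow> 'f::comm_ring_1 galg" where
  "asum d w = (\<Sum>g\<in>stab d w. gr g)"

definition bsum :: "nat \<Rightarrow> (nat \<Rightarrow> nat) \<Rightarrow> 'f::comm_ring_1 galg" where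
  "bsum d w = (\<Sum>g\<in>stab d w. Poly_Mapping.single g (sgn_of g))"

lemma lookup_asum: "Poly_Mapping.lookup (asum d w) g = (if g \<in> stab d w then 1 else 0)"
  by (simp add: asum_def lookup_sum lookup_single when_def)
lemma lookup_bsum: "Poly_Mapping.lookup (bsum d w) g = (if g \<in> stab d w then sgn_of g else 0)"
  by (simp add: bsum_def lookup_sum lookup_single when_def)
lemma asum_GA [simp]: "asum d w \<in> GA d"
  unfolding asum_def by (intro GA_sum GA_single) (rule stab_Sym)
lemma bsum_GA [simp]: "bsum d w \<in> GA d"
  unfolding bsum_def by (intro GA_sum GA_single) (rule stab_Sym)

lemma gr_asum: "g \<in> stab d w \<Longrightarrow> gr g * asum d w = asum d w"
  by (rule poly_mapping_eqI) (simp add: lookup_single_mult lookup_asum stab_plus_iff stab_uminus)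
lemma asum_gr: "g \<in> stab d w \<Longrightarrow> asum d w * gr g = asum d w"
  using stab_plus_iff'[OF stab_uminus]
  by (intro poly_mapping_eqI) (simp add: lookup_mult_single lookup_asum)

lemma sgn_of_minus_plus:
  "g \<in> stab d w \<Longrightarrow> h \<in> stab d w \<Longrightarrow> sgn_of (- g + h) = sgn_of g * sgn_of h"
  by (metis Sym_uminus sgn_of_plus sgn_of_uminus stab_Sym)
lemma sgn_of_minus:
  "g \<in> stab d w \<Longrightarrow> h \<in> stab d w \<Longrightarrow> sgn_of (h - g) = sgn_of g * sgn_of h"
  by (metis Sym_uminus add_uminus_conv_diff mult.commute sgn_of_plus sgn_of_uminus stab_Sym)
lemma stab_minus_iff: "g \<in> stab d w \<Longrightarrow> h - g \<in> stab d w \<longleftrightarrow> h \<in> stab d w"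
  using stab_plus_iff'[OF stab_uminus] by simp

lemma gr_bsum: "g \<in> stab d w \<Longrightarrow> gr g * bsum d w = sc (sgn_of g) * bsum d w"
  by (rule poly_mapping_eqI)
    (simp add: lookup_single_mult lookup_bsum stab_plus_iff stab_uminus sgn_of_minus_plus)
lemma bsum_gr: "g \<in> stab d w \<Longrightarrow> bsum d w * gr g = sc (sgn_of g) * bsum d w"
  by (rule poly_mapping_eqI)
    (simp add: lookup_mult_single lookup_bsum stab_minus_iff sgn_of_minus)

lemma asum_sq: "asum d w * asum d w = of_nat (card (stab d w)) * asum d w"
proof -
  have "asum d w * asum d w = (\<Sum>g\<in>stab d w. gr g * asum d w)"
    by (subst asum_def) (simp add: sum_distrib_right)
  then show ?thesis by (simp add: gr_asum)
qed

lemma bsum_sq: "bsum d w * bsum d w = of_nat (card (stab d w)) * bsum d w"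
proof -
  have "bsum d w * bsum d w = (\<Sum>g\<in>stab d w. Poly_Mapping.single g (sgn_of g) * bsum d w)"
    by (subst bsum_def) (simp add: sum_distrib_right)
  also have "\<dots> = (\<Sum>g\<in>stab d w. sc (sgn_of g) * (gr g * bsum d w))"
    by (intro sum.cong refl) (simp add: mult_single flip: mult.assoc)
  also have "\<dots> = (\<Sum>g\<in>stab d w. bsum d w)"
    by (intro sum.cong refl) (simp add: gr_bsum sc_mult_sc flip: mult.assoc)
  finally show ?thesis by simp
qed

section \<open>Boxes, rows and columns of a Young diagram\<close>

definition rw :: "nat list \<Rightarrow> nat \<Rightarrow> nat" where "rw \<mu> i = fst (boxes \<mu> ! i)"
definition cl :: "nat list \<Rightarrow> nat \<Rightarrow> nat" where "cl \<mu> i = snd (boxes \<mu> ! i)"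

lemma length_boxes [simp]: "length (boxes \<mu>) = sum_list \<mu>"
  by (simp add: boxes_def length_concat comp_def map_nth)

lemma set_boxes: "set (boxes \<mu>) = {(r, c). r < length \<mu> \<and> c < \<mu> ! r}"
  by (auto simp: boxes_def)

lemma distinct_boxes: "distinct (boxes \<mu>)"
proof -
  have "card (set (boxes \<mu>)) = length (boxes \<mu>)"
  proof -
    have "set (boxes \<mu>) = Sigma {..<length \<mu>} (\<lambda>r. {..<\<mu> ! r})"
      by (auto simp: set_boxes)
    then have "card (set (boxes \<mu>)) = (\<Sum>r<length \<mu>. \<mu> ! r)" by simp
    then show ?thesis by (simp add: sum_list_sum_nth atLeast0LessThan)
  qed
  then show ?thesis by (rule card_distinct)
qed

lemma rw_cl_inj:
  assumes "i < sum_list \<mu>" "j < sum_list \<mu>" "rw \<mu> i = rw \<mu> j" "cl \<mu> i = cl \<mu> j"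
  shows "i = j"
  using assms distinct_boxes[of \<mu>]
  by (metis cl_def rw_def length_boxes nth_eq_iff_index_eq prod_eqI)

lemma rw_cl_bounds:
  assumes "i < sum_list \<mu>"
  shows "rw \<mu> i < length \<mu>" "cl \<mu> i < \<mu> ! rw \<mu> i"
  using nth_mem[of i "boxes \<mu>"] assms by (auto simp: set_boxes rw_def cl_def split: prod.splits)

lemma ex_box:
  assumes "r < length \<mu>" "c < \<mu> ! r"
  obtains i where "i < sum_list \<mu>" "rw \<mu> i = r" "cl \<mu> i = c"
proof -
  have "(r, c) \<in> set (boxes \<mu>)" using assms by (simp add: set_boxes)
  then show ?thesis using that by (auto simp: in_set_conv_nth rw_def cl_def)
qed

lemma partition_mono:
  "is_partition \<mu> \<Longrightarrow> r \<le> s \<Longrightarrow> s < length \<mu> \<Longrightarrow> \<mu> ! s \<le> \<mu> ! r"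
  unfolding is_partition_def sorted_wrt_iff_nth_less by (cases "r = s") auto

lemma column_down:
  assumes "is_partition \<mu>" "i < sum_list \<mu>" "r \<le> rw \<mu> i"
  obtains j where "j < sum_list \<mu>" "rw \<mu> j = r" "cl \<mu> j = cl \<mu> i"
proof -
  have "r < length \<mu>" using rw_cl_bounds(1)[OF assms(2)] assms(3) by simp
  moreover have "cl \<mu> i < \<mu> ! r"
    using rw_cl_bounds[OF assms(2)] partition_mono[OF assms(1,3)] by linarith
  ultimately show ?thesis using ex_box that by blast
qed

definition column :: "nat list \<Rightarrow> nat \<Rightarrow> nat set" where
  "column \<mu> c = {i. i < sum_list \<mu> \<and> cl \<mu> i = c}"

lemma finite_column [simp]: "finite (column \<mu> c)" by (simp add: column_def)

lemma inj_on_rw_column: "inj_on (rw \<mu>) (column \<mu> c)"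
  using rw_cl_inj by (auto simp: inj_on_def column_def)

lemma down_closed_nat:
  fixes A :: "nat set"
  assumes "finite A" "\<And>a b. a \<in> A \<Longrightarrow> b \<le> a \<Longrightarrow> b \<in> A"
  shows "A = {..<card A}"
proof -
  have "{..<card A} \<subseteq> A"
  proof
    fix k assume "k \<in> {..<card A}"
    show "k \<in> A"
    proof (rule ccontr)
      assume "k \<notin> A"
      then have "A \<subseteq> {..<k}" using assms(2) by (meson lessThan_iff not_less subsetI)
      then have "card A \<le> k" using card_mono[of "{..<k}" A] by simp
      then show False using \<open>k \<in> {..<card A}\<close> by simp
    qed
  qed
  then show ?thesis using assms(1) by (metis card_lessThan card_subset_eq)
qed

lemma rw_column:
  assumes "is_partition \<mu>"
  shows "rw \<mu> ` column \<mu> c = {..<card (column \<mu> c)}"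
proof -
  have "rw \<mu> ` column \<mu> c = {..<card (rw \<mu> ` column \<mu> c)}"
  proof (rule down_closed_nat)
    fix a b assume "a \<in> rw \<mu> ` column \<mu> c" "b \<le> a"
    then show "b \<in> rw \<mu> ` column \<mu> c"
      using column_down[OF assms] unfolding column_def by (smt (verit) image_iff mem_Collect_eq)
  qed simp
  then show ?thesis using inj_on_rw_column by (metis card_image)
qed

text \<open>Induction by removal of the maximum, which is at least \<open>card A - 1\<close>. The
  equality case is the rigidity that \<open>row_column_factor\<close> exploits in every
  column.\<close>

lemma sum_ge_card:
  fixes A :: "nat set"
  assumes "finite A"
  shows "\<Sum>{..<card A} \<le> \<Sum>A \<and> (\<Sum>A = \<Sum>{..<card A} \<longrightarrow> A = {..<card A})"
  using assms
proof (induction "card A" arbitrary: A)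
  case 0
  then show ?case by simp
next
  case (Suc n)
  have ne: "A \<noteq> {}" using Suc.hyps(2) by auto
  define m where "m = Max A"
  have m: "m \<in> A" using ne Suc.prems by (simp add: m_def)
  have "A \<subseteq> {..m}" using Suc.prems by (auto simp: m_def)
  then have "card A \<le> Suc m" using card_mono[of "{..m}" A] by simp
  then have nm: "n \<le> m" using Suc.hyps(2) by simp
  have cA: "card (A - {m}) = n" using Suc.hyps(2) m by simp
  then have IH: "\<Sum>{..<n} \<le> \<Sum>(A - {m})" "\<Sum>(A - {m}) = \<Sum>{..<n} \<longrightarrow> A - {m} = {..<n}"
    using Suc.hyps(1)[of "A - {m}"] Suc.prems by auto
  have s: "\<Sum>A = m + \<Sum>(A - {m})" using m Suc.prems by (simp add: sum.remove)
  have t: "\<Sum>{..<card A} = n + \<Sum>{..<n}" using Suc.hyps(2)[symmetric] by simp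
  have "\<Sum>A = \<Sum>{..<card A} \<longrightarrow> A = {..<card A}"
  proof
    assume "\<Sum>A = \<Sum>{..<card A}"
    then have "m = n" "A - {m} = {..<n}" using s t IH nm by auto
    then have "A = insert n {..<n}" using m by auto
    then show "A = {..<card A}" using Suc.hyps(2)[symmetric] by (simp add: lessThan_Suc)
  qed
  then show ?case using s t IH nm by linarith
qed

lemma sum_over_columns:
  fixes f :: "nat \<Rightarrow> nat"
  shows "(\<Sum>i<sum_list \<mu>. f i) = (\<Sum>c\<in>cl \<mu> ` {..<sum_list \<mu>}. \<Sum>i\<in>column \<mu> c. f i)"
  by (subst sum.image_gen[of _ _ "cl \<mu>"]) (auto simp: column_def intro!: sum.cong)

text \<open>In each column the row sum of \<open>g\<close> is at least that of the identity; as the totals agree,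
  equality holds throughout, so \<open>g\<close> fills each column with the same set of rows.\<close>

lemma row_column_factor:
  assumes \<mu>: "is_partition \<mu>" and g: "g \<in> Sym (sum_list \<mu>)"
    and inj: "\<And>i j. i < sum_list \<mu> \<Longrightarrow> j < sum_list \<mu> \<Longrightarrow> cl \<mu> i = cl \<mu> j \<Longrightarrow>
      rw \<mu> (app g i) = rw \<mu> (app g j) \<Longrightarrow> i = j"
  shows "\<exists>p\<in>stab (sum_list \<mu>) (rw \<mu>). \<exists>q\<in>stab (sum_list \<mu>) (cl \<mu>). g = p + q"
proof -
  let ?d = "sum_list \<mu>"
  let ?w = "\<lambda>i. rw \<mu> (app g i)"
  have inj': "inj_on ?w (column \<mu> c)" for c
    using inj by (auto simp: inj_on_def column_def)
  have sum_w: "(\<Sum>i\<in>column \<mu> c. ?w i) = \<Sum>(?w ` column \<mu> c)" for c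
    using inj' by (simp add: sum.reindex)
  have card_w: "card (?w ` column \<mu> c) = card (column \<mu> c)" for c
    using inj' by (simp add: card_image)
  have sum_rw: "(\<Sum>i\<in>column \<mu> c. rw \<mu> i) = \<Sum>{..<card (column \<mu> c)}" for c
    using inj_on_rw_column[of \<mu> c] rw_column[OF \<mu>, of c] by (metis sum.reindex_cong)
  have le: "(\<Sum>i\<in>column \<mu> c. rw \<mu> i) \<le> (\<Sum>i\<in>column \<mu> c. ?w i)" for c
    using sum_ge_card[of "?w ` column \<mu> c"] by (simp only: sum_rw sum_w card_w) simp
  have "(\<Sum>i<?d. ?w i) = (\<Sum>i<?d. rw \<mu> i)"
    using g sum.permute[of "app g" "{..<?d}" "rw \<mu>"] by (simp add: Sym_def comp_def)
  then have tot: "(\<Sum>c\<in>cl \<mu> ` {..<?d}. \<Sum>i\<in>column \<mu> c. rw \<mu> i) =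
      (\<Sum>c\<in>cl \<mu> ` {..<?d}. \<Sum>i\<in>column \<mu> c. ?w i)"
    by (simp only: sum_over_columns)
  have eq: "(\<Sum>i\<in>column \<mu> c. rw \<mu> i) = (\<Sum>i\<in>column \<mu> c. ?w i)" if "c \<in> cl \<mu> ` {..<?d}" for c
    using sum_mono_inv[OF tot le that] by simp
  have img: "?w ` column \<mu> c = rw \<mu> ` column \<mu> c" if "c \<in> cl \<mu> ` {..<?d}" for c
    using sum_ge_card[of "?w ` column \<mu> c"] eq[OF that]
    by (simp only: rw_column[OF \<mu>] sum_rw sum_w card_w finite_column finite_imageI)
  have ex: "\<exists>j<?d. cl \<mu> j = cl \<mu> i \<and> rw \<mu> j = ?w i" if "i < ?d" for i
  proof -
    have "?w i \<in> rw \<mu> ` column \<mu> (cl \<mu> i)"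
      using img[of "cl \<mu> i"] that by (force simp: column_def)
    then show ?thesis by (auto simp: column_def)
  qed
  \<comment> \<open>\<open>q\<close> sends a box to the box of the same column that lies in the row
    into which \<open>g\<close> carries it. Then \<open>g\<close> and \<open>q\<close> lead to the
    same rows, so \<open>g - of_perm q\<close> preserves rows.\<close>
  define q where "q i = (if i < ?d then SOME j. j < ?d \<and> cl \<mu> j = cl \<mu> i \<and> rw \<mu> j = ?w i else i)" for i
  have q: "q i < ?d" "cl \<mu> (q i) = cl \<mu> i" "rw \<mu> (q i) = ?w i" if "i < ?d" for i
    using someI_ex[OF ex[OF that]] that by (simp_all add: q_def)
  have "inj_on q {..<?d}"
    by (rule inj_onI) (metis q inj lessThan_iff)
  moreover have "q ` {..<?d} \<subseteq> {..<?d}" using q by auto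
  ultimately have "bij_betw q {..<?d} {..<?d}"
    by (simp add: bij_betw_def endo_inj_surj)
  then have "q permutes {..<?d}" by (rule bij_imp_permutes) (simp add: q_def)
  then have Q: "of_perm q \<in> Sym ?d" "app (of_perm q) = q"
    by (simp_all add: of_perm_Sym app_of_perm)
  have qs: "of_perm q \<in> stab ?d (cl \<mu>)" using Q q by (simp add: stab_def)
  have ps: "g - of_perm q \<in> stab ?d (rw \<mu>)"
  proof -
    have "rw \<mu> (app (g - of_perm q) i) = rw \<mu> i" if "i < ?d" for i
    proof -
      define k where "k = inv q i"
      have "k < ?d" unfolding k_def using Sym_inv_less[OF Q(1), of i] Q(2) that by simp
      moreover have "q k = i" unfolding k_def using app_app_inv[of "of_perm q" i] Q(2) by simp
      ultimately have "rw \<mu> (app g k) = rw \<mu> i" using q(3)[of k] by simp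
      then show ?thesis using Q(2) by (simp add: k_def)
    qed
    then show ?thesis using g Q by (simp add: stab_def)
  qed
  have "g = (g - of_perm q) + of_perm q" by simp
  then show ?thesis using qs ps by blast
qed

text \<open>The sum of the squares of the fibre sizes of \<open>w\<close>. It is a numerical
  stand-in for the dominance order on partitions, and being bounded by \<open>d * d\<close> it can
  measure an induction.\<close>

definition npairs :: "nat \<Rightarrow> (nat \<Rightarrow> nat) \<Rightarrow> nat" where
  "npairs d w = card {(i, j). i < d \<and> j < d \<and> w i = w j}"

lemma npairs_le: "npairs d w \<le> d * d"
proof -
  have "npairs d w \<le> card ({..<d} \<times> {..<d})"
    unfolding npairs_def by (intro card_mono) auto
  then show ?thesis by simp
qed

lemma npairs_comp:
  assumes "g \<in> Sym d" shows "npairs d (\<lambda>i. w (app g i)) = npairs d w"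
  unfolding npairs_def
proof (rule bij_betw_same_card[where f = "\<lambda>(i, j). (app g i, app g j)"], rule bij_betw_imageI)
  let ?f = "\<lambda>(i, j). (app g i, app g j)"
  show "inj_on ?f {(i, j). i < d \<and> j < d \<and> w (app g i) = w (app g j)}"
    by (auto simp: inj_on_def)
  show "?f ` {(i, j). i < d \<and> j < d \<and> w (app g i) = w (app g j)} = {(i, j). i < d \<and> j < d \<and> w i = w j}"
  proof (intro equalityI subsetI)
    fix x assume "x \<in> {(i, j). i < d \<and> j < d \<and> w i = w j}"
    then have "x = ?f (app (- g) (fst x), app (- g) (snd x))"
      "(app (- g) (fst x), app (- g) (snd x)) \<in> {(i, j). i < d \<and> j < d \<and> w (app g i) = w (app g j)}"
      using assms by (auto split: prod.splits)
    then show "x \<in> ?f ` {(i, j). i < d \<and> j < d \<and> w (app g i) = w (app g j)}" by (rule image_eqI)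
  qed (use assms in auto)
qed

text \<open>Counting the pairs column by column: two columns contain at most as many pairs as the shorter
  of them has boxes, and for the row function this bound is attained.\<close>

lemma npairs_le_rw:
  assumes \<mu>: "is_partition \<mu>"
    and inj: "\<And>i j. i < sum_list \<mu> \<Longrightarrow> j < sum_list \<mu> \<Longrightarrow> cl \<mu> i = cl \<mu> j \<Longrightarrow> w i = w j \<Longrightarrow> i = j"
  shows "npairs (sum_list \<mu>) w \<le> npairs (sum_list \<mu>) (rw \<mu>)"
proof -
  let ?d = "sum_list \<mu>"
  let ?C = "cl \<mu> ` {..<?d}"
  define A where "A v c c' = {(i, j). i \<in> column \<mu> c \<and> j \<in> column \<mu> c' \<and> v i = v j}"
    for v :: "nat \<Rightarrow> nat" and c c'
  have finA: "finite (A v c c')" for v c c'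
    by (rule finite_subset[of _ "column \<mu> c \<times> column \<mu> c'"]) (auto simp: A_def)
  have dec: "npairs ?d v = (\<Sum>c\<in>?C. \<Sum>c'\<in>?C. card (A v c c'))" for v
  proof -
    have "{(i, j). i < ?d \<and> j < ?d \<and> v i = v j} = (\<Union>(c, c')\<in>?C \<times> ?C. A v c c')"
      by (auto simp: A_def column_def)
    moreover have "card (\<Union>(c, c')\<in>?C \<times> ?C. A v c c') = (\<Sum>(c, c')\<in>?C \<times> ?C. card (A v c c'))"
      by (subst card_UN_disjoint) (auto simp: finA case_prod_beta, auto simp: A_def column_def)
    ultimately show ?thesis by (simp add: npairs_def sum.cartesian_product)
  qed
  have le: "card (A w c c') \<le> card (A (rw \<mu>) c c')" for c c'
  proof -
    \<comment> \<open>\<open>w\<close> has distinct labels within a column, so either component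
      determines the pair.\<close>
    have inj1: "inj_on fst (A w c c')" and inj2: "inj_on snd (A w c c')"
      using inj by (auto simp: inj_on_def A_def column_def)
    have "fst ` A w c c' \<subseteq> column \<mu> c" "snd ` A w c c' \<subseteq> column \<mu> c'"
      by (auto simp: A_def)
    then have up: "card (A w c c') \<le> card (column \<mu> c)" "card (A w c c') \<le> card (column \<mu> c')"
      using card_inj_on_le[OF inj1] card_inj_on_le[OF inj2] by auto
    have "card (column \<mu> c) \<le> card (A (rw \<mu>) c c') \<or> card (column \<mu> c') \<le> card (A (rw \<mu>) c c')"
    proof (cases "card (column \<mu> c) \<le> card (column \<mu> c')")
      case True
      then have "column \<mu> c \<subseteq> fst ` A (rw \<mu>) c c'"
      proof (intro subsetI)
        fix i assume i: "i \<in> column \<mu> c"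
        then have "rw \<mu> i \<in> rw \<mu> ` column \<mu> c'" using True rw_column[OF \<mu>] by (metis image_eqI lessThan_iff order_less_le_trans)
        then show "i \<in> fst ` A (rw \<mu>) c c'" using i by (force simp: A_def)
      qed
      then show ?thesis using finA card_mono card_image_le order_trans by (meson finite_imageI)
    next
      case False
      then have "column \<mu> c' \<subseteq> snd ` A (rw \<mu>) c c'"
      proof (intro subsetI)
        fix j assume j: "j \<in> column \<mu> c'"
        then have "rw \<mu> j \<in> rw \<mu> ` column \<mu> c" using False rw_column[OF \<mu>]
          by (metis image_eqI lessThan_iff order_less_trans not_le)
        then show "j \<in> snd ` A (rw \<mu>) c c'" using j by (force simp: A_def)
      qed
      then show ?thesis using finA card_mono card_image_le order_trans by (meson finite_imageI)
    qed
    then show ?thesis using up by linarith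
  qed
  show ?thesis unfolding dec by (intro sum_mono le)
qed

text \<open>List the labels by decreasing multiplicity and let the multiplicities be \<mu>. The word
  with \<open>L ! r\<close> throughout row \<open>r\<close> has the same letters as
  \<open>w\<close>, so a permutation matches the two. This reduces arbitrary Young subgroups to row
  groups, up to conjugation.\<close>

lemma ex_sorted_relabelling:
  fixes w :: "nat \<Rightarrow> nat"
  obtains \<mu> g where "is_partition \<mu>" "sum_list \<mu> = d" "g \<in> Sym d"
    "\<And>i j. i < d \<Longrightarrow> j < d \<Longrightarrow> w i = w j \<longleftrightarrow> rw \<mu> (app g i) = rw \<mu> (app g j)"
proof -
  define sz where "sz v = card {i. i < d \<and> w i = v}" for v
  define L where "L = rev (sort_key sz (sorted_list_of_set (w ` {..<d})))"
  define \<mu> where "\<mu> = map sz L"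
  have setL: "set L = w ` {..<d}" and distL: "distinct L"
    by (simp_all add: L_def)
  have pos: "sz v > 0" if "v \<in> set L" for v
    using that unfolding setL sz_def by (auto simp: card_gt_0_iff)
  have "sorted (rev \<mu>)" by (simp add: \<mu>_def L_def rev_map)
  then have "sorted_wrt (\<ge>) \<mu>" by (simp add: sorted_wrt_rev)
  moreover have "0 \<notin> set \<mu>"
  proof
    assume "0 \<in> set \<mu>"
    then obtain v where "v \<in> set L" "sz v = 0" by (auto simp: \<mu>_def)
    then show False using pos[of v] by simp
  qed
  ultimately have part: "is_partition \<mu>" by (simp add: is_partition_def)
  have sum: "sum_list \<mu> = d"
  proof -
    have "sum_list \<mu> = (\<Sum>v\<in>w ` {..<d}. sz v)"
      using distL setL by (simp add: \<mu>_def sum_list_distinct_conv_sum_set)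
    also have "\<dots> = (\<Sum>v\<in>w ` {..<d}. \<Sum>i\<in>{i\<in>{..<d}. w i = v}. 1)"
      by (simp add: sz_def)
    also have "\<dots> = (\<Sum>i<d. 1)" by (rule sum.image_gen[symmetric]) simp
    finally show ?thesis by simp
  qed
  define f where "f i = L ! rw \<mu> i" for i
  have cnt: "count (mset (map f [0..<d])) v = count (mset (map w [0..<d])) v" for v
  proof -
    have cm: "count (mset (map h [0..<d])) v = card {i. i < d \<and> h i = v}" for h :: "nat \<Rightarrow> nat"
    proof -
      have "count (mset (map h [0..<d])) v = length (filter (\<lambda>x. v = x) (map h [0..<d]))"
        by (simp add: count_mset count_list_eq_length_filter del: mset_map)
      also have "\<dots> = card {i. i < d \<and> h i = v}"
        by (subst length_filter_conv_card) (auto intro!: arg_cong[where f = card])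
      finally show ?thesis .
    qed
    have "card {i. i < d \<and> f i = v} = sz v"
    proof (cases "v \<in> set L")
      case False
      have "f i \<in> set L" if "i < d" for i
        using rw_cl_bounds(1)[of i \<mu>] that sum by (simp add: f_def \<mu>_def)
      then have "{i. i < d \<and> f i = v} = {}" using False by auto
      moreover have "sz v = 0" using False setL by (auto simp: sz_def)
      ultimately show ?thesis by simp
    next
      case True
      then obtain r where r: "r < length L" "L ! r = v" by (auto simp: in_set_conv_nth)
      have eq: "{i. i < d \<and> f i = v} = {i. i < d \<and> rw \<mu> i = r}"
        using distL r rw_cl_bounds(1)[of _ \<mu>] sum
        by (auto simp: f_def \<mu>_def nth_eq_iff_index_eq)
      have "bij_betw (cl \<mu>) {i. i < d \<and> rw \<mu> i = r} {..<\<mu> ! r}"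
        unfolding bij_betw_def
      proof
        show "inj_on (cl \<mu>) {i. i < d \<and> rw \<mu> i = r}"
          using rw_cl_inj sum by (auto simp: inj_on_def)
        show "cl \<mu> ` {i. i < d \<and> rw \<mu> i = r} = {..<\<mu> ! r}"
        proof (intro equalityI subsetI)
          fix c assume "c \<in> {..<\<mu> ! r}"
          then obtain i where "i < d" "rw \<mu> i = r" "cl \<mu> i = c"
            using ex_box[of r \<mu> c] r sum by (auto simp: \<mu>_def)
          then show "c \<in> cl \<mu> ` {i. i < d \<and> rw \<mu> i = r}" by auto
        qed (use rw_cl_bounds(2)[of _ \<mu>] sum in auto)
      qed
      then have "card {i. i < d \<and> rw \<mu> i = r} = \<mu> ! r"
        by (simp add: bij_betw_same_card)
      then show ?thesis using r by (simp add: eq \<mu>_def)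
    qed
    then show ?thesis by (simp only: cm sz_def)
  qed
  then have "mset (map w [0..<d]) = mset (map f [0..<d])" by (simp add: multiset_eq_iff)
  then obtain p where p: "p permutes {..<length (map f [0..<d])}" "permute_list p (map f [0..<d]) = map w [0..<d]"
    by (rule mset_eq_permutation)
  have pd: "p permutes {..<d}" using p(1) by simp
  have wf: "w i = f (p i)" if "i < d" for i
  proof -
    have "map w [0..<d] ! i = permute_list p (map f [0..<d]) ! i" using p(2) by simp
    then show ?thesis using that pd permutes_in_image[OF pd, of i]
      by (simp add: permute_list_nth[OF p(1)])
  qed
  have "w i = w j \<longleftrightarrow> rw \<mu> (p i) = rw \<mu> (p j)" if "i < d" "j < d" for i j
  proof -
    have "rw \<mu> (p i) < length L" "rw \<mu> (p j) < length L"
      using rw_cl_bounds(1)[of _ \<mu>] that permutes_in_image[OF pd] sum by (auto simp: \<mu>_def)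
    then show ?thesis using wf that distL by (simp add: f_def nth_eq_iff_index_eq)
  qed
  then show thesis using that[OF part sum of_perm_Sym[OF pd]] app_of_perm[OF pd] by simp
qed

section \<open>Young symmetrizers and the scalars of their squares\<close>

definition csum :: "nat list \<Rightarrow> 'f::comm_ring_1 galg" where
  "csum \<mu> = asum (sum_list \<mu>) (rw \<mu>) * bsum (sum_list \<mu>) (cl \<mu>)"

lemma csum_GA [simp]: "csum \<mu> \<in> GA (sum_list \<mu>)"
  by (simp add: csum_def)

lemma stab_rw_cl_trivial:
  assumes "g \<in> stab (sum_list \<mu>) (rw \<mu>)" "g \<in> stab (sum_list \<mu>) (cl \<mu>)"
  shows "g = 0"
proof (rule Sym_eqI)
  show "g \<in> Sym (sum_list \<mu>)" "0 \<in> Sym (sum_list \<mu>)" using assms by (auto dest: stab_Sym)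
  show "app g i = app 0 i" if "i < sum_list \<mu>" for i
    using assms that rw_cl_inj[of "app g i" \<mu> i] by (auto simp: stab_def)
qed

text \<open>Row group and column group meet only in the identity, so nothing cancels there. The
  normalization shows that \<open>csum \<mu>\<close> is nonzero and makes scalar factors readable at
  the identity.\<close>

lemma lookup_csum_zero: "Poly_Mapping.lookup (csum \<mu>) 0 = 1"
proof -
  let ?d = "sum_list \<mu>"
  have "Poly_Mapping.lookup (csum \<mu>) 0 = (\<Sum>g\<in>Sym ?d. if g = 0 then 1 else 0 :: 'a)"
    unfolding csum_def lookup_GA_mult[OF asum_GA] add_0_right
  proof (intro sum.cong refl)
    fix g assume "g \<in> Sym ?d"
    show "Poly_Mapping.lookup (asum ?d (rw \<mu>)) g * Poly_Mapping.lookup (bsum ?d (cl \<mu>)) (- g) =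
      (if g = 0 then 1 else 0 :: 'a)"
    proof (cases "g = 0")
      case False
      then have "\<not> (g \<in> stab ?d (rw \<mu>) \<and> - g \<in> stab ?d (cl \<mu>))"
        using stab_rw_cl_trivial stab_uminus by (metis minus_minus)
      then show ?thesis using False by (auto simp: lookup_asum lookup_bsum)
    qed (simp add: lookup_asum lookup_bsum)
  qed
  then show ?thesis by simp
qed

lemma tr_conj: "g + tr i j = tr (app g i) (app g j) + g"
  by (rule bijn_eqI) (auto simp: app_tr transpose_def)

lemma tr_tr [simp]: "tr i j + tr i j = 0"
  by (rule bijn_eqI) (simp add: app_tr)

lemma uminus_tr [simp]: "- tr i j = tr i j"
  by (rule minus_unique) simp

lemma gr_csum: "p \<in> stab (sum_list \<mu>) (rw \<mu>) \<Longrightarrow> gr p * csum \<mu> = csum \<mu>"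
  by (simp add: csum_def gr_asum flip: mult.assoc)

lemma csum_gr:
  assumes "q \<in> stab (sum_list \<mu>) (cl \<mu>)" shows "csum \<mu> * gr q = sc (sgn_of q) * csum \<mu>"
proof -
  have "csum \<mu> * gr q = asum (sum_list \<mu>) (rw \<mu>) * sc (sgn_of q) * bsum (sum_list \<mu>) (cl \<mu>)"
    by (simp add: csum_def bsum_gr[OF assms] mult.assoc)
  then show ?thesis by (simp add: csum_def mult.assoc flip: sc_commute)
qed

text \<open>The ground field \<open>K\<close> of a \<open>GL\<close>-field has characteristic zero, but its type is only of class \<open>field\<close>;
  hence the explicit hypothesis on \<open>2\<close>.\<close>

lemma row_column_equivariant:
  fixes x :: "'f::idom galg"
  assumes two: "(2::'f) \<noteq> 0" and \<mu>: "is_partition \<mu>" and x: "x \<in> GA (sum_list \<mu>)"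
    and row: "\<And>p. p \<in> stab (sum_list \<mu>) (rw \<mu>) \<Longrightarrow> gr p * x = x"
    and column: "\<And>q. q \<in> stab (sum_list \<mu>) (cl \<mu>) \<Longrightarrow> x * gr q = sc (sgn_of q) * x"
  shows "x = sc (Poly_Mapping.lookup x 0) * csum \<mu>"
proof -
  let ?d = "sum_list \<mu>"
  have factored: "Poly_Mapping.lookup y (p + q) = sgn_of q * Poly_Mapping.lookup y 0"
    if p: "p \<in> stab ?d (rw \<mu>)" and q: "q \<in> stab ?d (cl \<mu>)"
      and row: "\<And>p. p \<in> stab (sum_list \<mu>) (rw \<mu>) \<Longrightarrow> gr p * y = y"
      and column: "\<And>q. q \<in> stab (sum_list \<mu>) (cl \<mu>) \<Longrightarrow> y * gr q = sc (sgn_of q) * y"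
    for p q and y :: "'f galg"
  proof -
    have "Poly_Mapping.lookup y (p + q) = Poly_Mapping.lookup y q"
      using arg_cong[OF row[OF p], of "\<lambda>z. Poly_Mapping.lookup z (p + q)"]
      by (simp add: lookup_single_mult flip: add.assoc)
    moreover have "Poly_Mapping.lookup y 0 = sgn_of q * Poly_Mapping.lookup y q"
      using arg_cong[OF column[OF q], of "\<lambda>z. Poly_Mapping.lookup z q"]
      by (simp add: lookup_mult_single)
    ultimately show ?thesis by (simp flip: mult.assoc)
  qed
  have vanish: "Poly_Mapping.lookup x g = 0"
    if g: "g \<in> Sym ?d" "\<not> (\<exists>p\<in>stab ?d (rw \<mu>). \<exists>q\<in>stab ?d (cl \<mu>). g = p + q)" for g
  proof -
    \<comment> \<open>Otherwise \<open>row_column_factor\<close> would apply. Moved past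
      \<open>g\<close>, the transposition of \<open>i\<close> and \<open>j\<close> becomes a row
      transposition; invariance on the left and the sign on the right make the coefficient at
      \<open>g\<close> its own negative.\<close>
    obtain i j where ij: "i < ?d" "j < ?d" "cl \<mu> i = cl \<mu> j"
        "rw \<mu> (app g i) = rw \<mu> (app g j)" "i \<noteq> j"
      using row_column_factor[OF \<mu> g(1)] g(2) by blast
    have t: "tr i j \<in> stab ?d (cl \<mu>)" using ij by (simp add: tr_stab)
    have s: "tr (app g i) (app g j) \<in> stab ?d (rw \<mu>)" using ij g(1) by (simp add: tr_stab)
    have gt: "g - tr i j = tr (app g i) (app g j) + g"
      using tr_conj[of g i j] by (metis add_uminus_conv_diff uminus_tr)
    have "Poly_Mapping.lookup x (g - tr i j) = - Poly_Mapping.lookup x g"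
      using arg_cong[OF column[OF t], of "\<lambda>z. Poly_Mapping.lookup z g"] ij(5)
      by (simp add: lookup_mult_single sgn_of_tr)
    moreover have "Poly_Mapping.lookup x (tr (app g i) (app g j) + g) = Poly_Mapping.lookup x g"
      using arg_cong[OF row[OF s], of "\<lambda>z. Poly_Mapping.lookup z g"]
      by (simp add: lookup_single_mult)
    ultimately have "Poly_Mapping.lookup x g = - Poly_Mapping.lookup x g" using gt by simp
    then have "2 * Poly_Mapping.lookup x g = 0" by (metis add.right_inverse mult_2)
    then show ?thesis using two by simp
  qed
  have vanish_c: "Poly_Mapping.lookup (csum \<mu> :: 'f galg) g = 0"
    if g: "g \<in> Sym ?d" "\<not> (\<exists>p\<in>stab ?d (rw \<mu>). \<exists>q\<in>stab ?d (cl \<mu>). g = p + q)" for g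
  proof -
    have "Poly_Mapping.lookup (asum ?d (rw \<mu>)) h * Poly_Mapping.lookup (bsum ?d (cl \<mu>)) (- h + g) = (0 :: 'f)"
      for h
      using g(2) by (force simp: lookup_asum lookup_bsum simp flip: add.assoc)
    then show ?thesis unfolding csum_def lookup_GA_mult[OF asum_GA] by (simp only: sum.neutral_const)
  qed
  show ?thesis
  proof (rule poly_mapping_eqI)
    fix g
    consider "g \<notin> Sym ?d" | p q where "p \<in> stab ?d (rw \<mu>)" "q \<in> stab ?d (cl \<mu>)" "g = p + q"
      | "g \<in> Sym ?d" "\<not> (\<exists>p\<in>stab ?d (rw \<mu>). \<exists>q\<in>stab ?d (cl \<mu>). g = p + q)" by blast
    then show "Poly_Mapping.lookup x g = Poly_Mapping.lookup (sc (Poly_Mapping.lookup x 0) * csum \<mu>) g"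
    proof cases
      case 1
      then show ?thesis using x GA_lookup csum_GA by (simp add: GA_lookup[of _ ?d])
    next
      case 2
      then show ?thesis
        using factored[OF 2(1,2) row column] factored[OF 2(1,2) gr_csum csum_gr]
        by (simp add: lookup_csum_zero)
    next
      case 3
      then show ?thesis using vanish vanish_c by simp
    qed
  qed
qed

lemma csum_mult_csum:
  fixes y :: "'f::idom galg"
  assumes "(2::'f) \<noteq> 0" "is_partition \<mu>" "y \<in> GA (sum_list \<mu>)"
  shows "csum \<mu> * y * csum \<mu> = sc (Poly_Mapping.lookup (csum \<mu> * y * csum \<mu>) 0) * csum \<mu>"
proof (rule row_column_equivariant[OF assms(1,2)])
  show "gr p * (csum \<mu> * y * csum \<mu>) = csum \<mu> * y * csum \<mu>" if "p \<in> stab (sum_list \<mu>) (rw \<mu>)" for p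
    using gr_csum[OF that] by (metis (no_types) mult.assoc)
  show "csum \<mu> * y * csum \<mu> * gr q = sc (sgn_of q) * (csum \<mu> * y * csum \<mu>)"
    if "q \<in> stab (sum_list \<mu>) (cl \<mu>)" for q
  proof -
    have "csum \<mu> * y * csum \<mu> * gr q = csum \<mu> * y * (sc (sgn_of q) * csum \<mu>)"
      by (simp add: csum_gr[OF that] mult.assoc)
    also have "\<dots> = sc (sgn_of q) * (csum \<mu> * y * csum \<mu>)"
      by (metis (no_types) mult.assoc sc_commute)
    finally show ?thesis .
  qed
qed (simp add: assms)

section \<open>The inversion of permutations and the nonvanishing of squares\<close>

definition star :: "'f::comm_ring_1 galg \<Rightarrow> 'f galg" where
  "star = Poly_Mapping.map_key uminus"

lemma lookup_star [simp]: "Poly_Mapping.lookup (star x) k = Poly_Mapping.lookup x (- k)"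
  unfolding star_def by (rule map_key.rep_eq[OF inj_uminus, THEN fun_cong, unfolded comp_def])

lemma star_GA:
  assumes "x \<in> GA d" shows "star x \<in> GA d"
proof -
  have "k \<in> Sym d" if "Poly_Mapping.lookup (star x) k \<noteq> 0" for k
  proof -
    have "- k \<in> Sym d" using that GA_lookup[OF assms, of "- k"] by auto
    from Sym_uminus[OF this] show ?thesis by simp
  qed
  then show ?thesis by (auto simp: GA_def in_keys_iff)
qed

lemma star_mult:
  assumes "x \<in> GA d" "y \<in> GA d" shows "star (x * y) = star y * star x"
proof (rule poly_mapping_eqI)
  fix k
  note sx = star_GA[OF assms(1)] and sy = star_GA[OF assms(2)]
  show "Poly_Mapping.lookup (star (x * y)) k = Poly_Mapping.lookup (star y * star x) k"
  proof (cases "k \<in> Sym d")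
    case False
    then have "- k \<notin> Sym d" using Sym_uminus by (metis minus_minus)
    then show ?thesis using False assms sx sy by (simp add: GA_lookup[of _ d])
  next
    case True
    have "(\<Sum>g\<in>Sym d. Poly_Mapping.lookup x g * Poly_Mapping.lookup y (- g + - k)) =
      (\<Sum>g\<in>Sym d. Poly_Mapping.lookup y (- g) * Poly_Mapping.lookup x (- (- g + k)))"
      by (rule sum.reindex_bij_witness[where i = "\<lambda>h. - k + h" and j = "\<lambda>g. k + g"])
        (use True in \<open>auto simp: mult.commute minus_add simp flip: add.assoc\<close>)
    then show ?thesis by (simp add: lookup_GA_mult[OF assms(1)] lookup_GA_mult[OF sy])
  qed
qed

definition integral :: "'f::comm_ring_1 galg \<Rightarrow> bool" where
  "integral x \<longleftrightarrow> (\<forall>k. Poly_Mapping.lookup x k \<in> \<int>)"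

lemma integral_mult: "integral x \<Longrightarrow> integral y \<Longrightarrow> integral (x * y)"
  unfolding integral_def by (auto simp: lookup_galg_mult)

text \<open>The field carries no order, but for integral \<open>x\<close> the identity coefficient
  of \<open>x * star x\<close> is the image of a sum of integer squares, which stays nonzero in
  characteristic zero.\<close>

lemma star_mult_nonzero:
  fixes x :: "'f::field_char_0 galg"
  assumes "x \<in> GA d" "integral x" "x \<noteq> 0"
  shows "x * star x \<noteq> 0"
proof
  assume "x * star x = 0"
  obtain z where z: "\<And>k. Poly_Mapping.lookup x k = of_int (z k)"
  proof -
    have "\<forall>k. \<exists>n. Poly_Mapping.lookup x k = of_int n"
      using assms(2) unfolding integral_def by (meson Ints_cases)
    from choice[OF this] show ?thesis using that by blast
  qed
  have "Poly_Mapping.lookup (x * star x) 0 = of_int (\<Sum>g\<in>Sym d. z g * z g)"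
    by (simp add: lookup_GA_mult[OF assms(1)] z)
  then have "(\<Sum>g\<in>Sym d. z g * z g) = 0"
    using \<open>x * star x = 0\<close> by (metis lookup_zero of_int_eq_0_iff)
  then have "\<forall>g\<in>Sym d. z g * z g = 0"
    by (subst (asm) sum_nonneg_eq_0_iff) auto
  then have "x = 0"
    using GA_lookup[OF assms(1)] by (intro poly_mapping_eqI) (auto simp: z)
  then show False using assms(3) by simp
qed

lemma star_asum: "star (asum d w) = asum d w"
  by (rule poly_mapping_eqI) (auto simp: lookup_asum dest: stab_uminus)
lemma star_bsum: "star (bsum d w) = bsum d w"
proof (rule poly_mapping_eqI)
  fix k
  have "- k \<in> stab d w \<longleftrightarrow> k \<in> stab d w" by (metis minus_minus stab_uminus)
  then show "Poly_Mapping.lookup (star (bsum d w)) k = Poly_Mapping.lookup (bsum d w) k"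
    by (simp add: lookup_bsum sgn_of_uminus[OF stab_Sym])
qed

text \<open>Let \<open>c = a * b\<close> with \<open>a\<close> and \<open>b\<close> fixed by
  \<open>star\<close>. Then \<open>c * star c\<close> is a multiple of \<open>a * b * a\<close>,
  which is therefore nonzero; it is fixed by \<open>star\<close>, so its square is nonzero too. But
  this square contains the factor \<open>a * b * a * b\<close>, which is
  \<open>c * c\<close>.\<close>

lemma csum_sq_nonzero: "csum \<mu> * csum \<mu> \<noteq> (0 :: 'f::field_char_0 galg)"
proof
  let ?d = "sum_list \<mu>"
  define a :: "'f galg" where "a = asum ?d (rw \<mu>)"
  define b :: "'f galg" where "b = bsum ?d (cl \<mu>)"
  have ab: "a \<in> GA ?d" "b \<in> GA ?d" "star a = a" "star b = b" "integral a" "integral b"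
    by (auto simp: a_def b_def star_asum star_bsum integral_def lookup_asum lookup_bsum sgn_of_def)
  obtain na nb :: "'f galg" where sq: "a * a = na * a" "b * b = nb * b"
    and n: "\<And>x. na * x = x * na" "\<And>x. nb * x = x * nb"
    using asum_sq[of ?d "rw \<mu>", where 'a = 'f] bsum_sq[of ?d "cl \<mu>", where 'a = 'f]
    unfolding a_def b_def by (metis mult_of_nat_commute)
  assume "csum \<mu> * csum \<mu> = (0 :: 'f galg)"
  then have z: "a * b * a * b = 0" by (simp add: csum_def a_def b_def mult.assoc)
  have "a * b \<noteq> 0" using lookup_csum_zero[of \<mu>, where 'a = 'f] unfolding csum_def a_def b_def by auto
  then have "(a * b) * star (a * b) \<noteq> 0"
    using star_mult_nonzero[of "a * b" ?d] ab by (simp add: integral_mult)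
  moreover have "(a * b) * star (a * b) = nb * (a * b * a)"
  proof -
    have "(a * b) * star (a * b) = a * (b * b) * a"
      using star_mult[of a ?d b] ab by (simp add: mult.assoc)
    also have "\<dots> = (a * nb) * b * a" by (simp only: sq mult.assoc)
    also have "a * nb = nb * a" by (rule n(2)[symmetric])
    also have "nb * a * b * a = nb * (a * b * a)" by (simp only: mult.assoc)
    finally show ?thesis .
  qed
  ultimately have "a * b * a \<noteq> 0" by auto
  moreover have s: "star (a * b * a) = a * b * a"
    using ab star_mult[of a ?d b] star_mult[of "a * b" ?d a] by (simp add: mult.assoc)
  ultimately have "(a * b * a) * (a * b * a) \<noteq> 0"
    using star_mult_nonzero[of "a * b * a" ?d] ab by (simp add: integral_mult)
  moreover have "(a * b * a) * (a * b * a) = na * (a * b * a * b) * a"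
  proof -
    have "(a * b * a) * (a * b * a) = a * b * (a * a) * b * a" by (simp only: mult.assoc)
    also have "\<dots> = (a * b * na) * a * b * a" by (simp only: sq mult.assoc)
    also have "a * b * na = na * (a * b)" by (rule n(1)[symmetric])
    also have "na * (a * b) * a * b * a = na * (a * b * a * b) * a" by (simp only: mult.assoc)
    finally show ?thesis .
  qed
  ultimately show False using z by simp
qed

text \<open>By \<open>csum_sq\<close> the factor by which squaring multiplies
  \<open>csum \<mu>\<close>; classically the product of the hook lengths of \<mu>.\<close>

definition hook :: "nat list \<Rightarrow> 'f::comm_ring_1" where
  "hook \<mu> = Poly_Mapping.lookup (csum \<mu> * csum \<mu>) 0"

lemma csum_sq:
  "(2::'f::idom) \<noteq> 0 \<Longrightarrow> is_partition \<mu> \<Longrightarrow> csum \<mu> * csum \<mu> = sc (hook \<mu> :: 'f) * csum \<mu>"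
  using csum_mult_csum[of \<mu> "1 :: 'f galg"] by (simp add: hook_def)

lemma hook_nonzero: "is_partition \<mu> \<Longrightarrow> hook \<mu> \<noteq> (0 :: 'f::field_char_0)"
  using csum_sq[of \<mu>, where 'f = 'f] csum_sq_nonzero[of \<mu>, where 'f = 'f] by auto

text \<open>The simplicity of the left ideal of \<open>csum \<mu>\<close> in explicit form. Take for
  \<open>y\<close> the inverse of a permutation in the support of \<xi>; the trace property moves
  \<open>csum \<mu>\<close> behind \<xi>, where it acts as \<open>hook \<mu>\<close>, and so the
  coefficient at the identity is nonzero.\<close>

lemma ex_csum_multiple:
  fixes \<xi> :: "'f::field galg"
  assumes two: "(2::'f) \<noteq> 0" and nz: "hook \<mu> \<noteq> (0::'f)" and \<mu>: "is_partition \<mu>" and \<xi>: "\<xi> \<in> GA (sum_list \<mu>)" "\<xi> * csum \<mu> = sc (hook \<mu>) * \<xi>" "\<xi> \<noteq> 0"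
  obtains y l where "y \<in> GA (sum_list \<mu>)" "l \<noteq> 0" "csum \<mu> * y * \<xi> = sc l * csum \<mu>"
proof -
  let ?d = "sum_list \<mu>"
  obtain g where g: "Poly_Mapping.lookup \<xi> g \<noteq> 0"
    using \<xi>(3) by (metis lookup_zero poly_mapping_eqI)
  then have gS: "g \<in> Sym ?d" using GA_lookup[OF \<xi>(1)] by blast
  define y :: "'f galg" where "y = gr (- g)"
  have y: "y \<in> GA ?d" using gS by (simp add: y_def)
  define x where "x = csum \<mu> * y * \<xi>"
  have xc: "x * csum \<mu> = sc (hook \<mu>) * x"
    unfolding x_def by (metis \<xi>(2) mult.assoc sc_commute)
  have "Poly_Mapping.lookup x 0 = Poly_Mapping.lookup (y * \<xi> * csum \<mu>) 0"
    unfolding x_def using lookup_mult_zero_commute[of "csum \<mu>" ?d "y * \<xi>"] \<xi>(1) y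
    by (simp add: mult.assoc)
  also have "y * \<xi> * csum \<mu> = sc (hook \<mu>) * (y * \<xi>)"
    by (metis \<xi>(2) mult.assoc sc_commute)
  also have "Poly_Mapping.lookup \<dots> 0 = hook \<mu> * Poly_Mapping.lookup \<xi> g"
    by (simp add: y_def lookup_single_mult)
  finally have x0: "Poly_Mapping.lookup x 0 \<noteq> 0" using g nz by simp
  have "x = sc (Poly_Mapping.lookup x 0) * csum \<mu>"
  proof (rule row_column_equivariant[OF two \<mu>])
    show "x \<in> GA ?d" using \<xi>(1) y by (simp add: x_def)
    show "gr p * x = x" if "p \<in> stab ?d (rw \<mu>)" for p
      unfolding x_def using gr_csum[OF that] by (metis mult.assoc)
    show "x * gr q = sc (sgn_of q) * x" if "q \<in> stab ?d (cl \<mu>)" for q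
    proof -
      have "sc (hook \<mu>) * (x * gr q) = x * csum \<mu> * gr q" by (simp add: xc mult.assoc)
      also have "\<dots> = x * sc (sgn_of q) * csum \<mu>" by (simp add: csum_gr[OF that] mult.assoc)
      also have "\<dots> = sc (hook \<mu>) * (sc (sgn_of q) * x)"
        by (metis (no_types) mult.assoc sc_commute xc)
      finally show ?thesis using sc_inverse[OF nz] by metis
    qed
  qed
  then show thesis using that[OF y x0] by (simp add: x_def)
qed

text \<open>Over every ring \<open>csum \<mu>\<close> is the image of one integral element.
  Therefore the embedding of \<open>k\<close> in \<open>K\<close> respects it, and the action of
  \<open>GL\<close> on \<open>K\<close> fixes its coefficients.\<close>

lemma lookup_csum_of_int:
  "Poly_Mapping.lookup (csum \<mu>) g = (of_int (Poly_Mapping.lookup (csum \<mu>) g) :: 'f::comm_ring_1)"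
  unfolding csum_def lookup_GA_mult[OF asum_GA]
  by (auto simp: lookup_asum lookup_bsum sgn_of_def intro!: sum.cong)

lemma hook_of_int: "hook \<mu> = (of_int (hook \<mu>) :: 'f::comm_ring_1)"
proof -
  have "Poly_Mapping.lookup (csum \<mu> * csum \<mu>) 0 =
      (of_int (Poly_Mapping.lookup (csum \<mu> * csum \<mu>) 0) :: 'f)"
    unfolding lookup_GA_mult[OF csum_GA] of_int_sum of_int_mult
    by (intro sum.cong refl) (simp add: lookup_csum_of_int[where 'f = 'f, symmetric])
  then show ?thesis by (simp add: hook_def)
qed

section \<open>The two-sided ideal of the Young symmetrizers, by straightening\<close>

inductive_set ideal_of :: "nat \<Rightarrow> 'f::comm_ring_1 galg set \<Rightarrow> 'f galg set" for d S where
  zero: "0 \<in> ideal_of d S"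
| step: "z \<in> ideal_of d S \<Longrightarrow> x \<in> GA d \<Longrightarrow> s \<in> S \<Longrightarrow> y \<in> GA d \<Longrightarrow> z + x * s * y \<in> ideal_of d S"

lemma ideal_gen: "s \<in> S \<Longrightarrow> x \<in> GA d \<Longrightarrow> y \<in> GA d \<Longrightarrow> x * s * y \<in> ideal_of d S"
  using ideal_of.step[OF ideal_of.zero] by fastforce

lemma ideal_add: "z \<in> ideal_of d S \<Longrightarrow> z' \<in> ideal_of d S \<Longrightarrow> z + z' \<in> ideal_of d S"
  by (rotate_tac 1, induction z' rule: ideal_of.induct) (auto intro: ideal_of.step simp flip: add.assoc)

lemma ideal_left: "z \<in> ideal_of d S \<Longrightarrow> x \<in> GA d \<Longrightarrow> x * z \<in> ideal_of d S"
  by (induction z rule: ideal_of.induct)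
    (auto simp: ideal_of.zero distrib_left simp flip: mult.assoc intro!: ideal_of.step)

lemma ideal_right: "z \<in> ideal_of d S \<Longrightarrow> x \<in> GA d \<Longrightarrow> z * x \<in> ideal_of d S"
proof (induction z rule: ideal_of.induct)
  case (step z x' s y)
  then show ?case using ideal_of.step[of "z * x" d S x' s "y * x"] by (simp add: distrib_right mult.assoc)
qed (simp add: ideal_of.zero)

lemma ideal_scale: "z \<in> ideal_of d S \<Longrightarrow> sc c * z \<in> ideal_of d S"
  by (rule ideal_left) simp_all

lemma ideal_uminus: "z \<in> ideal_of d S \<Longrightarrow> - z \<in> ideal_of d S"
proof -
  have eq: "- z = sc (- 1) * z" by (rule poly_mapping_eqI) simp
  show "z \<in> ideal_of d S \<Longrightarrow> - z \<in> ideal_of d S" unfolding eq by (rule ideal_scale)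
qed

lemma ideal_diff: "z \<in> ideal_of d S \<Longrightarrow> z' \<in> ideal_of d S \<Longrightarrow> z - z' \<in> ideal_of d S"
  using ideal_add[OF _ ideal_uminus] by fastforce

lemma ideal_sum: "(\<And>i. i \<in> A \<Longrightarrow> f i \<in> ideal_of d S) \<Longrightarrow> (\<Sum>i\<in>A. f i) \<in> ideal_of d S"
  by (induction A rule: infinite_finite_induct) (auto simp: ideal_of.zero intro: ideal_add)

lemma ideal_mono: "z \<in> ideal_of d S \<Longrightarrow> S \<subseteq> ideal_of d S' \<Longrightarrow> z \<in> ideal_of d S'"
proof (induction z rule: ideal_of.induct)
  case (step z x s y)
  then have "x * s * y \<in> ideal_of d S'" by (blast intro: ideal_right ideal_left)
  then show ?case using step by (simp add: ideal_add)
qed (rule ideal_of.zero)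

text \<open>If the fibres over \<open>i\<close> and \<open>j\<close> have \<open>a\<close> and
  \<open>b\<close> elements, the move changes the count by \<open>2 * (a - b + 1)\<close>, which is
  positive as soon as \<open>b \<le> a\<close>.\<close>

lemma npairs_increase:
  assumes z: "z < d" "w z = j" "j \<noteq> i"
    and le: "card {k. k < d \<and> w k = j} \<le> card {k. k < d \<and> w k = i}"
  shows "npairs d w < npairs d (w(z := i))"
proof -
  define X where "X = {k. k < d \<and> k \<noteq> z \<and> w k = j}"
  define Y where "Y = {k. k < d \<and> w k = i}"
  define C where "C = insert (z, z) {(a, b). a < d \<and> b < d \<and> a \<noteq> z \<and> b \<noteq> z \<and> w a = w b}"
  have finC: "finite C"
  proof -
    have "C \<subseteq> insert (z, z) ({..<d} \<times> {..<d})" by (auto simp: C_def)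
    then show ?thesis by (rule finite_subset) simp
  qed
  have count: "card (C \<union> ({z} \<times> U \<union> U \<times> {z})) = card C + 2 * card U"
    if U: "finite U" "z \<notin> U" for U
  proof -
    have "card ({z} \<times> U \<union> U \<times> {z}) = card U + card U"
      using U by (subst card_Un_disjoint) (auto simp: card_cartesian_product)
    moreover have "C \<inter> ({z} \<times> U \<union> U \<times> {z}) = {}" using U by (auto simp: C_def)
    ultimately show ?thesis using U finC by (subst card_Un_disjoint) auto
  qed
  have "{(a, b). a < d \<and> b < d \<and> w a = w b} = C \<union> ({z} \<times> X \<union> X \<times> {z})"
    using z by (auto simp: C_def X_def)
  then have w: "npairs d w = card C + 2 * card X"
    using count[of X] by (simp add: npairs_def X_def)
  have "{(a, b). a < d \<and> b < d \<and> (w(z := i)) a = (w(z := i)) b} = C \<union> ({z} \<times> Y \<union> Y \<times> {z})"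
    using z by (auto simp: C_def Y_def split: if_splits)
  then have w': "npairs d (w(z := i)) = card C + 2 * card Y"
    using count[of Y] z by (simp add: npairs_def Y_def)
  have "{k. k < d \<and> w k = j} = insert z X" using z by (auto simp: X_def)
  then have "card {k. k < d \<and> w k = j} = Suc (card X)" by (simp add: X_def)
  then show ?thesis using le w w' by (simp add: Y_def)
qed

lemma card_row_antimono:
  assumes \<mu>: "is_partition \<mu>" and "i \<le> j"
  shows "card {k. k < sum_list \<mu> \<and> rw \<mu> k = j} \<le> card {k. k < sum_list \<mu> \<and> rw \<mu> k = i}"
proof -
  let ?R = "\<lambda>r. {k. k < sum_list \<mu> \<and> rw \<mu> k = r}"
  have inj: "inj_on (cl \<mu>) (?R r)" for r
    using rw_cl_inj by (auto simp: inj_on_def)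
  have "cl \<mu> ` ?R j \<subseteq> cl \<mu> ` ?R i"
  proof
    fix c assume "c \<in> cl \<mu> ` ?R j"
    then obtain k where k: "k < sum_list \<mu>" "rw \<mu> k = j" "c = cl \<mu> k" by blast
    then obtain m where "m < sum_list \<mu>" "rw \<mu> m = i" "cl \<mu> m = cl \<mu> k"
      using column_down[OF \<mu>, of k i] \<open>i \<le> j\<close> by blast
    then show "c \<in> cl \<mu> ` ?R i" using k by (metis (mono_tags) image_eqI mem_Collect_eq)
  qed
  then have "card (cl \<mu> ` ?R j) \<le> card (cl \<mu> ` ?R i)" by (rule card_mono[rotated]) simp
  then show ?thesis by (simp add: card_image[OF inj])
qed

definition transp :: "nat \<Rightarrow> (nat \<Rightarrow> nat) \<Rightarrow> (nat \<Rightarrow> nat) \<Rightarrow> bijn set" where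
  "transp d r w = {x \<in> Sym d. \<forall>k<d. w (app x k) = r k}"

text \<open>A left coset sum of \<open>stab d r\<close>, or zero if \<open>w\<close> is not a
  rearrangement of \<open>r\<close>. The nonzero ones form the word basis of the left ideal of
  \<open>asum d r\<close>, a permutation module.\<close>

definition usum :: "nat \<Rightarrow> (nat \<Rightarrow> nat) \<Rightarrow> (nat \<Rightarrow> nat) \<Rightarrow> 'f::comm_ring_1 galg" where
  "usum d r w = (\<Sum>x\<in>transp d r w. gr x)"

lemma transp_subset: "transp d r w \<subseteq> Sym d" by (auto simp: transp_def)
lemma finite_transp [simp]: "finite (transp d r w)"
  using finite_subset[OF transp_subset] by simp

lemma usum_eq:
  assumes x: "x \<in> transp d r w" shows "usum d r w = gr x * asum d r"
proof -
  have xS: "x \<in> Sym d" using x by (simp add: transp_def)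
  have 1: "- x + y \<in> stab d r" if y: "y \<in> transp d r w" for y
  proof -
    have "r (app (- x + y) k) = r k" if "k < d" for k
    proof -
      have yk: "app y k < d" using y that by (simp add: transp_def)
      define m where "m = inv (app x) (app y k)"
      have "m < d" using yk xS by (simp add: m_def)
      then have "r m = w (app x m)" using x by (simp add: transp_def)
      also have "\<dots> = r k" using y that by (simp add: m_def transp_def)
      finally show ?thesis by (simp add: m_def)
    qed
    then show ?thesis using xS y by (simp add: stab_def transp_def)
  qed
  have 2: "x + g \<in> transp d r w" if "g \<in> stab d r" for g
    using that x by (simp add: stab_def transp_def)
  have "usum d r w = (\<Sum>g\<in>stab d r. gr (x + g))"
    unfolding usum_def
    by (rule sum.reindex_bij_witness[where i = "\<lambda>g. x + g" and j = "\<lambda>y. - x + y"])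
      (auto simp: 1 2 simp flip: add.assoc)
  then show ?thesis by (simp add: asum_def sum_distrib_left gr_plus)
qed

lemma usum_empty: "transp d r w = {} \<Longrightarrow> usum d r w = 0"
  by (simp add: usum_def)

text \<open>A double count of the pairs \<open>(q, x)\<close> with \<open>w(q := j) \<circ> x = r\<close>, indexed on the right by
  \<open>z = x\<^sup>-\<^sup>1 q\<close>. This is the Garnir-type relation that drives the straightening.\<close>

lemma exchange_relation:
  assumes "i \<noteq> j"
  shows "(\<Sum>q | q < d \<and> w q = i. usum d r (w(q := j))) =
    (\<Sum>z | z < d \<and> r z = j. usum d (r(z := i)) w :: 'f::comm_ring_1 galg)"
proof -
  have "(\<Sum>q | q < d \<and> w q = i. usum d r (w(q := j)) :: 'f galg) =
    (\<Sum>(q, x)\<in>Sigma {q. q < d \<and> w q = i} (\<lambda>q. transp d r (w(q := j))). gr x)"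
    unfolding usum_def by (subst sum.Sigma) auto
  also have "\<dots> = (\<Sum>(z, x)\<in>Sigma {z. z < d \<and> r z = j} (\<lambda>z. transp d (r(z := i)) w). gr x)"
  proof (rule sum.reindex_bij_witness[where i = "\<lambda>(z, x). (app x z, x)"
        and j = "\<lambda>(q, x). (app (- x) q, x)"], goal_cases)
    case (1 a)
    then show ?case by auto
  next
    case (2 a)
    then obtain q x where a: "a = (q, x)" "q < d" "w q = i" "x \<in> Sym d"
      "\<And>k. k < d \<Longrightarrow> (w(q := j)) (app x k) = r k"
      by (auto simp: transp_def)
    define z where "z = inv (app x) q"
    have z: "app x z = q" "z < d" using a by (simp_all add: z_def)
    have "r z = j" using a(5)[of z] z by simp
    moreover have "w (app x k) = (r(z := i)) k" if "k < d" for k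
    proof (cases "k = z")
      case False
      then have "app x k \<noteq> q" using z(1) by auto
      then show ?thesis using a(5)[OF that] False by simp
    qed (use z a in simp)
    ultimately show ?case using a z by (simp add: transp_def flip: z_def)
  next
    case (3 b)
    then show ?case by auto
  next
    case (4 b)
    then obtain z x where b: "b = (z, x)" "z < d" "r z = j" "x \<in> Sym d"
      "\<And>k. k < d \<Longrightarrow> w (app x k) = (r(z := i)) k"
      by (auto simp: transp_def)
    have "(w(app x z := j)) (app x k) = r k" if "k < d" for k
      using b(5)[OF that] b(3) by auto
    moreover have "w (app x z) = i" using b by simp
    ultimately show ?case using b by (simp add: transp_def)
  next
    case (5 a)
    then show ?case by (simp add: case_prod_beta)
  qed
  also have "\<dots> = (\<Sum>z | z < d \<and> r z = j. usum d (r(z := i)) w)"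
    unfolding usum_def by (subst sum.Sigma) auto
  finally show ?thesis .
qed

abbreviation higher :: "nat \<Rightarrow> (nat \<Rightarrow> nat) \<Rightarrow> 'f::comm_ring_1 galg set" where
  "higher d r \<equiv> ideal_of d {asum d w | w. npairs d r < npairs d w}"

lemma usum_GA [simp]: "usum d r w \<in> GA d"
  unfolding usum_def using transp_subset by (intro GA_sum GA_single) auto

lemma transp_swap:
  assumes "p < d" "q < d" and x: "x \<in> transp d r w"
    and w': "\<And>k. k < d \<Longrightarrow> w' k = w (transpose p q k)"
  shows "tr p q + x \<in> transp d r w'"
proof -
  have "w' (app (tr p q + x) k) = r k" if "k < d" for k
  proof -
    have xk: "app x k < d" using x that by (simp add: transp_def)
    then have "transpose p q (app x k) < d" using assms by (auto simp: transpose_def)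
    then have "w' (transpose p q (app x k)) = w (app x k)" by (simp add: w')
    then show ?thesis using x that by (simp add: app_tr transp_def)
  qed
  then show ?thesis using x assms(1,2) by (simp add: transp_def tr_Sym)
qed

text \<open>Modulo \<open>higher\<close>, every word of the content of \<open>r\<close> straightens to a multiple of \<open>r\<close>. If \<open>w p > r p\<close>,
  the exchange relation at \<open>p\<close> expresses \<open>w\<close> by words that agree with \<open>r\<close> in more places.\<close>

lemma straighten:
  fixes \<mu> :: "nat list"
  defines "r \<equiv> rw \<mu>" and "d \<equiv> sum_list \<mu>"
  assumes \<mu>: "is_partition \<mu>" and ne: "transp d r w \<noteq> {}"
  shows "\<exists>l. asum d r * usum d r w - sc l * asum d r \<in> (higher d r :: 'f::field_char_0 galg set)"
  using ne
proof (induction "d - card {k. k < d \<and> w k = r k}" arbitrary: w rule: less_induct)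
  case less
  let ?a = "asum d r :: 'f galg"
  obtain x where x: "x \<in> transp d r w" using less.prems by blast
  have xS: "x \<in> Sym d" and wx: "\<And>k. k < d \<Longrightarrow> w (app x k) = r k"
    using x by (auto simp: transp_def)
  show ?case
  proof (cases "\<forall>k<d. w k = r k")
    case True
    then have "transp d r w = stab d r" by (auto simp: transp_def stab_def)
    then have "usum d r w = ?a" by (simp add: usum_def asum_def)
    moreover have "?a * ?a = sc (of_nat (card (stab d r))) * ?a"
      using asum_sq[of d r, where 'a = 'f] by simp
    ultimately show ?thesis
      by (intro exI[of _ "of_nat (card (stab d r))"]) (simp add: ideal_of.zero)
  next
    case False
    \<comment> \<open>\<open>w\<close> is a rearrangement of \<open>r\<close>: their sums agree, so
      \<open>w\<close> exceeds \<open>r\<close> somewhere unless the two coincide.\<close>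
    have "\<exists>p<d. r p < w p"
    proof (rule ccontr)
      assume "\<not> (\<exists>p<d. r p < w p)"
      then have le: "w k \<le> r k" if "k \<in> {..<d}" for k using that by (meson lessThan_iff not_less)
      have "(\<Sum>k<d. r k) = (\<Sum>k<d. w (app x k))" by (simp add: wx)
      also have "\<dots> = (\<Sum>k<d. w k)"
        using xS sum.permute[of "app x" "{..<d}" w] by (simp add: Sym_def comp_def)
      finally have eq: "(\<Sum>k<d. w k) = (\<Sum>k<d. r k)" by simp
      have "w k = r k" if "k < d" for k
        using sum_mono_inv[OF eq le] that by simp
      then show False using False by blast
    qed
    then obtain p where p: "p < d" "r p < w p" by blast
    define i where "i = r p"
    define j where "j = w p"
    have ij: "i < j" using p by (simp add: i_def j_def)
    \<comment> \<open>One letter \<open>j\<close> of \<open>w\<close> is turned into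
      \<open>i\<close>. Turning the letter \<open>i\<close> of \<open>w'\<close> at some
      \<open>q\<close> back into \<open>j\<close> gives \<open>w\<close> with the letters at
      \<open>p\<close> and \<open>q\<close> exchanged; these are the words on the left of the
      exchange relation.\<close>
    define w' where "w' = w(p := i)"
    define Q where "Q = {q. q < d \<and> w' q = i}"
    have finQ: "finite Q" by (simp add: Q_def)
    have pQ: "p \<in> Q" using p by (simp add: Q_def w'_def)
    have sw: "(w'(q := j)) k = w (transpose p q k)" if "q \<in> Q" for q k
      using that by (auto simp: transpose_def w'_def Q_def j_def split: if_splits)
    have Qd: "q < d" if "q \<in> Q" for q using that by (simp add: Q_def)
    \<comment> \<open>Here \<open>p\<close> and \<open>q\<close> lie in one row and
      \<open>asum d r\<close> absorbs the transposition. Such terms reproduce the one for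
      \<open>w\<close>, and there is at least one of them, \<open>q = p\<close>.\<close>
    have same: "?a * usum d r (w'(q := j)) = ?a * usum d r w" if q: "q \<in> Q" "r q = i" for q
    proof -
      have s: "tr p q \<in> stab d r" using p Qd q by (simp add: tr_stab i_def)
      have "tr p q + x \<in> transp d r (w'(q := j))"
        using transp_swap[OF p(1) Qd[OF q(1)] x] sw[OF q(1)] by blast
      then have "usum d r (w'(q := j)) = gr (tr p q) * (gr x * ?a)"
        by (simp only: usum_eq gr_plus mult.assoc)
      then have "?a * usum d r (w'(q := j)) = ?a * gr (tr p q) * (gr x * ?a)"
        by (simp only: mult.assoc)
      then show ?thesis by (simp only: asum_gr[OF s] usum_eq[OF x])
    qed
    \<comment> \<open>Position \<open>p\<close> now carries its letter \<open>r p\<close>, while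
      \<open>q\<close> did not agree with \<open>r\<close> before; so the number of agreeing places
      grows.\<close>
    have IH: "\<exists>l. ?a * usum d r (w'(q := j)) - sc l * ?a \<in> higher d r" if q: "q \<in> Q" "r q \<noteq> i" for q
    proof (rule less.hyps)
      have "tr p q + x \<in> transp d r (w'(q := j))"
        using transp_swap[OF p(1) Qd[OF q(1)] x] sw[OF q(1)] by blast
      then show "transp d r (w'(q := j)) \<noteq> {}" by blast
      have pq: "p \<noteq> q" using q by (auto simp: i_def)
      have wq: "w q = i" using q pq by (simp add: Q_def w'_def)
      have "insert p {k. k < d \<and> w k = r k} \<subseteq> {k. k < d \<and> (w'(q := j)) k = r k}"
        using p pq wq q(2) by (auto simp: w'_def i_def)
      then have "card (insert p {k. k < d \<and> w k = r k}) \<le> card {k. k < d \<and> (w'(q := j)) k = r k}"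
        by (rule card_mono[rotated]) simp
      moreover have "card (insert p {k. k < d \<and> w k = r k}) = Suc (card {k. k < d \<and> w k = r k})"
        using p by simp
      moreover have "card {k. k < d \<and> (w'(q := j)) k = r k} \<le> d"
      proof -
        have "card {k. k < d \<and> (w'(q := j)) k = r k} \<le> card {..<d}" by (rule card_mono) blast+
        then show ?thesis by (simp only: card_lessThan)
      qed
      ultimately show "d - card {k. k < d \<and> (w'(q := j)) k = r k} < d - card {k. k < d \<and> w k = r k}"
        by linarith
    qed
    then have "\<forall>q\<in>{q \<in> Q. r q \<noteq> i}. \<exists>l. ?a * usum d r (w'(q := j)) - sc l * ?a \<in> higher d r"
      by blast
    from bchoice[OF this] obtain l
      where l: "\<And>q. q \<in> Q \<Longrightarrow> r q \<noteq> i \<Longrightarrow> ?a * usum d r (w'(q := j)) - sc (l q) * ?a \<in> higher d r"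
      by blast
    let ?Q1 = "{q \<in> Q. r q = i}"
    let ?Q2 = "{q \<in> Q. r q \<noteq> i}"
    define n where "n = card ?Q1"
    have n: "n \<noteq> 0" using pQ finQ by (auto simp: n_def i_def)
    \<comment> \<open>On the other side of the exchange relation a letter \<open>j\<close> of
      \<open>r\<close> becomes the smaller \<open>i\<close>. Rows do not grow downwards, so the
      receiving fibre is at least as large as the other one and the term lies in
      \<open>higher\<close>.\<close>
    have v: "usum d (r(z := i)) w' \<in> (higher d r :: 'f galg set)" if z: "z < d" "r z = j" for z
    proof (cases "transp d (r(z := i)) w' = {}")
      case True
      then show ?thesis by (simp add: usum_empty ideal_of.zero)
    next
      case False
      then obtain y where y: "y \<in> transp d (r(z := i)) w'" by blast
      have "npairs d r < npairs d (r(z := i))"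
        by (rule npairs_increase[where w = r, OF z])
          (use ij card_row_antimono[OF \<mu>, of i j] in \<open>auto simp: r_def d_def\<close>)
      then have "gr y * asum d (r(z := i)) * 1 \<in> (higher d r :: 'f galg set)"
        using y by (intro ideal_gen) (auto simp: transp_def)
      then show ?thesis by (simp add: usum_eq[OF y])
    qed
    have "(\<Sum>q\<in>Q. usum d r (w'(q := j))) \<in> (higher d r :: 'f galg set)"
      unfolding Q_def exchange_relation[OF less_imp_neq[OF ij]] by (rule ideal_sum) (simp add: v)
    then have "?a * (\<Sum>q\<in>Q. usum d r (w'(q := j))) \<in> higher d r"
      by (rule ideal_left) simp
    also have "?a * (\<Sum>q\<in>Q. usum d r (w'(q := j))) =
        (\<Sum>q\<in>?Q1. ?a * usum d r (w'(q := j))) + (\<Sum>q\<in>?Q2. ?a * usum d r (w'(q := j)))"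
    proof -
      have "Q = ?Q1 \<union> ?Q2" by blast
      then have "(\<Sum>q\<in>Q. ?a * usum d r (w'(q := j))) = (\<Sum>q\<in>?Q1 \<union> ?Q2. ?a * usum d r (w'(q := j)))" by simp
      also have "\<dots> = (\<Sum>q\<in>?Q1. ?a * usum d r (w'(q := j))) + (\<Sum>q\<in>?Q2. ?a * usum d r (w'(q := j)))"
        using finQ by (intro sum.union_disjoint) auto
      finally show ?thesis by (simp only: sum_distrib_left)
    qed
    also have "(\<Sum>q\<in>?Q1. ?a * usum d r (w'(q := j))) = sc (of_nat n) * (?a * usum d r w)"
      by (simp add: same n_def)
    finally have 1: "sc (of_nat n) * (?a * usum d r w) + (\<Sum>q\<in>?Q2. ?a * usum d r (w'(q := j))) \<in> higher d r" .
    have "(\<Sum>q\<in>?Q2. ?a * usum d r (w'(q := j)) - sc (l q) * ?a) \<in> higher d r"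
      by (rule ideal_sum) (simp add: l)
    from ideal_diff[OF 1 this]
    have "sc (of_nat n) * (?a * usum d r w) + (\<Sum>q\<in>?Q2. sc (l q) * ?a) \<in> higher d r"
      by (simp add: sum_subtractf)
    then have "sc (inverse (of_nat n)) * (sc (of_nat n) * (?a * usum d r w) + (\<Sum>q\<in>?Q2. sc (l q) * ?a)) \<in> higher d r"
      by (rule ideal_scale)
    also have "sc (inverse (of_nat n)) * (sc (of_nat n) * (?a * usum d r w) + (\<Sum>q\<in>?Q2. sc (l q) * ?a)) =
        ?a * usum d r w - sc (- (inverse (of_nat n) * (\<Sum>q\<in>?Q2. l q))) * ?a"
      using n by (intro poly_mapping_eqI)
        (simp add: lookup_add lookup_minus lookup_sum distrib_left sum_distrib_left sum_distrib_right mult.assoc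
          del: of_nat_single single_of_nat)
    finally show ?thesis by blast
  qed
qed

text \<open>A permutation is a word: for the filling \<open>r\<close> carried along by
  \<open>g\<close>, the sum \<open>usum\<close> is \<open>gr g * asum d r\<close>, and
  \<open>straighten\<close> applies.\<close>

lemma asum_sandwich:
  fixes \<mu> :: "nat list"
  defines "r \<equiv> rw \<mu>" and "d \<equiv> sum_list \<mu>"
  assumes "is_partition \<mu>" "g \<in> Sym d"
  shows "\<exists>l. asum d r * gr g * asum d r - sc l * asum d r \<in> (higher d r :: 'f::field_char_0 galg set)"
proof -
  let ?w = "\<lambda>i. r (app (- g) i)"
  have g: "g \<in> transp d r ?w" using assms by (simp add: transp_def)
  then have "transp d r ?w \<noteq> {}" by blast
  from straighten[OF assms(3) this[unfolded r_def d_def], folded r_def d_def]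
  show ?thesis unfolding usum_eq[OF g] by (simp only: mult.assoc)
qed

text \<open>By \<open>npairs_le_rw\<close> a filling with more pairs than the rows repeats a label
  in some column. The transposition of the two places is absorbed by \<open>asum\<close> on the left
  and changes the sign of \<open>bsum\<close> on the right, so the product equals its
  negative.\<close>

lemma higher_bsum:
  fixes \<mu> :: "nat list" and z :: "'f::field_char_0 galg"
  assumes \<mu>: "is_partition \<mu>" and "z \<in> higher (sum_list \<mu>) (rw \<mu>)"
  shows "z * bsum (sum_list \<mu>) (cl \<mu>) = 0"
  using assms(2)
proof (induction z rule: ideal_of.induct)
  case (step z x s y)
  let ?d = "sum_list \<mu>"
  let ?b = "bsum ?d (cl \<mu>) :: 'f galg"
  obtain w where w: "s = asum ?d w" "npairs ?d (rw \<mu>) < npairs ?d w" using step by blast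
  have single: "s * gr g * ?b = 0" if g: "g \<in> Sym ?d" for g
  proof -
    have "\<not> npairs ?d (\<lambda>i. w (app g i)) \<le> npairs ?d (rw \<mu>)"
      using w npairs_comp[OF g, of w] by simp
    then obtain i j where ij: "i < ?d" "j < ?d" "cl \<mu> i = cl \<mu> j" "w (app g i) = w (app g j)" "i \<noteq> j"
      using npairs_le_rw[OF \<mu>, of "\<lambda>i. w (app g i)"] by blast
    have t: "tr i j \<in> stab ?d (cl \<mu>)" and t': "tr (app g i) (app g j) \<in> stab ?d w"
      using ij g by (simp_all add: tr_stab)
    have "s * gr g * ?b = s * gr (tr (app g i) (app g j)) * gr g * ?b"
      by (simp add: w asum_gr[OF t'])
    also have "\<dots> = s * gr g * (gr (tr i j) * ?b)"
      by (simp only: mult.assoc flip: gr_plus tr_conj) (simp only: gr_plus mult.assoc)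
    also have "\<dots> = s * gr g * (sc (- 1) * ?b)"
      by (simp only: gr_bsum[OF t] sgn_of_tr[OF ij(5)])
    also have "\<dots> = sc (- 1) * (s * gr g * ?b)"
      by (metis (no_types) mult.assoc sc_commute)
    finally have eq: "s * gr g * ?b = sc (- 1) * (s * gr g * ?b)" .
    show ?thesis
    proof (rule poly_mapping_eqI)
      fix k
      have "Poly_Mapping.lookup (s * gr g * ?b) k = - Poly_Mapping.lookup (s * gr g * ?b) k"
        by (subst eq) (simp only: lookup_sc_mult mult_minus1)
      then show "Poly_Mapping.lookup (s * gr g * ?b) k = Poly_Mapping.lookup 0 k" by simp
    qed
  qed
  have "s * y * ?b = (\<Sum>g\<in>Sym ?d. s * Poly_Mapping.single g (Poly_Mapping.lookup y g) * ?b)"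
    using step.hyps(4) by (subst galg_eq_sum[of "Sym ?d" y]) (auto simp: GA_def sum_distrib_left sum_distrib_right)
  also have "\<dots> = (\<Sum>g\<in>Sym ?d. sc (Poly_Mapping.lookup y g) * (s * gr g * ?b))"
  proof (intro sum.cong refl)
    fix g
    show "s * Poly_Mapping.single g (Poly_Mapping.lookup y g) * ?b =
        sc (Poly_Mapping.lookup y g) * (s * gr g * ?b)"
      unfolding single_eq_sc_gr[of g "Poly_Mapping.lookup y g"] by (metis (no_types) mult.assoc sc_commute)
  qed
  also have "\<dots> = 0" by (simp add: single)
  finally show ?case using step.IH by (simp add: distrib_right mult.assoc)
qed simp

definition csums :: "nat \<Rightarrow> 'f::comm_ring_1 galg set" where
  "csums d = {csum \<mu> | \<mu>. is_partition \<mu> \<and> sum_list \<mu> = d}"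

text \<open>With \<open>a\<close> the row symmetrizer and \<open>b\<close> the column
  antisymmetrizer, straightening gives \<open>a * b * a = sc h * a\<close> modulo
  \<open>higher\<close>. Were \<open>h\<close> zero, multiplication by \<open>b\<close> would make
  the square of \<open>csum \<mu>\<close> vanish. So \<open>a\<close> is a multiple of
  \<open>csum \<mu> * a\<close> up to elements of \<open>higher\<close>.\<close>

lemma asum_rw_in_ideal:
  fixes \<mu> :: "nat list"
  defines "r \<equiv> rw \<mu>" and "d \<equiv> sum_list \<mu>"
  assumes \<mu>: "is_partition \<mu>" and sub: "higher d r \<subseteq> (ideal_of d (csums d) :: 'f::field_char_0 galg set)"
  shows "asum d r \<in> (ideal_of d (csums d) :: 'f galg set)"
proof -
  let ?a = "asum d r :: 'f galg"
  let ?b = "bsum d (cl \<mu>) :: 'f galg"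
  obtain l where l: "\<And>g. g \<in> Sym d \<Longrightarrow> ?a * gr g * ?a - sc (l g) * ?a \<in> higher d r"
  proof -
    have "\<forall>g\<in>Sym d. \<exists>l. ?a * gr g * ?a - sc l * ?a \<in> higher d r"
      using asum_sandwich[OF \<mu>, where 'f = 'f, folded r_def d_def] by blast
    from bchoice[OF this] show ?thesis using that by blast
  qed
  define h where "h = (\<Sum>g\<in>stab d (cl \<mu>). sgn_of g * l g)"
  have "(\<Sum>g\<in>stab d (cl \<mu>). sc (sgn_of g) * (?a * gr g * ?a - sc (l g) * ?a)) \<in> higher d r"
    using l by (intro ideal_sum ideal_scale) (simp add: stab_Sym)
  also have "(\<Sum>g\<in>stab d (cl \<mu>). sc (sgn_of g) * (?a * gr g * ?a - sc (l g) * ?a)) =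
      ?a * ?b * ?a - sc h * ?a"
  proof -
    have "?a * ?b * ?a = (\<Sum>g\<in>stab d (cl \<mu>). ?a * Poly_Mapping.single g (sgn_of g) * ?a)"
      by (simp add: bsum_def sum_distrib_left sum_distrib_right)
    also have "\<dots> = (\<Sum>g\<in>stab d (cl \<mu>). sc (sgn_of g) * (?a * gr g * ?a))"
    proof (intro sum.cong refl)
      fix g
      show "?a * Poly_Mapping.single g (sgn_of g) * ?a = sc (sgn_of g) * (?a * gr g * ?a)"
        unfolding single_eq_sc_gr[of g "sgn_of g"] by (metis (no_types) mult.assoc sc_commute)
    qed
    finally have 1: "?a * ?b * ?a = (\<Sum>g\<in>stab d (cl \<mu>). sc (sgn_of g) * (?a * gr g * ?a))" .
    have 2: "sc h * ?a = (\<Sum>g\<in>stab d (cl \<mu>). sc (sgn_of g) * (sc (l g) * ?a))"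
      by (rule poly_mapping_eqI) (simp add: h_def lookup_sum sum_distrib_right mult.assoc)
    show ?thesis unfolding 1 2 by (simp add: right_diff_distrib sum_subtractf)
  qed
  finally have aba: "?a * ?b * ?a - sc h * ?a \<in> higher d r" .
  have c: "csum \<mu> = ?a * ?b" by (simp add: csum_def r_def d_def)
  have "h \<noteq> 0"
  proof
    assume "h = 0"
    then have "?a * ?b * ?a \<in> higher d r" using aba by simp
    then have "?a * ?b * ?a * ?b = 0"
      using higher_bsum[OF \<mu>] unfolding r_def d_def by blast
    then show False using csum_sq_nonzero[of \<mu>, where 'f = 'f] by (simp add: c mult.assoc)
  qed
  have "1 * csum \<mu> * ?a \<in> ideal_of d (csums d)"
    using \<mu> by (intro ideal_gen) (auto simp: csums_def d_def)
  then have "?a * ?b * ?a \<in> ideal_of d (csums d)" by (simp add: c)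
  from ideal_diff[OF this subsetD[OF sub aba]] have "sc h * ?a \<in> ideal_of d (csums d)" by simp
  from ideal_scale[OF this, of "inverse h"] show ?thesis using sc_inverse[OF \<open>h \<noteq> 0\<close>] by simp
qed

text \<open>Induction from coarse fillings to fine ones: conjugation brings \<open>w\<close> into
  the form of the rows of a diagram, and \<open>higher\<close> is generated by symmetrizers of
  fillings with more pairs.\<close>

lemma asum_in_ideal: "asum d w \<in> (ideal_of d (csums d) :: 'f::field_char_0 galg set)"
proof (induction "d * d - npairs d w" arbitrary: w rule: less_induct)
  case less
  obtain \<mu> g where \<mu>: "is_partition \<mu>" "sum_list \<mu> = d" and g: "g \<in> Sym d"
    and iff: "\<And>i j. i < d \<Longrightarrow> j < d \<Longrightarrow> w i = w j \<longleftrightarrow> rw \<mu> (app g i) = rw \<mu> (app g j)"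
    by (rule ex_sorted_relabelling[where d = d and w = w]) (rule that)
  have "npairs d w = npairs d (\<lambda>i. rw \<mu> (app g i))"
    unfolding npairs_def using iff by (intro arg_cong[where f = card]) auto
  then have np: "npairs d w = npairs d (rw \<mu>)" by (simp add: npairs_comp[OF g])
  have "{asum d w' | w'. npairs d (rw \<mu>) < npairs d w'} \<subseteq> (ideal_of d (csums d) :: 'f galg set)"
    using less np npairs_le by (auto intro!: less diff_less_mono2 order_less_le_trans[OF _ npairs_le])
  then have sub: "higher d (rw \<mu>) \<subseteq> (ideal_of d (csums d) :: 'f galg set)"
    by (blast intro: ideal_mono)
  have a: "asum d (rw \<mu>) \<in> (ideal_of d (csums d) :: 'f galg set)"
    using asum_rw_in_ideal[OF \<mu>(1), where 'f = 'f] sub by (simp add: \<mu>(2))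
  have stab: "y \<in> stab d w \<longleftrightarrow> g + y - g \<in> stab d (rw \<mu>)" for y
  proof
    assume y: "y \<in> stab d w"
    have "rw \<mu> (app (g + y - g) i) = rw \<mu> i" if "i < d" for i
    proof -
      define k where "k = inv (app g) i"
      have k: "k < d" using g that by (simp add: k_def)
      moreover from k have "app y k < d" using y by (simp add: stab_def)
      ultimately have "rw \<mu> (app g (app y k)) = rw \<mu> (app g k)"
        using iff[of "app y k" k] y by (simp add: stab_def)
      then show ?thesis by (simp add: k_def)
    qed
    then show "g + y - g \<in> stab d (rw \<mu>)" using g y by (simp add: stab_def)
  next
    assume y: "g + y - g \<in> stab d (rw \<mu>)"
    have "- g + (g + y - g) + g \<in> Sym d" using g stab_Sym[OF y] by (intro Sym_plus Sym_uminus)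
    moreover have "- g + (g + y - g) + g = y" by (rule bijn_eqI) simp
    ultimately have yS: "y \<in> Sym d" by (simp only:)
    have "w (app y k) = w k" if "k < d" for k
    proof -
      have "app g k < d" using g that by simp
      then have "rw \<mu> (app (g + y - g) (app g k)) = rw \<mu> (app g k)" using y unfolding stab_def by blast
      then show ?thesis using iff[of "app y k" k] yS that by simp
    qed
    then show "y \<in> stab d w" using yS by (simp add: stab_def)
  qed
  have "asum d w = gr (- g) * asum d (rw \<mu>) * (gr g :: 'f galg)"
    by (rule poly_mapping_eqI) (simp add: lookup_mult_single lookup_single_mult lookup_asum stab add_diff_eq)
  then show ?case using a g by (simp add: ideal_left ideal_right)
qed

text \<open>The unit is the symmetrizer of the filling with distinct labels. Its decomposition will
  decompose every map on a tensor power.\<close>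

lemma one_in_ideal: "1 \<in> (ideal_of d (csums d) :: 'f::field_char_0 galg set)"
proof -
  have "stab d id = {0}" by (auto simp: stab_def intro: Sym_eqI)
  then have "asum d id = (1 :: 'f galg)" by (simp add: asum_def)
  then show ?thesis using asum_in_ideal[of d id, where 'f = 'f] by simp
qed

subsection \<open>Polarization of maps from tensor powers\<close>

lemma mtx_mult_block:
  assumes "A \<in> mtx_block n" "n \<le> m" "i < m"
  shows "mtx_mult A B i j = (\<Sum>l<m. A i l * B l j)"
proof -
  have "{l. A i l \<noteq> 0} \<subseteq> {..<m}"
  proof
    fix l assume "l \<in> {l. A i l \<noteq> 0}"
    then have nz: "A i l \<noteq> 0" by simp
    show "l \<in> {..<m}"
    proof (rule ccontr)
      assume "l \<notin> {..<m}"
      then have "A i l = mtx_one i l" using assms by (simp add: mtx_block_def)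
      then show False using nz assms(3) \<open>l \<notin> {..<m}\<close> by (auto simp: mtx_one_def)
    qed
  qed
  then show ?thesis unfolding mtx_mult_def by (intro sum.mono_neutral_left) auto
qed

lemma mtx_block_mono: "A \<in> mtx_block n \<Longrightarrow> n \<le> m \<Longrightarrow> A \<in> mtx_block m"
  unfolding mtx_block_def by (auto intro: order_trans)

lemma GL_I:
  assumes "A \<in> mtx_block n" "B \<in> mtx_block n" "mtx_mult A B = mtx_one" "mtx_mult B A = mtx_one"
  shows "A \<in> GL"
proof -
  have "A \<in> mtx_block (Suc n)" "B \<in> mtx_block (Suc n)"
    using assms(1,2) mtx_block_mono by (meson le_SucI order_refl)+
  then have "A \<in> GLn (Suc n)" using assms(3,4) unfolding GLn_def by blast
  then show ?thesis unfolding GL_def by (auto intro!: bexI[of _ "Suc n"])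
qed

lemma GL_block: "g \<in> GL \<Longrightarrow> \<exists>n. g \<in> mtx_block n"
  by (auto simp: GL_def GLn_def)

text \<open>A bound on the letters replaces the support of \<open>tensor_coeff g is js\<close>,
  which varies with \<open>g\<close> and \<open>js\<close>, by one finite index set.\<close>

definition words :: "nat \<Rightarrow> nat \<Rightarrow> nat list set" where
  "words B e = {js. length js = e \<and> set js \<subseteq> {..<B}}"

lemma finite_words [simp]: "finite (words B e)"
  using finite_lists_length_eq[of "{..<B}" e] by (simp add: words_def conj_commute)

lemma words_length: "js \<in> words B e \<Longrightarrow> length js = e" by (simp add: words_def)
lemma words_mono: "js \<in> words B e \<Longrightarrow> B \<le> C \<Longrightarrow> js \<in> words C e" by (auto simp: words_def)
lemma ex_words: "\<exists>B. js \<in> words B (length js)"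
  using finite_nat_set_iff_bounded[of "set js"] by (auto simp: words_def)
lemma ex_words_above: obtains B where "n \<le> B" "js \<in> words B (length js)"
  using ex_words[of js] words_mono by (metis max.cobounded1 max.cobounded2)

lemma tensor_coeff_support:
  assumes "g \<in> mtx_block n" "n \<le> B" "js \<in> words B e" "length is = e" "tensor_coeff g is js \<noteq> 0"
  shows "is \<in> words B e"
proof -
  have "is ! p < B" if "p < e" for p
  proof (rule ccontr)
    assume B: "\<not> is ! p < B"
    have "g (is ! p) (js ! p) \<noteq> 0"
      using assms(3,5) that unfolding tensor_coeff_def words_def by (auto simp: prod_zero_iff)
    moreover have "g (is ! p) (js ! p) = mtx_one (is ! p) (js ! p)"
      using assms(1,2) B by (simp add: mtx_block_def)
    ultimately have "is ! p = js ! p" by (auto simp: mtx_one_def split: if_splits)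
    moreover have "js ! p \<in> set js" using assms(3) that by (simp add: words_def)
    then have "js ! p < B" using assms(3) by (auto simp: words_def)
    ultimately show False using B by simp
  qed
  then show ?thesis using assms(4) by (auto simp: words_def in_set_conv_nth)
qed

lemma tensor_coeff_finite:
  assumes "g \<in> GL" shows "finite {is. length is = length js \<and> tensor_coeff g is js \<noteq> 0}"
proof -
  obtain n where n: "g \<in> mtx_block n" using GL_block[OF assms] by blast
  obtain B where "n \<le> B" "js \<in> words B (length js)" by (rule ex_words_above)
  then have "{is. length is = length js \<and> tensor_coeff g is js \<noteq> 0} \<subseteq> words B (length js)"
    using tensor_coeff_support[OF n] by blast
  then show ?thesis by (rule finite_subset) simp
qed

text \<open>A \<open>k\<close>-linear \<open>GL\<close>-map from \<open>V\<^sup>\<otimes>\<^sup>e\<close> to a representation is given by its values on the words of length \<open>e\<close>.\<close>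

definition cov :: "('k::field \<Rightarrow> 'x::ab_group_add \<Rightarrow> 'x) \<Rightarrow> ('k mtx \<Rightarrow> 'x \<Rightarrow> 'x) \<Rightarrow> nat \<Rightarrow>
    (nat list \<Rightarrow> 'x) set" where
  "cov s \<rho> e = {\<psi>. \<forall>g\<in>GL. \<forall>js. length js = e \<longrightarrow> \<rho> g (\<psi> js) =
     (\<Sum>is | length is = e \<and> tensor_coeff g is js \<noteq> 0. s (tensor_coeff g is js) (\<psi> is))}"

context vector_space
begin

lemma coeff_sum_words:
  assumes "g \<in> mtx_block n" "n \<le> B" "js \<in> words B e"
  shows "(\<Sum>is | length is = e \<and> tensor_coeff g is js \<noteq> 0. scale (tensor_coeff g is js) (\<psi> is)) =
    (\<Sum>is\<in>words B e. scale (tensor_coeff g is js) (\<psi> is))"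
  using tensor_coeff_support[OF assms]
  by (intro sum.mono_neutral_left) (auto simp: words_length)

lemma covD:
  assumes "\<psi> \<in> cov scale \<rho> e" "g \<in> GL" "g \<in> mtx_block n" "n \<le> B" "js \<in> words B e"
  shows "\<rho> g (\<psi> js) = (\<Sum>is\<in>words B e. scale (tensor_coeff g is js) (\<psi> is))"
proof -
  have "\<rho> g (\<psi> js) =
     (\<Sum>is | length is = e \<and> tensor_coeff g is js \<noteq> 0. scale (tensor_coeff g is js) (\<psi> is))"
    using assms(1,2) words_length[OF assms(5)] unfolding cov_def by blast
  then show ?thesis using coeff_sum_words[OF assms(3-5)] by simp
qed

lemma covI:
  assumes "\<And>g n B js. g \<in> GL \<Longrightarrow> g \<in> mtx_block n \<Longrightarrow> n \<le> B \<Longrightarrow> js \<in> words B e \<Longrightarrow>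
    \<rho> g (\<psi> js) = (\<Sum>is\<in>words B e. scale (tensor_coeff g is js) (\<psi> is))"
  shows "\<psi> \<in> cov scale \<rho> e"
  unfolding cov_def
proof (intro CollectI ballI allI impI)
  fix g :: "'a mtx" and js :: "nat list" assume g: "g \<in> GL" and js: "length js = e"
  obtain n where n: "g \<in> mtx_block n" using GL_block[OF g] by blast
  obtain B where B: "n \<le> B" "js \<in> words B e" using js by (metis ex_words_above)
  show "\<rho> g (\<psi> js) =
     (\<Sum>is | length is = e \<and> tensor_coeff g is js \<noteq> 0. scale (tensor_coeff g is js) (\<psi> is))"
    using assms[OF g n B] coeff_sum_words[OF n B] by simp
qed

end

lemma two_power_neq: "i < n \<Longrightarrow> (2::'k::field_char_0) ^ i \<noteq> 2 ^ n"
proof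
  assume "i < n" "(2::'k) ^ i = 2 ^ n"
  then have "of_nat (2 ^ i) = (of_nat (2 ^ n) :: 'k)" by simp
  then show False using \<open>i < n\<close> by (simp only: of_nat_eq_iff) simp
qed

locale GL_rep = vector_space scale
  for scale :: "'k::field_char_0 \<Rightarrow> 'x::ab_group_add \<Rightarrow> 'x" +
  fixes \<rho> :: "'k mtx \<Rightarrow> 'x \<Rightarrow> 'x"
  assumes act_add: "g \<in> GL \<Longrightarrow> \<rho> g (x + y) = \<rho> g x + \<rho> g y"
    and act_scale: "g \<in> GL \<Longrightarrow> \<rho> g (scale c x) = scale c (\<rho> g x)"
begin

text \<open>Write \<open>f t\<close> for the sum. Passing to
  \<open>f (2 * t) - 2 ^ Suc m * f t\<close> removes the coefficient of degree \<open>Suc m\<close>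
  and multiplies the others by \<open>2 ^ j - 2 ^ Suc m\<close>, which is nonzero in characteristic
  zero. Only nonzero \<open>t\<close> are available, since they will be entries of invertible
  matrices.\<close>

lemma polynomial_coefficients:
  assumes X: "subspace X" and f: "\<And>t. t \<noteq> 0 \<Longrightarrow> (\<Sum>j\<le>m. scale (t ^ j) (v j)) \<in> X"
    and "j \<le> m"
  shows "v j \<in> X"
  using f \<open>j \<le> m\<close>
proof (induction m arbitrary: v j)
  case 0
  then show ?case using "0.prems"(1)[of 1] by simp
next
  case (Suc m)
  have low: "v i \<in> X" if "i \<le> m" for i
  proof -
    have "(\<Sum>j\<le>m. scale (t ^ j) (scale (2 ^ j - 2 ^ Suc m) (v j))) \<in> X" if t: "t \<noteq> 0" for t
    proof -
      have "(\<Sum>j\<le>Suc m. scale ((2 * t) ^ j) (v j)) \<in> X"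
        "scale (2 ^ Suc m) (\<Sum>j\<le>Suc m. scale (t ^ j) (v j)) \<in> X"
        using Suc.prems(1)[of "2 * t"] Suc.prems(1)[OF t] t subspace_scale[OF X] by auto
      from subspace_diff[OF X this]
      have "(\<Sum>j\<le>Suc m. scale ((2 * t) ^ j) (v j) - scale (2 ^ Suc m) (scale (t ^ j) (v j))) \<in> X"
        by (simp only: scale_sum_right sum_subtractf)
      also have "(\<lambda>j. scale ((2 * t) ^ j) (v j) - scale (2 ^ Suc m) (scale (t ^ j) (v j))) =
          (\<lambda>j. scale (t ^ j * (2 ^ j - 2 ^ Suc m)) (v j))"
        by (rule ext) (simp only: scale_scale scale_left_diff_distrib[symmetric] power_mult_distrib
          right_diff_distrib mult.commute)
      finally have "(\<Sum>j\<le>Suc m. scale (t ^ j * (2 ^ j - 2 ^ Suc m)) (v j)) \<in> X" .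
      then show ?thesis by simp
    qed
    from Suc.IH[OF this that] have "scale (2 ^ i - 2 ^ Suc m) (v i) \<in> X" by simp
    from subspace_scale[OF X this, of "inverse (2 ^ i - 2 ^ Suc m)"] two_power_neq[of i "Suc m", where 'k = 'k] that
    show ?thesis by simp
  qed
  show ?case
  proof (cases "j \<le> m")
    case True
    then show ?thesis by (rule low)
  next
    case False
    have "(\<Sum>j\<le>Suc m. v j) \<in> X" using Suc.prems(1)[of 1] by simp
    moreover have "(\<Sum>j\<le>m. v j) \<in> X" using low by (intro subspace_sum[OF X]) simp
    ultimately have "v (Suc m) \<in> X" using subspace_diff[OF X] by fastforce
    then show ?thesis using False Suc.prems(2) by (simp add: le_Suc_eq)
  qed
qed

end

section \<open>Ryser's formula for the permanent\<close>

lemma ryser_signs: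
  fixes T U :: "nat set"
  assumes "finite U" "T \<subseteq> U"
  shows "(\<Sum>S | T \<subseteq> S \<and> S \<subseteq> U. (- 1) ^ (card U + card S) :: 'k::comm_ring_1) = (if T = U then 1 else 0)"
proof (cases "T = U")
  case True
  then have "{S. T \<subseteq> S \<and> S \<subseteq> U} = {U}" by blast
  then show ?thesis using True by simp
next
  case False
  then obtain x where x: "x \<in> U" "x \<notin> T" using assms by blast
  let ?A = "{S. T \<subseteq> S \<and> S \<subseteq> U \<and> x \<notin> S}"
  have finA: "finite ?A" using assms(1) by (auto intro: finite_subset[of _ "Pow U"])
  have dec: "{S. T \<subseteq> S \<and> S \<subseteq> U} = ?A \<union> insert x ` ?A"
  proof (intro equalityI subsetI)
    fix S assume S: "S \<in> {S. T \<subseteq> S \<and> S \<subseteq> U}"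
    show "S \<in> ?A \<union> insert x ` ?A"
    proof (cases "x \<in> S")
      case True
      then have "S = insert x (S - {x})" "S - {x} \<in> ?A" using S x by blast+
      then show ?thesis by blast
    qed (use S in blast)
  qed (use x in blast)
  have inj: "inj_on (insert x) ?A" by (auto simp: inj_on_def)
  have "(\<Sum>S | T \<subseteq> S \<and> S \<subseteq> U. (- 1) ^ (card U + card S) :: 'k) =
    (\<Sum>S\<in>?A. (- 1) ^ (card U + card S)) + (\<Sum>S\<in>insert x ` ?A. (- 1) ^ (card U + card S))"
    unfolding dec using finA by (intro sum.union_disjoint) auto
  also have "(\<Sum>S\<in>insert x ` ?A. (- 1) ^ (card U + card S) :: 'k) =
      (\<Sum>S\<in>?A. - ((- 1) ^ (card U + card S)))"
    unfolding sum.reindex[OF inj] comp_def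
  proof (intro sum.cong refl)
    fix S assume "S \<in> ?A"
    then have "card (insert x S) = Suc (card S)"
      using assms(1) by (auto intro!: card_insert_disjoint dest: finite_subset)
    then show "(- 1) ^ (card U + card (insert x S)) = - ((- 1) ^ (card U + card S) :: 'k)" by simp
  qed
  finally show ?thesis using False by (simp add: sum_negf)
qed

text \<open>Expand the product into a sum over functions on \<open>{..<E}\<close>. By inclusion and
  exclusion over the sets containing the image only the surjective functions survive, and these are
  the permutations.\<close>

lemma ryser:
  fixes m :: "nat \<Rightarrow> nat \<Rightarrow> 'k::comm_ring_1"
  shows "(\<Sum>S\<in>Pow {..<E}. (- 1) ^ (E + card S) * (\<Prod>k<E. \<Sum>q\<in>S. m k q)) =
    (\<Sum>g\<in>Sym E. \<Prod>k<E. m k (app g k))"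
proof -
  let ?U = "{..<E}"
  let ?F = "?U \<rightarrow>\<^sub>E ?U"
  have "(\<Sum>S\<in>Pow ?U. (- 1) ^ (E + card S) * (\<Prod>k<E. \<Sum>q\<in>S. m k q)) =
    (\<Sum>S\<in>Pow ?U. \<Sum>f\<in>?F. if f ` ?U \<subseteq> S then (- 1) ^ (E + card S) * (\<Prod>k<E. m k (f k)) else 0)"
  proof (intro sum.cong refl)
    fix S assume S: "S \<in> Pow ?U"
    then have finS: "finite S" by (auto intro: finite_subset)
    have "(\<Prod>k<E. \<Sum>q\<in>S. m k q) = (\<Sum>f\<in>?U \<rightarrow>\<^sub>E S. \<Prod>k<E. m k (f k))"
      using finS by (intro prod_sum_PiE) auto
    also have "?U \<rightarrow>\<^sub>E S = {f \<in> ?F. f ` ?U \<subseteq> S}" using S by (auto simp: PiE_def Pi_def)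
    also have "(\<Sum>f\<in>{f \<in> ?F. f ` ?U \<subseteq> S}. \<Prod>k<E. m k (f k)) =
        (\<Sum>f\<in>?F. if f ` ?U \<subseteq> S then \<Prod>k<E. m k (f k) else 0)"
      by (rule sum.inter_filter) (simp add: finite_PiE)
    finally have 1: "(\<Prod>k<E. \<Sum>q\<in>S. m k q) =
        (\<Sum>f\<in>?F. if f ` ?U \<subseteq> S then \<Prod>k<E. m k (f k) else 0)" .
    show "(- 1) ^ (E + card S) * (\<Prod>k<E. \<Sum>q\<in>S. m k q) =
      (\<Sum>f\<in>?F. if f ` ?U \<subseteq> S then (- 1) ^ (E + card S) * (\<Prod>k<E. m k (f k)) else 0)"
      unfolding 1 sum_distrib_left by (intro sum.cong refl) simp
  qed
  also have "\<dots> = (\<Sum>f\<in>?F. \<Sum>S\<in>Pow ?U. if f ` ?U \<subseteq> S then (- 1) ^ (E + card S) * (\<Prod>k<E. m k (f k)) else 0)"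
    by (rule sum.swap)
  also have "\<dots> = (\<Sum>f\<in>?F. if f ` ?U = ?U then \<Prod>k<E. m k (f k) else 0)"
  proof (intro sum.cong refl)
    fix f assume "f \<in> ?F"
    then have sub: "f ` ?U \<subseteq> ?U" by auto
    have "(\<Sum>S\<in>Pow ?U. if f ` ?U \<subseteq> S then (- 1) ^ (E + card S) * (\<Prod>k<E. m k (f k)) else 0) =
      (\<Sum>S | f ` ?U \<subseteq> S \<and> S \<subseteq> ?U. (- 1) ^ (card ?U + card S)) * (\<Prod>k<E. m k (f k))"
      unfolding sum_distrib_right
      by (subst sum.inter_filter[symmetric]) (auto intro!: sum.cong)
    then show "(\<Sum>S\<in>Pow ?U. if f ` ?U \<subseteq> S then (- 1) ^ (E + card S) * (\<Prod>k<E. m k (f k)) else 0) =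
      (if f ` ?U = ?U then \<Prod>k<E. m k (f k) else 0)"
      using ryser_signs[OF _ sub, where 'k = 'k] by simp
  qed
  also have "\<dots> = (\<Sum>f\<in>{f \<in> ?F. f ` ?U = ?U}. \<Prod>k<E. m k (f k))"
    by (rule sum.inter_filter[symmetric]) (simp add: finite_PiE)
  also have "\<dots> = (\<Sum>g\<in>Sym E. \<Prod>k<E. m k (app g k))"
  proof (rule sum.reindex_bij_witness[where i = "\<lambda>g. restrict (app g) ?U"
        and j = "\<lambda>f. of_perm (\<lambda>i. if i < E then f i else i)"])
    fix f assume f: "f \<in> {f \<in> ?F. f ` ?U = ?U}"
    define p where "p i = (if i < E then f i else i)" for i
    have "f ` ?U = ?U" using f by blast
    then have "bij_betw f ?U ?U" using eq_card_imp_inj_on[of ?U f] by (simp add: bij_betw_def)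
    then have "bij_betw p ?U ?U" by (rule bij_betw_cong[THEN iffD1, rotated]) (simp add: p_def)
    then have p: "p permutes ?U" by (rule bij_imp_permutes) (simp add: p_def)
    show "of_perm (\<lambda>i. if i < E then f i else i) \<in> Sym E"
      using of_perm_Sym[OF p] by (simp add: p_def[abs_def])
    have a: "app (of_perm (\<lambda>i. if i < E then f i else i)) = p"
      using app_of_perm[OF p] by (simp add: p_def[abs_def])
    show "restrict (app (of_perm (\<lambda>i. if i < E then f i else i))) ?U = f"
      unfolding a using f by (auto simp: p_def fun_eq_iff PiE_def extensional_def)
    show "(\<Prod>k<E. m k (app (of_perm (\<lambda>i. if i < E then f i else i)) k)) = (\<Prod>k<E. m k (f k))"
      unfolding a by (simp add: p_def)
  next
    fix g assume g: "g \<in> Sym E"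
    have gp: "app g permutes ?U" using g by (simp add: Sym_def)
    have eq: "(\<lambda>i. if i < E then restrict (app g) ?U i else i) = app g"
      using Sym_outside[OF g] by (auto simp: fun_eq_iff)
    show "of_perm (\<lambda>i. if i < E then restrict (app g) ?U i else i) = g"
      unfolding eq by simp
    have "restrict (app g) ?U ` ?U = ?U" using permutes_image[OF gp] by (simp add: image_restrict_eq)
    then show "restrict (app g) ?U \<in> {f \<in> ?F. f ` ?U = ?U}" using g by auto
  qed
  finally show ?thesis .
qed

section \<open>Substitution of letters as a limit of group elements\<close>

definition subst_mtx :: "nat set \<Rightarrow> 'k::field mtx \<Rightarrow> 'k \<Rightarrow> 'k mtx" where
  "subst_mtx L A t i l = (if l \<in> L then t * mtx_one i l + A i l else mtx_one i l)"

text \<open>\<open>A\<close> sends letters of \<open>L\<close> to combinations of letters outside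
  \<open>L\<close>, so the matrix is block triangular with \<open>t\<close> on the diagonal of the
  block \<open>L\<close>. At \<open>t = 0\<close> it becomes the substitution by \<open>A\<close>,
  which in general is not invertible.\<close>

lemma subst_mtx_GL:
  assumes L: "L \<subseteq> {..<n}" and A: "\<And>i l. l \<in> L \<Longrightarrow> A i l \<noteq> 0 \<Longrightarrow> i \<notin> L \<and> i < n" and t: "t \<noteq> 0"
  shows "subst_mtx L A t \<in> GL" "subst_mtx L A t \<in> mtx_block n"
proof -
  define g where "g = subst_mtx L A t"
  \<comment> \<open>The explicit inverse: the columns of \<open>A\<close> only involve letters that
    the matrix fixes, so they can be subtracted before division by \<open>t\<close>.\<close>
  define h where "h i l = (if l \<in> L then inverse t * (mtx_one i l - A i l) else mtx_one i l)" for i l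
  have z: "l \<in> L \<Longrightarrow> n \<le> i \<Longrightarrow> A i l = 0" for i l using A[of l i] by force
  show gb: "subst_mtx L A t \<in> mtx_block n"
    using L z by (auto simp: mtx_block_def subst_mtx_def mtx_one_def subset_iff)
  have hb: "h \<in> mtx_block n"
    using L z by (auto simp: mtx_block_def h_def mtx_one_def subset_iff)
  have one: "(\<Sum>l<m. mtx_one i l * f l) = f i" "(\<Sum>l<m. f l * mtx_one l i) = f i" if "i < m" for i m and f :: "nat \<Rightarrow> 'a"
  proof -
    have "(\<Sum>l<m. mtx_one i l * f l) = (\<Sum>l<m. if l = i then f l else 0)"
      "(\<Sum>l<m. f l * mtx_one l i) = (\<Sum>l<m. if l = i then f l else 0)"
      by (intro sum.cong refl, simp add: mtx_one_def)+
    then show "(\<Sum>l<m. mtx_one i l * f l) = f i" "(\<Sum>l<m. f l * mtx_one l i) = f i"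
      using that by simp_all
  qed
  have gA: "(\<Sum>l<m. g i l * A l j) = A i j" "(\<Sum>l<m. h i l * A l j) = A i j" if "i < m" "j \<in> L" for i j m
  proof -
    have "(\<Sum>l<m. g i l * A l j) = (\<Sum>l<m. mtx_one i l * A l j)"
      using A[OF that(2)] by (intro sum.cong refl) (auto simp: g_def subst_mtx_def)
    then show "(\<Sum>l<m. g i l * A l j) = A i j" using one that by simp
    have "(\<Sum>l<m. h i l * A l j) = (\<Sum>l<m. mtx_one i l * A l j)"
      using A[OF that(2)] by (intro sum.cong refl) (auto simp: h_def)
    then show "(\<Sum>l<m. h i l * A l j) = A i j" using one that by simp
  qed
  have gh: "mtx_mult g h = mtx_one"
  proof (intro ext)
    fix i j
    define m where "m = max n (Suc (max i j))"
    have m: "n \<le> m" "i < m" "j < m" by (auto simp: m_def)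
    have eq: "mtx_mult g h i j = (\<Sum>l<m. g i l * h l j)"
      using gb m by (simp add: mtx_mult_block g_def)
    show "mtx_mult g h i j = mtx_one i j"
    proof (cases "j \<in> L")
      case True
      have "(\<Sum>l<m. g i l * h l j) = inverse t * ((\<Sum>l<m. g i l * mtx_one l j) - (\<Sum>l<m. g i l * A l j))"
        using True by (simp add: h_def sum_distrib_left sum_subtractf[symmetric] algebra_simps)
      also have "\<dots> = inverse t * (g i j - A i j)" using one m gA True by simp
      finally have 1: "(\<Sum>l<m. g i l * h l j) = inverse t * (g i j - A i j)" .
      have "g i j = t * mtx_one i j + A i j" using True by (simp add: g_def subst_mtx_def)
      then show ?thesis using t by (simp add: eq 1)
    next
      case False
      then have 1: "(\<Sum>l<m. g i l * h l j) = g i j" using one m by (simp add: h_def)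
      have "g i j = mtx_one i j" using False by (simp add: g_def subst_mtx_def)
      then show ?thesis by (simp add: eq 1)
    qed
  qed
  have hg: "mtx_mult h g = mtx_one"
  proof (intro ext)
    fix i j
    define m where "m = max n (Suc (max i j))"
    have m: "n \<le> m" "i < m" "j < m" by (auto simp: m_def)
    have eq: "mtx_mult h g i j = (\<Sum>l<m. h i l * g l j)"
      using hb m by (simp add: mtx_mult_block)
    show "mtx_mult h g i j = mtx_one i j"
    proof (cases "j \<in> L")
      case True
      have "(\<Sum>l<m. h i l * g l j) = t * (\<Sum>l<m. h i l * mtx_one l j) + (\<Sum>l<m. h i l * A l j)"
        using True by (simp add: g_def subst_mtx_def sum_distrib_left sum.distrib[symmetric] algebra_simps)
      also have "\<dots> = t * h i j + A i j" using one m gA True by simp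
      finally show ?thesis using True t by (simp add: eq h_def flip: mult.assoc)
    next
      case False
      then have "(\<Sum>l<m. h i l * g l j) = h i j" using one m by (simp add: g_def subst_mtx_def)
      then show ?thesis using False by (simp add: eq h_def)
    qed
  qed
  show "subst_mtx L A t \<in> GL" using GL_I[OF gb hb] gh hg by (simp add: g_def)
qed

lemma length_permute_list_words:
  "js \<in> words B e \<Longrightarrow> g \<in> Sym e \<Longrightarrow> permute_list (app g) js \<in> words B e"
  by (auto simp: words_def Sym_def)

lemma tensor_coeff_permute:
  assumes "g \<in> Sym (length js)" "length is = length js"
  shows "tensor_coeff A (permute_list (app g) is) (permute_list (app g) js) = tensor_coeff A is js"
proof -
  have p: "app g permutes {..<length js}" "app g permutes {..<length is}" using assms by (simp_all add: Sym_def)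
  have "tensor_coeff A (permute_list (app g) is) (permute_list (app g) js) =
    (\<Prod>k<length js. A (is ! app g k) (js ! app g k))"
    unfolding tensor_coeff_def
    by (intro prod.cong) (auto simp: permute_list_nth[OF p(1)] permute_list_nth[OF p(2)] assms(2))
  also have "\<dots> = (\<Prod>k<length js. A (is ! k) (js ! k))"
    using prod.permute[OF p(1), of "\<lambda>k. A (is ! k) (js ! k)"] by (simp add: comp_def)
  finally show ?thesis by (simp add: tensor_coeff_def)
qed

lemma permute_list_app_inv:
  assumes "g \<in> Sym (length js)"
  shows "permute_list (app g) (permute_list (app (- g)) js) = js"
    and "permute_list (app (- g)) (permute_list (app g) js) = js"
proof -
  have g: "app g permutes {..<length js}" "app (- g) permutes {..<length js}"
    using assms Sym_uminus[OF assms] by (simp_all add: Sym_def)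
  have "app (- g) \<circ> app g = id" "app g \<circ> app (- g) = id" by auto
  then show "permute_list (app g) (permute_list (app (- g)) js) = js"
    "permute_list (app (- g)) (permute_list (app g) js) = js"
    using permute_list_compose[OF g(1), of "app (- g)"] permute_list_compose[OF g(2), of "app g"]
    by (simp_all del: app_uminus)
qed

context GL_rep
begin

lemma act_zero: "g \<in> GL \<Longrightarrow> \<rho> g 0 = 0"
  using act_add[of g 0 0] by simp

lemma act_sum: "g \<in> GL \<Longrightarrow> \<rho> g (\<Sum>i\<in>I. f i) = (\<Sum>i\<in>I. \<rho> g (f i))"
  by (induction I rule: infinite_finite_induct) (auto simp: act_zero act_add)

lemma polynomial_coefficients_sum:
  assumes X: "subspace X" and Z: "finite Z"
    and f: "\<And>t. t \<noteq> 0 \<Longrightarrow> (\<Sum>z\<in>Z. scale (poly (P z) t) (v z)) \<in> X"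
  shows "(\<Sum>z\<in>Z. scale (coeff (P z) j) (v z)) \<in> X"
proof -
  define m where "m = Max (insert j (degree ` P ` Z))"
  have m: "degree (P z) \<le> m" if "z \<in> Z" for z
    unfolding m_def using Z that by (intro Max_ge) auto
  have "(\<Sum>i\<le>m. scale (t ^ i) (\<Sum>z\<in>Z. scale (coeff (P z) i) (v z))) \<in> X" if "t \<noteq> 0" for t
  proof -
    have "poly (P z) t = (\<Sum>i\<le>m. coeff (P z) i * t ^ i)" if "z \<in> Z" for z
      unfolding poly_altdef using m[OF that]
      by (intro sum.mono_neutral_left) (auto simp: coeff_eq_0)
    then have "(\<Sum>z\<in>Z. scale (poly (P z) t) (v z)) =
        (\<Sum>z\<in>Z. \<Sum>i\<le>m. scale (t ^ i) (scale (coeff (P z) i) (v z)))"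
      by (simp add: scale_sum_left mult.commute)
    also have "\<dots> = (\<Sum>i\<le>m. \<Sum>z\<in>Z. scale (t ^ i) (scale (coeff (P z) i) (v z)))"
      by (rule sum.swap)
    finally show ?thesis using f[OF that] by (simp only: scale_sum_right)
  qed
  then show ?thesis
    by (rule polynomial_coefficients[OF X]) (use Z in \<open>auto simp: m_def\<close>)
qed

definition stable :: "'x set \<Rightarrow> bool" where
  "stable X \<longleftrightarrow> subspace X \<and> (\<forall>g\<in>GL. \<forall>x\<in>X. \<rho> g x \<in> X)"

lemma act_combination:
  assumes Z: "finite Z" and u: "\<And>z. z \<in> Z \<Longrightarrow> u z \<in> cov scale \<rho> (length (wd z))"
    and wd: "\<And>z. z \<in> Z \<Longrightarrow> set (wd z) \<subseteq> {..<B}"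
    and g: "g \<in> GL" "g \<in> mtx_block n" "n \<le> B"
  shows "\<rho> g (\<Sum>z\<in>Z. scale (c z) (u z (wd z))) =
    (\<Sum>(z, is)\<in>Sigma Z (\<lambda>z. words B (length (wd z))). scale (tensor_coeff g is (wd z)) (scale (c z) (u z is)))"
proof -
  have "\<rho> g (\<Sum>z\<in>Z. scale (c z) (u z (wd z))) =
    (\<Sum>z\<in>Z. \<Sum>is\<in>words B (length (wd z)). scale (tensor_coeff g is (wd z)) (scale (c z) (u z is)))"
    unfolding act_sum[OF g(1)]
  proof (intro sum.cong refl)
    fix z assume z: "z \<in> Z"
    have "wd z \<in> words B (length (wd z))" using wd[OF z] by (simp add: words_def)
    then show "\<rho> g (scale (c z) (u z (wd z))) =
      (\<Sum>is\<in>words B (length (wd z)). scale (tensor_coeff g is (wd z)) (scale (c z) (u z is)))"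
      using covD[OF u[OF z] g] by (simp add: act_scale[OF g(1)] scale_sum_right mult.commute)
  qed
  then show ?thesis using Z by (simp add: sum.Sigma)
qed

text \<open>Act by \<open>subst_mtx L A t\<close> and extract the coefficient of \<open>t\<^sup>j\<close>.\<close>

lemma subst_coefficient:
  assumes X: "stable X" and Z: "finite Z" and u: "\<And>z. z \<in> Z \<Longrightarrow> u z \<in> cov scale \<rho> (length (wd z))"
    and wd: "\<And>z. z \<in> Z \<Longrightarrow> set (wd z) \<subseteq> L" and L: "L \<subseteq> {..<n}"
    and A: "\<And>i l. l \<in> L \<Longrightarrow> A i l \<noteq> 0 \<Longrightarrow> i \<notin> L \<and> i < n"
    and x: "(\<Sum>z\<in>Z. scale (c z) (u z (wd z))) \<in> X"
  shows "(\<Sum>(z, is)\<in>Sigma Z (\<lambda>z. words n (length (wd z))).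
    scale (coeff (\<Prod>p<length (wd z). [:A (is ! p) (wd z ! p), mtx_one (is ! p) (wd z ! p):]) j)
      (scale (c z) (u z is))) \<in> X"
proof -
  have sub: "subspace X" using X by (simp add: stable_def)
  have wd': "set (wd z) \<subseteq> {..<n}" if "z \<in> Z" for z using wd[OF that] L by blast
  have "(\<Sum>y\<in>Sigma Z (\<lambda>z. words n (length (wd z))).
    scale (coeff ((\<lambda>(z, is). \<Prod>p<length (wd z). [:A (is ! p) (wd z ! p), mtx_one (is ! p) (wd z ! p):]) y) j)
      ((\<lambda>(z, is). scale (c z) (u z is)) y)) \<in> X"
  proof (rule polynomial_coefficients_sum[OF sub])
    show "finite (Sigma Z (\<lambda>z. words n (length (wd z))))" using Z by simp
    fix t :: 'k assume t: "t \<noteq> 0"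
    define g where "g = subst_mtx L A t"
    have g: "g \<in> GL" "g \<in> mtx_block n" unfolding g_def by (rule subst_mtx_GL[OF L A t]; assumption)+
    have "tensor_coeff g is (wd z) =
        poly (\<Prod>p<length (wd z). [:A (is ! p) (wd z ! p), mtx_one (is ! p) (wd z ! p):]) t"
      if "z \<in> Z" for z "is"
    proof -
      have "g (is ! p) (wd z ! p) = A (is ! p) (wd z ! p) + t * mtx_one (is ! p) (wd z ! p)"
        if "p < length (wd z)" for p
        using wd[OF \<open>z \<in> Z\<close>] that by (simp add: g_def subst_mtx_def subset_iff)
      then show ?thesis by (simp add: tensor_coeff_def poly_prod)
    qed
    note tc = this
    have ac: "\<rho> g (\<Sum>z\<in>Z. scale (c z) (u z (wd z))) =
      (\<Sum>(z, is)\<in>Sigma Z (\<lambda>z. words n (length (wd z))). scale (tensor_coeff g is (wd z)) (scale (c z) (u z is)))"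
      by (rule act_combination[OF Z u wd' g order_refl])
    have eq: "\<rho> g (\<Sum>z\<in>Z. scale (c z) (u z (wd z))) =
      (\<Sum>y\<in>Sigma Z (\<lambda>z. words n (length (wd z))).
      scale (poly ((\<lambda>(z, is). \<Prod>p<length (wd z). [:A (is ! p) (wd z ! p), mtx_one (is ! p) (wd z ! p):]) y) t)
        ((\<lambda>(z, is). scale (c z) (u z is)) y))"
      unfolding ac by (intro sum.cong refl) (auto simp: tc)
    have "\<rho> g (\<Sum>z\<in>Z. scale (c z) (u z (wd z))) \<in> X" using X g(1) x by (simp add: stable_def)
    then show "(\<Sum>y\<in>Sigma Z (\<lambda>z. words n (length (wd z))).
      scale (poly ((\<lambda>(z, is). \<Prod>p<length (wd z). [:A (is ! p) (wd z ! p), mtx_one (is ! p) (wd z ! p):]) y) t)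
        ((\<lambda>(z, is). scale (c z) (u z is)) y)) \<in> X"
      by (simp only: eq)
  qed
  then show ?thesis by (simp add: case_prod_beta)
qed

lemma coeff_prod_linear:
  fixes a b :: "nat \<Rightarrow> 'k"
  shows "coeff (\<Prod>p<e. [:a p, b p:]) 0 = (\<Prod>p<e. a p)"
    and "coeff (\<Prod>p<e. [:0, b p:]) j = (if j = e then \<Prod>p<e. b p else 0)"
proof -
  show "coeff (\<Prod>p<e. [:a p, b p:]) 0 = (\<Prod>p<e. a p)"
    by (simp add: poly_prod flip: poly_0_coeff_0)
  have "[:0, b p:] = monom (b p) 1" for p by (simp add: monom_altdef)
  then have "(\<Prod>p<e. [:0, b p:]) = monom (\<Prod>p<e. b p) e"
    by (induction e) (simp_all add: mult_monom one_pCons monom_0)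
  then show "coeff (\<Prod>p<e. [:0, b p:]) j = (if j = e then \<Prod>p<e. b p else 0)" by simp
qed

lemma sum_mtx_one:
  assumes "js \<in> words n e"
  shows "(\<Sum>is\<in>words n e. scale (\<Prod>p<e. mtx_one (is ! p) (js ! p)) (f is)) = f js"
proof -
  have "(\<Prod>p<e. mtx_one (is ! p) (js ! p)) = (if is = js then 1 else 0 :: 'k)" if "is \<in> words n e" for "is"
  proof (cases "is = js")
    case False
    have "length is = e" "length js = e" using that assms by (auto simp: words_def)
    have "\<exists>p<e. is ! p \<noteq> js ! p"
    proof (rule ccontr)
      assume "\<not> (\<exists>p<e. is ! p \<noteq> js ! p)"
      then have "is = js" using \<open>length is = e\<close> \<open>length js = e\<close> by (intro nth_equalityI) auto
      then show False using False by simp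
    qed
    then obtain p where "p < e" "is ! p \<noteq> js ! p" by blast
    then show ?thesis using False by (auto simp: mtx_one_def intro!: prod_zero bexI[of _ p])
  qed (simp add: mtx_one_def)
  then have "(\<Sum>is\<in>words n e. scale (\<Prod>p<e. mtx_one (is ! p) (js ! p)) (f is)) =
      (\<Sum>is\<in>words n e. if is = js then f is else 0)"
    by (intro sum.cong) auto
  then show ?thesis using assms by simp
qed

text \<open>With \<open>A = 0\<close> and all letters in \<open>L\<close> the substitution
  multiplies a word of length \<open>e\<close> by the \<open>e\<close>-th power of \<open>t\<close>,
  so that extraction of coefficients separates the lengths.\<close>

lemma homogeneous_part:
  assumes X: "stable X" and Z: "finite Z" and u: "\<And>z. z \<in> Z \<Longrightarrow> u z \<in> cov scale \<rho> (length (wd z))"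
    and wd: "\<And>z. z \<in> Z \<Longrightarrow> set (wd z) \<subseteq> {..<n}"
    and x: "(\<Sum>z\<in>Z. scale (c z) (u z (wd z))) \<in> X"
  shows "(\<Sum>z\<in>{z \<in> Z. length (wd z) = e}. scale (c z) (u z (wd z))) \<in> X"
proof -
  have "(\<Sum>(z, is)\<in>Sigma Z (\<lambda>z. words n (length (wd z))).
    scale (coeff (\<Prod>p<length (wd z). [:0, mtx_one (is ! p) (wd z ! p):]) e)
      (scale (c z) (u z is))) \<in> X"
    using subst_coefficient[OF X Z u wd order_refl _ x, where A = "\<lambda>_ _. 0"] by simp
  also have "(\<Sum>(z, is)\<in>Sigma Z (\<lambda>z. words n (length (wd z))).
    scale (coeff (\<Prod>p<length (wd z). [:0, mtx_one (is ! p) (wd z ! p):]) e)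
      (scale (c z) (u z is))) = (\<Sum>z\<in>Z. if length (wd z) = e then scale (c z) (u z (wd z)) else 0)"
  proof (subst sum.Sigma[symmetric], goal_cases)
    case 3
    show ?case
    proof (intro sum.cong refl)
      fix z assume z: "z \<in> Z"
      have "wd z \<in> words n (length (wd z))" using wd[OF z] by (simp add: words_def)
      from sum_mtx_one[OF this, of "\<lambda>is. scale (c z) (u z is)"]
      show "(\<Sum>is\<in>words n (length (wd z)).
        scale (coeff (\<Prod>p<length (wd z). [:0, mtx_one (is ! p) (wd z ! p):]) e)
          (scale (c z) (u z is))) = (if length (wd z) = e then scale (c z) (u z (wd z)) else 0)"
        by (cases "length (wd z) = e") (simp_all add: coeff_prod_linear(2))
    qed
  qed (use Z in auto)
  also have "\<dots> = (\<Sum>z\<in>{z \<in> Z. length (wd z) = e}. scale (c z) (u z (wd z)))"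
    by (rule sum.inter_filter[symmetric]) (rule Z)
  finally show ?thesis .
qed

lemma subst_const:
  assumes X: "stable X" and Z: "finite Z" and u: "\<And>z. z \<in> Z \<Longrightarrow> u z \<in> cov scale \<rho> (length (wd z))"
    and wd: "\<And>z. z \<in> Z \<Longrightarrow> set (wd z) \<subseteq> L" and L: "L \<subseteq> {..<n}"
    and A: "\<And>i l. l \<in> L \<Longrightarrow> A i l \<noteq> 0 \<Longrightarrow> i \<notin> L \<and> i < n"
    and x: "(\<Sum>z\<in>Z. scale (c z) (u z (wd z))) \<in> X"
  shows "(\<Sum>z\<in>Z. \<Sum>is\<in>words n (length (wd z)). scale (tensor_coeff A is (wd z)) (scale (c z) (u z is))) \<in> X"
  using subst_coefficient[OF X Z u wd L A x, where j = 0]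
  by (subst sum.Sigma) (use Z in \<open>auto simp: coeff_prod_linear(1) tensor_coeff_def\<close>)

text \<open>Substitution of the letters by arbitrary vectors: first move the letters out of the way, then
  substitute. Both steps are limits of actions of group elements.\<close>

lemma subst_arbitrary:
  assumes X: "stable X" and Z: "finite Z" and u: "\<And>z. z \<in> Z \<Longrightarrow> u z \<in> cov scale \<rho> (length (wd z))"
    and wd: "\<And>z. z \<in> Z \<Longrightarrow> set (wd z) \<subseteq> {..<B}"
    and A: "\<And>i l. A i l \<noteq> 0 \<Longrightarrow> i < C"
    and x: "(\<Sum>z\<in>Z. scale (c z) (u z (wd z))) \<in> X"
  shows "(\<Sum>z\<in>Z. \<Sum>is\<in>words C (length (wd z)). scale (tensor_coeff A is (wd z)) (scale (c z) (u z is))) \<in> X"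
proof -
  define D where "D = max B C"
  define n where "n = D + B"
  have BD: "B \<le> D" "C \<le> D" "D \<le> n" by (auto simp: D_def n_def)
  define A1 :: "'k mtx" where "A1 i l = (if i = D + l \<and> l < B then 1 else 0)" for i l
  define A2 :: "'k mtx" where "A2 i l = (if i < C then A i (l - D) else 0)" for i l
  define wd' where "wd' z = map ((+) D) (wd z)" for z
  have len: "length (wd' z) = length (wd z)" for z by (simp add: wd'_def)
  have "(\<Sum>z\<in>Z. \<Sum>is\<in>words n (length (wd z)). scale (tensor_coeff A1 is (wd z)) (scale (c z) (u z is))) \<in> X"
    by (rule subst_const[where A = A1 and L = "{..<B}", OF X Z u wd _ _ x]) (use BD in \<open>auto simp: A1_def n_def split: if_splits\<close>)
  also have "(\<Sum>z\<in>Z. \<Sum>is\<in>words n (length (wd z)). scale (tensor_coeff A1 is (wd z)) (scale (c z) (u z is))) =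
      (\<Sum>z\<in>Z. scale (c z) (u z (wd' z)))"
  proof (intro sum.cong refl)
    fix z assume z: "z \<in> Z"
    let ?e = "length (wd z)"
    have w: "wd' z \<in> words n ?e" using wd[OF z] by (auto simp: words_def wd'_def n_def subset_iff)
    have "tensor_coeff A1 is (wd z) = (\<Prod>p<?e. mtx_one (is ! p) (wd' z ! p))" for "is"
      unfolding tensor_coeff_def
    proof (intro prod.cong refl)
      fix p assume "p \<in> {..<?e}"
      then have "wd z ! p < B" using wd[OF z] by (auto simp: subset_iff)
      then show "A1 (is ! p) (wd z ! p) = mtx_one (is ! p) (wd' z ! p)"
        using \<open>p \<in> {..<?e}\<close> by (simp add: A1_def wd'_def mtx_one_def)
    qed
    then show "(\<Sum>is\<in>words n ?e. scale (tensor_coeff A1 is (wd z)) (scale (c z) (u z is))) =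
        scale (c z) (u z (wd' z))"
      using sum_mtx_one[OF w, of "\<lambda>is. scale (c z) (u z is)"] by simp
  qed
  finally have x': "(\<Sum>z\<in>Z. scale (c z) (u z (wd' z))) \<in> X" .
  have u': "u z \<in> cov scale \<rho> (length (wd' z))" if "z \<in> Z" for z using u[OF that] by (simp add: len)
  have set': "set (wd' z) \<subseteq> {D..<n}" if "z \<in> Z" for z
    using wd[OF that] by (auto simp: wd'_def n_def)
  have A2: "i \<notin> {D..<n} \<and> i < n" if "A2 i l \<noteq> 0" for i l
    using that BD by (auto simp: A2_def split: if_splits)
  have "(\<Sum>z\<in>Z. \<Sum>is\<in>words n (length (wd' z)). scale (tensor_coeff A2 is (wd' z)) (scale (c z) (u z is))) \<in> X"
    by (rule subst_const[where wd = wd' and L = "{D..<n}" and A = A2, OF X Z u' set' _ A2 x']) auto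
  also have "(\<Sum>z\<in>Z. \<Sum>is\<in>words n (length (wd' z)). scale (tensor_coeff A2 is (wd' z)) (scale (c z) (u z is))) =
     (\<Sum>z\<in>Z. \<Sum>is\<in>words C (length (wd z)). scale (tensor_coeff A is (wd z)) (scale (c z) (u z is)))"
  proof (rule sum.cong[OF refl])
    fix z assume z: "z \<in> Z"
    let ?e = "length (wd z)"
    have eq: "tensor_coeff A2 is (wd' z) = tensor_coeff A is (wd z)" if "is \<in> words C ?e" for "is"
      unfolding tensor_coeff_def len
    proof (intro prod.cong refl)
      fix p assume p: "p \<in> {..<?e}"
      then have "is ! p < C" using that by (auto simp: words_def subset_iff)
      then show "A2 (is ! p) (wd' z ! p) = A (is ! p) (wd z ! p)" using p by (simp add: A2_def wd'_def)
    qed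
    have zero: "tensor_coeff A2 is (wd' z) = 0" if "is \<in> words n ?e - words C ?e" for "is"
    proof -
      have len_is: "length is = ?e" and "\<not> set is \<subseteq> {..<C}"
        using that by (simp_all add: words_def)
      then obtain l where "l \<in> set is" "\<not> l < C" by blast
      then obtain p where p: "p < ?e" "\<not> is ! p < C"
        using len_is by (metis in_set_conv_nth)
      then show ?thesis unfolding tensor_coeff_def len by (auto simp: A2_def intro!: prod_zero bexI[of _ p])
    qed
    have "(\<Sum>is\<in>words n ?e. scale (tensor_coeff A2 is (wd' z)) (scale (c z) (u z is))) =
      (\<Sum>is\<in>words C ?e. scale (tensor_coeff A2 is (wd' z)) (scale (c z) (u z is)))"
      using BD words_mono[of _ C ?e n] zero by (intro sum.mono_neutral_right) auto
    then show "(\<Sum>is\<in>words n (length (wd' z)). scale (tensor_coeff A2 is (wd' z)) (scale (c z) (u z is))) =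
      (\<Sum>is\<in>words C ?e. scale (tensor_coeff A is (wd z)) (scale (c z) (u z is)))"
      by (simp add: len eq)
  qed
  finally show ?thesis .
qed

text \<open>The matrix in Ryser's formula records whether position \<open>q\<close> of
  \<open>p\<close> and \<open>js\<close> agrees with position \<open>k\<close> of \<open>w\<close>
  and \<open>is\<close>. Its permanent counts the permutations that match both pairs of words at
  once.\<close>

lemma ryser_words:
  fixes p js w "is" :: "nat list"
  assumes "length p = e" "length js = e" "length w = e" "length is = e"
  shows "(\<Sum>S\<in>Pow {..<e}. (- 1) ^ (e + card S) *
      tensor_coeff (\<lambda>i l. \<Sum>q\<in>S. if p ! q = l \<and> js ! q = i then 1 else 0) is w) =
    (\<Sum>g\<in>Sym e. if permute_list (app g) p = w \<and> permute_list (app g) js = is then 1 else 0 :: 'k)"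
proof -
  have "(\<Sum>S\<in>Pow {..<e}. (- 1) ^ (e + card S) *
      tensor_coeff (\<lambda>i l. \<Sum>q\<in>S. if p ! q = l \<and> js ! q = i then 1 else 0) is w) =
    (\<Sum>g\<in>Sym e. \<Prod>k<e. if p ! app g k = w ! k \<and> js ! app g k = is ! k then 1 else 0 :: 'k)"
    unfolding tensor_coeff_def assms(3) by (rule ryser)
  also have "\<dots> = (\<Sum>g\<in>Sym e. if permute_list (app g) p = w \<and> permute_list (app g) js = is then 1 else 0)"
  proof (rule sum.cong[OF refl])
    fix g assume "g \<in> Sym e"
    then have g: "app g permutes {..<length p}" "app g permutes {..<length js}"
      using assms by (simp_all add: Sym_def)
    have "permute_list (app g) p = w \<longleftrightarrow> (\<forall>k<e. p ! app g k = w ! k)"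
      "permute_list (app g) js = is \<longleftrightarrow> (\<forall>k<e. js ! app g k = is ! k)"
      using assms by (auto simp: list_eq_iff_nth_eq permute_list_nth[OF g(1)] permute_list_nth[OF g(2)])
    then show "(\<Prod>k<e. if p ! app g k = w ! k \<and> js ! app g k = is ! k then 1 else 0 :: 'k) =
      (if permute_list (app g) p = w \<and> permute_list (app g) js = is then 1 else 0)"
      by (auto intro!: prod.neutral prod_zero)
  qed
  finally show ?thesis .
qed

text \<open>Polarization: the part of \<open>x\<close> of degree \<open>e\<close> is a combination of values of maps
  \<open>V\<^sup>\<otimes>\<^sup>e \<rightarrow> X\<close>. The alternating sum over \<open>S\<close> of the substitutions \<open>e_l \<mapsto> \<Sum>q\<in>S with p_q = l. e_{js_q}\<close>
  extracts the multilinear part, by Ryser's formula for the permanent.\<close>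

definition polar :: "'z set \<Rightarrow> ('z \<Rightarrow> 'k) \<Rightarrow> ('z \<Rightarrow> nat list \<Rightarrow> 'x) \<Rightarrow> ('z \<Rightarrow> nat list) \<Rightarrow> nat list \<Rightarrow> nat list \<Rightarrow> 'x" where
  "polar Z c u wd p js = (\<Sum>z\<in>{z \<in> Z. length (wd z) = length p}.
     \<Sum>g\<in>{g \<in> Sym (length p). permute_list (app g) p = wd z}. scale (c z) (u z (permute_list (app g) js)))"

lemma polar_in:
  assumes X: "stable X" and Z: "finite Z" and u: "\<And>z. z \<in> Z \<Longrightarrow> u z \<in> cov scale \<rho> (length (wd z))"
    and x: "(\<Sum>z\<in>Z. scale (c z) (u z (wd z))) \<in> X" and len: "length js = length p"
  shows "polar Z c u wd p js \<in> X"
proof -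
  define e where "e = length p"
  have sub: "subspace X" using X by (simp add: stable_def)
  define Y where "Y = {z \<in> Z. length (wd z) = e}"
  have "finite (\<Union>z\<in>Z. set (wd z))" using Z by simp
  then obtain B where "(\<Union>z\<in>Z. set (wd z)) \<subseteq> {..<B}"
    using finite_nat_iff_bounded by blast
  then have wd: "set (wd z) \<subseteq> {..<B}" if "z \<in> Z" for z using that by blast
  obtain C where C: "js \<in> words C e" using ex_words[of js] len by (auto simp: e_def)
  have Y: "finite Y" "\<And>z. z \<in> Y \<Longrightarrow> u z \<in> cov scale \<rho> (length (wd z))" "\<And>z. z \<in> Y \<Longrightarrow> set (wd z) \<subseteq> {..<B}"
    "\<And>z. z \<in> Y \<Longrightarrow> length (wd z) = e"
    using Z u wd by (auto simp: Y_def)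
  have y: "(\<Sum>z\<in>Y. scale (c z) (u z (wd z))) \<in> X"
    unfolding Y_def by (rule homogeneous_part[OF X Z u wd x])
  define A :: "nat set \<Rightarrow> 'k mtx" where
    "A S i l = (\<Sum>q\<in>S. if p ! q = l \<and> js ! q = i then 1 else 0)" for S i l
  have AC: "i < C" if "A S i l \<noteq> 0" "S \<in> Pow {..<e}" for S i l
  proof (rule ccontr)
    assume "\<not> i < C"
    have "(if p ! q = l \<and> js ! q = i then 1 else 0) = (0::'k)" if "q \<in> S" for q
    proof -
      have "js ! q \<in> set js" using C that \<open>S \<in> Pow {..<e}\<close> by (auto simp: words_def)
      then have "js ! q < C" using C by (auto simp: words_def)
      then show ?thesis using \<open>\<not> i < C\<close> by auto
    qed
    then show False using that(1) by (simp add: A_def)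
  qed
  have "(\<Sum>z\<in>Y. \<Sum>is\<in>words C (length (wd z)). scale (tensor_coeff (A S) is (wd z)) (scale (c z) (u z is))) \<in> X"
    if "S \<in> Pow {..<e}" for S
    by (rule subst_arbitrary[where A = "A S", OF X Y(1,2,3) AC[OF _ that] y])
  then have "(\<Sum>S\<in>Pow {..<e}. scale ((- 1) ^ (e + card S))
      (\<Sum>z\<in>Y. \<Sum>is\<in>words C (length (wd z)). scale (tensor_coeff (A S) is (wd z)) (scale (c z) (u z is)))) \<in> X"
    by (intro subspace_sum[OF sub]) (rule subspace_scale[OF sub])
  also have "(\<Sum>S\<in>Pow {..<e}. scale ((- 1) ^ (e + card S))
      (\<Sum>z\<in>Y. \<Sum>is\<in>words C (length (wd z)). scale (tensor_coeff (A S) is (wd z)) (scale (c z) (u z is)))) =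
    (\<Sum>z\<in>Y. \<Sum>is\<in>words C (length (wd z)). \<Sum>S\<in>Pow {..<e}. scale ((- 1) ^ (e + card S))
      (scale (tensor_coeff (A S) is (wd z)) (scale (c z) (u z is))))"
    unfolding scale_sum_right
    by (subst sum.swap, rule sum.cong[OF refl], rule sum.swap)
  also have "\<dots> = polar Z c u wd p js"
    unfolding polar_def e_def[symmetric] Y_def[symmetric]
  proof (rule sum.cong[OF refl])
    fix z assume z: "z \<in> Y"
    have lw: "length (wd z) = e" by (rule Y(4)[OF z])
    have "(\<Sum>is\<in>words C (length (wd z)). \<Sum>S\<in>Pow {..<e}. scale ((- 1) ^ (e + card S))
      (scale (tensor_coeff (A S) is (wd z)) (scale (c z) (u z is)))) =
      (\<Sum>is\<in>words C e. \<Sum>g\<in>Sym e. scale (if permute_list (app g) p = wd z \<and> permute_list (app g) js = is then 1 else 0)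
        (scale (c z) (u z is)))"
      unfolding lw
    proof (rule sum.cong[OF refl])
      fix "is" assume "is \<in> words C e"
      then have "length is = e" by (rule words_length)
      from ryser_words[OF e_def[symmetric] words_length[OF C] lw this]
      show "(\<Sum>S\<in>Pow {..<e}. scale ((- 1) ^ (e + card S))
        (scale (tensor_coeff (A S) is (wd z)) (scale (c z) (u z is)))) =
        (\<Sum>g\<in>Sym e. scale (if permute_list (app g) p = wd z \<and> permute_list (app g) js = is then 1 else 0)
        (scale (c z) (u z is)))"
        unfolding A_def[abs_def] scale_sum_left[symmetric] scale_scale by (simp only: sum_distrib_right[symmetric] mult.assoc[symmetric])
    qed
    also have "\<dots> = (\<Sum>g\<in>Sym e. \<Sum>is\<in>words C e. scale (if permute_list (app g) p = wd z \<and> permute_list (app g) js = is then 1 else 0)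
        (scale (c z) (u z is)))"
      by (rule sum.swap)
    also have "\<dots> = (\<Sum>g\<in>Sym e. if permute_list (app g) p = wd z then scale (c z) (u z (permute_list (app g) js)) else 0)"
    proof (rule sum.cong[OF refl])
      fix g assume "g \<in> Sym e"
      then have "permute_list (app g) js \<in> words C e" by (rule length_permute_list_words[OF C])
      moreover have "(\<Sum>is\<in>words C e. scale (if permute_list (app g) p = wd z \<and> permute_list (app g) js = is then 1 else 0)
          (scale (c z) (u z is))) =
        (\<Sum>is\<in>words C e. if permute_list (app g) js = is then
          (if permute_list (app g) p = wd z then scale (c z) (u z is) else 0) else 0)"
        by (rule sum.cong[OF refl]) simp
      ultimately show "(\<Sum>is\<in>words C e. scale (if permute_list (app g) p = wd z \<and> permute_list (app g) js = is then 1 else 0)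
          (scale (c z) (u z is))) =
        (if permute_list (app g) p = wd z then scale (c z) (u z (permute_list (app g) js)) else 0)"
        by (simp add: sum.delta')
    qed
    also have "\<dots> = (\<Sum>g\<in>{g \<in> Sym e. permute_list (app g) p = wd z}. scale (c z) (u z (permute_list (app g) js)))"
      by (rule sum.inter_filter[symmetric]) simp
    finally show "(\<Sum>is\<in>words C (length (wd z)). \<Sum>S\<in>Pow {..<e}. scale ((- 1) ^ (e + card S))
      (scale (tensor_coeff (A S) is (wd z)) (scale (c z) (u z is)))) =
      (\<Sum>g\<in>{g \<in> Sym e. permute_list (app g) p = wd z}. scale (c z) (u z (permute_list (app g) js)))" .
  qed
  finally show ?thesis .
qed

lemma cov_zero: "(\<lambda>_. 0) \<in> cov scale \<rho> e"
  by (rule covI) (simp add: act_zero)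

lemma cov_add:
  assumes "\<phi> \<in> cov scale \<rho> e" "\<psi> \<in> cov scale \<rho> e"
  shows "(\<lambda>js. \<phi> js + \<psi> js) \<in> cov scale \<rho> e"
proof (rule covI)
  fix g :: "'k mtx" and n B js assume g: "g \<in> GL" "g \<in> mtx_block n" "n \<le> B" "js \<in> words B e"
  show "\<rho> g (\<phi> js + \<psi> js) = (\<Sum>is\<in>words B e. scale (tensor_coeff g is js) (\<phi> is + \<psi> is))"
    using covD[OF assms(1) g] covD[OF assms(2) g]
    by (simp add: act_add[OF g(1)] scale_right_distrib sum.distrib)
qed

lemma cov_scale:
  assumes "\<phi> \<in> cov scale \<rho> e" shows "(\<lambda>js. scale c (\<phi> js)) \<in> cov scale \<rho> e"
proof (rule covI)
  fix g :: "'k mtx" and n B js assume g: "g \<in> GL" "g \<in> mtx_block n" "n \<le> B" "js \<in> words B e"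
  show "\<rho> g (scale c (\<phi> js)) = (\<Sum>is\<in>words B e. scale (tensor_coeff g is js) (scale c (\<phi> is)))"
    using covD[OF assms g] by (simp add: act_scale[OF g(1)] scale_sum_right mult.commute)
qed

lemma cov_sum:
  "(\<And>i. i \<in> I \<Longrightarrow> f i \<in> cov scale \<rho> e) \<Longrightarrow> (\<lambda>js. \<Sum>i\<in>I. f i js) \<in> cov scale \<rho> e"
  by (induction I rule: infinite_finite_induct) (auto simp: cov_zero cov_add)

lemma cov_permute:
  assumes \<phi>: "\<phi> \<in> cov scale \<rho> e" and h: "h \<in> Sym e"
  shows "(\<lambda>js. \<phi> (permute_list (app h) js)) \<in> cov scale \<rho> e"
proof (rule covI)
  fix g :: "'k mtx" and n B js assume g: "g \<in> GL" "g \<in> mtx_block n" "n \<le> B" "js \<in> words B e"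
  have "\<rho> g (\<phi> (permute_list (app h) js)) =
    (\<Sum>is\<in>words B e. scale (tensor_coeff g is (permute_list (app h) js)) (\<phi> is))"
    using covD[OF \<phi> g(1-3) length_permute_list_words[OF g(4) h]] .
  also have "\<dots> = (\<Sum>is\<in>words B e. scale (tensor_coeff g is js) (\<phi> (permute_list (app h) is)))"
  proof (rule sum.reindex_bij_witness[where i = "permute_list (app h)" and j = "permute_list (app (- h))"])
    fix a assume a: "a \<in> words B e"
    have hl: "h \<in> Sym (length a)" using h words_length[OF a] by simp
    show "permute_list (app h) (permute_list (app (- h)) a) = a"
      "permute_list (app (- h)) (permute_list (app h) a) = a"
      by (rule permute_list_app_inv[OF hl])+
    show "permute_list (app (- h)) a \<in> words B e" "permute_list (app h) a \<in> words B e"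
      using length_permute_list_words[OF a] h Sym_uminus by blast+
    have "tensor_coeff g (permute_list (app h) (permute_list (app (- h)) a)) (permute_list (app h) js) =
        tensor_coeff g (permute_list (app (- h)) a) js"
      by (rule tensor_coeff_permute) (use h words_length[OF a] words_length[OF g(4)] in simp_all)
    then show "scale (tensor_coeff g (permute_list (app (- h)) a) js) (\<phi> (permute_list (app h) (permute_list (app (- h)) a))) =
        scale (tensor_coeff g a (permute_list (app h) js)) (\<phi> a)"
      by (simp only: permute_list_app_inv[OF hl])
  qed
  finally show "\<rho> g (\<phi> (permute_list (app h) js)) =
    (\<Sum>is\<in>words B e. scale (tensor_coeff g is js) (\<phi> (permute_list (app h) is)))" .
qed

lemma polar_cov:
  assumes "\<And>z. z \<in> Z \<Longrightarrow> u z \<in> cov scale \<rho> (length (wd z))"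
  shows "polar Z c u wd p \<in> cov scale \<rho> (length p)"
  unfolding polar_def[abs_def]
proof (intro cov_sum cov_scale cov_permute)
  fix z g assume "z \<in> {z \<in> Z. length (wd z) = length p}" "g \<in> {g \<in> Sym (length p). permute_list (app g) p = wd z}"
  then show "u z \<in> cov scale \<rho> (length p)" "g \<in> Sym (length p)" using assms[of z] by simp_all
qed

text \<open>Sum \<open>polar Z c u wd p p\<close> over all words \<open>p\<close> of one length
  \<open>e\<close>. For every \<open>z\<close> and \<open>g\<close> exactly one \<open>p\<close>
  contributes, so the sum is \<open>card (Sym e)\<close> times the part of length \<open>e\<close>,
  and characteristic zero permits the division.\<close>

lemma polar_recover:
  assumes sub: "subspace X" and Z: "finite Z" and p: "\<And>p. polar Z c u wd p p \<in> X"
  shows "(\<Sum>z\<in>Z. scale (c z) (u z (wd z))) \<in> X"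
proof -
  have "finite (\<Union>z\<in>Z. set (wd z))" using Z by simp
  then obtain B where "(\<Union>z\<in>Z. set (wd z)) \<subseteq> {..<B}"
    using finite_nat_iff_bounded by blast
  then have wd: "wd z \<in> words B (length (wd z))" if "z \<in> Z" for z using that by (auto simp: words_def)
  have part: "(\<Sum>z\<in>{z \<in> Z. length (wd z) = e}. scale (c z) (u z (wd z))) \<in> X" for e
  proof -
    define Y where "Y = {z \<in> Z. length (wd z) = e}"
    have Y: "finite Y" "\<And>z. z \<in> Y \<Longrightarrow> wd z \<in> words B e" using Z wd by (auto simp: Y_def)
    have "(\<Sum>p\<in>words B e. polar Z c u wd p p) =
      (\<Sum>p\<in>words B e. \<Sum>z\<in>Y. \<Sum>g\<in>Sym e. if permute_list (app g) p = wd z then scale (c z) (u z (wd z)) else 0)"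
    proof (rule sum.cong[OF refl])
      fix p assume "p \<in> words B e"
      then have e: "length p = e" by (rule words_length)
      show "polar Z c u wd p p =
        (\<Sum>z\<in>Y. \<Sum>g\<in>Sym e. if permute_list (app g) p = wd z then scale (c z) (u z (wd z)) else 0)"
        unfolding polar_def e Y_def[symmetric]
        by (rule sum.cong[OF refl], subst sum.inter_filter) (auto intro!: sum.cong)
    qed
    also have "\<dots> = (\<Sum>z\<in>Y. \<Sum>p\<in>words B e. \<Sum>g\<in>Sym e. if permute_list (app g) p = wd z then scale (c z) (u z (wd z)) else 0)"
      by (rule sum.swap)
    also have "\<dots> = (\<Sum>z\<in>Y. \<Sum>g\<in>Sym e. \<Sum>p\<in>words B e. if permute_list (app g) p = wd z then scale (c z) (u z (wd z)) else 0)"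
      by (rule sum.cong[OF refl], rule sum.swap)
    also have "\<dots> = (\<Sum>z\<in>Y. \<Sum>g\<in>Sym e. scale (c z) (u z (wd z)))"
    proof (rule sum.cong[OF refl], rule sum.cong[OF refl])
      fix z g assume z: "z \<in> Y" and g: "g \<in> Sym e"
      define q where "q = permute_list (app (- g)) (wd z)"
      have q: "q \<in> words B e" unfolding q_def using length_permute_list_words[OF Y(2)[OF z] Sym_uminus[OF g]] .
      have "permute_list (app g) p = wd z \<longleftrightarrow> p = q" if "p \<in> words B e" for p
        unfolding q_def using permute_list_app_inv[of g p] permute_list_app_inv[of g "wd z"] g
          words_length[OF that] words_length[OF Y(2)[OF z]] by metis
      then have "(\<Sum>p\<in>words B e. if permute_list (app g) p = wd z then scale (c z) (u z (wd z)) else 0) =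
        (\<Sum>p\<in>words B e. if p = q then scale (c z) (u z (wd z)) else 0)"
        by (intro sum.cong) auto
      then show "(\<Sum>p\<in>words B e. if permute_list (app g) p = wd z then scale (c z) (u z (wd z)) else 0) =
        scale (c z) (u z (wd z))" using q by simp
    qed
    also have "\<dots> = scale (of_nat (card (Sym e))) (\<Sum>z\<in>Y. scale (c z) (u z (wd z)))"
      by (simp add: scale_sum_right sum_constant_scale)
    finally have "scale (of_nat (card (Sym e))) (\<Sum>z\<in>Y. scale (c z) (u z (wd z))) \<in> X"
      using p subspace_sum[OF sub] by metis
    then have "scale (inverse (of_nat (card (Sym e)))) (scale (of_nat (card (Sym e))) (\<Sum>z\<in>Y. scale (c z) (u z (wd z)))) \<in> X"
      by (rule subspace_scale[OF sub])
    moreover have "card (Sym e) \<noteq> 0" by (metis Sym_zero card_0_eq empty_iff finite_Sym)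
    ultimately show ?thesis by (simp add: Y_def)
  qed
  have "(\<Sum>z\<in>Z. scale (c z) (u z (wd z))) =
    (\<Sum>e\<in>(\<lambda>z. length (wd z)) ` Z. \<Sum>z\<in>{z \<in> Z. length (wd z) = e}. scale (c z) (u z (wd z)))"
    by (rule sum.image_gen[OF Z])
  also have "\<dots> \<in> X" by (rule subspace_sum[OF sub]) (rule part)
  finally show ?thesis .
qed

text \<open>The word with distinct letters is generic: substituting the letters of \<open>js\<close>
  for \<open>0, ..., e - 1\<close> turns its value into \<open>v js\<close>.\<close>

lemma cov_generated:
  assumes X: "stable X" and v: "v \<in> cov scale \<rho> e" and base: "v [0..<e] \<in> X" and js: "length js = e"
  shows "v js \<in> X"
proof -
  obtain C where C: "js \<in> words C e" using ex_words[of js] js by auto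
  define A :: "'k mtx" where "A i l = (if l < e \<and> js ! l = i then 1 else 0)" for i l
  have AC: "i < C" if "A i l \<noteq> 0" for i l
    using that C by (auto simp: A_def words_def subset_iff split: if_splits)
  have "(\<Sum>z\<in>{()}. \<Sum>is\<in>words C (length [0..<e]). scale (tensor_coeff A is [0..<e]) (scale 1 (v is))) \<in> X"
    by (rule subst_arbitrary[where B = e and c = "\<lambda>_. 1" and u = "\<lambda>_. v" and wd = "\<lambda>_. [0..<e]" and A = A, OF X])
      (use v base AC in auto)
  moreover have "tensor_coeff A is [0..<e] = (\<Prod>p<e. mtx_one (is ! p) (js ! p))" for "is"
    unfolding tensor_coeff_def by (intro prod.cong) (auto simp: A_def mtx_one_def)
  ultimately show ?thesis using sum_mtx_one[OF C, of v] by simp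
qed

end

text \<open>Permutations of the letters of a word act from the right on words, hence from the left on functions
  of words.\<close>

definition gact :: "('f::comm_ring_1 \<Rightarrow> 'x::ab_group_add \<Rightarrow> 'x) \<Rightarrow> nat \<Rightarrow> 'f galg \<Rightarrow> (nat list \<Rightarrow> 'x) \<Rightarrow> nat list \<Rightarrow> 'x" where
  "gact s d x \<phi> js = (\<Sum>g\<in>Sym d. s (Poly_Mapping.lookup x g) (\<phi> (permute_list (app g) js)))"

lemma permute_list_plus:
  "h \<in> Sym (length js) \<Longrightarrow> permute_list (app (g + h)) js = permute_list (app h) (permute_list (app g) js)"
  by (simp add: Sym_def permute_list_compose)

lemma gact_cong:
  "length js = d \<Longrightarrow> (\<And>ks. length ks = d \<Longrightarrow> \<phi> ks = \<psi> ks) \<Longrightarrow> gact s d x \<phi> js = gact s d x \<psi> js"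
  by (simp add: gact_def)

context vector_space
begin

lemma gact_mult:
  assumes "x \<in> GA d" "y \<in> GA d" "length js = d"
  shows "gact scale d x (gact scale d y \<phi>) js = gact scale d (x * y) \<phi> js"
proof -
  let ?P = "\<lambda>g. permute_list (app g) js"
  have "gact scale d x (gact scale d y \<phi>) js =
    (\<Sum>g\<in>Sym d. \<Sum>h\<in>Sym d. scale (Poly_Mapping.lookup x g * Poly_Mapping.lookup y h) (\<phi> (?P (g + h))))"
    using assms(3) by (simp add: gact_def scale_sum_right permute_list_plus del: app_plus)
  also have "\<dots> = (\<Sum>g\<in>Sym d. \<Sum>k\<in>Sym d. scale (Poly_Mapping.lookup x g * Poly_Mapping.lookup y (- g + k)) (\<phi> (?P k)))"
  proof (rule sum.cong[OF refl])
    fix g assume g: "g \<in> Sym d"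
    show "(\<Sum>h\<in>Sym d. scale (Poly_Mapping.lookup x g * Poly_Mapping.lookup y h) (\<phi> (?P (g + h)))) =
      (\<Sum>k\<in>Sym d. scale (Poly_Mapping.lookup x g * Poly_Mapping.lookup y (- g + k)) (\<phi> (?P k)))"
      by (rule sum.reindex_bij_witness[where i = "\<lambda>k. - g + k" and j = "\<lambda>h. g + h"])
        (use g in \<open>auto simp del: app_plus simp flip: add.assoc\<close>)
  qed
  also have "\<dots> = (\<Sum>k\<in>Sym d. \<Sum>g\<in>Sym d. scale (Poly_Mapping.lookup x g * Poly_Mapping.lookup y (- g + k)) (\<phi> (?P k)))"
    by (rule sum.swap)
  also have "\<dots> = gact scale d (x * y) \<phi> js"
    by (simp add: gact_def lookup_GA_mult[OF assms(1)] scale_sum_left)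
  finally show ?thesis .
qed

lemma gact_add: "gact scale d (x + y) \<phi> js = gact scale d x \<phi> js + gact scale d y \<phi> js"
  by (simp add: gact_def lookup_add scale_left_distrib sum.distrib)

lemma gact_sc: "gact scale d (sc c * x) \<phi> js = scale c (gact scale d x \<phi> js)"
  by (simp add: gact_def scale_sum_right)

lemma gact_one: "gact scale d 1 \<phi> js = \<phi> js"
proof -
  have "gact scale d 1 \<phi> js = (\<Sum>g\<in>Sym d. if g = 0 then \<phi> js else 0)"
    unfolding gact_def by (intro sum.cong refl) (simp add: lookup_one when_def)
  then show ?thesis by simp
qed

lemma gact_zero: "gact scale d 0 \<phi> js = 0"
  by (simp add: gact_def)

lemma gact_in_span:
  assumes "length js = d"
  shows "gact scale d x \<phi> js \<in> span {\<phi> ks | ks. length ks = d}"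
  unfolding gact_def
proof (intro span_sum span_scale span_base)
  fix g
  have "length (permute_list (app g) js) = d" using assms by simp
  then show "\<phi> (permute_list (app g) js) \<in> {\<phi> ks | ks. length ks = d}" by blast
qed

end

text \<open>For a partition, \<open>csum \<mu>\<close> divided by \<open>hook \<mu>\<close> is an
  idempotent. The equation says that it leaves \<phi> invariant, so \<phi> factors through the
  projection of the tensor power onto the Schur functor.\<close>

definition mcov :: "('k::field_char_0 \<Rightarrow> 'x::ab_group_add \<Rightarrow> 'x) \<Rightarrow> ('k mtx \<Rightarrow> 'x \<Rightarrow> 'x) \<Rightarrow> nat list \<Rightarrow>
    (nat list \<Rightarrow> 'x) set" where
  "mcov s \<rho> \<mu> = {\<phi> \<in> cov s \<rho> (sum_list \<mu>). \<forall>js. length js = sum_list \<mu> \<longrightarrow>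
     gact s (sum_list \<mu>) (csum \<mu>) \<phi> js = s (hook \<mu>) (\<phi> js)}"

subsection \<open>Families of maps from Schur functors\<close>

text \<open>Each map carries its partition along, since the map does not determine it: the zero map
  occurs for every shape.\<close>

type_synonym 'x family = "(nat list \<times> (nat list \<Rightarrow> 'x)) set"

definition fvals :: "'x family \<Rightarrow> 'x set" where
  "fvals F = {\<phi> js | \<mu> \<phi> js. (\<mu>, \<phi>) \<in> F \<and> length js = sum_list \<mu>}"

definition mfamily :: "('k::field_char_0 \<Rightarrow> 'x::ab_group_add \<Rightarrow> 'x) \<Rightarrow> ('k mtx \<Rightarrow> 'x \<Rightarrow> 'x) \<Rightarrow> 'x family \<Rightarrow> bool" where
  "mfamily s \<rho> F \<longleftrightarrow> finite F \<and> (\<forall>(\<mu>, \<phi>)\<in>F. is_partition \<mu> \<and> \<phi> \<in> mcov s \<rho> \<mu>)"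

lemma fvals_Un: "fvals (F \<union> G) = fvals F \<union> fvals G"
  by (auto simp: fvals_def)
lemma fvals_mono: "F \<subseteq> G \<Longrightarrow> fvals F \<subseteq> fvals G"
  by (auto simp: fvals_def)
lemma mfamily_Un: "mfamily s \<rho> F \<Longrightarrow> mfamily s \<rho> G \<Longrightarrow> mfamily s \<rho> (F \<union> G)"
  by (auto simp: mfamily_def)
lemma mfamily_subset: "mfamily s \<rho> F \<Longrightarrow> G \<subseteq> F \<Longrightarrow> mfamily s \<rho> G"
  by (auto simp: mfamily_def finite_subset)

context GL_rep
begin

lemma cov_gact:
  assumes "\<phi> \<in> cov scale \<rho> e" shows "gact scale e x \<phi> \<in> cov scale \<rho> e"
  unfolding gact_def[abs_def] using assms by (intro cov_sum cov_scale cov_permute)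

lemma gact_csum_mcov:
  assumes \<mu>: "is_partition \<mu>" and \<phi>: "\<phi> \<in> cov scale \<rho> (sum_list \<mu>)" and y: "y \<in> GA (sum_list \<mu>)"
  shows "gact scale (sum_list \<mu>) (csum \<mu> * y) \<phi> \<in> mcov scale \<rho> \<mu>"
  unfolding mcov_def
proof (intro CollectI conjI allI impI)
  show "gact scale (sum_list \<mu>) (csum \<mu> * y) \<phi> \<in> cov scale \<rho> (sum_list \<mu>)" by (rule cov_gact[OF \<phi>])
  fix js :: "nat list" assume js: "length js = sum_list \<mu>"
  have "gact scale (sum_list \<mu>) (csum \<mu>) (gact scale (sum_list \<mu>) (csum \<mu> * y) \<phi>) js =
      gact scale (sum_list \<mu>) (csum \<mu> * csum \<mu> * y) \<phi> js"
    using y js by (subst gact_mult) (simp_all add: mult.assoc)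
  also have "csum \<mu> * csum \<mu> * y = sc (hook \<mu>) * (csum \<mu> * y)"
    using csum_sq[OF _ \<mu>, where 'f = 'k] by (simp add: mult.assoc)
  finally show "gact scale (sum_list \<mu>) (csum \<mu>) (gact scale (sum_list \<mu>) (csum \<mu> * y) \<phi>) js =
     scale (hook \<mu>) (gact scale (sum_list \<mu>) (csum \<mu> * y) \<phi> js)"
    by (simp only: gact_sc)
qed

text \<open>The unit of the group algebra lies in the ideal generated by the Young symmetrizers.\<close>

lemma ex_mfamily:
  assumes \<phi>: "\<phi> \<in> cov scale \<rho> e"
  shows "\<exists>F. mfamily scale \<rho> F \<and> (\<forall>(\<mu>, \<psi>)\<in>F. sum_list \<mu> = e) \<and>
    span (fvals F) = span {\<phi> ks | ks. length ks = e}"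
proof -
  let ?S = "{\<phi> ks | ks. length ks = e}"
  have "z \<in> ideal_of e (csums e) \<Longrightarrow> \<exists>F. mfamily scale \<rho> F \<and> (\<forall>(\<mu>, \<psi>)\<in>F. sum_list \<mu> = e) \<and>
    fvals F \<subseteq> span ?S \<and> (\<forall>js. length js = e \<longrightarrow> gact scale e z \<phi> js \<in> span (fvals F))" for z
  proof (induction z rule: ideal_of.induct)
    case zero
    show ?case by (rule exI[of _ "{}"]) (auto simp: mfamily_def fvals_def gact_zero)
  next
    case (step z x s y)
    then obtain F where F: "mfamily scale \<rho> F" "\<forall>(\<mu>, \<psi>)\<in>F. sum_list \<mu> = e" "fvals F \<subseteq> span ?S"
      "\<And>js. length js = e \<Longrightarrow> gact scale e z \<phi> js \<in> span (fvals F)" by blast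
    obtain \<mu> where \<mu>: "is_partition \<mu>" "sum_list \<mu> = e" "s = csum \<mu>" using step.hyps(3) by (auto simp: csums_def)
    \<comment> \<open>The symmetrizer and the right factor \<open>y\<close> go into the new
      generator, which thereby belongs to \<open>mcov\<close>; the left factor \<open>x\<close> only
      recombines its values.\<close>
    define \<psi> where "\<psi> = gact scale e (s * y) \<phi>"
    define F' where "F' = insert (\<mu>, \<psi>) F"
    have sG: "s \<in> GA e" using \<mu> csum_GA by blast
    have "\<psi> \<in> mcov scale \<rho> \<mu>"
      using gact_csum_mcov[OF \<mu>(1)] \<phi> step.hyps(4) \<mu> by (simp add: \<psi>_def)
    then have 1: "mfamily scale \<rho> F'" using F(1) \<mu>(1) by (simp add: F'_def mfamily_def)
    have v: "fvals F' = fvals F \<union> {\<psi> ks | ks. length ks = e}"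
      using \<mu>(2) by (auto simp: F'_def fvals_def)
    have \<psi>: "{\<psi> ks | ks. length ks = e} \<subseteq> span ?S"
      using gact_in_span[of _ e "s * y" \<phi>] by (auto simp: \<psi>_def)
    have "gact scale e (z + x * s * y) \<phi> js \<in> span (fvals F')" if js: "length js = e" for js
    proof -
      have "gact scale e x \<psi> js = gact scale e (x * s * y) \<phi> js"
        unfolding \<psi>_def using step.hyps(2,4) sG js by (subst gact_mult) (simp_all add: mult.assoc)
      moreover have "gact scale e x \<psi> js \<in> span (fvals F')"
        using gact_in_span[OF js, of x \<psi>] span_mono[of _ "fvals F'"] v by blast
      ultimately show ?thesis
        using F(4)[OF js] span_mono[of "fvals F" "fvals F'"] v by (auto simp: gact_add intro!: span_add)
    qed
    then show ?case using 1 F \<psi> v \<mu>(2) by (intro exI[of _ F']) (auto simp: F'_def)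
  qed
  from this[OF one_in_ideal] obtain F where F: "mfamily scale \<rho> F" "\<forall>(\<mu>, \<psi>)\<in>F. sum_list \<mu> = e"
    "fvals F \<subseteq> span ?S" "\<And>js. length js = e \<Longrightarrow> \<phi> js \<in> span (fvals F)" by (auto simp: gact_one)
  then have "span (fvals F) = span ?S"
    by (intro span_eq[THEN iffD2]) auto
  then show ?thesis using F by blast
qed

end

section \<open>Shifted matrices and words containing fixed letters\<close>

lemma mtx_one_shift [simp]: "block_shift n (mtx_one :: 'k::field mtx) = mtx_one"
  by (intro ext) (auto simp: block_shift_def mtx_one_def)

lemma block_shift_block: "g \<in> mtx_block m \<Longrightarrow> block_shift n g \<in> mtx_block (n + m)"
  by (auto simp: mtx_block_def block_shift_def mtx_one_def)

lemma block_shift_add: "block_shift n (block_shift m g) = block_shift (n + m) g"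
  by (intro ext) (auto simp: block_shift_def mtx_one_def)

lemma Sh_Sh: "Sh m (Sh n \<rho>) = Sh (n + m) \<rho>"
  by (intro ext) (simp add: Sh_def block_shift_add)

lemma Sh_0 [simp]: "Sh 0 \<rho> = \<rho>"
proof -
  have "block_shift 0 g = g" for g :: "'a mtx" by (intro ext) (simp add: block_shift_def)
  then show ?thesis by (intro ext) (simp add: Sh_def)
qed

lemma block_shift_mult:
  fixes g h :: "'k::field mtx"
  assumes g: "g \<in> mtx_block m" and h: "h \<in> mtx_block m"
  shows "mtx_mult (block_shift n g) (block_shift n h) = block_shift n (mtx_mult g h)"
proof (intro ext)
  fix i j
  define B where "B = n + (m + Suc (max i j))"
  have bs: "mtx_mult (block_shift n g) (block_shift n h) i j = (\<Sum>l<B. block_shift n g i l * block_shift n h l j)"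
    by (rule mtx_mult_block[OF block_shift_block[OF g]]) (auto simp: B_def)
  show "mtx_mult (block_shift n g) (block_shift n h) i j = block_shift n (mtx_mult g h) i j"
  proof (cases "i < n")
    case True
    then have "(\<Sum>l<B. block_shift n g i l * block_shift n h l j) = (\<Sum>l<B. if l = i then block_shift n h i j else 0)"
      by (intro sum.cong refl) (auto simp: block_shift_def mtx_one_def)
    then show ?thesis using True bs by (auto simp: B_def block_shift_def mtx_one_def)
  next
    case False
    note i = this
    show ?thesis
    proof (cases "j < n")
      case True
      then have "(\<Sum>l<B. block_shift n g i l * block_shift n h l j) = (\<Sum>l<B. if l = j then block_shift n g i j else 0)"
        by (intro sum.cong refl) (auto simp: block_shift_def mtx_one_def)
      then show ?thesis using True bs i by (auto simp: B_def block_shift_def mtx_one_def)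
    next
      case False
      let ?C = "m + Suc (max i j)"
      have "(\<Sum>l<B. block_shift n g i l * block_shift n h l j) =
        (\<Sum>l\<in>{n..<n + ?C}. g (i - n) (l - n) * h (l - n) (j - n))"
        unfolding B_def by (rule sum.mono_neutral_cong_right)
          (use i False in \<open>auto simp: block_shift_def mtx_one_def\<close>)
      also have "\<dots> = (\<Sum>l<?C. g (i - n) l * h l (j - n))"
        by (rule sum.reindex_bij_witness[where i = "\<lambda>l. l + n" and j = "\<lambda>l. l - n"]) auto
      also have "\<dots> = mtx_mult g h (i - n) (j - n)"
        by (rule mtx_mult_block[OF g, symmetric]) auto
      finally show ?thesis using bs i False by (simp add: block_shift_def)
    qed
  qed
qed

lemma block_shift_GL:
  assumes "g \<in> GL" shows "block_shift n g \<in> GL"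
proof -
  obtain m h where m: "g \<in> mtx_block m" "h \<in> mtx_block m" "mtx_mult g h = mtx_one" "mtx_mult h g = mtx_one"
    using assms by (auto simp: GL_def GLn_def)
  show ?thesis
    by (rule GL_I[OF block_shift_block[OF m(1)] block_shift_block[OF m(2)]])
      (simp_all add: block_shift_mult[OF m(1,2)] block_shift_mult[OF m(2,1)] m(3,4))
qed

lemma tensor_coeff_prod_list:
  "length is = length js \<Longrightarrow> tensor_coeff g is js = prod_list (map2 g is js)"
  by (simp add: tensor_coeff_def prod.list_conv_set_nth atLeast0LessThan)

lemma tensor_coeff_append:
  "length is = length js \<Longrightarrow> length is' = length js' \<Longrightarrow>
    tensor_coeff g (is @ is') (js @ js') = tensor_coeff g is js * tensor_coeff g is' js'"
  by (simp add: tensor_coeff_prod_list)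

lemma tensor_coeff_shift:
  "length is = length js \<Longrightarrow>
    tensor_coeff (block_shift n g) (map ((+) n) is) (map ((+) n) js) = tensor_coeff g is js"
  by (simp add: tensor_coeff_def block_shift_def)

lemma tensor_coeff_shift_fixed:
  assumes "length is = length p" "set p \<subseteq> {..<n}"
  shows "tensor_coeff (block_shift n g) is p = (if is = p then 1 else 0)"
proof (cases "is = p")
  case True
  then show ?thesis using assms by (auto simp: tensor_coeff_def block_shift_def mtx_one_def subset_iff intro!: prod.neutral)
next
  case False
  then obtain q where "q < length p" "is ! q \<noteq> p ! q" using assms(1) nth_equalityI by metis
  moreover have "p ! q < n" using assms(2) \<open>q < length p\<close> by (auto simp: subset_iff)
  ultimately show ?thesis using False
    by (auto simp: tensor_coeff_def block_shift_def mtx_one_def intro!: prod_zero bexI[of _ q])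
qed

lemma tensor_coeff_shift_zero:
  assumes "length is = length js" "is \<notin> range (map ((+) n))"
  shows "tensor_coeff (block_shift n g) is (map ((+) n) js) = 0"
proof -
  have "\<not> set is \<subseteq> {n..}"
  proof
    assume "set is \<subseteq> {n..}"
    then have "is = map ((+) n) (map (\<lambda>i. i - n) is)" by (auto simp: comp_def subset_iff intro!: map_idI[symmetric])
    then show False using assms(2) by blast
  qed
  then obtain q where "q < length is" "is ! q < n" by (auto simp: in_set_conv_nth subset_iff not_le)
  then show ?thesis using assms(1)
    by (auto simp: tensor_coeff_def block_shift_def mtx_one_def intro!: prod_zero bexI[of _ q])
qed

text \<open>Under the shifted group, V is the sum of a trivial space on the letters below
  \<open>n\<close> and a copy of V. Moving the letters below \<open>n\<close> to the front makes the
  resulting decomposition of tensor powers explicit.\<close>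

lemma ex_pattern:
  fixes js :: "nat list"
  obtains p ks g where "set p \<subseteq> {..<n}" "g \<in> Sym (length js)" "length p + length ks = length js"
    "js = permute_list (app g) (p @ map ((+) n) ks)"
    "length ks = length (filter ((\<le>) n) js)"
proof -
  define p where "p = filter (\<lambda>i. i < n) js"
  define ks where "ks = map (\<lambda>i. i - n) (filter ((\<le>) n) js)"
  have s: "map ((+) n) ks = filter (\<lambda>i. \<not> i < n) js"
    by (auto simp: ks_def comp_def not_less intro!: map_idI cong: filter_cong)
  have ms: "mset js = mset (p @ map ((+) n) ks)"
    unfolding s p_def by simp
  obtain f where f: "f permutes {..<length (p @ map ((+) n) ks)}" "permute_list f (p @ map ((+) n) ks) = js"
    using mset_eq_permutation[OF ms] by blast
  have len: "length (p @ map ((+) n) ks) = length js" using mset_eq_length[OF ms] by simp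
  show thesis
  proof (rule that)
    show "set p \<subseteq> {..<n}" by (auto simp: p_def)
    show "of_perm f \<in> Sym (length js)" using f(1) len of_perm_Sym by simp
    show "length p + length ks = length js" using len by simp
    show "js = permute_list (app (of_perm f)) (p @ map ((+) n) ks)" using f by (simp add: app_of_perm[OF f(1)])
    show "length ks = length (filter ((\<le>) n) js)" by (simp add: ks_def)
  qed
qed

context GL_rep
begin

lemma GL_rep_Sh: "GL_rep scale (Sh n \<rho>)"
  by unfold_locales (simp_all add: Sh_def act_add act_scale block_shift_GL)

text \<open>The shifted group fixes the basis vectors with index below \<open>n\<close>, so
  inserting them into an equivariant map keeps it equivariant and lowers its degree by their
  number.\<close>

lemma pattern_cov:
  assumes \<phi>: "\<phi> \<in> cov scale \<rho> (length p + e)" and p: "set p \<subseteq> {..<n}"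
  shows "(\<lambda>ks. \<phi> (p @ map ((+) n) ks)) \<in> cov scale (Sh n \<rho>) e"
proof (rule covI)
  fix g :: "'k mtx" and m B ks assume g: "g \<in> GL" "g \<in> mtx_block m" "m \<le> B" and ks: "ks \<in> words B e"
  let ?g = "block_shift n g" and ?f = "\<lambda>ks. p @ map ((+) n) ks"
  let ?W = "words (n + B) (length p + e)"
  have "x < n + B" if "x \<in> set p" for x using p that by (meson lessThan_iff subsetD trans_less_add1)
  then have sub: "?f ` words B e \<subseteq> ?W" by (auto simp: words_def subset_iff)
  then have w: "?f ks \<in> ?W" using ks by blast
  have inj: "inj_on ?f (words B e)" by (auto simp: inj_on_def intro: map_injective[of "(+) n"])
  have "Sh n \<rho> g (\<phi> (?f ks)) = (\<Sum>is\<in>?W. scale (tensor_coeff ?g is (?f ks)) (\<phi> is))"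
    unfolding Sh_def
    by (rule covD[OF \<phi> block_shift_GL[OF g(1)] block_shift_block[OF g(2)] _ w]) (simp add: g(3))
  also have "\<dots> = (\<Sum>is\<in>?f ` words B e. scale (tensor_coeff ?g is (?f ks)) (\<phi> is))"
  proof (rule sum.mono_neutral_right[OF _ sub], simp, rule ballI)
    fix "is" assume "is": "is \<in> ?W - ?f ` words B e"
    define i1 where "i1 = take (length p) is"
    define i2 where "i2 = drop (length p) is"
    have i: "is = i1 @ i2" "length i1 = length p" "length i2 = length ks"
      using "is" ks by (auto simp: i1_def i2_def words_def)
    have "tensor_coeff ?g is (?f ks) = tensor_coeff ?g i1 p * tensor_coeff ?g i2 (map ((+) n) ks)"
      unfolding i(1) using i by (simp add: tensor_coeff_append)
    also have "\<dots> = 0"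
    proof (rule ccontr)
      assume nz: "\<dots> \<noteq> 0"
      then have "i1 = p" using tensor_coeff_shift_fixed[OF i(2) p, of g] by (auto split: if_splits)
      obtain ks' where ks': "i2 = map ((+) n) ks'"
        using nz tensor_coeff_shift_zero[OF i(3), of n g] by fastforce
      have "ks' \<in> words B e"
        using "is" ks i ks' by (auto simp: words_def)
      then show False using "is" i ks' \<open>i1 = p\<close> by blast
    qed
    finally show "scale (tensor_coeff ?g is (?f ks)) (\<phi> is) = 0" by simp
  qed
  also have "\<dots> = (\<Sum>ks'\<in>words B e. scale (tensor_coeff ?g (?f ks') (?f ks)) (\<phi> (?f ks')))"
    by (rule sum.reindex[OF inj, unfolded comp_def])
  also have "\<dots> = (\<Sum>ks'\<in>words B e. scale (tensor_coeff g ks' ks) (\<phi> (?f ks')))"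
  proof (rule sum.cong[OF refl])
    fix ks' assume "ks' \<in> words B e"
    then have l: "length ks' = length ks" using ks by (simp add: words_def)
    have "tensor_coeff ?g (?f ks') (?f ks) = tensor_coeff g ks' ks"
      using l tensor_coeff_shift_fixed[OF refl p, of g] by (simp add: tensor_coeff_append tensor_coeff_shift)
    then show "scale (tensor_coeff ?g (?f ks') (?f ks)) (\<phi> (?f ks')) = scale (tensor_coeff g ks' ks) (\<phi> (?f ks'))"
      by simp
  qed
  finally show "Sh n \<rho> g (\<phi> (?f ks)) = (\<Sum>ks'\<in>words B e. scale (tensor_coeff g ks' ks) (\<phi> (?f ks')))" .
qed

end

section \<open>Elimination of a generator by the group algebra\<close>

lemma (in vector_space) gact_mult_csum:
  assumes nz: "hook \<mu> \<noteq> (0 :: 'a)" and \<phi>: "\<And>js. length js = sum_list \<mu> \<Longrightarrow>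
      gact scale (sum_list \<mu>) (csum \<mu>) \<phi> js = scale (hook \<mu>) (\<phi> js)"
    and x: "x \<in> GA (sum_list \<mu>)" and js: "length js = sum_list \<mu>"
  shows "scale (hook \<mu>) (gact scale (sum_list \<mu>) x \<phi> js) = gact scale (sum_list \<mu>) (x * csum \<mu>) \<phi> js"
proof -
  have "gact scale (sum_list \<mu>) (x * csum \<mu>) \<phi> js =
      gact scale (sum_list \<mu>) x (\<lambda>js. scale (hook \<mu>) (\<phi> js)) js"
    using x js \<phi> by (simp add: gact_mult[symmetric] cong: gact_cong)
  then show ?thesis by (simp add: gact_def scale_sum_right mult.commute)
qed

text \<open>\<open>\<phi> i0\<close> sees its coefficient only through
  \<open>\<xi> i0 * csum \<mu>\<close>, a nonzero element of a simple left ideal. A further factor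
  on the left turns this into a nonzero multiple of \<open>csum \<mu>\<close>, which acts on
  \<open>\<phi> i0\<close> as a scalar, so the relation can be solved for its values.\<close>

lemma (in vector_space) eliminate:
  assumes two: "(2::'a) \<noteq> 0" and nz: "hook \<mu> \<noteq> (0::'a)" and \<mu>: "is_partition \<mu>" and d: "d = sum_list \<mu>"
    and I: "finite I" "i0 \<in> I"
    and \<phi>: "\<And>js. length js = d \<Longrightarrow> gact scale d (csum \<mu>) (\<phi> i0) js = scale (hook \<mu>) (\<phi> i0 js)"
    and \<xi>: "\<And>i. \<xi> i \<in> GA d" "\<xi> i0 * csum \<mu> \<noteq> 0"
    and X: "subspace X" and rel: "\<And>js. length js = d \<Longrightarrow> (\<Sum>i\<in>I. gact scale d (\<xi> i) (\<phi> i) js) \<in> X"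
    and js: "length js = d"
  shows "\<phi> i0 js \<in> span (X \<union> {\<phi> i ks | i ks. i \<in> I - {i0} \<and> length ks = d})"
proof -
  let ?S = "X \<union> {\<phi> i ks | i ks. i \<in> I - {i0} \<and> length ks = d}"
  define \<eta> where "\<eta> = \<xi> i0 * csum \<mu>"
  have c: "csum \<mu> \<in> GA d" for c by (simp add: d)
  have \<eta>: "\<eta> \<in> GA (sum_list \<mu>)" "\<eta> \<noteq> 0" using \<xi> by (auto simp: \<eta>_def d)
  have "\<eta> * csum \<mu> = \<xi> i0 * (csum \<mu> * csum \<mu>)" by (simp add: \<eta>_def mult.assoc)
  also have "\<dots> = sc (hook \<mu>) * \<eta>"
    unfolding csum_sq[OF two \<mu>] \<eta>_def mult.assoc[symmetric] by (simp only: sc_commute[symmetric])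
  finally obtain y l where y: "y \<in> GA (sum_list \<mu>)" "l \<noteq> 0" "csum \<mu> * y * \<eta> = sc l * csum \<mu>"
    using ex_csum_multiple[OF two nz \<mu> \<eta>(1) _ \<eta>(2)] by metis
  define x where "x = csum \<mu> * y"
  have x: "x \<in> GA d" using y(1) by (simp add: x_def d)
  have "gact scale d x (\<lambda>js. \<Sum>i\<in>I. gact scale d (\<xi> i) (\<phi> i) js) js \<in> X"
    unfolding gact_def[of _ _ x]
    by (rule subspace_sum[OF X], rule subspace_scale[OF X], rule rel) (simp add: js)
  also have "gact scale d x (\<lambda>js. \<Sum>i\<in>I. gact scale d (\<xi> i) (\<phi> i) js) js =
    (\<Sum>i\<in>I. gact scale d x (gact scale d (\<xi> i) (\<phi> i)) js)"
    unfolding gact_def[of _ _ x] scale_sum_right by (rule sum.swap)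
  also have "\<dots> = (\<Sum>i\<in>I. gact scale d (x * \<xi> i) (\<phi> i) js)"
    using gact_mult[OF x \<xi>(1) js] by simp
  also have "\<dots> = gact scale d (x * \<xi> i0) (\<phi> i0) js + (\<Sum>i\<in>I - {i0}. gact scale d (x * \<xi> i) (\<phi> i) js)"
    using I by (rule sum.remove)
  finally have "gact scale d (x * \<xi> i0) (\<phi> i0) js + (\<Sum>i\<in>I - {i0}. gact scale d (x * \<xi> i) (\<phi> i) js) \<in> span ?S"
    using span_base by blast
  moreover have "(\<Sum>i\<in>I - {i0}. gact scale d (x * \<xi> i) (\<phi> i) js) \<in> span ?S"
  proof (rule span_sum)
    fix i assume "i \<in> I - {i0}"
    then have "{\<phi> i ks | ks. length ks = d} \<subseteq> ?S" by blast
    from span_mono[OF this] show "gact scale d (x * \<xi> i) (\<phi> i) js \<in> span ?S"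
      using gact_in_span[OF js, of "x * \<xi> i" "\<phi> i"] by blast
  qed
  ultimately have "gact scale d (x * \<xi> i0) (\<phi> i0) js \<in> span ?S"
    using span_diff by fastforce
  then have "scale (hook \<mu>) (gact scale d (x * \<xi> i0) (\<phi> i0) js) \<in> span ?S" by (rule span_scale)
  also have "scale (hook \<mu>) (gact scale d (x * \<xi> i0) (\<phi> i0) js) = gact scale d (x * \<xi> i0 * csum \<mu>) (\<phi> i0) js"
    using gact_mult_csum[OF nz, of "\<phi> i0" "x * \<xi> i0" js] \<phi> x \<xi>(1)[of i0] js by (simp add: d)
  also have "x * \<xi> i0 * csum \<mu> = sc l * csum \<mu>" using y(3) by (simp add: x_def \<eta>_def mult.assoc)
  also have "gact scale d (sc l * csum \<mu>) (\<phi> i0) js = scale (l * hook \<mu>) (\<phi> i0 js)"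
    using \<phi>[OF js] by (simp add: gact_sc)
  finally have "scale (inverse (l * hook \<mu>)) (scale (l * hook \<mu>) (\<phi> i0 js)) \<in> span ?S" by (rule span_scale)
  moreover have "inverse (l * hook \<mu>) * (l * hook \<mu>) = 1" using y(2) nz by (simp add: field_simps)
  ultimately show ?thesis by (simp only: scale_scale scale_one)
qed

section \<open>Permutations that preserve two blocks of positions\<close>

definition blk :: "nat \<Rightarrow> bijn \<Rightarrow> bijn \<Rightarrow> bijn" where
  "blk n g h = of_perm (\<lambda>k. if k < n then app g k else n + app h (k - n))"

lemma
  assumes g: "g \<in> Sym n" and h: "h \<in> Sym d"
  shows app_blk: "app (blk n g h) k = (if k < n then app g k else n + app h (k - n))"
    and blk_Sym: "blk n g h \<in> Sym (n + d)"
proof -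
  let ?f = "\<lambda>g h k. if k < n then app g k else n + app h (k - n)"
  have inv: "?f g h (?f (- g) (- h) k) = k" "?f (- g) (- h) (?f g h k) = k" for k using g by auto
  have "bij (?f g h)" by (rule o_bij[of "?f (- g) (- h)"]) (use inv in \<open>auto simp: fun_eq_iff\<close>)
  moreover have "?f g h k = k" if "k \<notin> {..<n + d}" for k
    using that Sym_outside[OF h, of "k - n"] by auto
  ultimately have p: "?f g h permutes {..<n + d}" unfolding permutes_def bij_iff by blast
  show "app (blk n g h) k = (if k < n then app g k else n + app h (k - n))"
    unfolding blk_def by (simp only: app_of_perm[OF p])
  show "blk n g h \<in> Sym (n + d)" unfolding blk_def by (rule of_perm_Sym[OF p])
qed

lemma permute_list_blk:
  assumes g: "g \<in> Sym (length xs)" and h: "h \<in> Sym (length ys)"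
  shows "permute_list (app (blk (length xs) g h)) (xs @ ys) = permute_list (app g) xs @ permute_list (app h) ys"
proof (rule nth_equalityI)
  fix k assume "k < length (permute_list (app (blk (length xs) g h)) (xs @ ys))"
  then have k: "k < length xs + length ys" by simp
  have p: "app (blk (length xs) g h) permutes {..<length (xs @ ys)}" "app g permutes {..<length xs}"
    "app h permutes {..<length ys}"
    using g h blk_Sym[OF g h] by (simp_all add: Sym_def)
  show "permute_list (app (blk (length xs) g h)) (xs @ ys) ! k =
      (permute_list (app g) xs @ permute_list (app h) ys) ! k"
  proof (cases "k < length xs")
    case True
    then show ?thesis using k g
      by (simp add: permute_list_nth[OF p(1)] permute_list_nth[OF p(2)] app_blk[OF g h] nth_append)
  next
    case False
    then have "k - length xs < length ys" using k by simp
    then show ?thesis using False k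
      by (simp add: permute_list_nth[OF p(1)] permute_list_nth[OF p(3)] app_blk[OF g h] nth_append)
  qed
qed simp

text \<open>An injection of the finite set of upper positions into itself is onto, so no lower
  position can be sent up.\<close>

lemma ex_blk:
  assumes g: "g \<in> Sym (n + d)" and pres: "\<And>k. n \<le> k \<Longrightarrow> k < n + d \<Longrightarrow> n \<le> app g k"
  obtains g1 g2 where "g1 \<in> Sym n" "g2 \<in> Sym d" "g = blk n g1 g2"
proof -
  have low: "app g k < n" if "k < n" for k
  proof (rule ccontr)
    assume a: "\<not> app g k < n"
    have "app g ` {n..<n + d} \<subseteq> {n..<n + d}" using pres g by auto
    moreover have "inj_on (app g) {n..<n + d}" by (simp add: inj_on_def)
    ultimately have "app g ` {n..<n + d} = {n..<n + d}" by (meson endo_inj_surj finite_atLeastLessThan)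
    moreover have "app g k \<in> {n..<n + d}" using a g that by simp
    ultimately obtain m where "m \<in> {n..<n + d}" "app g k = app g m" by (metis imageE)
    then show False using that by simp
  qed
  define f1 where "f1 k = (if k < n then app g k else k)" for k
  define f2 where "f2 k = (if k < d then app g (n + k) - n else k)" for k
  have "f1 ` {..<n} \<subseteq> {..<n}" "inj_on f1 {..<n}" using low by (auto simp: f1_def inj_on_def)
  then have "bij_betw f1 {..<n} {..<n}" by (simp add: bij_betw_def endo_inj_surj)
  then have p1: "f1 permutes {..<n}" by (rule bij_imp_permutes) (simp add: f1_def)
  have ge: "n \<le> app g (n + k) \<and> app g (n + k) < n + d" if "k < d" for k using pres[of "n + k"] that g by simp
  have "inj_on f2 {..<d}"
  proof (rule inj_onI)
    fix a b assume ab: "a \<in> {..<d}" "b \<in> {..<d}" "f2 a = f2 b"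
    then have "app g (n + a) - n = app g (n + b) - n" by (simp add: f2_def)
    then have "app g (n + a) = app g (n + b)" using ge[of a] ge[of b] ab by (metis eq_diff_iff lessThan_iff)
    then show "a = b" by simp
  qed
  moreover have "f2 ` {..<d} \<subseteq> {..<d}" using ge by (force simp: f2_def)
  ultimately have "bij_betw f2 {..<d} {..<d}" by (simp add: bij_betw_def endo_inj_surj)
  then have p2: "f2 permutes {..<d}" by (rule bij_imp_permutes) (simp add: f2_def)
  have S: "of_perm f1 \<in> Sym n" "of_perm f2 \<in> Sym d" using p1 p2 by (simp_all add: of_perm_Sym)
  have "g = blk n (of_perm f1) (of_perm f2)"
  proof (rule Sym_eqI[OF g blk_Sym[OF S]])
    fix k assume k: "k < n + d"
    show "app g k = app (blk n (of_perm f1) (of_perm f2)) k"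
      using ge[of "k - n"] k by (auto simp: app_blk[OF S] app_of_perm[OF p1] app_of_perm[OF p2] f1_def f2_def)
  qed
  then show thesis using that S by blast
qed

lemma blk_inject:
  assumes "g \<in> Sym n" "h \<in> Sym d" "g' \<in> Sym n" "h' \<in> Sym d" "blk n g h = blk n g' h'"
  shows "g = g' \<and> h = h'"
proof
  have eq: "app (blk n g h) k = app (blk n g' h') k" for k using assms(5) by simp
  show "g = g'" by (rule Sym_eqI[OF assms(1,3)]) (use eq assms in \<open>metis app_blk\<close>)
  show "h = h'"
  proof (rule Sym_eqI[OF assms(2,4)])
    fix k show "app h k = app h' k"
      using eq[of "n + k"] by (simp add: app_blk[OF assms(1,2)] app_blk[OF assms(3,4)])
  qed
qed

lemma permute_list_map_comm:
  "g \<in> Sym (length xs) \<Longrightarrow> permute_list (app g) (map f xs) = map f (permute_list (app g) xs)"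
  by (simp add: permute_list_map Sym_def)

text \<open>If \<open>b\<close> is the coefficient function of a tensor, then \<open>rmult \<mu> b\<close> is that of its product with the Young
  symmetrizer from the right.\<close>

definition rmult :: "nat list \<Rightarrow> (nat list \<Rightarrow> 'f::comm_ring_1) \<Rightarrow> nat list \<Rightarrow> 'f" where
  "rmult \<mu> b js = (\<Sum>g\<in>Sym (sum_list \<mu>). Poly_Mapping.lookup (csum \<mu>) (- g) * b (permute_list (app g) js))"

text \<open>The values of a family on words with fewer than \<open>D\<close> letters \<open>\<ge> n\<close>: these form the
  part of degree less than \<open>D\<close> after shifting by \<open>n\<close>.\<close>

definition lower_values :: "nat \<Rightarrow> nat \<Rightarrow> 'x family \<Rightarrow> 'x set" where
  "lower_values n D F = {\<phi> js | \<mu> \<phi> js. (\<mu>, \<phi>) \<in> F \<and> length js = sum_list \<mu> \<and> sum_list \<mu> \<le> D \<and>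
     length (filter ((\<le>) n) js) < D}"

section \<open>Semilinear representations and polarization of relations over K\<close>

locale semilinear_rep = vector_space scale
  for scale :: "'K::field \<Rightarrow> 'm::ab_group_add \<Rightarrow> 'm" +
  fixes \<iota> :: "'k::field_char_0 \<Rightarrow> 'K" and \<sigma> :: "'k mtx \<Rightarrow> 'K \<Rightarrow> 'K" and \<rho> :: "'k mtx \<Rightarrow> 'm \<Rightarrow> 'm"
  assumes embed_one: "\<iota> 1 = 1"
    and embed_add: "\<iota> (c + c') = \<iota> c + \<iota> c'"
    and embed_mult: "\<iota> (c * c') = \<iota> c * \<iota> c'"
    and field_act_add: "g \<in> GL \<Longrightarrow> \<sigma> g (a + b) = \<sigma> g a + \<sigma> g b"
    and field_act_mult: "g \<in> GL \<Longrightarrow> \<sigma> g (a * b) = \<sigma> g a * \<sigma> g b"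
    and field_act_embed: "g \<in> GL \<Longrightarrow> \<sigma> g (\<iota> c) = \<iota> c"
    and module_act_add: "g \<in> GL \<Longrightarrow> \<rho> g (x + y) = \<rho> g x + \<rho> g y"
    and module_act_scale: "g \<in> GL \<Longrightarrow> \<rho> g (scale a x) = scale (\<sigma> g a) (\<rho> g x)"
begin

abbreviation "kmult \<equiv> (\<lambda>c x. \<iota> c * x)"
abbreviation "kscale \<equiv> (\<lambda>c. scale (\<iota> c))"

text \<open>Field and module both become representations over \<open>k\<close>, so polarization
  applies to the coefficients of a relation as well as to the vectors in it.\<close>

sublocale K: GL_rep kmult \<sigma>
  by unfold_locales
    (simp_all add: embed_one embed_add embed_mult field_act_add field_act_mult field_act_embed algebra_simps)

sublocale M: GL_rep kscale \<rho>
  by unfold_locales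
    (simp_all add: embed_one embed_add embed_mult field_act_embed module_act_add module_act_scale
      scale_left_distrib scale_right_distrib)

lemma semilinear_rep_Sh: "semilinear_rep scale \<iota> (Sh n \<sigma>) (Sh n \<rho>)"
  by unfold_locales
    (simp_all add: embed_one embed_add embed_mult field_act_add field_act_mult field_act_embed
      module_act_add module_act_scale Sh_def block_shift_GL)

lemma embed_zero [simp]: "\<iota> 0 = 0"
  using embed_add[of 0 0] by (metis add_0 add_cancel_right_right)

lemma embed_sum: "\<iota> (\<Sum>i\<in>I. f i) = (\<Sum>i\<in>I. \<iota> (f i))"
  by (induction I rule: infinite_finite_induct) (simp_all add: embed_add)

lemma embed_uminus: "\<iota> (- c) = - \<iota> c"
  using embed_add[of c "- c"] by (simp add: eq_neg_iff_add_eq_0 add.commute)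

lemma embed_eq_0_iff [simp]: "\<iota> c = 0 \<longleftrightarrow> c = 0"
proof
  assume "\<iota> c = 0"
  then show "c = 0" using embed_mult[of c "inverse c"] embed_one by (cases "c = 0") auto
qed simp

lemma embed_of_nat: "\<iota> (of_nat n) = of_nat n"
  by (induction n) (simp_all add: embed_add embed_one)

lemma embed_of_int: "\<iota> (of_int z) = of_int z"
  by (cases z rule: int_cases2) (simp_all add: embed_of_nat embed_uminus)

lemma two_neq_zero: "(2::'K) \<noteq> 0"
  using embed_of_nat[of 2] embed_eq_0_iff[of 2] by simp

lemma embed_hook: "\<iota> (hook \<mu>) = hook \<mu>"
  using embed_of_int hook_of_int by metis

lemma hook_neq_zero: "is_partition \<mu> \<Longrightarrow> hook \<mu> \<noteq> (0::'K)"
  using hook_nonzero embed_eq_0_iff embed_hook by metis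

lemma embed_csum: "\<iota> (Poly_Mapping.lookup (csum \<mu>) g) = Poly_Mapping.lookup (csum \<mu>) g"
  using embed_of_int lookup_csum_of_int by metis

lemma mcovD:
  assumes "\<phi> \<in> mcov kscale \<rho> \<mu>"
  shows "\<phi> \<in> cov kscale \<rho> (sum_list \<mu>)"
    and "length js = sum_list \<mu> \<Longrightarrow>
      gact scale (sum_list \<mu>) (csum \<mu>) \<phi> js = scale (hook \<mu>) (\<phi> js)"
  using assms by (simp_all add: mcov_def gact_def embed_csum embed_hook)

lemma sum_words_append:
  "(\<Sum>is\<in>words B (a + d). F (take a is) (drop a is)) = (\<Sum>i1\<in>words B a. \<Sum>i2\<in>words B d. F i1 i2)"
proof -
  have "(\<Sum>i1\<in>words B a. \<Sum>i2\<in>words B d. F i1 i2) = (\<Sum>(i1, i2)\<in>words B a \<times> words B d. F i1 i2)"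
    by (simp add: sum.cartesian_product)
  also have "\<dots> = (\<Sum>is\<in>words B (a + d). F (take a is) (drop a is))"
    by (rule sum.reindex_bij_witness[where i = "\<lambda>is. (take a is, drop a is)" and j = "\<lambda>(i1, i2). i1 @ i2"])
      (auto simp: words_def dest: in_set_takeD in_set_dropD)
  finally show ?thesis ..
qed

text \<open>Semilinearity gives a coefficient map and a module map a product on concatenated words.
  A term of a relation thus becomes the value of a single map, and the letters of its coefficient
  are polarized together with those of its argument.\<close>

lemma cov_scale_append:
  assumes f: "f \<in> cov kmult \<sigma> a" and \<phi>: "\<phi> \<in> cov kscale \<rho> d"
  shows "(\<lambda>js. scale (f (take a js)) (\<phi> (drop a js))) \<in> cov kscale \<rho> (a + d)"
proof (rule M.covI)
  fix g :: "'k mtx" and n B js assume g: "g \<in> GL" "g \<in> mtx_block n" "n \<le> B" and js: "js \<in> words B (a + d)"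
  define j1 where "j1 = take a js"
  define j2 where "j2 = drop a js"
  have j: "js = j1 @ j2" "j1 \<in> words B a" "j2 \<in> words B d"
    using js by (auto simp: j1_def j2_def words_def dest: in_set_takeD in_set_dropD)
  have "\<rho> g (scale (f j1) (\<phi> j2)) = scale (\<sigma> g (f j1)) (\<rho> g (\<phi> j2))"
    by (rule module_act_scale[OF g(1)])
  also have "\<dots> = (\<Sum>i1\<in>words B a. \<Sum>i2\<in>words B d.
      kscale (tensor_coeff g i1 j1 * tensor_coeff g i2 j2) (scale (f i1) (\<phi> i2)))"
    unfolding K.covD[OF f g j(2)] M.covD[OF \<phi> g j(3)] scale_sum_left scale_sum_right
    by (subst sum.swap) (simp add: embed_mult mult_ac)
  also have "\<dots> = (\<Sum>is\<in>words B (a + d).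
      kscale (tensor_coeff g (take a is) j1 * tensor_coeff g (drop a is) j2) (scale (f (take a is)) (\<phi> (drop a is))))"
    by (rule sum_words_append[symmetric])
  also have "\<dots> = (\<Sum>is\<in>words B (a + d). kscale (tensor_coeff g is js) (scale (f (take a is)) (\<phi> (drop a is))))"
  proof (rule sum.cong[OF refl])
    fix "is" assume "is \<in> words B (a + d)"
    then have "tensor_coeff g (take a is @ drop a is) (j1 @ j2) = tensor_coeff g (take a is) j1 * tensor_coeff g (drop a is) j2"
      using j by (intro tensor_coeff_append) (auto simp: words_def)
    then show "kscale (tensor_coeff g (take a is) j1 * tensor_coeff g (drop a is) j2) (scale (f (take a is)) (\<phi> (drop a is))) =
      kscale (tensor_coeff g is js) (scale (f (take a is)) (\<phi> (drop a is)))" using j by simp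
  qed
  finally show "\<rho> g (scale (f (take a js)) (\<phi> (drop a js))) =
      (\<Sum>is\<in>words B (a + d). kscale (tensor_coeff g is js) (scale (f (take a is)) (\<phi> (drop a is))))"
    by (simp add: j1_def j2_def)
qed

text \<open>Evaluate the polarized relation at \<open>e_0, ..., e_{n-1}\<close> followed by \<open>D\<close> letters \<open>\<ge> n\<close>. All terms lie in the
  lower part except those in which each of the \<open>D\<close> letters enters a map of degree \<open>D\<close>.\<close>

lemma polar_relation:
  assumes F: "mfamily kscale \<rho> F" and Z: "finite Z"
    and z: "\<And>z. z \<in> Z \<Longrightarrow> x z \<in> F" "\<And>z. z \<in> Z \<Longrightarrow> length (q z) = sum_list (fst (x z))"
      "\<And>z. z \<in> Z \<Longrightarrow> sum_list (fst (x z)) \<le> D" "\<And>z. z \<in> Z \<Longrightarrow> f z \<in> cov kmult \<sigma> (length (p z))"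
    and rel: "(\<Sum>z\<in>Z. scale (f z (p z)) (snd (x z) (q z))) = 0"
    and len: "length p1 = n" "length q0 = D" "length ks = D"
  shows "(\<Sum>z\<in>{z \<in> Z. length (p z) = n \<and> sum_list (fst (x z)) = D}.
     \<Sum>g2\<in>{g2 \<in> Sym D. permute_list (app g2) q0 = q z}. \<Sum>g1\<in>{g1 \<in> Sym n. permute_list (app g1) p1 = p z}.
       scale (f z (permute_list (app g1) [0..<n])) (snd (x z) (map ((+) n) (permute_list (app g2) ks))))
    \<in> span (lower_values n D F)"
proof -
  let ?L = "span (lower_values n D F)"
  define js where "js = [0..<n] @ map ((+) n) ks"
  define u where "u z js = scale (f z (take (length (p z)) js)) (snd (x z) (drop (length (p z)) js))" for z js
  have mc: "snd (x z) \<in> cov kscale \<rho> (sum_list (fst (x z)))" if "z \<in> Z" for z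
    using F z(1)[OF that] mcovD(1) by (fastforce simp: mfamily_def)
  have u: "u z \<in> cov kscale \<rho> (length (p z @ q z))" if "z \<in> Z" for z
    using cov_scale_append[OF z(4) mc, OF that that] z(2)[OF that] by (simp add: u_def[abs_def])
  have st: "M.stable {0}" by (auto simp: M.stable_def M.subspace_def M.act_zero)
  have ljs: "length js = n + D" by (simp add: js_def len)
  have "M.polar Z (\<lambda>_. 1) u (\<lambda>z. p z @ q z) (p1 @ q0) js \<in> {0}"
    by (rule M.polar_in[OF st Z u]) (use rel z(2) in \<open>simp_all add: u_def embed_one len ljs\<close>)
  then have pol: "(\<Sum>z\<in>{z \<in> Z. length (p z) + length (q z) = n + D}.
     \<Sum>g\<in>{g \<in> Sym (n + D). permute_list (app g) (p1 @ q0) = p z @ q z}. u z (permute_list (app g) js)) = 0"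
    by (simp add: M.polar_def embed_one len)
  let ?Z1 = "{z \<in> Z. length (p z) = n \<and> sum_list (fst (x z)) = D}"
  let ?Z2 = "{z \<in> Z. length (p z) + length (q z) = n + D}"
  let ?G = "\<lambda>z. {g \<in> Sym (n + D). permute_list (app g) (p1 @ q0) = p z @ q z}"
  let ?B = "\<lambda>z. (\<lambda>(g2, g1). blk n g1 g2) ` ({g2 \<in> Sym D. permute_list (app g2) q0 = q z} \<times> {g1 \<in> Sym n. permute_list (app g1) p1 = p z})"
  have low: "u z (permute_list (app g) js) \<in> ?L"
    if zZ: "z \<in> ?Z2" and g: "g \<in> ?G z" and out: "length (p z) = n \<Longrightarrow> g \<notin> ?B z" for z g
  proof -
    define w where "w = drop (length (p z)) (permute_list (app g) js)"
    have zz: "z \<in> Z" "length (p z) + length (q z) = n + D" using zZ by auto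
    have lw: "length w = sum_list (fst (x z))" using zz z(2)[OF zz(1)] by (simp add: w_def ljs)
    \<comment> \<open>Coefficient and argument take \<open>n + D\<close> letters together. If the
      coefficient does not take exactly \<open>n\<close>, it takes more and the map has degree below
      \<open>D\<close>. Otherwise, if all arguments were letters from \<open>n\<close> on,
      \<open>g\<close> would preserve the last \<open>D\<close> positions and be one of the excluded
      block permutations.\<close>
    have "length (filter ((\<le>) n) w) < D"
    proof (cases "length (p z) = n")
      case False
      then have "length w < D" using z(2,3)[OF zz(1)] lw zz(2) by linarith
      then show ?thesis using length_filter_le le_less_trans by blast
    next
      case True
      show ?thesis
      proof (rule ccontr)
        assume "\<not> length (filter ((\<le>) n) w) < D"
        moreover have "length w = D" using True zz z(2) lw by auto
        ultimately have all: "\<forall>i\<in>set w. n \<le> i"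
          by (metis length_filter_less not_less)
        have gS: "g \<in> Sym (n + D)" using g by simp
        have gp: "app g permutes {..<length js}" using gS by (simp add: Sym_def ljs)
        have "n \<le> app g k" if k: "n \<le> k" "k < n + D" for k
        proof -
          have "w ! (k - n) = js ! app g k"
            using k True \<open>length w = D\<close> by (simp add: w_def ljs permute_list_nth[OF gp])
          moreover have "w ! (k - n) \<in> set w" using k \<open>length w = D\<close> by (intro nth_mem) simp
          ultimately have "n \<le> js ! app g k" using all by metis
          then show ?thesis by (cases "app g k < n") (auto simp: js_def nth_append)
        qed
        then obtain g1 g2 where gg: "g1 \<in> Sym n" "g2 \<in> Sym D" "g = blk n g1 g2"
          using ex_blk[OF gS] by metis
        have "permute_list (app g) (p1 @ q0) = permute_list (app g1) p1 @ permute_list (app g2) q0"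
          using permute_list_blk[of g1 p1 g2 q0] gg len by simp
        then have "permute_list (app g1) p1 @ permute_list (app g2) q0 = p z @ q z" using g by simp
        then have "permute_list (app g1) p1 = p z \<and> permute_list (app g2) q0 = q z"
          by (rule append_eq_append_conv[THEN iffD1, rotated]) (simp add: len True)
        then have "g \<in> ?B z" using gg by (intro image_eqI[of _ _ "(g2, g1)"]) auto
        then show False using out True by blast
      qed
    qed
    then have "snd (x z) w \<in> lower_values n D F"
      unfolding lower_values_def using z(1,3)[OF zz(1)] lw by (metis (mono_tags, lifting) mem_Collect_eq prod.collapse)
    then show ?thesis unfolding u_def w_def[symmetric] by (intro span_scale span_base)
  qed
  have inj: "inj_on (\<lambda>(g2, g1). blk n g1 g2) ({g2 \<in> Sym D. permute_list (app g2) q0 = q z} \<times> {g1 \<in> Sym n. permute_list (app g1) p1 = p z})" for z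
    by (rule inj_onI) (use blk_inject in auto)
  have main: "(\<Sum>g\<in>?B z. u z (permute_list (app g) js)) =
      (\<Sum>g2\<in>{g2 \<in> Sym D. permute_list (app g2) q0 = q z}. \<Sum>g1\<in>{g1 \<in> Sym n. permute_list (app g1) p1 = p z}.
       scale (f z (permute_list (app g1) [0..<n])) (snd (x z) (map ((+) n) (permute_list (app g2) ks))))"
    if zn: "length (p z) = n" for z
    unfolding sum.reindex[OF inj] sum.cartesian_product
  proof (rule sum.cong[OF refl], clarsimp)
    fix g1 g2 assume "g2 \<in> Sym D" "g1 \<in> Sym n"
    then have "permute_list (app (blk n g1 g2)) js = permute_list (app g1) [0..<n] @ map ((+) n) (permute_list (app g2) ks)"
      using permute_list_blk[of g1 "[0..<n]" g2 "map ((+) n) ks"] by (simp add: js_def len permute_list_map_comm)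
    then show "u z (permute_list (app (blk n g1 g2)) js) =
      scale (f z (permute_list (app g1) [0..<n])) (snd (x z) (map ((+) n) (permute_list (app g2) ks)))"
      using zn by (simp add: u_def)
  qed
  have sub: "?B z \<subseteq> ?G z" if "z \<in> ?Z1" for z
    using permute_list_blk[of _ p1 _ q0] blk_Sym by (auto simp: len)
  have neg: "0 = a + b + c \<Longrightarrow> a = - (b + c)" for a b c :: 'm
    by (metis add.assoc eq_neg_iff_add_eq_0)
  have Z12: "?Z1 \<subseteq> ?Z2" using z(2) by auto
  have "0 = (\<Sum>z\<in>?Z2. \<Sum>g\<in>?G z. u z (permute_list (app g) js))" by (rule pol[symmetric])
  also have "\<dots> =
    (\<Sum>z\<in>?Z1. \<Sum>g\<in>?G z. u z (permute_list (app g) js)) + (\<Sum>z\<in>?Z2 - ?Z1. \<Sum>g\<in>?G z. u z (permute_list (app g) js))"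
    using Z Z12 by (subst sum.subset_diff[of ?Z1 ?Z2]) (auto simp: add.commute)
  also have "(\<Sum>z\<in>?Z1. \<Sum>g\<in>?G z. u z (permute_list (app g) js)) =
    (\<Sum>z\<in>?Z1. (\<Sum>g\<in>?B z. u z (permute_list (app g) js)) + (\<Sum>g\<in>?G z - ?B z. u z (permute_list (app g) js)))"
    by (rule sum.cong[OF refl], subst sum.subset_diff[OF sub]) (simp_all add: add.commute)
  also have "\<dots> = (\<Sum>z\<in>?Z1. \<Sum>g\<in>?B z. u z (permute_list (app g) js)) + (\<Sum>z\<in>?Z1. \<Sum>g\<in>?G z - ?B z. u z (permute_list (app g) js))"
    by (rule sum.distrib)
  finally have "(\<Sum>z\<in>?Z1. \<Sum>g\<in>?B z. u z (permute_list (app g) js)) =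
     - ((\<Sum>z\<in>?Z1. \<Sum>g\<in>?G z - ?B z. u z (permute_list (app g) js)) + (\<Sum>z\<in>?Z2 - ?Z1. \<Sum>g\<in>?G z. u z (permute_list (app g) js)))"
    by (rule neg)
  moreover have "(\<Sum>z\<in>?Z1. \<Sum>g\<in>?G z - ?B z. u z (permute_list (app g) js)) \<in> ?L"
    by (intro span_sum low) (use Z12 in blast)+
  moreover have "(\<Sum>z\<in>?Z2 - ?Z1. \<Sum>g\<in>?G z. u z (permute_list (app g) js)) \<in> ?L"
    by (intro span_sum low) (use z(2) in auto)
  ultimately have "(\<Sum>z\<in>?Z1. \<Sum>g\<in>?B z. u z (permute_list (app g) js)) \<in> ?L"
    by (simp only: span_add span_neg)
  then show ?thesis using main by simp
qed

end

context semilinear_rep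
begin

text \<open>The relation from \<open>polar_relation\<close> is nontrivial for some \<open>p1\<close>: its coefficients are polarizations of
  those of the given one, from which the latter can be recovered.\<close>

lemma drop_top_element:
  assumes F: "mfamily kscale \<rho> F" and Z: "finite Z"
    and z: "\<And>z. z \<in> Z \<Longrightarrow> x z \<in> F" "\<And>z. z \<in> Z \<Longrightarrow> length (q z) = sum_list (fst (x z))"
      "\<And>z. z \<in> Z \<Longrightarrow> sum_list (fst (x z)) \<le> D" "\<And>z. z \<in> Z \<Longrightarrow> f z \<in> cov kmult \<sigma> (length (p z))"
      "\<And>z. z \<in> Z \<Longrightarrow> length (p z) \<in> L"
    and rel: "(\<Sum>z\<in>Z. scale (f z (p z)) (snd (x z) (q z))) = 0"
    and x0: "(\<mu>, \<phi>) \<in> F" "sum_list \<mu> = D"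
    and q0: "length q0 = D" "rmult \<mu> (\<lambda>js. \<Sum>z\<in>{z \<in> Z. x z = (\<mu>, \<phi>) \<and> q z = js}. f z (p z)) q0 \<noteq> 0"
  shows "\<exists>n\<in>L. \<forall>js. length js = D \<longrightarrow> \<phi> (map ((+) n) js) \<in>
    span (lower_values n D F \<union> {\<psi> (map ((+) n) ks) | \<nu> \<psi> ks. (\<nu>, \<psi>) \<in> F - {(\<mu>, \<phi>)} \<and> sum_list \<nu> = D \<and> length ks = D})"
proof -
  define Z0 where "Z0 = {z \<in> Z. x z = (\<mu>, \<phi>)}"
  have Z0: "finite Z0" "Z0 \<subseteq> Z" using Z by (auto simp: Z0_def)
  \<comment> \<open>Unfolded, the hypothesis on \<open>rmult\<close> is a combination of the
    coefficients \<open>f z (p z)\<close> with scalars in \<open>k\<close>, because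
    \<open>csum \<mu>\<close> is integral. To such a combination \<open>polar_recover\<close>
    applies.\<close>
  define C :: "_ \<Rightarrow> 'k" where
    "C z = (\<Sum>g\<in>{g \<in> Sym D. permute_list (app g) q0 = q z}. Poly_Mapping.lookup (csum \<mu>) (- g))" for z
  have "rmult \<mu> (\<lambda>js. \<Sum>z\<in>{z \<in> Z. x z = (\<mu>, \<phi>) \<and> q z = js}. f z (p z)) q0 =
    (\<Sum>g\<in>Sym D. \<Sum>z\<in>Z0. if permute_list (app g) q0 = q z then Poly_Mapping.lookup (csum \<mu>) (- g) * f z (p z) else 0)"
    unfolding rmult_def x0(2)
  proof (rule sum.cong[OF refl])
    fix g
    have "{z \<in> Z. x z = (\<mu>, \<phi>) \<and> q z = permute_list (app g) q0} = {z \<in> Z0. permute_list (app g) q0 = q z}"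
      by (auto simp: Z0_def)
    then show "Poly_Mapping.lookup (csum \<mu>) (- g) * (\<Sum>z\<in>{z \<in> Z. x z = (\<mu>, \<phi>) \<and> q z = permute_list (app g) q0}. f z (p z)) =
      (\<Sum>z\<in>Z0. if permute_list (app g) q0 = q z then Poly_Mapping.lookup (csum \<mu>) (- g) * f z (p z) else 0)"
      using sum.inter_filter[OF Z0(1), of "\<lambda>z. Poly_Mapping.lookup (csum \<mu>) (- g) * f z (p z)" "\<lambda>z. permute_list (app g) q0 = q z"]
      by (simp add: sum_distrib_left)
  qed
  also have "\<dots> = (\<Sum>z\<in>Z0. \<Sum>g\<in>Sym D. if permute_list (app g) q0 = q z then Poly_Mapping.lookup (csum \<mu>) (- g) * f z (p z) else 0)"
    by (rule sum.swap)
  also have "\<dots> = (\<Sum>z\<in>Z0. kmult (C z) (f z (p z)))"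
    unfolding C_def by (subst sum.inter_filter[symmetric]) (simp_all add: embed_sum embed_csum sum_distrib_right)
  finally have nz: "(\<Sum>z\<in>Z0. kmult (C z) (f z (p z))) \<notin> {0}" using q0(2) by simp
  have st: "K.stable {0}" by (auto simp: K.stable_def K.subspace_def K.act_zero)
  have sub0: "K.subspace {0}" using st by (simp add: K.stable_def)
  have "\<exists>p1. K.polar Z0 C f p p1 p1 \<noteq> 0"
  proof (rule ccontr)
    assume "\<not> (\<exists>p1. K.polar Z0 C f p p1 p1 \<noteq> 0)"
    then have "K.polar Z0 C f p p1 p1 \<in> {0}" for p1 by simp
    from K.polar_recover[OF sub0 Z0(1) this] nz show False by simp
  qed
  then obtain p1 where p1: "K.polar Z0 C f p p1 p1 \<noteq> 0" ..
  define n where "n = length p1"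
  have pc: "K.polar Z0 C f p p1 \<in> cov kmult \<sigma> n"
    unfolding n_def by (rule K.polar_cov) (rule z(4), use Z0(2) in blast)
  \<comment> \<open>A map from a tensor power that vanishes on the generic word vanishes on all
    words of its length, in particular on \<open>p1\<close>.\<close>
  have nz1: "K.polar Z0 C f p p1 [0..<n] \<noteq> 0"
  proof
    assume "K.polar Z0 C f p p1 [0..<n] = 0"
    then have "K.polar Z0 C f p p1 [0..<n] \<in> {0}" by simp
    from K.cov_generated[OF st pc this n_def[symmetric]] p1 show False by simp
  qed
  have nA: "n \<in> L"
  proof (rule ccontr)
    assume "n \<notin> L"
    moreover have "length (p z) \<in> L" if "z \<in> Z0" for z using z(5) Z0(2) that by blast
    ultimately have "{z \<in> Z0. length (p z) = length p1} = {}" unfolding n_def by force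
    then have "K.polar Z0 C f p p1 [0..<n] = 0" by (simp only: K.polar_def sum.empty)
    then show False using nz1 by contradiction
  qed
  \<comment> \<open>\<open>\<xi> i\<close> gathers the coefficients that
    \<open>polar_relation\<close> gives to the generator \<open>i\<close> into an element of the
    group algebra over \<open>K\<close>. For the chosen generator, the identity coefficient of
    \<open>\<xi> i * csum \<mu>\<close> is the polarization just shown to be nonzero.\<close>
  define xc where "xc i g = (\<Sum>z\<in>{z \<in> Z. x z = i \<and> length (p z) = n \<and> permute_list (app g) q0 = q z}.
     \<Sum>g1\<in>{g1 \<in> Sym n. permute_list (app g1) p1 = p z}. f z (permute_list (app g1) [0..<n]))" for i g
  define \<xi> :: "_ \<Rightarrow> 'K galg" where "\<xi> i = (\<Sum>g\<in>Sym D. Poly_Mapping.single g (xc i g))" for i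
  have \<xi>G: "\<xi> i \<in> GA D" for i unfolding \<xi>_def by (intro GA_sum GA_single)
  have \<xi>l: "Poly_Mapping.lookup (\<xi> i) g = xc i g" if "g \<in> Sym D" for i g
    using that by (simp add: \<xi>_def lookup_sum lookup_single when_def)
  have "Poly_Mapping.lookup (\<xi> (\<mu>, \<phi>) * csum \<mu>) 0 = (\<Sum>g\<in>Sym D. xc (\<mu>, \<phi>) g * Poly_Mapping.lookup (csum \<mu>) (- g))"
    by (simp add: lookup_GA_mult[OF \<xi>G] \<xi>l)
  also have "\<dots> = (\<Sum>g\<in>Sym D. \<Sum>z\<in>{z \<in> Z0. length (p z) = n}. if permute_list (app g) q0 = q z then
      Poly_Mapping.lookup (csum \<mu>) (- g) * (\<Sum>g1\<in>{g1 \<in> Sym n. permute_list (app g1) p1 = p z}. f z (permute_list (app g1) [0..<n])) else 0)"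
  proof (rule sum.cong[OF refl])
    fix g
    have eq: "{z \<in> Z. x z = (\<mu>, \<phi>) \<and> length (p z) = n \<and> permute_list (app g) q0 = q z} =
      {z \<in> {z \<in> Z0. length (p z) = n}. permute_list (app g) q0 = q z}" by (auto simp: Z0_def)
    show "xc (\<mu>, \<phi>) g * Poly_Mapping.lookup (csum \<mu>) (- g) = (\<Sum>z\<in>{z \<in> Z0. length (p z) = n}. if permute_list (app g) q0 = q z then
      Poly_Mapping.lookup (csum \<mu>) (- g) * (\<Sum>g1\<in>{g1 \<in> Sym n. permute_list (app g1) p1 = p z}. f z (permute_list (app g1) [0..<n])) else 0)"
      unfolding xc_def eq sum_distrib_right[of _ "{z \<in> {z \<in> Z0. length (p z) = n}. permute_list (app g) q0 = q z}"]
      using Z0(1) by (subst sum.inter_filter[symmetric]) (simp_all add: mult.commute)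
  qed
  also have "\<dots> = (\<Sum>z\<in>{z \<in> Z0. length (p z) = n}. \<Sum>g\<in>Sym D. if permute_list (app g) q0 = q z then
      Poly_Mapping.lookup (csum \<mu>) (- g) * (\<Sum>g1\<in>{g1 \<in> Sym n. permute_list (app g1) p1 = p z}. f z (permute_list (app g1) [0..<n])) else 0)"
    by (rule sum.swap)
  also have "\<dots> = K.polar Z0 C f p p1 [0..<n]"
    unfolding K.polar_def n_def[symmetric] C_def
    by (rule sum.cong[OF refl], subst sum.inter_filter[symmetric])
      (simp_all add: embed_sum embed_csum flip: sum_distrib_left sum_distrib_right)
  finally have \<xi>0: "\<xi> (\<mu>, \<phi>) * csum \<mu> \<noteq> 0" using nz1 by auto
  define I where "I = {i \<in> F. sum_list (fst i) = D}"
  define \<phi>' where "\<phi>' i ks = snd i (map ((+) n) ks)" for i :: "nat list \<times> (nat list \<Rightarrow> 'm)" and ks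
  let ?L = "span (lower_values n D F)"
  have finI: "finite I" "(\<mu>, \<phi>) \<in> I" using F x0 by (auto simp: I_def mfamily_def)
  have mu: "is_partition \<mu>" "\<phi> \<in> mcov kscale \<rho> \<mu>" using F x0(1) by (auto simp: mfamily_def)
  have \<phi>'c: "gact scale D (csum \<mu>) (\<phi>' (\<mu>, \<phi>)) js = scale (hook \<mu>) (\<phi>' (\<mu>, \<phi>) js)" if "length js = D" for js
    using mcovD(2)[OF mu(2), of "map ((+) n) js"] that x0(2)
    by (simp add: gact_def \<phi>'_def permute_list_map_comm)
  have rel': "(\<Sum>i\<in>I. gact scale D (\<xi> i) (\<phi>' i) ks) \<in> ?L" if ks: "length ks = D" for ks
  proof -
    have eqi: "gact scale D (\<xi> i) (\<phi>' i) ks = (\<Sum>z\<in>{z \<in> {z \<in> Z. length (p z) = n \<and> sum_list (fst (x z)) = D}. x z = i}.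
     \<Sum>g2\<in>{g2 \<in> Sym D. permute_list (app g2) q0 = q z}. \<Sum>g1\<in>{g1 \<in> Sym n. permute_list (app g1) p1 = p z}.
       scale (f z (permute_list (app g1) [0..<n])) (snd (x z) (map ((+) n) (permute_list (app g2) ks))))"
      if i: "i \<in> I" for i
    proof -
      let ?Zi = "{z \<in> {z \<in> Z. length (p z) = n \<and> sum_list (fst (x z)) = D}. x z = i}"
      let ?t = "\<lambda>z g2. \<Sum>g1\<in>{g1 \<in> Sym n. permute_list (app g1) p1 = p z}.
         scale (f z (permute_list (app g1) [0..<n])) (snd (x z) (map ((+) n) (permute_list (app g2) ks)))"
      have "gact scale D (\<xi> i) (\<phi>' i) ks = (\<Sum>g2\<in>Sym D. \<Sum>z\<in>?Zi. if permute_list (app g2) q0 = q z then ?t z g2 else 0)"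
        unfolding gact_def
      proof (rule sum.cong[OF refl])
        fix g2 assume g2: "g2 \<in> Sym D"
        have eq: "{z \<in> Z. x z = i \<and> length (p z) = n \<and> permute_list (app g2) q0 = q z} = {z \<in> ?Zi. permute_list (app g2) q0 = q z}"
          using i by (auto simp: I_def)
        show "scale (Poly_Mapping.lookup (\<xi> i) g2) (\<phi>' i (permute_list (app g2) ks)) =
          (\<Sum>z\<in>?Zi. if permute_list (app g2) q0 = q z then ?t z g2 else 0)"
          unfolding \<xi>l[OF g2] xc_def eq using Z
          by (subst sum.inter_filter[symmetric]) (auto simp: \<phi>'_def scale_sum_left intro!: sum.cong)
      qed
      also have "\<dots> = (\<Sum>z\<in>?Zi. \<Sum>g2\<in>Sym D. if permute_list (app g2) q0 = q z then ?t z g2 else 0)"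
        by (rule sum.swap)
      also have "\<dots> = (\<Sum>z\<in>?Zi. \<Sum>g2\<in>{g2 \<in> Sym D. permute_list (app g2) q0 = q z}. ?t z g2)"
        by (rule sum.cong[OF refl], rule sum.inter_filter[symmetric]) simp
      finally show ?thesis .
    qed
    have fZ: "finite {z \<in> Z. length (p z) = n \<and> sum_list (fst (x z)) = D}" using Z by simp
    have sub: "x ` {z \<in> Z. length (p z) = n \<and> sum_list (fst (x z)) = D} \<subseteq> I" using z(1) by (auto simp: I_def)
    have "(\<Sum>i\<in>I. gact scale D (\<xi> i) (\<phi>' i) ks) = (\<Sum>i\<in>I. \<Sum>z\<in>{z \<in> {z \<in> Z. length (p z) = n \<and> sum_list (fst (x z)) = D}. x z = i}.
     \<Sum>g2\<in>{g2 \<in> Sym D. permute_list (app g2) q0 = q z}. \<Sum>g1\<in>{g1 \<in> Sym n. permute_list (app g1) p1 = p z}.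
       scale (f z (permute_list (app g1) [0..<n])) (snd (x z) (map ((+) n) (permute_list (app g2) ks))))"
      by (rule sum.cong[OF refl eqi])
    also have "\<dots> = (\<Sum>z\<in>{z \<in> Z. length (p z) = n \<and> sum_list (fst (x z)) = D}.
     \<Sum>g2\<in>{g2 \<in> Sym D. permute_list (app g2) q0 = q z}. \<Sum>g1\<in>{g1 \<in> Sym n. permute_list (app g1) p1 = p z}.
       scale (f z (permute_list (app g1) [0..<n])) (snd (x z) (map ((+) n) (permute_list (app g2) ks))))"
      by (rule sum.group[OF fZ finI(1) sub])
    also have "\<dots> \<in> ?L" by (rule polar_relation[OF F Z z(1-4) rel n_def[symmetric] q0(1) ks])
    finally show ?thesis .
  qed
  have "\<phi> (map ((+) n) js) \<in> span (lower_values n D F \<union>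
      {\<psi> (map ((+) n) ks) | \<nu> \<psi> ks. (\<nu>, \<psi>) \<in> F - {(\<mu>, \<phi>)} \<and> sum_list \<nu> = D \<and> length ks = D})"
    (is "_ \<in> span ?T") if js: "length js = D" for js
  proof -
    have "\<phi>' (\<mu>, \<phi>) js \<in> span (?L \<union> {\<phi>' i ks | i ks. i \<in> I - {(\<mu>, \<phi>)} \<and> length ks = D})"
      by (rule eliminate[OF two_neq_zero hook_neq_zero[OF mu(1)] mu(1) x0(2)[symmetric] finI \<phi>'c \<xi>G \<xi>0 _ rel' js]) simp_all
    also have "?L \<union> {\<phi>' i ks | i ks. i \<in> I - {(\<mu>, \<phi>)} \<and> length ks = D} \<subseteq> span ?T"
    proof (rule Un_least)
      show "?L \<subseteq> span ?T" by (rule span_mono) blast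
      have "{\<phi>' i ks | i ks. i \<in> I - {(\<mu>, \<phi>)} \<and> length ks = D} \<subseteq> ?T"
        by (force simp: \<phi>'_def I_def)
      then show "{\<phi>' i ks | i ks. i \<in> I - {(\<mu>, \<phi>)} \<and> length ks = D} \<subseteq> span ?T"
        using span_superset by blast
    qed
    then have "span (?L \<union> {\<phi>' i ks | i ks. i \<in> I - {(\<mu>, \<phi>)} \<and> length ks = D}) \<subseteq> span ?T"
      by (rule span_minimal) simp
    finally show ?thesis by (simp add: \<phi>'_def)
  qed
  then show ?thesis using nA by blast
qed

end

text \<open>The maps in a family factor through right multiplication by Young symmetrizers, so a relation
  counts as trivial as soon as this multiplication kills it.\<close>

definition free_mod :: "('f::comm_ring_1 \<Rightarrow> 'x::ab_group_add \<Rightarrow> 'x) \<Rightarrow> 'x set \<Rightarrow> 'x family \<Rightarrow> bool" where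
  "free_mod s U F \<longleftrightarrow> (\<forall>B b. (\<Sum>x\<in>F. \<Sum>js\<in>words B (sum_list (fst x)). s (b x js) (snd x js)) \<in> U \<longrightarrow>
     (\<forall>x\<in>F. \<forall>ks\<in>words B (sum_list (fst x)). rmult (fst x) (b x) ks = 0))"

text \<open>\<open>L\<close> records which degrees may occur. It is \<open>UNIV\<close> for general
  polynomial coefficients and \<open>{0}\<close> for constants; in the latter case the shift found
  by \<open>drop_top\<close>, being a member of \<open>L\<close>, is 0.\<close>

definition cov_values :: "('k::field \<Rightarrow> 'x::ab_group_add \<Rightarrow> 'x) \<Rightarrow> ('k mtx \<Rightarrow> 'x \<Rightarrow> 'x) \<Rightarrow> nat set \<Rightarrow> 'x set" where
  "cov_values s \<rho> L = {f js | f js. length js \<in> L \<and> f \<in> cov s \<rho> (length js)}"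

lemma sum_words_permute:
  assumes "g \<in> Sym d"
  shows "(\<Sum>js\<in>words B d. F js (permute_list (app g) js)) = (\<Sum>ks\<in>words B d. F (permute_list (app (- g)) ks) ks)"
proof (rule sum.reindex_bij_witness[where i = "permute_list (app (- g))" and j = "permute_list (app g)"])
  fix a assume a: "a \<in> words B d"
  have gl: "g \<in> Sym (length a)" using assms words_length[OF a] by simp
  show "permute_list (app g) (permute_list (app (- g)) a) = a" "permute_list (app (- g)) (permute_list (app g) a) = a"
    by (rule permute_list_app_inv[OF gl])+
  then show "F (permute_list (app (- g)) (permute_list (app g) a)) (permute_list (app g) a) = F a (permute_list (app g) a)"
    by simp
  show "permute_list (app g) a \<in> words B d" "permute_list (app (- g)) a \<in> words B d"
    using length_permute_list_words[OF a] assms Sym_uminus by blast+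
qed

lemma fvals_I: "x \<in> F \<Longrightarrow> length js = sum_list (fst x) \<Longrightarrow> snd x js \<in> fvals F"
  by (cases x) (auto simp: fvals_def)

lemma rmult_cong:
  assumes "ks \<in> words B (sum_list \<mu>)" "\<And>js. js \<in> words B (sum_list \<mu>) \<Longrightarrow> b js = b' js"
  shows "rmult \<mu> b ks = rmult \<mu> b' ks"
  unfolding rmult_def using assms(2) length_permute_list_words[OF assms(1)] by (intro sum.cong refl) simp

context vector_space
begin

text \<open>Stated for all large \<open>B\<close> rather than for one, so that finitely many vectors
  can be written with a common bound on the letters.\<close>

lemma eventually_span_fvals:
  assumes F: "finite F" and v: "v \<in> span (fvals F)"
  shows "\<forall>\<^sub>F B in sequentially. \<exists>b. v = (\<Sum>x\<in>F. \<Sum>js\<in>words B (sum_list (fst x)). scale (b x js) (snd x js))"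
  using v
proof (induction rule: span_induct_alt)
  case base
  have "\<exists>b. 0 = (\<Sum>x\<in>F. \<Sum>js\<in>words B (sum_list (fst x)). scale (b x js) (snd x js))" for B
    by (rule exI[of _ "\<lambda>_ _. 0"]) simp
  then show ?case by (intro always_eventually allI)
next
  case (step c v w)
  then obtain y ks where y: "y \<in> F" "length ks = sum_list (fst y)" "v = snd y ks" by (force simp: fvals_def)
  obtain B0 where B0: "ks \<in> words B0 (sum_list (fst y))" using ex_words[of ks] y(2) by auto
  from step.IH eventually_ge_at_top[of B0] show ?case
  proof eventually_elim
    case (elim B)
    then obtain b where b: "w = (\<Sum>x\<in>F. \<Sum>js\<in>words B (sum_list (fst x)). scale (b x js) (snd x js))" by blast
    have ksB: "ks \<in> words B (sum_list (fst y))" using words_mono[OF B0] elim by simp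
    have "scale c v = (\<Sum>x\<in>F. \<Sum>js\<in>words B (sum_list (fst x)). scale (if x = y \<and> js = ks then c else 0) (snd x js))"
    proof -
      have "(\<Sum>js\<in>words B (sum_list (fst x)). scale (if x = y \<and> js = ks then c else 0) (snd x js)) =
        (if x = y then scale c v else 0)" for x
        using ksB y(3) by (cases "x = y") (simp_all add: if_distrib[of "\<lambda>a. scale a _"] cong: if_cong)
      then show ?thesis using F y(1) by simp
    qed
    then have "scale c v + w = (\<Sum>x\<in>F. \<Sum>js\<in>words B (sum_list (fst x)).
        scale ((if x = y \<and> js = ks then c else 0) + b x js) (snd x js))"
      unfolding b scale_left_distrib sum.distrib by simp
    then show ?case by (intro exI[of _ "\<lambda>x js. (if x = y \<and> js = ks then c else 0) + b x js"])
  qed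
qed

lemma sum_in_span_fvals:
  "G \<subseteq> F \<Longrightarrow> (\<Sum>x\<in>G. \<Sum>js\<in>words B (sum_list (fst x)). scale (b x js) (snd x js)) \<in> span (fvals F)"
  by (intro span_sum span_scale span_base fvals_I) (auto simp: words_length)

end

context semilinear_rep
begin

lemma kspan_subset_span: "M.span A \<subseteq> span A"
proof
  fix v assume "v \<in> M.span A"
  then show "v \<in> span A"
    by (induction rule: M.span_induct_alt) (auto intro: span_zero span_add span_scale span_base)
qed

lemma span_eq_if_kspan_eq: "M.span A = M.span B \<Longrightarrow> span A = span B"
  using kspan_subset_span M.span_superset by (intro span_eq[THEN iffD2] conjI) blast+

text \<open>The symmetrizer is transferred from \<phi>, on which it acts as
  \<open>hook \<mu>\<close>, to the coefficients. Transposing a permutation inverts it, whence the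
  argument \<open>- g\<close> in \<open>rmult\<close>.\<close>

lemma rmult_sum_words:
  assumes \<phi>: "\<phi> \<in> mcov kscale \<rho> \<mu>"
  shows "scale (hook \<mu>) (\<Sum>js\<in>words B (sum_list \<mu>). scale (b js) (\<phi> js)) =
    (\<Sum>ks\<in>words B (sum_list \<mu>). scale (rmult \<mu> b ks) (\<phi> ks))"
proof -
  let ?d = "sum_list \<mu>"
  have "scale (hook \<mu>) (\<Sum>js\<in>words B ?d. scale (b js) (\<phi> js)) =
    (\<Sum>js\<in>words B ?d. \<Sum>g\<in>Sym ?d. scale (b js * Poly_Mapping.lookup (csum \<mu>) g) (\<phi> (permute_list (app g) js)))"
    unfolding scale_sum_right
  proof (rule sum.cong[OF refl])
    fix js assume "js \<in> words B ?d"
    then have "scale (hook \<mu>) (scale (b js) (\<phi> js)) = scale (b js) (gact scale ?d (csum \<mu>) \<phi> js)"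
      using mcovD(2)[OF \<phi> words_length] by (simp add: mult.commute)
    then show "scale (hook \<mu>) (scale (b js) (\<phi> js)) =
      (\<Sum>g\<in>Sym ?d. scale (b js * Poly_Mapping.lookup (csum \<mu>) g) (\<phi> (permute_list (app g) js)))"
      by (simp add: gact_def scale_sum_right)
  qed
  also have "\<dots> = (\<Sum>g\<in>Sym ?d. \<Sum>js\<in>words B ?d. scale (b js * Poly_Mapping.lookup (csum \<mu>) g) (\<phi> (permute_list (app g) js)))"
    by (rule sum.swap)
  also have "\<dots> = (\<Sum>g\<in>Sym ?d. \<Sum>ks\<in>words B ?d. scale (b (permute_list (app (- g)) ks) * Poly_Mapping.lookup (csum \<mu>) g) (\<phi> ks))"
    by (intro sum.cong refl sum_words_permute[where F = "\<lambda>a c. scale (b a * Poly_Mapping.lookup (csum \<mu>) _) (\<phi> c)"])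
  also have "\<dots> = (\<Sum>ks\<in>words B ?d. \<Sum>g\<in>Sym ?d. scale (b (permute_list (app (- g)) ks) * Poly_Mapping.lookup (csum \<mu>) g) (\<phi> ks))"
    by (rule sum.swap)
  also have "\<dots> = (\<Sum>ks\<in>words B ?d. scale (rmult \<mu> b ks) (\<phi> ks))"
  proof (rule sum.cong[OF refl])
    fix ks
    have "(\<Sum>g\<in>Sym ?d. scale (b (permute_list (app (- g)) ks) * Poly_Mapping.lookup (csum \<mu>) g) (\<phi> ks)) =
      (\<Sum>g\<in>Sym ?d. scale (Poly_Mapping.lookup (csum \<mu>) (- g) * b (permute_list (app g) ks)) (\<phi> ks))"
      by (rule sum.reindex_bij_witness[where i = uminus and j = uminus]) (auto simp: mult.commute)
    then show "(\<Sum>g\<in>Sym ?d. scale (b (permute_list (app (- g)) ks) * Poly_Mapping.lookup (csum \<mu>) g) (\<phi> ks)) =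
      scale (rmult \<mu> b ks) (\<phi> ks)"
      by (simp add: rmult_def scale_sum_left)
  qed
  finally show ?thesis .
qed

lemma sum_words_zero:
  assumes \<mu>: "is_partition \<mu>" and \<phi>: "\<phi> \<in> mcov kscale \<rho> \<mu>"
    and z: "\<And>ks. ks \<in> words B (sum_list \<mu>) \<Longrightarrow> rmult \<mu> b ks = 0"
  shows "(\<Sum>js\<in>words B (sum_list \<mu>). scale (b js) (\<phi> js)) = 0"
proof -
  have "scale (hook \<mu>) (\<Sum>js\<in>words B (sum_list \<mu>). scale (b js) (\<phi> js)) = 0"
    unfolding rmult_sum_words[OF \<phi>] using z by simp
  then show ?thesis using hook_neq_zero[OF \<mu>] by simp
qed

lemma rmult_embed: "rmult \<mu> (\<lambda>js. \<iota> (b js)) ks = \<iota> (rmult \<mu> b ks)"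
  by (simp add: rmult_def embed_sum embed_mult embed_csum)

text \<open>Write every coefficient as a combination over \<open>k\<close> of values of maps and
  list all terms, indexed by generator, word and value. With the scalars absorbed in the maps this
  is the situation of \<open>drop_top_element\<close>.\<close>

lemma drop_top:
  assumes F: "mfamily kscale \<rho> F" and D: "\<And>x. x \<in> F \<Longrightarrow> sum_list (fst x) \<le> D"
    and rel: "(\<Sum>x\<in>F. \<Sum>js\<in>words B (sum_list (fst x)). scale (b x js) (snd x js)) = 0"
    and b: "\<And>x js. x \<in> F \<Longrightarrow> js \<in> words B (sum_list (fst x)) \<Longrightarrow> b x js \<in> K.span (cov_values kmult \<sigma> L)"
    and x0: "(\<mu>, \<phi>) \<in> F" "sum_list \<mu> = D" and q0: "q0 \<in> words B D" "rmult \<mu> (b (\<mu>, \<phi>)) q0 \<noteq> 0"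
  shows "\<exists>n\<in>L. \<forall>js. length js = D \<longrightarrow> \<phi> (map ((+) n) js) \<in>
    span (lower_values n D F \<union> {\<psi> (map ((+) n) ks) | \<nu> \<psi> ks. (\<nu>, \<psi>) \<in> F - {(\<mu>, \<phi>)} \<and> sum_list \<nu> = D \<and> length ks = D})"
proof -
  have finF: "finite F" using F by (simp add: mfamily_def)
  let ?I = "SIGMA x:F. words B (sum_list (fst x))"
  have "\<exists>tr. finite (fst tr) \<and> fst tr \<subseteq> cov_values kmult \<sigma> L \<and>
      b (fst i) (snd i) = (\<Sum>a\<in>fst tr. kmult (snd tr a) a)" if i: "i \<in> ?I" for i
  proof -
    have "b (fst i) (snd i) \<in> K.span (cov_values kmult \<sigma> L)" using i by (auto intro: b)
    then obtain t r where "finite t \<and> t \<subseteq> cov_values kmult \<sigma> L \<and> b (fst i) (snd i) = (\<Sum>a\<in>t. kmult (r a) a)"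
      unfolding K.span_explicit by blast
    then show ?thesis by (intro exI[of _ "(t, r)"]) simp
  qed
  then have "\<forall>i\<in>?I. \<exists>tr. finite (fst tr) \<and> fst tr \<subseteq> cov_values kmult \<sigma> L \<and>
      b (fst i) (snd i) = (\<Sum>a\<in>fst tr. kmult (snd tr a) a)" by blast
  from bchoice[OF this] obtain tr where tr: "\<forall>i\<in>?I. finite (fst (tr i)) \<and> fst (tr i) \<subseteq> cov_values kmult \<sigma> L \<and>
      b (fst i) (snd i) = (\<Sum>a\<in>fst (tr i). kmult (snd (tr i) a) a)" ..
  define t where "t i = fst (tr i)" for i
  define r where "r i = snd (tr i)" for i
  have t: "finite (t i)" "t i \<subseteq> cov_values kmult \<sigma> L" "b (fst i) (snd i) = (\<Sum>a\<in>t i. kmult (r i a) a)"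
    if "i \<in> ?I" for i
    using bspec[OF tr that] by (simp_all add: t_def r_def)
  have "\<forall>a\<in>cov_values kmult \<sigma> L. \<exists>fw. a = fst fw (snd fw) \<and> length (snd fw) \<in> L \<and> fst fw \<in> cov kmult \<sigma> (length (snd fw))"
    unfolding cov_values_def by fastforce
  from bchoice[OF this] obtain fw where fw': "\<forall>a\<in>cov_values kmult \<sigma> L. a = fst (fw a) (snd (fw a)) \<and>
    length (snd (fw a)) \<in> L \<and> fst (fw a) \<in> cov kmult \<sigma> (length (snd (fw a)))" ..
  have fw: "a = fst (fw a) (snd (fw a))" "length (snd (fw a)) \<in> L" "fst (fw a) \<in> cov kmult \<sigma> (length (snd (fw a)))"
    if "a \<in> cov_values kmult \<sigma> L" for a
    using bspec[OF fw' that] by simp_all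
  define Z where "Z = Sigma ?I t"
  define f where "f z js = kmult (r (fst z) (snd z)) (fst (fw (snd z)) js)" for z js
  define p where "p z = snd (fw (snd z))" for z :: "((nat list \<times> (nat list \<Rightarrow> 'm)) \<times> nat list) \<times> 'K"
  have zI: "fst z \<in> ?I" "snd z \<in> cov_values kmult \<sigma> L" if "z \<in> Z" for z
    using that t(2)[of "fst z"] by (auto simp: Z_def)
  have finI: "finite ?I" using finF by simp
  have Z: "finite Z" using finI t(1) unfolding Z_def by (rule finite_SigmaI)
  have fp: "f z (p z) = kmult (r (fst z) (snd z)) (snd z)" if "z \<in> Z" for z
    using fw(1)[OF zI(2)[OF that]] by (simp add: f_def p_def)
  have rel': "(\<Sum>z\<in>Z. scale (f z (p z)) (snd (fst (fst z)) (snd (fst z)))) = 0"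
  proof -
    have "(\<Sum>z\<in>Z. scale (f z (p z)) (snd (fst (fst z)) (snd (fst z)))) =
      (\<Sum>z\<in>Z. scale (kmult (r (fst z) (snd z)) (snd z)) (snd (fst (fst z)) (snd (fst z))))"
      by (rule sum.cong[OF refl]) (simp only: fp)
    also have "\<dots> = (\<Sum>i\<in>?I. \<Sum>a\<in>t i. scale (kmult (r i a) a) (snd (fst i) (snd i)))"
      unfolding Z_def by (subst sum.Sigma[OF finI]) (auto simp: t(1) case_prod_beta)
    also have "\<dots> = (\<Sum>i\<in>?I. scale (b (fst i) (snd i)) (snd (fst i) (snd i)))"
      by (rule sum.cong[OF refl]) (simp only: t(3) scale_sum_left)
    also have "\<dots> = (\<Sum>x\<in>F. \<Sum>js\<in>words B (sum_list (fst x)). scale (b x js) (snd x js))"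
      by (subst sum.Sigma[OF finF]) (auto simp: case_prod_beta)
    finally show ?thesis using rel by simp
  qed
  have co: "(\<Sum>z\<in>{z \<in> Z. fst (fst z) = (\<mu>, \<phi>) \<and> snd (fst z) = js}. f z (p z)) = b (\<mu>, \<phi>) js"
    if js: "js \<in> words B D" for js
  proof -
    have i: "((\<mu>, \<phi>), js) \<in> ?I" using js x0 by simp
    have eq: "{z \<in> Z. fst (fst z) = (\<mu>, \<phi>) \<and> snd (fst z) = js} = {((\<mu>, \<phi>), js)} \<times> t ((\<mu>, \<phi>), js)"
      using i by (auto simp: Z_def)
    have "(\<Sum>z\<in>{z \<in> Z. fst (fst z) = (\<mu>, \<phi>) \<and> snd (fst z) = js}. f z (p z)) =
      (\<Sum>z\<in>{z \<in> Z. fst (fst z) = (\<mu>, \<phi>) \<and> snd (fst z) = js}. kmult (r (fst z) (snd z)) (snd z))"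
      by (rule sum.cong[OF refl]) (simp add: fp)
    also have "\<dots> = (\<Sum>a\<in>t ((\<mu>, \<phi>), js). kmult (r ((\<mu>, \<phi>), js) a) a)"
      unfolding eq
      by (rule sum.reindex_bij_witness[where i = "\<lambda>a. (((\<mu>, \<phi>), js), a)" and j = snd]) auto
    finally show ?thesis using t(3)[OF i] by simp
  qed
  have rm: "rmult \<mu> (\<lambda>js. \<Sum>z\<in>{z \<in> Z. fst (fst z) = (\<mu>, \<phi>) \<and> snd (fst z) = js}. f z (p z)) q0 \<noteq> 0"
    using q0(2) rmult_cong[of q0 B \<mu> _ "b (\<mu>, \<phi>)", OF _ co] q0(1) x0(2) by simp
  show ?thesis
  proof (rule drop_top_element[where x = "\<lambda>z. fst (fst z)" and q = "\<lambda>z. snd (fst z)" and f = f and p = p, OF F Z _ _ _ _ _ rel' x0 words_length[OF q0(1)] rm])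
    fix z assume z: "z \<in> Z"
    show "fst (fst z) \<in> F" "sum_list (fst (fst (fst z))) \<le> D" using zI(1)[OF z] D by auto
    show "length (snd (fst z)) = sum_list (fst (fst (fst z)))" using zI(1)[OF z] by (auto simp: words_length)
    show "length (p z) \<in> L" using fw(2)[OF zI(2)[OF z]] by (simp add: p_def)
    show "f z \<in> cov kmult \<sigma> (length (p z))"
      unfolding f_def[abs_def] p_def using fw(3)[OF zI(2)[OF z]] by (rule K.cov_scale)
  qed
qed

end

lemma not_free_modE:
  assumes "\<not> free_mod s U F"
  obtains B b where "(\<Sum>x\<in>F. \<Sum>js\<in>words B (sum_list (fst x)). s (b x js) (snd x js)) \<in> U"
    "\<exists>x\<in>F. \<exists>ks\<in>words B (sum_list (fst x)). rmult (fst x) (b x) ks \<noteq> 0"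
  using assms unfolding free_mod_def not_all not_imp ball_simps(10)
  by (elim exE conjE) (rule that)

lemma free_modD:
  assumes "free_mod s U F" "(\<Sum>x\<in>F. \<Sum>js\<in>words B (sum_list (fst x)). s (b x js) (snd x js)) \<in> U"
    and "x \<in> F" "ks \<in> words B (sum_list (fst x))"
  shows "rmult (fst x) (b x) ks = 0"
  by (rule ccontr) (use assms in \<open>simp add: free_mod_def\<close>)

lemma (in vector_space) span_trans_subset: "v \<in> span A \<Longrightarrow> A \<subseteq> span B \<Longrightarrow> v \<in> span B"
  using span_minimal[OF _ subspace_span] by blast

lemma (in vector_space) span_mono_in: "v \<in> span A \<Longrightarrow> A \<subseteq> B \<Longrightarrow> v \<in> span B"
  using span_mono by blast

section \<open>Families after a shift\<close>

context GL_rep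
begin

lemma mcov_shift:
  assumes "\<phi> \<in> mcov scale \<rho> \<mu>"
  shows "(\<lambda>ks. \<phi> (map ((+) n) ks)) \<in> mcov scale (Sh n \<rho>) \<mu>"
  using assms pattern_cov[of \<phi> "[]" "sum_list \<mu>" n]
  by (auto simp: mcov_def gact_def permute_list_map_comm[symmetric] simp del: permute_list_map)

lemma filter_permute_list:
  "g \<in> Sym (length js) \<Longrightarrow> length (filter P (permute_list (app g) js)) = length (filter P js)"
  by (metis Sym_def mem_Collect_eq mset_filter mset_permute_list size_mset)

lemma pattern_in_cov:
  assumes \<phi>: "\<phi> \<in> cov scale \<rho> d" and d: "length p + e = d" and p: "set p \<subseteq> {..<n}" and g: "g \<in> Sym d"
  shows "(\<lambda>ks. \<phi> (permute_list (app g) (p @ map ((+) n) ks))) \<in> cov scale (Sh n \<rho>) e"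
  using pattern_cov[of "\<lambda>js. \<phi> (permute_list (app g) js)" p e n] cov_permute[OF \<phi> g] d p by simp

lemma cov_values_Sh: "cov_values scale \<rho> UNIV \<subseteq> cov_values scale (Sh n \<rho>) UNIV"
proof
  fix v assume "v \<in> cov_values scale \<rho> UNIV"
  then obtain \<phi> js where \<phi>: "v = \<phi> js" "\<phi> \<in> cov scale \<rho> (length js)" by (auto simp: cov_values_def)
  obtain p ks g where p: "set p \<subseteq> {..<n}" "g \<in> Sym (length js)" "length p + length ks = length js"
    "js = permute_list (app g) (p @ map ((+) n) ks)" using ex_pattern by metis
  have "(\<lambda>ks. \<phi> (permute_list (app g) (p @ map ((+) n) ks))) \<in> cov scale (Sh n \<rho>) (length ks)"
    by (rule pattern_in_cov[OF \<phi>(2) p(3,1,2)])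
  then show "v \<in> cov_values scale (Sh n \<rho>) UNIV"
    unfolding cov_values_def using \<phi>(1) p(4) by (auto intro!: exI[of _ "\<lambda>ks. \<phi> (permute_list (app g) (p @ map ((+) n) ks))"] exI[of _ ks])
qed

text \<open>A word with fewer than \<open>D\<close> letters from \<open>n\<close> on consists of
  letters below \<open>n\<close> at certain places and a shifted word of length below
  \<open>D\<close>. There are finitely many such patterns; each gives an equivariant map for the
  shifted action, which \<open>ex_mfamily\<close> splits into shapes.\<close>

lemma pattern_family:
  assumes F: "mfamily scale \<rho> F"
  shows "\<exists>G. mfamily scale (Sh n \<rho>) G \<and> (\<forall>x\<in>G. sum_list (fst x) < D) \<and>
    span (fvals G) = span (lower_values n D F)"
proof -
  define T where "T = {(x, p, g, e). x \<in> F \<and> sum_list (fst x) \<le> D \<and> e < D \<and> length p + e = sum_list (fst x) \<and>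
     set p \<subseteq> {..<n} \<and> g \<in> Sym (sum_list (fst x))}"
  define \<psi> where "\<psi> t ks = (case t of (x, p, g, e) \<Rightarrow> snd x (permute_list (app g) (p @ map ((+) n) ks)))"
    for t :: "(nat list \<times> (nat list \<Rightarrow> 'x)) \<times> nat list \<times> bijn \<times> nat" and ks
  define dg where "dg t = snd (snd (snd t))" for t :: "(nat list \<times> (nat list \<Rightarrow> 'x)) \<times> nat list \<times> bijn \<times> nat"
  have finF: "finite F" using F by (simp add: mfamily_def)
  have "T \<subseteq> F \<times> (\<Union>a\<le>D. words n a) \<times> (\<Union>x\<in>F. Sym (sum_list (fst x))) \<times> {..<D}"
    by (auto simp: T_def words_def)
  then have finT: "finite T" by (rule finite_subset) (use finF in simp)
  have "\<exists>G. mfamily scale (Sh n \<rho>) G \<and> (\<forall>x\<in>G. sum_list (fst x) < D) \<and>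
    span (fvals G) = span {\<psi> t ks | ks. length ks = dg t}" if t: "t \<in> T" for t
  proof -
    obtain x p g e where tt: "t = (x, p, g, e)" by (cases t)
    have x: "x \<in> F" "e < D" "length p + e = sum_list (fst x)" "set p \<subseteq> {..<n}" "g \<in> Sym (sum_list (fst x))"
      using t by (auto simp: T_def tt)
    have "snd x \<in> cov scale \<rho> (sum_list (fst x))" using F x(1) by (auto simp: mfamily_def mcov_def)
    then have "\<psi> t \<in> cov scale (Sh n \<rho>) e"
      using pattern_in_cov[OF _ x(3-5)] by (simp add: \<psi>_def[abs_def] tt)
    from GL_rep.ex_mfamily[OF GL_rep_Sh this] show ?thesis using x(2) by (fastforce simp: dg_def tt)
  qed
  then have "\<forall>t\<in>T. \<exists>G. mfamily scale (Sh n \<rho>) G \<and> (\<forall>x\<in>G. sum_list (fst x) < D) \<and>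
    span (fvals G) = span {\<psi> t ks | ks. length ks = dg t}" by blast
  from bchoice[OF this] obtain G where G: "\<And>t. t \<in> T \<Longrightarrow> mfamily scale (Sh n \<rho>) (G t)"
    "\<And>t x. t \<in> T \<Longrightarrow> x \<in> G t \<Longrightarrow> sum_list (fst x) < D"
    "\<And>t. t \<in> T \<Longrightarrow> span (fvals (G t)) = span {\<psi> t ks | ks. length ks = dg t}" by blast
  define H where "H = (\<Union>t\<in>T. G t)"
  have fH: "fvals H = (\<Union>t\<in>T. fvals (G t))" by (auto simp: H_def fvals_def)
  have low: "lower_values n D F = (\<Union>t\<in>T. {\<psi> t ks | ks. length ks = dg t})"
  proof (intro equalityI subsetI)
    fix v assume "v \<in> lower_values n D F"
    then obtain \<mu> \<phi> js where v: "v = \<phi> js" "(\<mu>, \<phi>) \<in> F" "length js = sum_list \<mu>" "sum_list \<mu> \<le> D"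
      "length (filter ((\<le>) n) js) < D" unfolding lower_values_def by blast
    obtain p ks g where p: "set p \<subseteq> {..<n}" "g \<in> Sym (length js)" "length p + length ks = length js"
      "js = permute_list (app g) (p @ map ((+) n) ks)" "length ks = length (filter ((\<le>) n) js)"
      using ex_pattern by metis
    have q: "length p + length ks = sum_list \<mu>" "g \<in> Sym (sum_list \<mu>)" "length ks < D"
      using p(2,3) v(3) p(5) v(5) by metis+
    have "((\<mu>, \<phi>), p, g, length ks) \<in> T" using v(2,4) p(1) q by (simp add: T_def)
    moreover have "v = \<psi> ((\<mu>, \<phi>), p, g, length ks) ks" using v(1) p(4) by (simp add: \<psi>_def)
    ultimately show "v \<in> (\<Union>t\<in>T. {\<psi> t ks | ks. length ks = dg t})"
      by (intro UN_I) (auto simp: dg_def)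
  next
    fix v assume "v \<in> (\<Union>t\<in>T. {\<psi> t ks | ks. length ks = dg t})"
    then obtain x p g e ks where x: "x \<in> F" "sum_list (fst x) \<le> D" "e < D" "length p + e = sum_list (fst x)"
      "set p \<subseteq> {..<n}" "g \<in> Sym (sum_list (fst x))" "length ks = e"
      "v = snd x (permute_list (app g) (p @ map ((+) n) ks))"
      by (auto simp: T_def \<psi>_def dg_def)
    have "filter ((\<le>) n) p = []" using x(5) by (auto simp: filter_empty_conv subset_iff)
    then have "length (filter ((\<le>) n) (p @ map ((+) n) ks)) = e" using x(7) by (simp add: comp_def)
    then have "length (filter ((\<le>) n) (permute_list (app g) (p @ map ((+) n) ks))) < D"
      using filter_permute_list[of g "p @ map ((+) n) ks" "(\<le>) n"] x by simp
    then show "v \<in> lower_values n D F"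
      unfolding lower_values_def using x
      by (intro CollectI exI[of _ "fst x"] exI[of _ "snd x"] exI[of _ "permute_list (app g) (p @ map ((+) n) ks)"]) auto
  qed
  have "span (fvals H) = span (lower_values n D F)"
    unfolding span_eq
  proof
    show "fvals H \<subseteq> span (lower_values n D F)"
    proof
      fix v assume "v \<in> fvals H"
      then obtain t where t: "t \<in> T" "v \<in> fvals (G t)" by (auto simp: fH)
      have "v \<in> span (fvals (G t))" using t(2) by (rule span_base)
      then have "v \<in> span {\<psi> t ks | ks. length ks = dg t}" by (simp only: G(3)[OF t(1)])
      moreover have "{\<psi> t ks | ks. length ks = dg t} \<subseteq> lower_values n D F" using t(1) unfolding low by blast
      ultimately show "v \<in> span (lower_values n D F)" by (rule span_mono_in)
    qed
    show "lower_values n D F \<subseteq> span (fvals H)"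
    proof
      fix v assume "v \<in> lower_values n D F"
      then obtain t where t: "t \<in> T" "v \<in> {\<psi> t ks | ks. length ks = dg t}" unfolding low by blast
      from t(2) have "v \<in> span {\<psi> t ks | ks. length ks = dg t}" by (rule span_base)
      then have "v \<in> span (fvals (G t))" by (simp only: G(3)[OF t(1)])
      moreover have "fvals (G t) \<subseteq> fvals H" using t(1) unfolding fH by blast
      ultimately show "v \<in> span (fvals H)" by (rule span_mono_in)
    qed
  qed
  moreover have "mfamily scale (Sh n \<rho>) H" using G(1) finT by (auto simp: H_def mfamily_def)
  moreover have "\<forall>x\<in>H. sum_list (fst x) < D" using G(2) by (auto simp: H_def)
  ultimately show ?thesis by blast
qed

text \<open>For \<open>D\<close> beyond all degrees every value counts as a lower value.\<close>

lemma shift_family: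
  assumes F: "mfamily scale \<rho> F"
  shows "\<exists>G. mfamily scale (Sh n \<rho>) G \<and> span (fvals G) = span (fvals F)"
proof -
  have "finite ((\<lambda>x. sum_list (fst x)) ` F)" using F by (simp add: mfamily_def)
  then obtain D where D: "\<And>x. x \<in> F \<Longrightarrow> sum_list (fst x) < D"
    unfolding finite_nat_set_iff_bounded by blast
  have "lower_values n D F = fvals F"
  proof
    show "lower_values n D F \<subseteq> fvals F" by (auto simp: lower_values_def fvals_def)
    have "sum_list \<mu> < D" if "(\<mu>, \<phi>) \<in> F" for \<mu> \<phi> using D[OF that] by simp
    then show "fvals F \<subseteq> lower_values n D F"
      by (fastforce simp: lower_values_def fvals_def intro: le_less_trans[OF length_filter_le])
  qed
  then show ?thesis using pattern_family[OF F, of n D] by auto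
qed

text \<open>The case of constant coefficients of \<open>drop_top\<close>, in which no shift is needed.\<close>

lemma free_subfamily:
  assumes F: "mfamily scale \<rho> F"
  shows "\<exists>H\<subseteq>F. span (fvals H) = span (fvals F) \<and> free_mod scale {0} H"
proof -
  interpret S: semilinear_rep scale "\<lambda>c. c" "\<lambda>_ a. a" \<rho>
    by unfold_locales (simp_all add: act_add act_scale)
  note S.embed_eq_0_iff [simp del] S.embed_zero [simp del]
  have "\<exists>H. (H \<subseteq> F \<and> span (fvals H) = span (fvals F)) \<and>
      (\<forall>H'. H' \<subseteq> F \<and> span (fvals H') = span (fvals F) \<longrightarrow> card H \<le> card H')"
    by (rule ex_has_least_nat[of _ F]) simp
  then obtain H where H: "H \<subseteq> F" "span (fvals H) = span (fvals F)"
    "\<forall>H'. H' \<subseteq> F \<and> span (fvals H') = span (fvals F) \<longrightarrow> card H \<le> card H'"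
    by (elim exE conjE)
  have mH: "mfamily scale \<rho> H" using F H(1) by (rule mfamily_subset)
  have finH: "finite H" using mH by (simp add: mfamily_def)
  have "free_mod scale {0} H"
  proof (rule ccontr)
    assume "\<not> free_mod scale {0} H"
    then obtain B b where b: "(\<Sum>x\<in>H. \<Sum>js\<in>words B (sum_list (fst x)). scale (b x js) (snd x js)) \<in> {0}"
      and x: "\<exists>x\<in>H. \<exists>ks\<in>words B (sum_list (fst x)). rmult (fst x) (b x) ks \<noteq> 0"
      by (rule not_free_modE)
    \<comment> \<open>Generators with trivial coefficients contribute 0 by
      \<open>sum_words_zero\<close>. So \<open>D\<close> may be the largest degree with a nontrivial
      coefficient, and the generators of higher degree leave the relation.\<close>
    define bad where "bad = {x \<in> H. \<exists>ks\<in>words B (sum_list (fst x)). rmult (fst x) (b x) ks \<noteq> 0}"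
    have bad: "finite bad" by (rule finite_subset[OF _ finH]) (unfold bad_def, rule Collect_restrict)
    obtain x1 where "x1 \<in> H" "\<exists>ks\<in>words B (sum_list (fst x1)). rmult (fst x1) (b x1) ks \<noteq> 0" using x by (rule bexE)
    then have x1: "x1 \<in> bad" by (simp add: bad_def)
    define D where "D = Max ((\<lambda>x. sum_list (fst x)) ` bad)"
    have "D \<in> (\<lambda>x. sum_list (fst x)) ` bad" unfolding D_def using bad x1 by (intro Max_in) auto
    then obtain x0 where x0: "x0 \<in> bad" "sum_list (fst x0) = D" by blast
    have "\<exists>ks\<in>words B D. rmult (fst x0) (b x0) ks \<noteq> 0" using x0 by (simp add: bad_def)
    then obtain q0 where q0: "q0 \<in> words B D" "rmult (fst x0) (b x0) q0 \<noteq> 0" by (rule bexE)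
    have badD: "sum_list (fst x) \<le> D" if "x \<in> bad" for x unfolding D_def using bad that by (intro Max_ge) auto
    define HD where "HD = {x \<in> H. sum_list (fst x) \<le> D}"
    have x0H: "(fst x0, snd x0) \<in> HD" "x0 \<in> H" using x0 by (auto simp: HD_def bad_def)
    have "(\<Sum>x\<in>H. \<Sum>js\<in>words B (sum_list (fst x)). scale (b x js) (snd x js)) =
      (\<Sum>x\<in>HD. \<Sum>js\<in>words B (sum_list (fst x)). scale (b x js) (snd x js))"
    proof (rule sum.mono_neutral_right[OF finH], force simp: HD_def, rule ballI)
      fix x assume x: "x \<in> H - HD"
      then have "x \<notin> bad" using badD[of x] by (auto simp: HD_def)
      moreover have "is_partition (fst x)" "snd x \<in> mcov scale \<rho> (fst x)" using mH x by (auto simp: mfamily_def)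
      ultimately show "(\<Sum>js\<in>words B (sum_list (fst x)). scale (b x js) (snd x js)) = 0"
        using x by (intro S.sum_words_zero) (auto simp: bad_def)
    qed
    then have rel: "(\<Sum>x\<in>HD. \<Sum>js\<in>words B (sum_list (fst x)). scale (b x js) (snd x js)) = 0" using b by simp
    have mHD: "mfamily scale \<rho> HD" using mH by (rule mfamily_subset) (auto simp: HD_def)
    \<comment> \<open>A scalar is a multiple of the value 1 of a constant map of degree 0. This
      allows \<open>L = {0}\<close> and hence no shift.\<close>
    have const: "c \<in> S.K.span (cov_values (\<lambda>c x. c * x) (\<lambda>_ a. a) {0})" for c :: 'k
    proof -
      have "(\<lambda>_. 1) \<in> cov (\<lambda>c x. c * x) (\<lambda>_ a. a :: 'k) 0"
      proof (rule S.K.covI)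
        fix js :: "nat list" and B assume "js \<in> words B 0"
        moreover have "words B 0 = {[]}" by (auto simp: words_def)
        ultimately show "(1::'k) = (\<Sum>is\<in>words B 0. tensor_coeff g is js * 1)" for g :: "'k mtx" by (simp add: tensor_coeff_def)
      qed
      then have "1 \<in> cov_values (\<lambda>c x. c * x) (\<lambda>_ a. a :: 'k) {0}"
        unfolding cov_values_def by (intro CollectI exI[of _ "\<lambda>_. 1"] exI[of _ "[]"]) simp
      from S.K.span_scale[OF S.K.span_base[OF this], of c] show ?thesis by simp
    qed
    have "\<exists>n\<in>{0}. \<forall>js. length js = D \<longrightarrow> snd x0 (map ((+) n) js) \<in> span (lower_values n D HD \<union>
       {\<psi> (map ((+) n) ks) | \<nu> \<psi> ks. (\<nu>, \<psi>) \<in> HD - {(fst x0, snd x0)} \<and> sum_list \<nu> = D \<and> length ks = D})"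
      by (rule S.drop_top[OF mHD _ rel const x0H(1) x0(2) q0(1)]) (use q0(2) in \<open>simp_all add: HD_def\<close>)
    moreover have "map ((+) 0) js = js" for js :: "nat list" by (simp add: map_idI)
    ultimately have red: "snd x0 js \<in> span (lower_values 0 D HD \<union>
       {\<psi> ks | \<nu> \<psi> ks. (\<nu>, \<psi>) \<in> HD - {x0} \<and> sum_list \<nu> = D \<and> length ks = D})" if "length js = D" for js
      using that by simp
    have "lower_values 0 D HD \<subseteq> fvals (H - {x0})"
    proof
      fix v assume "v \<in> lower_values 0 D HD"
      then obtain \<mu> \<phi> js where v: "v = \<phi> js" "(\<mu>, \<phi>) \<in> HD" "length js = sum_list \<mu>" "length (filter ((\<le>) 0) js) < D"
        unfolding lower_values_def by blast
      then have "(\<mu>, \<phi>) \<noteq> x0" using x0(2) by auto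
      then show "v \<in> fvals (H - {x0})" using v by (auto simp: fvals_def HD_def)
    qed
    moreover have "{\<psi> ks | \<nu> \<psi> ks. (\<nu>, \<psi>) \<in> HD - {x0} \<and> sum_list \<nu> = D \<and> length ks = D} \<subseteq> fvals (H - {x0})"
      by (auto simp: fvals_def HD_def)
    ultimately have "lower_values 0 D HD \<union>
       {\<psi> ks | \<nu> \<psi> ks. (\<nu>, \<psi>) \<in> HD - {x0} \<and> sum_list \<nu> = D \<and> length ks = D} \<subseteq> fvals (H - {x0})" by (rule Un_least)
    then have red': "snd x0 js \<in> span (fvals (H - {x0}))" if "length js = D" for js
      by (rule span_mono_in[OF red[OF that]])
    have "fvals H = fvals (H - {x0}) \<union> {snd x0 js | js. length js = D}"
      using x0(2) x0H(2) by (cases x0) (auto simp: fvals_def)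
    then have "fvals H \<subseteq> span (fvals (H - {x0}))" using span_superset[of "fvals (H - {x0})"] red' by auto
    moreover have "fvals (H - {x0}) \<subseteq> span (fvals H)"
      using fvals_mono[of "H - {x0}" H] span_superset[of "fvals H"] by auto
    ultimately have "span (fvals (H - {x0})) = span (fvals F)" unfolding H(2)[symmetric] span_eq by (intro conjI)
    then have "card H \<le> card (H - {x0})" using H(1) by (intro H(3)[rule_format]) auto
    moreover have "card (H - {x0}) < card H" using finH x0H(2) by (rule card_Diff1_less)
    ultimately show False by simp
  qed
  then show ?thesis using H by blast
qed

end

section \<open>Freeness over K from freeness over k\<close>

context semilinear_rep
begin

lemma rmult_sum_embed:
  "rmult \<mu> (\<lambda>js. \<Sum>\<beta>\<in>E. \<iota> (c \<beta> js) * \<beta>) ks = (\<Sum>\<beta>\<in>E. \<iota> (rmult \<mu> (c \<beta>) ks) * \<beta>)"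
  unfolding rmult_def embed_sum embed_mult embed_csum sum_distrib_left sum_distrib_right
  by (subst sum.swap) (simp add: mult.assoc)

text \<open>Expand the coefficients of a relation over \<open>K\<close> in a \<open>k\<close>-basis of their span.\<close>

lemma free_mod_kspan:
  assumes T: "mfamily kscale \<rho> T" "free_mod scale U T"
    and H: "finite H" "fvals H \<subseteq> M.span (fvals T)" "free_mod kscale {0} H"
  shows "free_mod scale U H"
  unfolding free_mod_def
proof (intro allI impI ballI)
  fix B b x ks
  assume bU: "(\<Sum>x\<in>H. \<Sum>js\<in>words B (sum_list (fst x)). scale (b x js) (snd x js)) \<in> U"
    and x: "x \<in> H" and ks: "ks \<in> words B (sum_list (fst x))"
  have finT: "finite T" using T by (simp add: mfamily_def)
  define S where "S = (\<Union>x\<in>H. b x ` words B (sum_list (fst x)))"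
  have finS: "finite S" using H(1) by (simp add: S_def)
  obtain E where E: "E \<subseteq> S" "K.independent E" "S \<subseteq> K.span E" by (rule K.maximal_independent_subset)
  have finE: "finite E" using E(1) finS by (rule finite_subset)
  have "\<forall>s\<in>S. \<exists>r. s = (\<Sum>\<beta>\<in>E. kmult (r \<beta>) \<beta>)" using E(3) unfolding K.span_finite[OF finE] by blast
  from bchoice[OF this] obtain r where r: "\<And>s. s \<in> S \<Longrightarrow> s = (\<Sum>\<beta>\<in>E. kmult (r s \<beta>) \<beta>)" by blast
  \<comment> \<open>\<open>X \<beta>\<close> is the component of the relation at the basis element
    \<beta>, a combination of \<open>fvals H\<close> over \<open>k\<close>. Rewritten through
    \<open>T\<close>, freeness of \<open>T\<close> and independence of \<open>E\<close> make every
    component zero, and freeness of \<open>H\<close> over \<open>k\<close> then applies to each of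
    them.\<close>
  define X where "X \<beta> = (\<Sum>x\<in>H. \<Sum>js\<in>words B (sum_list (fst x)). kscale (r (b x js) \<beta>) (snd x js))" for \<beta>
  have X: "X \<beta> \<in> M.span (fvals T)" for \<beta>
  proof -
    have "X \<beta> \<in> M.span (fvals H)" unfolding X_def by (rule M.sum_in_span_fvals) simp
    moreover have "M.span (fvals H) \<subseteq> M.span (fvals T)" using H(2) by (rule M.span_minimal) simp
    ultimately show ?thesis by blast
  qed
  have "\<forall>\<^sub>F B' in sequentially. \<forall>\<beta>\<in>E. \<exists>a. X \<beta> = (\<Sum>y\<in>T. \<Sum>js\<in>words B' (sum_list (fst y)). kscale (a y js) (snd y js))"
    using finE M.eventually_span_fvals[OF finT X] by (intro eventually_ball_finite ballI)
  then obtain B' where "\<forall>\<beta>\<in>E. \<exists>a. X \<beta> = (\<Sum>y\<in>T. \<Sum>js\<in>words B' (sum_list (fst y)). kscale (a y js) (snd y js))"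
    by (auto simp: eventually_sequentially)
  from bchoice[OF this] obtain a where
    a: "\<And>\<beta>. \<beta> \<in> E \<Longrightarrow> X \<beta> = (\<Sum>y\<in>T. \<Sum>js\<in>words B' (sum_list (fst y)). kscale (a \<beta> y js) (snd y js))" by blast
  have bS: "b x js \<in> S" if "x \<in> H" "js \<in> words B (sum_list (fst x))" for x js
    using that by (auto simp: S_def)
  have "(\<Sum>x\<in>H. \<Sum>js\<in>words B (sum_list (fst x)). scale (b x js) (snd x js)) =
    (\<Sum>x\<in>H. \<Sum>js\<in>words B (sum_list (fst x)). \<Sum>\<beta>\<in>E. scale \<beta> (kscale (r (b x js) \<beta>) (snd x js)))"
  proof (intro sum.cong refl)
    fix x js assume "x \<in> H" "js \<in> words B (sum_list (fst x))"
    then have "scale (b x js) (snd x js) = scale (\<Sum>\<beta>\<in>E. kmult (r (b x js) \<beta>) \<beta>) (snd x js)"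
      using r[OF bS] by simp
    then show "scale (b x js) (snd x js) = (\<Sum>\<beta>\<in>E. scale \<beta> (kscale (r (b x js) \<beta>) (snd x js)))"
      by (simp add: scale_sum_left mult.commute)
  qed
  also have "\<dots> = (\<Sum>x\<in>H. \<Sum>\<beta>\<in>E. \<Sum>js\<in>words B (sum_list (fst x)). scale \<beta> (kscale (r (b x js) \<beta>) (snd x js)))"
    by (rule sum.cong[OF refl], rule sum.swap)
  also have "\<dots> = (\<Sum>\<beta>\<in>E. scale \<beta> (X \<beta>))"
    unfolding X_def scale_sum_right by (rule sum.swap)
  also have "\<dots> = (\<Sum>\<beta>\<in>E. \<Sum>y\<in>T. \<Sum>js\<in>words B' (sum_list (fst y)). scale (\<iota> (a \<beta> y js) * \<beta>) (snd y js))"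
    by (intro sum.cong refl) (simp add: a scale_sum_right mult.commute)
  also have "\<dots> = (\<Sum>y\<in>T. \<Sum>js\<in>words B' (sum_list (fst y)). scale (\<Sum>\<beta>\<in>E. \<iota> (a \<beta> y js) * \<beta>) (snd y js))"
    unfolding scale_sum_left
    by (subst sum.swap[of _ T E], rule sum.cong[OF refl], rule sum.swap)
  finally have "(\<Sum>y\<in>T. \<Sum>js\<in>words B' (sum_list (fst y)). scale (\<Sum>\<beta>\<in>E. \<iota> (a \<beta> y js) * \<beta>) (snd y js)) \<in> U"
    using bU by simp
  from free_modD[OF T(2) this]
  have z: "(\<Sum>\<beta>\<in>E. \<iota> (rmult (fst y) (a \<beta> y) js) * \<beta>) = 0" if "y \<in> T" "js \<in> words B' (sum_list (fst y))" for y js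
    using that by (simp only: rmult_sum_embed)
  have az: "rmult (fst y) (a \<beta> y) js = 0" if "\<beta> \<in> E" "y \<in> T" "js \<in> words B' (sum_list (fst y))" for \<beta> y js
    by (rule K.independentD[OF E(2) finE order_refl z[OF that(2,3)] that(1)])
  have X0: "X \<beta> = 0" if "\<beta> \<in> E" for \<beta>
    unfolding a[OF that]
  proof (rule sum.neutral, rule ballI)
    fix y assume y: "y \<in> T"
    then have "is_partition (fst y)" "snd y \<in> mcov kscale \<rho> (fst y)" using T(1) by (auto simp: mfamily_def)
    then show "(\<Sum>js\<in>words B' (sum_list (fst y)). kscale (a \<beta> y js) (snd y js)) = 0"
      by (rule sum_words_zero) (simp add: rmult_embed az[OF that y])
  qed
  have rz: "rmult (fst x) (\<lambda>js. r (b x js) \<beta>) ks = 0" if "\<beta> \<in> E" for \<beta>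
    using free_modD[OF H(3), where B = B and b = "\<lambda>x js. r (b x js) \<beta>" and x = x and ks = ks] X0[OF that] x ks
    by (simp add: X_def)
  have "rmult (fst x) (b x) ks = rmult (fst x) (\<lambda>js. \<Sum>\<beta>\<in>E. \<iota> (r (b x js) \<beta>) * \<beta>) ks"
    by (rule rmult_cong[OF ks]) (use r[OF bS[OF x]] in blast)
  also have "\<dots> = 0" unfolding rmult_sum_embed by (simp add: rz)
  finally show "rmult (fst x) (b x) ks = 0" .
qed

text \<open>Modulo the span of \<open>G\<close> only the part from \<open>H\<close> remains, so its
  coefficients are trivial and its sum vanishes; after that \<open>G\<close> stands alone. The
  families may overlap: common members are counted with \<open>H\<close> and get coefficient 0 in
  \<open>G\<close>.\<close>

lemma free_mod_Un:
  assumes G: "mfamily kscale \<rho> G" "free_mod scale {0} G"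
    and H: "mfamily kscale \<rho> H" "free_mod scale (span (fvals G)) H"
  shows "free_mod scale {0} (G \<union> H)"
  unfolding free_mod_def
proof (intro allI impI)
  fix B b
  let ?s = "\<lambda>x. \<Sum>js\<in>words B (sum_list (fst x)). scale (b x js) (snd x js)"
  assume zero: "(\<Sum>x\<in>G \<union> H. ?s x) \<in> {0}"
  have fin: "finite G" "finite H" using G H by (simp_all add: mfamily_def)
  have "(\<Sum>x\<in>(G - H) \<union> H. ?s x) = (\<Sum>x\<in>G - H. ?s x) + (\<Sum>x\<in>H. ?s x)"
    by (rule sum.union_disjoint) (use fin in auto)
  then have e: "(\<Sum>x\<in>G - H. ?s x) + (\<Sum>x\<in>H. ?s x) = 0" using zero by simp
  have "a + b = 0 \<Longrightarrow> b = - a" for a b :: 'm by (simp add: eq_neg_iff_add_eq_0 add.commute)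
  from this[OF e] have "(\<Sum>x\<in>H. ?s x) = - (\<Sum>x\<in>G - H. ?s x)" .
  also have "\<dots> \<in> span (fvals G)" by (intro span_neg sum_in_span_fvals) blast
  finally have h: "\<forall>x\<in>H. \<forall>ks\<in>words B (sum_list (fst x)). rmult (fst x) (b x) ks = 0"
    using free_modD[OF H(2)] by blast
  have "(\<Sum>x\<in>H. ?s x) = 0"
  proof (rule sum.neutral, rule ballI)
    fix x assume x: "x \<in> H"
    then have "is_partition (fst x)" "snd x \<in> mcov kscale \<rho> (fst x)" using H(1) by (auto simp: mfamily_def)
    then show "?s x = 0" by (rule sum_words_zero) (use h x in blast)
  qed
  then have g0: "(\<Sum>x\<in>G - H. ?s x) = 0" using e by simp
  have "(\<Sum>x\<in>G. \<Sum>js\<in>words B (sum_list (fst x)). scale (if x \<in> H then 0 else b x js) (snd x js)) =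
    (\<Sum>x\<in>G. if x \<notin> H then ?s x else 0)"
    by (intro sum.cong refl) simp
  also have "\<dots> = (\<Sum>x\<in>{x \<in> G. x \<notin> H}. ?s x)" by (rule sum.inter_filter[symmetric]) (rule fin)
  also have "{x \<in> G. x \<notin> H} = G - H" by blast
  finally have "(\<Sum>x\<in>G. \<Sum>js\<in>words B (sum_list (fst x)). scale (if x \<in> H then 0 else b x js) (snd x js)) \<in> {0}"
    using g0 by simp
  then have "\<forall>x\<in>G. \<forall>ks\<in>words B (sum_list (fst x)). rmult (fst x) (\<lambda>js. if x \<in> H then 0 else b x js) ks = 0"
    using free_modD[OF G(2), where B = B and b = "\<lambda>x js. if x \<in> H then 0 else b x js"] by blast
  then show "\<forall>x\<in>G \<union> H. \<forall>ks\<in>words B (sum_list (fst x)). rmult (fst x) (b x) ks = 0"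
    using h by fastforce
qed

end

subsection \<open>Free families after a shift\<close>

text \<open>The fraction axiom of a GL-field, with the polynomial part replaced by the span of the
  values of maps from tensor powers. In this form it passes to shifts, by
  \<open>cov_values_Sh\<close>, and can accompany an induction.\<close>

definition cov_fractions :: "('k::field_char_0 \<Rightarrow> 'K::field) \<Rightarrow> ('k mtx \<Rightarrow> 'K \<Rightarrow> 'K) \<Rightarrow> bool" where
  "cov_fractions \<iota> \<sigma> \<longleftrightarrow> (let P = module.span (\<lambda>c x. \<iota> c * x) (cov_values (\<lambda>c x. \<iota> c * x) \<sigma> UNIV) in
     \<forall>a. \<exists>r\<in>P. \<exists>s\<in>P. s \<noteq> 0 \<and> a = r / s)"

context semilinear_rep
begin

abbreviation "P \<equiv> K.span (cov_values kmult \<sigma> UNIV)"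

lemma cov_fractionsD:
  assumes "cov_fractions \<iota> \<sigma>" obtains r s where "r \<in> P" "s \<in> P" "s \<noteq> 0" "a = r / s"
  using assms unfolding cov_fractions_def Let_def by blast

lemma cov_fractions_Sh:
  assumes "cov_fractions \<iota> \<sigma>" shows "cov_fractions \<iota> (Sh n \<sigma>)"
  using assms K.span_mono[OF K.cov_values_Sh[of n]] unfolding cov_fractions_def Let_def by blast

text \<open>\<open>K\<close> is a module over itself, so \<open>cov_scale_append\<close> yields the
  product of two maps on the concatenated word. This is what permits common denominators.\<close>

lemma cov_values_mult:
  assumes "v \<in> cov_values kmult \<sigma> UNIV" "w \<in> cov_values kmult \<sigma> UNIV"
  shows "v * w \<in> cov_values kmult \<sigma> UNIV"
proof -
  interpret S: semilinear_rep "(*)" \<iota> \<sigma> \<sigma>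
    by unfold_locales (simp_all add: embed_one embed_add embed_mult field_act_add field_act_mult field_act_embed algebra_simps)
  obtain f p where f: "v = f p" "f \<in> cov kmult \<sigma> (length p)" using assms(1) by (auto simp: cov_values_def)
  obtain h q where h: "w = h q" "h \<in> cov kmult \<sigma> (length q)" using assms(2) by (auto simp: cov_values_def)
  define u where "u js = f (take (length p) js) * h (drop (length p) js)" for js
  have "u \<in> cov kmult \<sigma> (length (p @ q))"
    unfolding u_def[abs_def] length_append by (rule S.cov_scale_append[OF f(2) h(2)])
  moreover have "v * w = u (p @ q)" using f(1) h(1) by (simp add: u_def)
  ultimately show ?thesis unfolding cov_values_def by (intro CollectI exI[of _ u] exI[of _ "p @ q"]) simp
qed

lemma P_mult:
  assumes "v \<in> P" "w \<in> P" shows "v * w \<in> P"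
  using assms(1)
proof (induction rule: K.span_induct_alt)
  case base
  show ?case by (simp add: K.span_zero)
next
  case (step c v v')
  note v = step.hyps
  have vw: "v * w \<in> P"
    using assms(2)
  proof (induction rule: K.span_induct_alt)
    case base
    show ?case by (simp add: K.span_zero)
  next
    case (step c w w')
    have "kmult c (v * w) + v * w' \<in> P"
      by (rule K.span_add[OF K.span_scale[OF K.span_base[OF cov_values_mult[OF v step.hyps]]] step.IH])
    then show ?case by (simp add: algebra_simps)
  qed
  have "kmult c (v * w) + v' * w \<in> P" by (rule K.span_add[OF K.span_scale[OF vw] step.IH])
  then show ?case by (simp add: algebra_simps)
qed

lemma common_denominator:
  assumes fr: "cov_fractions \<iota> \<sigma>" and S: "finite S"
  shows "\<exists>d\<in>P. d \<noteq> 0 \<and> (\<forall>a\<in>S. d * a \<in> P)"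
  using S
proof (induction S)
  case empty
  show ?case by (rule cov_fractionsD[OF fr, of 1]) blast
next
  case (insert a S)
  then obtain d where d: "d \<in> P" "d \<noteq> 0" "\<forall>a\<in>S. d * a \<in> P" by blast
  obtain r s where rs: "r \<in> P" "s \<in> P" "s \<noteq> 0" "a = r / s" by (rule cov_fractionsD[OF fr])
  have "d * s * a = d * r" using rs by simp
  moreover have "d * s * b = d * b * s" for b by simp
  ultimately have "\<forall>b\<in>insert a S. d * s * b \<in> P" using d rs P_mult by (metis insert_iff)
  then show ?case using d rs P_mult by (intro bexI[of _ "d * s"]) auto
qed

text \<open>\<open>drop_top\<close> expresses the shifted values of one top generator by those of
  the others and by lower values. The new family joins a family of degree below \<open>D\<close> for
  the lower values to the remaining top generators, restricted to shifted words.\<close>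

lemma ex_smaller_family:
  assumes fr: "cov_fractions \<iota> \<sigma>" and G: "mfamily kscale \<rho> G" and D: "\<And>x. x \<in> G \<Longrightarrow> sum_list (fst x) \<le> D"
    and dep: "\<not> free_mod scale (span (fvals {x \<in> G. sum_list (fst x) < D})) {x \<in> G. sum_list (fst x) = D}"
  shows "\<exists>n G'. mfamily kscale (Sh n \<rho>) G' \<and> (\<forall>x\<in>G'. sum_list (fst x) \<le> D) \<and> span (fvals G') = span (fvals G) \<and>
    card {x \<in> G'. sum_list (fst x) = D} < card {x \<in> G. sum_list (fst x) = D}"
proof -
  define Gl where "Gl = {x \<in> G. sum_list (fst x) < D}"
  define Gt where "Gt = {x \<in> G. sum_list (fst x) = D}"
  have fin: "finite G" "finite Gl" "finite Gt" using G by (auto simp: mfamily_def Gl_def Gt_def)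
  have GU: "G = Gl \<union> Gt" "Gl \<inter> Gt = {}" using D by (force simp: Gl_def Gt_def)+
  obtain B b where b: "(\<Sum>x\<in>Gt. \<Sum>js\<in>words B (sum_list (fst x)). scale (b x js) (snd x js)) \<in> span (fvals Gl)"
    and nz: "\<exists>x\<in>Gt. \<exists>ks\<in>words B (sum_list (fst x)). rmult (fst x) (b x) ks \<noteq> 0"
    using dep unfolding Gl_def[symmetric] Gt_def[symmetric] by (rule not_free_modE)
  obtain x0 q0 where x0: "x0 \<in> Gt" "q0 \<in> words B (sum_list (fst x0))" "rmult (fst x0) (b x0) q0 \<noteq> 0"
    using nz by (elim bexE)
  have x0D: "sum_list (fst x0) = D" "x0 \<in> G" using x0 by (auto simp: Gt_def)
  from eventually_span_fvals[OF fin(2) b] eventually_ge_at_top[of B]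
  have "\<forall>\<^sub>F C in sequentially. B \<le> C \<and> (\<exists>b'. (\<Sum>x\<in>Gt. \<Sum>js\<in>words B (sum_list (fst x)). scale (b x js) (snd x js)) =
    (\<Sum>x\<in>Gl. \<Sum>js\<in>words C (sum_list (fst x)). scale (b' x js) (snd x js)))"
    by eventually_elim blast
  then obtain C b' where C: "B \<le> C" and b': "(\<Sum>x\<in>Gt. \<Sum>js\<in>words B (sum_list (fst x)). scale (b x js) (snd x js)) =
    (\<Sum>x\<in>Gl. \<Sum>js\<in>words C (sum_list (fst x)). scale (b' x js) (snd x js))"
    by (auto simp: eventually_sequentially)
  \<comment> \<open>A single relation on all of \<open>G\<close>: the top coefficients, extended by
    zero to the letters below \<open>C\<close>, and the lower part brought over with opposite
    sign.\<close>
  define b1 where "b1 x js = (if x \<in> Gl then - b' x js else if js \<in> words B (sum_list (fst x)) then b x js else 0)" for x js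
  have "(\<Sum>x\<in>Gt. \<Sum>js\<in>words C (sum_list (fst x)). scale (b1 x js) (snd x js)) =
    (\<Sum>x\<in>Gt. \<Sum>js\<in>words B (sum_list (fst x)). scale (b x js) (snd x js))"
  proof (rule sum.cong[OF refl], rule sum.mono_neutral_cong_right)
    fix x assume "x \<in> Gt"
    then have n: "x \<notin> Gl" using GU by blast
    show "finite (words C (sum_list (fst x)))" by simp
    show "words B (sum_list (fst x)) \<subseteq> words C (sum_list (fst x))" using words_mono[OF _ C] by blast
    show "\<forall>js\<in>words C (sum_list (fst x)) - words B (sum_list (fst x)). scale (b1 x js) (snd x js) = 0"
      using n by (simp add: b1_def)
    show "scale (b1 x js) (snd x js) = scale (b x js) (snd x js)" if "js \<in> words B (sum_list (fst x))" for js
      using n that by (simp add: b1_def)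
  qed
  moreover have "(\<Sum>x\<in>Gl. \<Sum>js\<in>words C (sum_list (fst x)). scale (b1 x js) (snd x js)) =
    - (\<Sum>x\<in>Gl. \<Sum>js\<in>words C (sum_list (fst x)). scale (b' x js) (snd x js))"
    by (simp add: b1_def sum_negf)
  ultimately have b1: "(\<Sum>x\<in>G. \<Sum>js\<in>words C (sum_list (fst x)). scale (b1 x js) (snd x js)) = 0"
    by (subst GU(1), subst sum.union_disjoint[OF fin(2,3) GU(2)]) (simp only: b' left_minus)
  define S where "S = (\<Union>x\<in>G. b1 x ` words C (sum_list (fst x)))"
  have "finite S" using fin by (simp add: S_def)
  from common_denominator[OF fr this]
  obtain d where d: "d \<in> P" "d \<noteq> 0" "\<forall>a\<in>S. d * a \<in> P" by (elim bexE conjE)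
  have rel: "(\<Sum>x\<in>G. \<Sum>js\<in>words C (sum_list (fst x)). scale (d * b1 x js) (snd x js)) = 0"
    using arg_cong[OF b1, of "scale d"] by (simp add: scale_sum_right)
  have q0C: "q0 \<in> words C D" using words_mono[OF x0(2) C] x0D by simp
  have nl: "x0 \<notin> Gl" using GU(2) x0(1) by blast
  have "rmult (fst x0) (\<lambda>js. d * b1 x0 js) q0 = d * rmult (fst x0) (b1 x0) q0"
    by (simp add: rmult_def sum_distrib_left mult_ac)
  also have "rmult (fst x0) (b1 x0) q0 = rmult (fst x0) (b x0) q0"
    by (rule rmult_cong[OF x0(2)]) (simp add: b1_def nl)
  finally have rm: "rmult (fst x0) (\<lambda>js. d * b1 (fst x0, snd x0) js) q0 \<noteq> 0" using d(2) x0(3) by simp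
  have "\<exists>n\<in>UNIV. \<forall>js. length js = D \<longrightarrow> snd x0 (map ((+) n) js) \<in> span (lower_values n D G \<union>
      {\<psi> (map ((+) n) ks) | \<nu> \<psi> ks. (\<nu>, \<psi>) \<in> G - {(fst x0, snd x0)} \<and> sum_list \<nu> = D \<and> length ks = D})"
    by (rule drop_top[OF G D rel _ _ x0D(1) q0C rm]) (use d(3) x0D(2) in \<open>auto simp: S_def\<close>)
  then obtain n where n: "\<And>js. length js = D \<Longrightarrow> snd x0 (map ((+) n) js) \<in> span (lower_values n D G \<union>
      {\<psi> (map ((+) n) ks) | \<nu> \<psi> ks. (\<nu>, \<psi>) \<in> G - {x0} \<and> sum_list \<nu> = D \<and> length ks = D})" by auto
  obtain H where H: "mfamily kscale (Sh n \<rho>) H" "\<forall>x\<in>H. sum_list (fst x) < D" "M.span (fvals H) = M.span (lower_values n D G)"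
    using M.pattern_family[OF G] by blast
  have spH: "span (fvals H) = span (lower_values n D G)" by (rule span_eq_if_kspan_eq[OF H(3)])
  define sh :: "nat list \<times> (nat list \<Rightarrow> 'm) \<Rightarrow> nat list \<times> (nat list \<Rightarrow> 'm)"
    where "sh x = (fst x, \<lambda>ks. snd x (map ((+) n) ks))" for x
  define G' where "G' = H \<union> sh ` (Gt - {x0})"
  have "mfamily kscale (Sh n \<rho>) (sh ` (Gt - {x0}))"
    using G fin(3) M.mcov_shift by (fastforce simp: mfamily_def sh_def Gt_def)
  then have 1: "mfamily kscale (Sh n \<rho>) G'" using H(1) by (simp add: G'_def mfamily_Un)
  have 2: "\<forall>x\<in>G'. sum_list (fst x) \<le> D" using H(2) by (auto simp: G'_def sh_def Gt_def)
  have "{x \<in> G'. sum_list (fst x) = D} \<subseteq> sh ` (Gt - {x0})" using H(2) by (auto simp: G'_def)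
  then have "card {x \<in> G'. sum_list (fst x) = D} \<le> card (sh ` (Gt - {x0}))" using fin(3) by (intro card_mono) auto
  also have "\<dots> \<le> card (Gt - {x0})" using fin(3) by (intro card_image_le) simp
  also have "\<dots> < card Gt" using fin(3) x0(1) by (rule card_Diff1_less)
  finally have 3: "card {x \<in> G'. sum_list (fst x) = D} < card {x \<in> G. sum_list (fst x) = D}" by (simp add: Gt_def)
  have fG': "fvals G' = fvals H \<union> {\<psi> (map ((+) n) ks) | \<nu> \<psi> ks. (\<nu>, \<psi>) \<in> G - {x0} \<and> sum_list \<nu> = D \<and> length ks = D}"
    by (force simp: G'_def fvals_def sh_def Gt_def)
  have low_sub: "lower_values n D G \<subseteq> span (fvals G')"
  proof -
    have "lower_values n D G \<subseteq> span (fvals H)" unfolding spH by (rule span_superset)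
    also have "\<dots> \<subseteq> span (fvals G')" by (rule span_mono) (simp add: fG')
    finally show ?thesis .
  qed
  have "span (fvals G') = span (fvals G)"
    unfolding span_eq
  proof
    have "lower_values n D G \<subseteq> fvals G" by (auto simp: lower_values_def fvals_def)
    then have "span (fvals H) \<subseteq> span (fvals G)" unfolding spH by (rule span_mono)
    then have "fvals H \<subseteq> span (fvals G)" using span_superset by (rule order_trans[rotated])
    moreover have "{\<psi> (map ((+) n) ks) | \<nu> \<psi> ks. (\<nu>, \<psi>) \<in> G - {x0} \<and> sum_list \<nu> = D \<and> length ks = D} \<subseteq> fvals G"
      by (force simp: fvals_def)
    ultimately show "fvals G' \<subseteq> span (fvals G)" unfolding fG' using span_superset[of "fvals G"] by (intro Un_least) auto
    show "fvals G \<subseteq> span (fvals G')"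
    proof
      fix v assume "v \<in> fvals G"
      then obtain x js where v: "x \<in> G" "length js = sum_list (fst x)" "v = snd x js" by (force simp: fvals_def)
      \<comment> \<open>A word of length \<open>D\<close> without letters below \<open>n\<close> is
        a shifted word, at which a remaining top generator or \<open>x0\<close> is evaluated; in all
        other cases \<open>v\<close> is a lower value.\<close>
      show "v \<in> span (fvals G')"
      proof (cases "length (filter ((\<le>) n) js) < D")
        case True
        then have "v \<in> lower_values n D G" unfolding lower_values_def using v D[OF v(1)] by (cases x) auto
        then show ?thesis using low_sub by blast
      next
        case False
        then have lD: "length js = D" "sum_list (fst x) = D"
          using v(2) D[OF v(1)] length_filter_le[of "(\<le>) n" js] by auto
        then have all: "\<forall>i\<in>set js. n \<le> i" using False by (metis length_filter_less)
        define ks where "ks = map (\<lambda>i. i - n) js"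
        have ks: "js = map ((+) n) ks" "length ks = D" using all lD by (auto simp: ks_def comp_def intro!: map_idI[symmetric])
        show ?thesis
        proof (cases "x = x0")
          case True
          have "lower_values n D G \<union> {\<psi> (map ((+) n) ks) | \<nu> \<psi> ks. (\<nu>, \<psi>) \<in> G - {x0} \<and> sum_list \<nu> = D \<and> length ks = D} \<subseteq> span (fvals G')"
            using low_sub span_superset[of "fvals G'"] unfolding fG' by (intro Un_least) auto
          then show ?thesis using span_trans_subset[OF n[OF ks(2)]] v(3) ks(1) True by simp
        next
          case False
          then have "v \<in> fvals G'" unfolding fG' using v ks lD by (cases x) auto
          then show ?thesis by (rule span_base)
        qed
      qed
    qed
  qed
  then show ?thesis using 1 2 3 by blast
qed

end

text \<open>A shift changes the action but not the vectors, so the lower part can be shifted further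
  while its span over \<open>K\<close> stays the same. The top generators then have to be decomposed
  anew; the family from \<open>shift_family\<close> may be redundant and is pruned over
  \<open>k\<close>, before \<open>free_mod_kspan\<close> restores freeness over
  \<open>K\<close>.\<close>

lemma free_family:
  assumes "semilinear_rep scale \<iota> \<sigma> \<rho>" "cov_fractions \<iota> \<sigma>" "mfamily (\<lambda>c. scale (\<iota> c)) \<rho> F"
    "\<And>x. x \<in> F \<Longrightarrow> sum_list (fst x) < D"
  shows "\<exists>n G. mfamily (\<lambda>c. scale (\<iota> c)) (Sh n \<rho>) G \<and>
    module.span scale (fvals G) = module.span scale (fvals F) \<and> free_mod scale {0} G"
  using assms
proof (induction D arbitrary: \<sigma> \<rho> F)
  case 0
  then have "F = {}" by blast
  then show ?case using 0 by (intro exI[of _ 0] exI[of _ "{}"]) (simp add: free_mod_def)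
next
  case (Suc D)
  define Q where "Q t \<longleftrightarrow> (\<exists>n G. mfamily (\<lambda>c. scale (\<iota> c)) (Sh n \<rho>) G \<and> (\<forall>x\<in>G. sum_list (fst x) \<le> D) \<and>
     module.span scale (fvals G) = module.span scale (fvals F) \<and> card {x \<in> G. sum_list (fst x) = D} = t)" for t
  have "Q (card {x \<in> F. sum_list (fst x) = D})"
    unfolding Q_def using Suc.prems(3,4) by (intro exI[of _ 0] exI[of _ F]) (auto simp: less_Suc_eq_le)
  define t where "t = (LEAST t. Q t)"
  have "Q t" unfolding t_def by (rule LeastI) fact
  then obtain n G where G: "mfamily (\<lambda>c. scale (\<iota> c)) (Sh n \<rho>) G" "\<And>x. x \<in> G \<Longrightarrow> sum_list (fst x) \<le> D"
     "module.span scale (fvals G) = module.span scale (fvals F)" "card {x \<in> G. sum_list (fst x) = D} = t"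
    unfolding Q_def by blast
  interpret R: semilinear_rep scale \<iota> \<sigma> \<rho> by (rule Suc.prems(1))
  interpret S: semilinear_rep scale \<iota> "Sh n \<sigma>" "Sh n \<rho>" by (rule R.semilinear_rep_Sh)
  have fr: "cov_fractions \<iota> (Sh n \<sigma>)" by (rule R.cov_fractions_Sh[OF Suc.prems(2)])
  define Gl where "Gl = {x \<in> G. sum_list (fst x) < D}"
  define Gt where "Gt = {x \<in> G. sum_list (fst x) = D}"
  have GU: "G = Gl \<union> Gt" using G(2) by (force simp: Gl_def Gt_def)
  have mG: "mfamily (\<lambda>c. scale (\<iota> c)) (Sh n \<rho>) Gl" "mfamily (\<lambda>c. scale (\<iota> c)) (Sh n \<rho>) Gt"
    using mfamily_subset[OF G(1)] GU by blast+
  have free: "free_mod scale (R.span (fvals Gl)) Gt"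
  proof (rule ccontr)
    assume "\<not> free_mod scale (R.span (fvals Gl)) Gt"
    then have "\<exists>n' G'. mfamily (\<lambda>c. scale (\<iota> c)) (Sh n' (Sh n \<rho>)) G' \<and> (\<forall>x\<in>G'. sum_list (fst x) \<le> D) \<and>
       R.span (fvals G') = R.span (fvals G) \<and>
       card {x \<in> G'. sum_list (fst x) = D} < card {x \<in> G. sum_list (fst x) = D}"
      using S.ex_smaller_family[OF fr G(1,2)] unfolding Gl_def Gt_def by blast
    then obtain n' G' where "mfamily (\<lambda>c. scale (\<iota> c)) (Sh (n + n') \<rho>) G'" "\<forall>x\<in>G'. sum_list (fst x) \<le> D"
       "R.span (fvals G') = R.span (fvals G)" "card {x \<in> G'. sum_list (fst x) = D} < t"
      unfolding Sh_Sh G(4) by blast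
    then have "Q (card {x \<in> G'. sum_list (fst x) = D})" unfolding Q_def G(3) by blast
    then have "t \<le> card {x \<in> G'. sum_list (fst x) = D}" unfolding t_def by (rule Least_le)
    then show False using \<open>_ < t\<close> by simp
  qed
  have "\<exists>m G'. mfamily (\<lambda>c. scale (\<iota> c)) (Sh m (Sh n \<rho>)) G' \<and> R.span (fvals G') = R.span (fvals Gl) \<and> free_mod scale {0} G'"
    by (rule Suc.IH[OF S.semilinear_rep_axioms fr mG(1)]) (simp add: Gl_def)
  then obtain m G' where G': "mfamily (\<lambda>c. scale (\<iota> c)) (Sh m (Sh n \<rho>)) G'" "R.span (fvals G') = R.span (fvals Gl)"
    "free_mod scale {0} G'" by blast
  interpret T: semilinear_rep scale \<iota> "Sh m (Sh n \<sigma>)" "Sh m (Sh n \<rho>)" by (rule S.semilinear_rep_Sh)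
  obtain H0 where H0: "mfamily (\<lambda>c. scale (\<iota> c)) (Sh m (Sh n \<rho>)) H0" "R.M.span (fvals H0) = R.M.span (fvals Gt)"
    using S.M.shift_family[OF mG(2)] by blast
  obtain H where H: "H \<subseteq> H0" "R.M.span (fvals H) = R.M.span (fvals H0)" "free_mod (\<lambda>c. scale (\<iota> c)) {0} H"
    using T.M.free_subfamily[OF H0(1)] by blast
  have mH: "mfamily (\<lambda>c. scale (\<iota> c)) (Sh m (Sh n \<rho>)) H" by (rule mfamily_subset[OF H0(1) H(1)])
  have "fvals H \<subseteq> R.M.span (fvals Gt)" unfolding H0(2)[symmetric] H(2)[symmetric] by (rule R.M.span_superset)
  then have "free_mod scale (R.span (fvals Gl)) H"
    using mH by (intro S.free_mod_kspan[OF mG(2) free _ _ H(3)]) (auto simp: mfamily_def)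
  then have "free_mod scale {0} (G' \<union> H)"
    using T.free_mod_Un[OF G'(1,3) mH] G'(2) by simp
  moreover have "R.span (fvals (G' \<union> H)) = R.span (fvals F)"
  proof -
    have "R.span (fvals H) = R.span (fvals Gt)" using H(2) H0(2) by (intro S.span_eq_if_kspan_eq) simp
    then have "R.span (fvals G' \<union> fvals H) = R.span (fvals Gl \<union> fvals Gt)"
      using G'(2) by (simp add: R.span_Un)
    then show ?thesis using G(3) GU by (simp add: fvals_Un)
  qed
  moreover have "mfamily (\<lambda>c. scale (\<iota> c)) (Sh (n + m) \<rho>) (G' \<union> H)"
    using mfamily_Un[OF G'(1) mH] by (simp add: Sh_Sh)
  ultimately show ?case by blast
qed

subsection \<open>Tensors and Schur functors\<close>

lemma lookup_smul [simp]: "Poly_Mapping.lookup (smul a t) js = a * Poly_Mapping.lookup t js"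
  by (simp add: smul_def map.rep_eq when_def)

lemma smul_zero [simp]: "smul a 0 = 0"
  by (rule poly_mapping_eqI) simp

lemma lookup_sum_smul [simp]: "Poly_Mapping.lookup (sum_smul a t) i = smul a (Poly_Mapping.lookup t i)"
  by (simp add: sum_smul_def map.rep_eq when_def)

lemma tensor_act_zero [simp]: "tensor_act \<iota> \<tau> g 0 = 0"
  by (simp add: tensor_act_def)

lemma lookup_sum_act [simp]: "Poly_Mapping.lookup (sum_act \<iota> \<sigma> g t) i = tensor_act \<iota> (\<sigma> g) g (Poly_Mapping.lookup t i)"
  by (simp add: sum_act_def map.rep_eq when_def)

lemma vector_space_smul: "vector_space (smul :: 'l::field \<Rightarrow> _)"
  by unfold_locales (auto intro!: poly_mapping_eqI simp: lookup_add algebra_simps)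

lemma vector_space_sum_smul: "vector_space (sum_smul :: 'l::field \<Rightarrow> ('i \<Rightarrow>\<^sub>0 (nat list \<Rightarrow>\<^sub>0 'l)) \<Rightarrow> _)"
  by unfold_locales (auto intro!: poly_mapping_eqI simp: lookup_add algebra_simps)

lemma smul_single: "smul a (Poly_Mapping.single js b) = Poly_Mapping.single js (a * b)"
  by (rule poly_mapping_eqI) (simp add: lookup_single when_def)

lemma sum_smul_single: "sum_smul a (Poly_Mapping.single i t) = Poly_Mapping.single i (smul a t)"
  by (rule poly_mapping_eqI) (simp add: lookup_single when_def)

lemma poly_mapping_eq_sum_single: "t = (\<Sum>i\<in>Poly_Mapping.keys t. Poly_Mapping.single i (Poly_Mapping.lookup t i))"
  by (rule poly_mapping_eqI) (simp add: lookup_sum lookup_single when_def in_keys_iff)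

lemma single_sum: "Poly_Mapping.single i (\<Sum>j\<in>J. f j) = (\<Sum>j\<in>J. Poly_Mapping.single i (f j))"
  by (induction J rule: infinite_finite_induct) (simp_all add: single_add)

lemma tensor_power_words:
  assumes "t \<in> tensor_power d" obtains B where "n \<le> B" "Poly_Mapping.keys t \<subseteq> words B d"
proof -
  have "finite (\<Union>js\<in>Poly_Mapping.keys t. set js)" by simp
  then obtain C where "(\<Union>js\<in>Poly_Mapping.keys t. set js) \<subseteq> {..<C}" using finite_nat_iff_bounded by blast
  then have "Poly_Mapping.keys t \<subseteq> words (max n C) d"
    using assms by (force simp: tensor_power_def words_def)
  then show thesis using that by (metis max.cobounded1)
qed

context semilinear_rep
begin

lemma lookup_tensor_act:
  assumes g: "g \<in> GL" and A: "finite A" "Poly_Mapping.keys s \<subseteq> A"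
  shows "Poly_Mapping.lookup (tensor_act \<iota> (\<sigma> g) g s) ks =
    (\<Sum>js\<in>A. if length js = length ks then \<iota> (tensor_coeff g ks js) * \<sigma> g (Poly_Mapping.lookup s js) else 0)"
proof -
  have "Poly_Mapping.lookup (tensor_act \<iota> (\<sigma> g) g s) ks =
    (\<Sum>js\<in>Poly_Mapping.keys s. \<Sum>is | length is = length js \<and> tensor_coeff g is js \<noteq> 0.
      if is = ks then \<iota> (tensor_coeff g is js) * \<sigma> g (Poly_Mapping.lookup s js) else 0)"
    by (simp add: tensor_act_def lookup_sum lookup_single when_def)
  also have "\<dots> = (\<Sum>js\<in>Poly_Mapping.keys s. if length js = length ks then \<iota> (tensor_coeff g ks js) * \<sigma> g (Poly_Mapping.lookup s js) else 0)"
    by (rule sum.cong[OF refl], subst sum.delta[OF tensor_coeff_finite[OF g]]) auto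
  also have "\<dots> = (\<Sum>js\<in>A. if length js = length ks then \<iota> (tensor_coeff g ks js) * \<sigma> g (Poly_Mapping.lookup s js) else 0)"
    using A by (intro sum.mono_neutral_left) (auto simp: in_keys_iff K.act_zero[OF g])
  finally show ?thesis .
qed

lemma tensor_act_add:
  assumes g: "g \<in> GL"
  shows "tensor_act \<iota> (\<sigma> g) g (s + t) = tensor_act \<iota> (\<sigma> g) g s + tensor_act \<iota> (\<sigma> g) g t"
proof (rule poly_mapping_eqI)
  fix ks
  let ?A = "Poly_Mapping.keys s \<union> Poly_Mapping.keys t"
  have "Poly_Mapping.keys (s + t) \<subseteq> ?A" by (rule keys_add)
  then show "Poly_Mapping.lookup (tensor_act \<iota> (\<sigma> g) g (s + t)) ks =
      Poly_Mapping.lookup (tensor_act \<iota> (\<sigma> g) g s + tensor_act \<iota> (\<sigma> g) g t) ks"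
    by (simp add: lookup_add lookup_tensor_act[OF g, of ?A] field_act_add[OF g] distrib_left
      flip: sum.distrib) (auto intro!: sum.cong simp: distrib_left lookup_add field_act_add[OF g])
qed

lemma tensor_act_smul:
  assumes g: "g \<in> GL"
  shows "tensor_act \<iota> (\<sigma> g) g (smul a s) = smul (\<sigma> g a) (tensor_act \<iota> (\<sigma> g) g s)"
proof (rule poly_mapping_eqI)
  fix ks
  have "Poly_Mapping.keys (smul a s) \<subseteq> Poly_Mapping.keys s" by (auto simp: in_keys_iff)
  then show "Poly_Mapping.lookup (tensor_act \<iota> (\<sigma> g) g (smul a s)) ks =
      Poly_Mapping.lookup (smul (\<sigma> g a) (tensor_act \<iota> (\<sigma> g) g s)) ks"
    by (simp add: lookup_tensor_act[OF g, of "Poly_Mapping.keys s"] field_act_mult[OF g] sum_distrib_left)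
      (auto intro!: sum.cong simp: field_act_mult[OF g])
qed

lemma sum_act_add:
  "g \<in> GL \<Longrightarrow> sum_act \<iota> \<sigma> g (s + t) = sum_act \<iota> \<sigma> g s + sum_act \<iota> \<sigma> g t"
  by (rule poly_mapping_eqI) (simp add: lookup_add tensor_act_add)

lemma sum_act_smul:
  "g \<in> GL \<Longrightarrow> sum_act \<iota> \<sigma> g (sum_smul a t) = sum_smul (\<sigma> g a) (sum_act \<iota> \<sigma> g t)"
  by (rule poly_mapping_eqI) (simp add: tensor_act_smul)

end

section \<open>Polynomial elements as combinations of values of maps from tensor powers\<close>

lemma semilinear_rep_trivial: "semilinear_rep ((*) :: 'k::field_char_0 \<Rightarrow> _) id (\<lambda>_. id) (\<lambda>_. id)"
  by unfold_locales (simp_all add: algebra_simps)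

lemma GL_rep_tensor_sum:
  "GL_rep (sum_smul :: 'k::field_char_0 \<Rightarrow> ('i \<Rightarrow>\<^sub>0 (nat list \<Rightarrow>\<^sub>0 'k)) \<Rightarrow> _) (sum_act id (\<lambda>_. id))"
proof -
  interpret T: semilinear_rep "(*) :: 'k \<Rightarrow> _" id "\<lambda>_. id" "\<lambda>_. id" by (rule semilinear_rep_trivial)
  show ?thesis
    by (intro GL_rep.intro vector_space_sum_smul GL_rep_axioms.intro) (simp_all add: T.sum_act_add T.sum_act_smul)
qed

lemma basis_cov:
  "(\<lambda>js. Poly_Mapping.single i (Poly_Mapping.single js 1)) \<in>
    cov (sum_smul :: 'k::field_char_0 \<Rightarrow> ('i \<Rightarrow>\<^sub>0 (nat list \<Rightarrow>\<^sub>0 'k)) \<Rightarrow> _) (sum_act id (\<lambda>_. id)) d"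
  unfolding cov_def
proof (intro CollectI ballI allI impI)
  fix g :: "'k mtx" and js :: "nat list" assume js: "length js = d"
  have "sum_act id (\<lambda>_. id) g (Poly_Mapping.single i (Poly_Mapping.single js 1)) =
    Poly_Mapping.single i (tensor_act id id g (Poly_Mapping.single js 1))"
    by (rule poly_mapping_eqI) (simp add: lookup_single when_def)
  also have "tensor_act id id g (Poly_Mapping.single js 1) =
    (\<Sum>is | length is = d \<and> tensor_coeff g is js \<noteq> 0. Poly_Mapping.single is (tensor_coeff g is js))"
    by (simp add: tensor_act_def js)
  finally show "sum_act id (\<lambda>_. id) g (Poly_Mapping.single i (Poly_Mapping.single js 1)) =
    (\<Sum>is | length is = d \<and> tensor_coeff g is js \<noteq> 0.
      sum_smul (tensor_coeff g is js) (Poly_Mapping.single i (Poly_Mapping.single is 1)))"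
    by (simp only: single_sum sum_smul_single smul_single mult_1_right)
qed

context GL_rep
begin

text \<open>The element is the image of a tensor in \<open>X\<close>, but the basis tensors
  occurring in it may lie outside \<open>X\<close>, where nothing is known about \<phi>.
  Polarization expresses the tensor by values of maps from tensor powers into \<open>X\<close>, and
  these can be composed with \<phi>.\<close>

lemma pol_part_subset_span: "pol_part scale \<rho> \<subseteq> span (cov_values scale \<rho> UNIV)"
proof
  fix u assume "u \<in> pol_part scale \<rho>"
  then obtain U where U: "is_polynomial_subrep scale \<rho> U" "u \<in> U" by (auto simp: pol_part_def)
  from U(1) obtain X :: "('x \<times> nat \<Rightarrow>\<^sub>0 (nat list \<Rightarrow>\<^sub>0 'k)) set" and \<phi> where
    X: "is_subrep sum_smul (sum_act id (\<lambda>_. id)) X"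
      "hom_on sum_smul (sum_act id (\<lambda>_. id)) X scale \<rho> \<phi>" "\<phi> ` X = U"
    unfolding is_polynomial_subrep_def by blast
  interpret T: GL_rep "sum_smul :: 'k \<Rightarrow> ('x \<times> nat \<Rightarrow>\<^sub>0 (nat list \<Rightarrow>\<^sub>0 'k)) \<Rightarrow> _" "sum_act id (\<lambda>_. id)"
    by (rule GL_rep_tensor_sum)
  have st: "T.stable X" using X(1) unfolding T.stable_def is_subrep_def .
  then have sX: "T.subspace X" by (simp add: T.stable_def)
  have h: "x \<in> X \<Longrightarrow> y \<in> X \<Longrightarrow> \<phi> (x + y) = \<phi> x + \<phi> y" "x \<in> X \<Longrightarrow> \<phi> (sum_smul a x) = scale a (\<phi> x)"
    "g \<in> GL \<Longrightarrow> x \<in> X \<Longrightarrow> \<phi> (sum_act id (\<lambda>_. id) g x) = \<rho> g (\<phi> x)" for x y a g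
    using X(2) unfolding hom_on_def by simp_all
  have h0: "\<phi> 0 = 0" using h(2)[of 0 0] T.subspace_0[OF sX] by simp
  have hsum: "(\<And>i. i \<in> I \<Longrightarrow> f i \<in> X) \<Longrightarrow> \<phi> (\<Sum>i\<in>I. f i) = (\<Sum>i\<in>I. \<phi> (f i))" for I and f :: "nat list \<Rightarrow> _"
  proof (induction I rule: infinite_finite_induct)
    case (insert i I)
    then have "(\<Sum>i\<in>I. f i) \<in> X" by (intro T.subspace_sum[OF sX]) blast
    then show ?case using insert by (simp add: h(1))
  qed (simp_all add: h0)
  \<comment> \<open>The aim is \<open>t \<in> Y\<close>. As \<open>Y\<close> is a subspace,
    \<open>polar_recover\<close> reduces this to the polarizations of \<open>t\<close>.\<close>
  define Y where "Y = {x \<in> X. \<phi> x \<in> span (cov_values scale \<rho> UNIV)}"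
  have sY: "T.subspace Y"
    unfolding Y_def T.subspace_def using T.subspace_0[OF sX] T.subspace_add[OF sX] T.subspace_scale[OF sX]
    by (auto simp: h h0 span_zero span_add span_scale)
  obtain t where t: "t \<in> X" "\<phi> t = u" using U(2) X(3) by blast
  define Z where "Z = (SIGMA i:Poly_Mapping.keys t. Poly_Mapping.keys (Poly_Mapping.lookup t i))"
  define c where "c z = Poly_Mapping.lookup (Poly_Mapping.lookup t (fst z)) (snd z)" for z
  define e :: "('x \<times> nat) \<times> nat list \<Rightarrow> nat list \<Rightarrow> ('x \<times> nat \<Rightarrow>\<^sub>0 (nat list \<Rightarrow>\<^sub>0 'k))"
    where "e z js = Poly_Mapping.single (fst z) (Poly_Mapping.single js 1)" for z js
  have Z: "finite Z" by (simp add: Z_def)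
  have e: "e z \<in> cov sum_smul (sum_act id (\<lambda>_. id)) (length (snd z))" for z
    unfolding e_def[abs_def] by (rule basis_cov)
  have "t = (\<Sum>i\<in>Poly_Mapping.keys t. \<Sum>js\<in>Poly_Mapping.keys (Poly_Mapping.lookup t i). sum_smul (c (i, js)) (e (i, js) js))"
    by (subst poly_mapping_eq_sum_single[of t], rule sum.cong[OF refl], subst poly_mapping_eq_sum_single)
      (simp add: single_sum c_def e_def sum_smul_single smul_single)
  also have "\<dots> = (\<Sum>z\<in>Z. sum_smul (c z) (e z (snd z)))"
    unfolding Z_def by (subst sum.Sigma) (auto simp: case_prod_beta)
  finally have tZ: "t = (\<Sum>z\<in>Z. sum_smul (c z) (e z (snd z)))" .
  have "(\<Sum>z\<in>Z. sum_smul (c z) (e z (snd z))) \<in> Y"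
  proof (rule T.polar_recover[OF sY Z])
    fix p :: "nat list"
    define w where "w = T.polar Z c e snd p"
    have wX: "w js \<in> X" if "length js = length p" for js
      unfolding w_def by (rule T.polar_in[OF st Z e _ that]) (use t tZ in simp)
    have wc: "w \<in> cov sum_smul (sum_act id (\<lambda>_. id)) (length p)" unfolding w_def by (rule T.polar_cov[OF e])
    have "(\<lambda>js. \<phi> (w js)) \<in> cov scale \<rho> (length p)"
    proof (rule covI)
      fix g :: "'k mtx" and n B js assume g: "g \<in> GL" "g \<in> mtx_block n" "n \<le> B" and js: "js \<in> words B (length p)"
      have "\<rho> g (\<phi> (w js)) = \<phi> (\<Sum>is\<in>words B (length p). sum_smul (tensor_coeff g is js) (w is))"
        using h(3)[OF g(1) wX[OF words_length[OF js]]] T.covD[OF wc g js] by simp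
      also have "\<dots> = (\<Sum>is\<in>words B (length p). \<phi> (sum_smul (tensor_coeff g is js) (w is)))"
        by (rule hsum) (rule T.subspace_scale[OF sX wX[OF words_length]])
      also have "\<dots> = (\<Sum>is\<in>words B (length p). scale (tensor_coeff g is js) (\<phi> (w is)))"
        by (rule sum.cong[OF refl]) (rule h(2)[OF wX[OF words_length]])
      finally show "\<rho> g (\<phi> (w js)) = (\<Sum>is\<in>words B (length p). scale (tensor_coeff g is js) (\<phi> (w is)))" .
    qed
    then have "\<phi> (w p) \<in> cov_values scale \<rho> UNIV"
      unfolding cov_values_def by (intro CollectI exI[of _ "\<lambda>js. \<phi> (w js)"] exI[of _ p]) simp
    then show "T.polar Z c e snd p p \<in> Y"
      using wX[of p] unfolding Y_def w_def[symmetric] by (simp add: span_base)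
  qed
  then show "u \<in> span (cov_values scale \<rho> UNIV)" using t tZ by (simp add: Y_def)
qed

text \<open>The sum in the definition of \<open>cov\<close> writes \<open>\<rho> g (f js)\<close> by
  values of \<open>f\<close> for all \<open>g\<close> at once, so one decomposition of
  \<open>f\<close> serves the whole orbit.\<close>

lemma orbit_in_family_span:
  assumes "y \<in> span (cov_values scale \<rho> UNIV)"
  shows "\<exists>F. mfamily scale \<rho> F \<and> (\<forall>g\<in>GL. \<rho> g y \<in> span (fvals F))"
  using assms
proof (induction rule: span_induct_alt)
  case base
  show ?case by (rule exI[of _ "{}"]) (simp add: mfamily_def act_zero span_zero)
next
  case (step c v y)
  then obtain F where F: "mfamily scale \<rho> F" "\<And>g. g \<in> GL \<Longrightarrow> \<rho> g y \<in> span (fvals F)" by blast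
  obtain f js where f: "v = f js" "f \<in> cov scale \<rho> (length js)" using step.hyps by (auto simp: cov_values_def)
  obtain G where G: "mfamily scale \<rho> G" "span (fvals G) = span {f ks | ks. length ks = length js}"
    using ex_mfamily[OF f(2)] by blast
  have v: "\<rho> g v \<in> span (fvals G)" if g: "g \<in> GL" for g
  proof -
    have "\<rho> g (f js) = (\<Sum>is | length is = length js \<and> tensor_coeff g is js \<noteq> 0. scale (tensor_coeff g is js) (f is))"
      using f(2) g by (simp add: cov_def)
    also have "\<dots> \<in> span {f ks | ks. length ks = length js}"
      by (intro span_sum span_scale span_base) auto
    finally show ?thesis by (simp add: f(1) G(2))
  qed
  have "\<rho> g (scale c v + y) \<in> span (fvals (G \<union> F))" if g: "g \<in> GL" for g
    unfolding act_add[OF g] act_scale[OF g] fvals_Un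
    using span_mono_in[OF v[OF g], of "fvals G \<union> fvals F"] span_mono_in[OF F(2)[OF g], of "fvals G \<union> fvals F"]
    by (intro span_add span_scale) auto
  then show ?case using mfamily_Un[OF G(1) F(1)] by blast
qed

end

text \<open>Right multiplication of tensors is the left action of the inverted symmetrizer on
  coefficient functions. Through \<open>star\<close> it inherits the equation for the square of
  \<open>csum \<mu>\<close>.\<close>

lemma gact_star: "gact (*) (sum_list \<mu>) (star (csum \<mu>)) b ks = rmult \<mu> b ks"
  by (simp add: gact_def rmult_def)

lemma rmult_rmult:
  fixes b :: "nat list \<Rightarrow> 'f::field"
  assumes two: "(2::'f) \<noteq> 0" and \<mu>: "is_partition \<mu>" and ks: "length ks = sum_list \<mu>"
  shows "rmult \<mu> (rmult \<mu> b) ks = hook \<mu> * rmult \<mu> b ks"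
proof -
  interpret V: vector_space "(*) :: 'f \<Rightarrow> _" by unfold_locales (simp_all add: algebra_simps)
  let ?d = "sum_list \<mu>"
  have "rmult \<mu> (rmult \<mu> b) ks = gact (*) ?d (star (csum \<mu>)) (gact (*) ?d (star (csum \<mu>)) b) ks"
    unfolding gact_star[abs_def] by (simp only: gact_star gact_star[abs_def])
  also have "\<dots> = gact (*) ?d (star (csum \<mu>) * star (csum \<mu>)) b ks"
    by (rule V.gact_mult) (simp_all add: star_GA ks)
  also have "star (csum \<mu>) * star (csum \<mu>) = star (csum \<mu> * csum \<mu> :: 'f galg)"
    by (rule star_mult[where d = ?d, symmetric]) simp_all
  also have "\<dots> = sc (hook \<mu>) * star (csum \<mu>)"
    unfolding csum_sq[OF two \<mu>] by (rule poly_mapping_eqI) simp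
  also have "gact (*) ?d (sc (hook \<mu>) * star (csum \<mu>)) b ks = hook \<mu> * rmult \<mu> b ks"
    by (simp add: V.gact_sc gact_star)
  finally show ?thesis .
qed

section \<open>Comparison with the Young symmetrizer on tensors\<close>

lemma sum_lookup_csum:
  fixes F :: "bijn \<Rightarrow> 'f::comm_ring_1"
  shows "(\<Sum>g\<in>Sym (sum_list \<mu>). Poly_Mapping.lookup (csum \<mu>) g * F g) =
    (\<Sum>p\<in>stab (sum_list \<mu>) (rw \<mu>). \<Sum>q\<in>stab (sum_list \<mu>) (cl \<mu>). sgn_of q * F (p + q))"
proof -
  let ?d = "sum_list \<mu>"
  have e: "csum \<mu> = (\<Sum>p\<in>stab ?d (rw \<mu>). \<Sum>q\<in>stab ?d (cl \<mu>). Poly_Mapping.single (p + q) (sgn_of q) :: 'f galg)"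
    unfolding csum_def asum_def bsum_def by (simp add: sum_product mult_single)
  have "(\<Sum>g\<in>Sym ?d. Poly_Mapping.lookup (csum \<mu>) g * F g) =
    (\<Sum>g\<in>Sym ?d. \<Sum>p\<in>stab ?d (rw \<mu>). \<Sum>q\<in>stab ?d (cl \<mu>). if g = p + q then sgn_of q * F g else 0)"
    unfolding e lookup_sum lookup_single sum_distrib_right by (intro sum.cong refl) (simp add: when_def)
  also have "\<dots> = (\<Sum>p\<in>stab ?d (rw \<mu>). \<Sum>g\<in>Sym ?d. \<Sum>q\<in>stab ?d (cl \<mu>). if g = p + q then sgn_of q * F g else 0)"
    by (rule sum.swap)
  also have "\<dots> = (\<Sum>p\<in>stab ?d (rw \<mu>). \<Sum>q\<in>stab ?d (cl \<mu>). \<Sum>g\<in>Sym ?d. if g = p + q then sgn_of q * F g else 0)"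
    by (rule sum.cong[OF refl], rule sum.swap)
  also have "\<dots> = (\<Sum>p\<in>stab ?d (rw \<mu>). \<Sum>q\<in>stab ?d (cl \<mu>). sgn_of q * F (p + q))"
    using stab_Sym by (intro sum.cong refl) (simp add: sum.delta)
  finally show ?thesis .
qed

lemma stab_groups:
  "app ` stab (sum_list \<mu>) (rw \<mu>) = row_group \<mu>" "app ` stab (sum_list \<mu>) (cl \<mu>) = column_group \<mu>"
proof -
  have "app ` {g \<in> Sym d. Q (app g)} = {p. p permutes {..<d} \<and> Q p}" for d Q
  proof (intro equalityI subsetI)
    fix p assume p: "p \<in> {p. p permutes {..<d} \<and> Q p}"
    then have "of_perm p \<in> Sym d" "app (of_perm p) = p" using of_perm_Sym app_of_perm by blast+
    then show "p \<in> app ` {g \<in> Sym d. Q (app g)}" using p by (intro image_eqI[of _ _ "of_perm p"]) auto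
  qed (auto simp: Sym_def)
  note eq = this
  show "app ` stab (sum_list \<mu>) (rw \<mu>) = row_group \<mu>"
    unfolding stab_def row_group_def rw_def
    by (rule eq[where Q = "\<lambda>p. \<forall>i<sum_list \<mu>. fst (boxes \<mu> ! p i) = fst (boxes \<mu> ! i)"])
  show "app ` stab (sum_list \<mu>) (cl \<mu>) = column_group \<mu>"
    unfolding stab_def column_group_def cl_def
    by (rule eq[where Q = "\<lambda>p. \<forall>i<sum_list \<mu>. snd (boxes \<mu> ! p i) = snd (boxes \<mu> ! i)"])
qed

lemma young_symmetrizer_eq:
  "young_symmetrizer \<mu> t = (\<Sum>p\<in>stab (sum_list \<mu>) (rw \<mu>). \<Sum>q\<in>stab (sum_list \<mu>) (cl \<mu>). \<Sum>js\<in>Poly_Mapping.keys t.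
     Poly_Mapping.single (permute_list (app (p + q)) js) (sgn_of q * Poly_Mapping.lookup t js))"
proof -
  have inj: "inj_on app A" for A by (simp add: inj_on_def app_inject)
  show ?thesis
    unfolding young_symmetrizer_def stab_groups[symmetric] sum.reindex[OF inj] comp_def
    by (simp add: sgn_of_def comp_def)
qed

lemma lookup_young_symmetrizer:
  assumes t: "t \<in> tensor_power (sum_list \<mu>)" and ks: "length ks = sum_list \<mu>"
  shows "Poly_Mapping.lookup (young_symmetrizer \<mu> t) ks = rmult \<mu> (Poly_Mapping.lookup t) ks"
proof -
  let ?d = "sum_list \<mu>"
  have "(\<Sum>js\<in>Poly_Mapping.keys t. Poly_Mapping.lookup (Poly_Mapping.single (permute_list (app g) js) (c * Poly_Mapping.lookup t js)) ks) =
    c * Poly_Mapping.lookup t (permute_list (app (- g)) ks)" if g: "g \<in> Sym ?d" for g c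
  proof -
    have "(permute_list (app g) js = ks) = (js = permute_list (app (- g)) ks)" if "js \<in> Poly_Mapping.keys t" for js
    proof -
      have "length js = ?d" using t that by (simp add: tensor_power_def)
      then show ?thesis using permute_list_app_inv[of g js] permute_list_app_inv[of g ks] g ks by metis
    qed
    then have "(\<Sum>js\<in>Poly_Mapping.keys t. Poly_Mapping.lookup (Poly_Mapping.single (permute_list (app g) js) (c * Poly_Mapping.lookup t js)) ks) =
      (\<Sum>js\<in>Poly_Mapping.keys t. if js = permute_list (app (- g)) ks then c * Poly_Mapping.lookup t js else 0)"
      by (intro sum.cong refl) (simp add: lookup_single when_def del: app_uminus)
    then show ?thesis by (simp add: in_keys_iff del: app_uminus)
  qed
  then have "Poly_Mapping.lookup (young_symmetrizer \<mu> t) ks =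
    (\<Sum>p\<in>stab ?d (rw \<mu>). \<Sum>q\<in>stab ?d (cl \<mu>). sgn_of q * Poly_Mapping.lookup t (permute_list (app (- (p + q))) ks))"
    unfolding young_symmetrizer_eq lookup_sum using stab_Sym by (intro sum.cong refl) (simp del: app_uminus app_plus)
  also have "\<dots> = (\<Sum>g\<in>Sym ?d. Poly_Mapping.lookup (csum \<mu>) g * Poly_Mapping.lookup t (permute_list (app (- g)) ks))"
    by (rule sum_lookup_csum[symmetric])
  also have "\<dots> = rmult \<mu> (Poly_Mapping.lookup t) ks"
    unfolding rmult_def by (rule sum.reindex_bij_witness[where i = uminus and j = uminus]) auto
  finally show ?thesis .
qed

lemma tensor_powerI: "(\<And>js. length js \<noteq> d \<Longrightarrow> Poly_Mapping.lookup t js = 0) \<Longrightarrow> t \<in> tensor_power d"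
  by (auto simp: tensor_power_def in_keys_iff)

lemma tensor_powerD: "t \<in> tensor_power d \<Longrightarrow> length js \<noteq> d \<Longrightarrow> Poly_Mapping.lookup t js = 0"
  by (auto simp: tensor_power_def in_keys_iff)

lemma young_symmetrizer_tensor_power:
  assumes "t \<in> tensor_power (sum_list \<mu>)" shows "young_symmetrizer \<mu> t \<in> tensor_power (sum_list \<mu>)"
proof (rule tensor_powerI)
  fix js :: "nat list" assume "length js \<noteq> sum_list \<mu>"
  then show "Poly_Mapping.lookup (young_symmetrizer \<mu> t) js = 0"
    using assms unfolding young_symmetrizer_eq lookup_sum
    by (intro sum.neutral ballI) (auto simp: lookup_single when_def tensor_power_def)
qed

section \<open>Evaluation of maps on tensors and Schur functors over K\<close>

definition Ev :: "('f \<Rightarrow> 'x \<Rightarrow> 'x) \<Rightarrow> (nat list \<Rightarrow> 'x) \<Rightarrow> (nat list \<Rightarrow>\<^sub>0 'f::field) \<Rightarrow> 'x::ab_group_add" where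
  "Ev s \<phi> t = (\<Sum>js\<in>Poly_Mapping.keys t. s (Poly_Mapping.lookup t js) (\<phi> js))"

context vector_space
begin

lemma Ev_superset: "finite A \<Longrightarrow> Poly_Mapping.keys t \<subseteq> A \<Longrightarrow> Ev scale \<phi> t = (\<Sum>js\<in>A. scale (Poly_Mapping.lookup t js) (\<phi> js))"
  unfolding Ev_def by (rule sum.mono_neutral_left) (auto simp: in_keys_iff)

lemma Ev_add: "Ev scale \<phi> (s + t) = Ev scale \<phi> s + Ev scale \<phi> t"
proof -
  let ?A = "Poly_Mapping.keys s \<union> Poly_Mapping.keys t"
  have "Poly_Mapping.keys (s + t) \<subseteq> ?A" by (rule keys_add)
  then show ?thesis by (simp add: Ev_superset[of ?A] lookup_add scale_left_distrib sum.distrib)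
qed

lemma Ev_zero: "Ev scale \<phi> 0 = 0" by (simp add: Ev_def)

lemma Ev_sum: "Ev scale \<phi> (\<Sum>i\<in>I. f i) = (\<Sum>i\<in>I. Ev scale \<phi> (f i))"
  by (induction I rule: infinite_finite_induct) (simp_all add: Ev_zero Ev_add)

lemma Ev_single: "Ev scale \<phi> (Poly_Mapping.single js c) = scale c (\<phi> js)"
  by (simp add: Ev_superset[of "{js}"])

lemma Ev_smul: "Ev scale \<phi> (smul a t) = scale a (Ev scale \<phi> t)"
proof -
  have "Poly_Mapping.keys (smul a t) \<subseteq> Poly_Mapping.keys t" by (auto simp: in_keys_iff)
  then show ?thesis by (simp add: Ev_superset[of "Poly_Mapping.keys t"] scale_sum_right)
qed

end

context semilinear_rep
begin

lemma Ev_act: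
  assumes \<phi>: "\<phi> \<in> cov kscale \<rho> d" and s: "s \<in> tensor_power d" and g: "g \<in> GL"
  shows "Ev scale \<phi> (tensor_act \<iota> (\<sigma> g) g s) = \<rho> g (Ev scale \<phi> s)"
proof -
  have "\<rho> g (Ev scale \<phi> s) = (\<Sum>js\<in>Poly_Mapping.keys s. scale (\<sigma> g (Poly_Mapping.lookup s js)) (\<rho> g (\<phi> js)))"
    unfolding Ev_def by (simp add: M.act_sum[OF g] module_act_scale[OF g])
  also have "\<dots> = (\<Sum>js\<in>Poly_Mapping.keys s. \<Sum>is | length is = length js \<and> tensor_coeff g is js \<noteq> 0.
      scale (\<iota> (tensor_coeff g is js) * \<sigma> g (Poly_Mapping.lookup s js)) (\<phi> is))"
  proof (rule sum.cong[OF refl])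
    fix js assume "js \<in> Poly_Mapping.keys s"
    then have js: "length js = d" using s by (simp add: tensor_power_def)
    then have "\<rho> g (\<phi> js) = (\<Sum>is | length is = length js \<and> tensor_coeff g is js \<noteq> 0. kscale (tensor_coeff g is js) (\<phi> is))"
      using \<phi> g by (simp add: cov_def)
    then show "scale (\<sigma> g (Poly_Mapping.lookup s js)) (\<rho> g (\<phi> js)) = (\<Sum>is | length is = length js \<and> tensor_coeff g is js \<noteq> 0.
      scale (\<iota> (tensor_coeff g is js) * \<sigma> g (Poly_Mapping.lookup s js)) (\<phi> is))"
      by (simp add: scale_sum_right mult.commute)
  qed
  also have "\<dots> = Ev scale \<phi> (tensor_act \<iota> (\<sigma> g) g s)"
    by (simp add: tensor_act_def Ev_sum Ev_single)
  finally show ?thesis ..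
qed

lemma lookup_map_embed [simp]: "Poly_Mapping.lookup (Poly_Mapping.map \<iota> t) js = \<iota> (Poly_Mapping.lookup t js)"
  by (simp add: map.rep_eq when_def)

sublocale T: vector_space "smul :: 'K \<Rightarrow> (nat list \<Rightarrow>\<^sub>0 'K) \<Rightarrow> _"
  by (rule vector_space_smul)

text \<open>The image of a quasi-idempotent with nonzero factor is its eigenspace. For the way back,
  a tensor in the eigenspace is its own image up to \<open>hook \<mu>\<close>, and expanding it in
  basis tensors exhibits it as a combination over \<open>K\<close> of symmetrized tensors over
  \<open>k\<close>.\<close>

lemma base_change_schur_iff:
  assumes \<mu>: "is_partition \<mu>"
  shows "s \<in> base_change \<iota> (schur \<mu>) \<longleftrightarrow> s \<in> tensor_power (sum_list \<mu>) \<and>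
    (\<forall>ks. length ks = sum_list \<mu> \<longrightarrow> rmult \<mu> (Poly_Mapping.lookup s) ks = hook \<mu> * Poly_Mapping.lookup s ks)"
    (is "_ \<longleftrightarrow> ?R s")
proof
  let ?d = "sum_list \<mu>"
  assume "s \<in> base_change \<iota> (schur \<mu>)"
  then show "?R s"
    unfolding base_change_def
  proof (induction rule: T.span_induct_alt)
    case base
    show ?case by (auto intro: tensor_powerI simp: rmult_def)
  next
    case (step c v w)
    then obtain t where t: "t \<in> tensor_power ?d" "v = Poly_Mapping.map \<iota> (young_symmetrizer \<mu> t)"
      by (auto simp: schur_def)
    have v: "Poly_Mapping.lookup v js = (if length js = ?d then \<iota> (rmult \<mu> (Poly_Mapping.lookup t) js) else 0)" for js
      using lookup_young_symmetrizer[OF t(1)] tensor_powerD[OF young_symmetrizer_tensor_power[OF t(1)]]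
      by (simp add: t(2))
    have rv: "rmult \<mu> (Poly_Mapping.lookup v) ks = hook \<mu> * Poly_Mapping.lookup v ks" if ks: "length ks = ?d" for ks
    proof -
      have "rmult \<mu> (Poly_Mapping.lookup v) ks = rmult \<mu> (\<lambda>js. \<iota> (rmult \<mu> (Poly_Mapping.lookup t) js)) ks"
        unfolding rmult_def[of \<mu> "Poly_Mapping.lookup v"] rmult_def[of \<mu> "\<lambda>js. \<iota> (rmult \<mu> (Poly_Mapping.lookup t) js)"]
        using ks by (simp add: v)
      also have "\<dots> = \<iota> (hook \<mu> * rmult \<mu> (Poly_Mapping.lookup t) ks)"
        unfolding rmult_embed using rmult_rmult[OF _ \<mu> ks, of "Poly_Mapping.lookup t"] by simp
      finally show ?thesis using ks by (simp add: v embed_mult embed_hook)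
    qed
    have lin: "rmult \<mu> (Poly_Mapping.lookup (smul c v + w)) ks =
      c * rmult \<mu> (Poly_Mapping.lookup v) ks + rmult \<mu> (Poly_Mapping.lookup w) ks" for ks
      by (simp add: rmult_def lookup_add distrib_left sum.distrib sum_distrib_left mult_ac)
    have "rmult \<mu> (Poly_Mapping.lookup (smul c v + w)) ks = hook \<mu> * Poly_Mapping.lookup (smul c v + w) ks"
      if "length ks = ?d" for ks
      unfolding lin using rv[OF that] step.IH that by (simp add: lookup_add distrib_left mult_ac)
    moreover have "smul c v + w \<in> tensor_power ?d"
      using step.IH v by (intro tensor_powerI) (simp add: lookup_add tensor_powerD[of w ?d])
    ultimately show ?case by blast
  qed
next
  let ?d = "sum_list \<mu>"
  assume R: "?R s"
  define e where "e js = Poly_Mapping.map \<iota> (young_symmetrizer \<mu> (Poly_Mapping.single js 1))" for js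
  have e: "e js \<in> base_change \<iota> (schur \<mu>)" if "length js = ?d" for js
    unfolding base_change_def e_def schur_def using that
    by (intro T.span_base imageI) (auto simp: tensor_power_def)
  have le: "Poly_Mapping.lookup (e js) ks = (\<Sum>g\<in>Sym ?d. if permute_list (app g) ks = js then Poly_Mapping.lookup (csum \<mu>) (- g) else 0)"
    if "length js = ?d" "length ks = ?d" for js ks
  proof -
    have "Poly_Mapping.single js (1::'k) \<in> tensor_power ?d" using that by (auto simp: tensor_power_def)
    from lookup_young_symmetrizer[OF this that(2)]
    have "Poly_Mapping.lookup (e js) ks = \<iota> (rmult \<mu> (Poly_Mapping.lookup (Poly_Mapping.single js 1)) ks)" by (simp add: e_def)
    then show ?thesis
      by (simp add: rmult_def embed_sum embed_mult embed_csum lookup_single when_def) (auto intro!: sum.cong simp: embed_one)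
  qed
  have "s = smul (inverse (hook \<mu>)) (\<Sum>js\<in>Poly_Mapping.keys s. smul (Poly_Mapping.lookup s js) (e js))"
  proof (rule poly_mapping_eqI)
    fix ks
    have len: "length js = ?d" if "js \<in> Poly_Mapping.keys s" for js using R that by (simp add: tensor_power_def)
    show "Poly_Mapping.lookup s ks = Poly_Mapping.lookup (smul (inverse (hook \<mu>)) (\<Sum>js\<in>Poly_Mapping.keys s. smul (Poly_Mapping.lookup s js) (e js))) ks"
    proof (cases "length ks = ?d")
      case True
      have "(\<Sum>js\<in>Poly_Mapping.keys s. Poly_Mapping.lookup s js * Poly_Mapping.lookup (e js) ks) =
        (\<Sum>js\<in>Poly_Mapping.keys s. \<Sum>g\<in>Sym ?d. if permute_list (app g) ks = js then Poly_Mapping.lookup (csum \<mu>) (- g) * Poly_Mapping.lookup s js else 0)"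
        by (rule sum.cong[OF refl]) (auto simp: le[OF len True] sum_distrib_left mult.commute intro!: sum.cong)
      also have "\<dots> = (\<Sum>g\<in>Sym ?d. \<Sum>js\<in>Poly_Mapping.keys s. if permute_list (app g) ks = js then Poly_Mapping.lookup (csum \<mu>) (- g) * Poly_Mapping.lookup s js else 0)"
        by (rule sum.swap)
      also have "\<dots> = rmult \<mu> (Poly_Mapping.lookup s) ks"
        unfolding rmult_def by (intro sum.cong refl) (simp add: sum.delta' in_keys_iff)
      also have "\<dots> = hook \<mu> * Poly_Mapping.lookup s ks" using R True by blast
      finally show ?thesis using hook_neq_zero[OF \<mu>] by (simp add: lookup_sum)
    next
      case False
      have "Poly_Mapping.lookup (e js) ks = 0" if "js \<in> Poly_Mapping.keys s" for js
      proof -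
        have "Poly_Mapping.single js (1::'k) \<in> tensor_power ?d" using len[OF that] by (auto simp: tensor_power_def)
        from tensor_powerD[OF young_symmetrizer_tensor_power[OF this] False] show ?thesis by (simp add: e_def)
      qed
      then show ?thesis using R False by (simp add: lookup_sum tensor_powerD[of s ?d])
    qed
  qed
  also have "\<dots> \<in> base_change \<iota> (schur \<mu>)"
    unfolding base_change_def
  proof (intro T.span_scale T.span_sum)
    fix js assume "js \<in> Poly_Mapping.keys s"
    then have "length js = ?d" using R by (simp add: tensor_power_def)
    from e[OF this] show "e js \<in> module.span smul (Poly_Mapping.map \<iota> ` schur \<mu>)" unfolding base_change_def .
  qed
  finally show "s \<in> base_change \<iota> (schur \<mu>)" .
qed

text \<open>The diagonal action commutes with permutations of the factors, and
  \<open>\<sigma> g\<close> fixes the integral coefficients of \<open>csum \<mu>\<close>. So the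
  eigenspace of \<open>base_change_schur_iff\<close> is preserved although the action is only
  semilinear.\<close>

lemma base_change_schur_act:
  assumes \<mu>: "is_partition \<mu>" and s: "s \<in> base_change \<iota> (schur \<mu>)" and g: "g \<in> GL"
  shows "tensor_act \<iota> (\<sigma> g) g s \<in> base_change \<iota> (schur \<mu>)"
proof -
  let ?d = "sum_list \<mu>"
  have s': "s \<in> tensor_power ?d"
    "\<And>ks. length ks = ?d \<Longrightarrow> rmult \<mu> (Poly_Mapping.lookup s) ks = hook \<mu> * Poly_Mapping.lookup s ks"
    using s base_change_schur_iff[OF \<mu>] by blast+
  obtain B where B: "Poly_Mapping.keys s \<subseteq> words B ?d" using tensor_power_words[OF s'(1), of 0] by blast
  have \<sigma>_csum: "\<sigma> g (Poly_Mapping.lookup (csum \<mu>) h) = Poly_Mapping.lookup (csum \<mu>) h" for h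
    using field_act_embed[OF g] embed_csum by metis
  have \<sigma>_hook: "\<sigma> g (hook \<mu>) = hook \<mu>" using field_act_embed[OF g] embed_hook by metis
  have l: "Poly_Mapping.lookup (tensor_act \<iota> (\<sigma> g) g s) ks =
    (\<Sum>js\<in>words B ?d. \<iota> (tensor_coeff g ks js) * \<sigma> g (Poly_Mapping.lookup s js))" if "length ks = ?d" for ks
    unfolding lookup_tensor_act[OF g finite_words B] using that by (intro sum.cong refl) (simp add: words_length)
  have "Poly_Mapping.lookup (tensor_act \<iota> (\<sigma> g) g s) ks = 0" if "length ks \<noteq> ?d" for ks
    unfolding lookup_tensor_act[OF g finite_words B] using that by (intro sum.neutral ballI) (auto simp: words_length)
  then have tp: "tensor_act \<iota> (\<sigma> g) g s \<in> tensor_power ?d" by (rule tensor_powerI)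
  have "rmult \<mu> (Poly_Mapping.lookup (tensor_act \<iota> (\<sigma> g) g s)) ks = hook \<mu> * Poly_Mapping.lookup (tensor_act \<iota> (\<sigma> g) g s) ks"
    if ks: "length ks = ?d" for ks
  proof -
    have "rmult \<mu> (Poly_Mapping.lookup (tensor_act \<iota> (\<sigma> g) g s)) ks =
      (\<Sum>h\<in>Sym ?d. \<Sum>js\<in>words B ?d. \<iota> (tensor_coeff g ks js) * (Poly_Mapping.lookup (csum \<mu>) (- h) * \<sigma> g (Poly_Mapping.lookup s (permute_list (app h) js))))"
      unfolding rmult_def
    proof (rule sum.cong[OF refl])
      fix h assume h: "h \<in> Sym ?d"
      have "Poly_Mapping.lookup (tensor_act \<iota> (\<sigma> g) g s) (permute_list (app h) ks) =
        (\<Sum>js\<in>words B ?d. \<iota> (tensor_coeff g (permute_list (app h) ks) js) * \<sigma> g (Poly_Mapping.lookup s js))"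
        by (rule l) (simp add: ks)
      also have "\<dots> = (\<Sum>js\<in>words B ?d. \<iota> (tensor_coeff g (permute_list (app h) ks) (permute_list (app h) js)) * \<sigma> g (Poly_Mapping.lookup s (permute_list (app h) js)))"
        using sum_words_permute[OF Sym_uminus[OF h], where B = B and F = "\<lambda>a c. \<iota> (tensor_coeff g (permute_list (app h) ks) a) * \<sigma> g (Poly_Mapping.lookup s a)"]
        by (simp only: minus_minus)
      also have "\<dots> = (\<Sum>js\<in>words B ?d. \<iota> (tensor_coeff g ks js) * \<sigma> g (Poly_Mapping.lookup s (permute_list (app h) js)))"
        using h ks by (intro sum.cong refl) (simp add: tensor_coeff_permute words_length)
      finally show "Poly_Mapping.lookup (csum \<mu>) (- h) * Poly_Mapping.lookup (tensor_act \<iota> (\<sigma> g) g s) (permute_list (app h) ks) =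
        (\<Sum>js\<in>words B ?d. \<iota> (tensor_coeff g ks js) * (Poly_Mapping.lookup (csum \<mu>) (- h) * \<sigma> g (Poly_Mapping.lookup s (permute_list (app h) js))))"
        by (simp add: sum_distrib_left mult_ac)
    qed
    also have "\<dots> = (\<Sum>js\<in>words B ?d. \<Sum>h\<in>Sym ?d. \<iota> (tensor_coeff g ks js) * (Poly_Mapping.lookup (csum \<mu>) (- h) * \<sigma> g (Poly_Mapping.lookup s (permute_list (app h) js))))"
      by (rule sum.swap)
    also have "\<dots> = (\<Sum>js\<in>words B ?d. \<iota> (tensor_coeff g ks js) * \<sigma> g (rmult \<mu> (Poly_Mapping.lookup s) js))"
      by (simp add: rmult_def K.act_sum[OF g] field_act_mult[OF g] \<sigma>_csum sum_distrib_left)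
    also have "\<dots> = (\<Sum>js\<in>words B ?d. \<iota> (tensor_coeff g ks js) * (hook \<mu> * \<sigma> g (Poly_Mapping.lookup s js)))"
      by (intro sum.cong refl) (simp add: s'(2) words_length field_act_mult[OF g] \<sigma>_hook)
    finally show ?thesis by (simp add: l[OF ks] sum_distrib_left mult_ac)
  qed
  then show ?thesis using base_change_schur_iff[OF \<mu>] tp by blast
qed

end

context semilinear_rep
begin

lemma subspace_base_change: "T.subspace (base_change \<iota> W)"
  unfolding base_change_def by (rule T.subspace_span)

text \<open>On a symmetrized basis tensor, evaluation amounts to the action of
  \<open>csum \<mu>\<close> on \<phi>, which is multiplication by \<open>hook \<mu>\<close>. Hence
  all values of \<phi> are attained on the Schur functor.\<close>

lemma Ev_young_symmetrizer:
  assumes \<mu>: "is_partition \<mu>" and \<phi>: "\<phi> \<in> mcov kscale \<rho> \<mu>" and js: "length js = sum_list \<mu>"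
  shows "Ev scale \<phi> (smul (inverse (hook \<mu>)) (Poly_Mapping.map \<iota> (young_symmetrizer \<mu> (Poly_Mapping.single js 1)))) = \<phi> js"
proof -
  let ?d = "sum_list \<mu>"
  have map_sum: "Poly_Mapping.map \<iota> (\<Sum>i\<in>I. f i) = (\<Sum>i\<in>I. Poly_Mapping.map \<iota> (f i))" for I :: "'i set" and f :: "'i \<Rightarrow> nat list \<Rightarrow>\<^sub>0 'k"
    by (rule poly_mapping_eqI) (simp add: lookup_sum embed_sum)
  have map_single: "Poly_Mapping.map \<iota> (Poly_Mapping.single ks c) = Poly_Mapping.single ks (\<iota> c)" for ks c
    by (rule poly_mapping_eqI) (simp add: lookup_single when_def)
  have emb: "\<iota> (sgn_of q) = sgn_of q" for q by (simp add: sgn_of_def embed_of_int)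
  have "Poly_Mapping.map \<iota> (young_symmetrizer \<mu> (Poly_Mapping.single js 1)) =
    (\<Sum>p\<in>stab ?d (rw \<mu>). \<Sum>q\<in>stab ?d (cl \<mu>). Poly_Mapping.single (permute_list (app (p + q)) js) (sgn_of q))"
    unfolding young_symmetrizer_eq map_sum by (simp add: map_single emb del: app_plus)
  then have "Ev scale \<phi> (Poly_Mapping.map \<iota> (young_symmetrizer \<mu> (Poly_Mapping.single js 1))) =
    (\<Sum>p\<in>stab ?d (rw \<mu>). \<Sum>q\<in>stab ?d (cl \<mu>). scale (sgn_of q) (\<phi> (permute_list (app (p + q)) js)))"
    by (simp add: Ev_sum Ev_single del: app_plus)
  also have "\<dots> = gact scale ?d (csum \<mu>) \<phi> js"
  proof -
    have "csum \<mu> = (\<Sum>p\<in>stab ?d (rw \<mu>). \<Sum>q\<in>stab ?d (cl \<mu>). Poly_Mapping.single (p + q) (sgn_of q) :: 'K galg)"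
      unfolding csum_def asum_def bsum_def by (simp add: sum_product mult_single)
    moreover have "gact scale ?d (\<Sum>i\<in>I. x i) \<phi> js = (\<Sum>i\<in>I. gact scale ?d (x i) \<phi> js)" for I :: "bijn set" and x
      by (induction I rule: infinite_finite_induct) (simp_all add: gact_zero gact_add)
    moreover have "gact scale ?d (Poly_Mapping.single (p + q) c) \<phi> js = scale c (\<phi> (permute_list (app (p + q)) js))"
      if "p \<in> stab ?d (rw \<mu>)" "q \<in> stab ?d (cl \<mu>)" for p q c
    proof -
      have "gact scale ?d (Poly_Mapping.single (p + q) c) \<phi> js =
        (\<Sum>g\<in>Sym ?d. if g = p + q then scale c (\<phi> (permute_list (app (p + q)) js)) else 0)"
        unfolding gact_def by (intro sum.cong refl) (simp add: lookup_single when_def del: app_plus)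
      then show ?thesis using stab_Sym that by (simp del: app_plus)
    qed
    ultimately show ?thesis by (simp del: app_plus)
  qed
  also have "\<dots> = scale (hook \<mu>) (\<phi> js)" by (rule mcovD(2)[OF \<phi> js])
  finally show ?thesis using hook_neq_zero[OF \<mu>] by (simp add: Ev_smul)
qed

text \<open>Evaluation of the generators is an equivariant map from the sum of Schur functors onto
  the module. On a Schur functor \<open>rmult\<close> is multiplication by
  \<open>hook \<mu>\<close>, so freeness makes the kernel zero. The required map is the
  inverse.\<close>

lemma isomorphic_schur_sum:
  assumes G: "mfamily kscale \<rho> G" "free_mod scale {0} G" "span (fvals G) = UNIV"
  shows "\<exists>(\<mu>s :: nat list list) \<phi>. (\<forall>\<mu>\<in>set \<mu>s. is_partition \<mu>) \<and>
    hom_on scale \<rho> UNIV sum_smul (sum_act \<iota> \<sigma>) \<phi> \<and> bij_betw \<phi> UNIV (schur_sum \<iota> \<mu>s)"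
proof -
  obtain xs where xs: "set xs = G" "distinct xs"
    using finite_distinct_list G(1) by (auto simp: mfamily_def)
  define r where "r = length xs"
  define \<mu>s where "\<mu>s = map fst xs"
  define X where "X = schur_sum \<iota> \<mu>s"
  have xG: "xs ! i \<in> G" if "i < r" for i using xs that by (auto simp: r_def)
  have pm: "is_partition (fst x)" "snd x \<in> mcov kscale \<rho> (fst x)" if "x \<in> G" for x
    using G(1) that by (auto simp: mfamily_def)
  have X: "t \<in> X \<longleftrightarrow> Poly_Mapping.keys t \<subseteq> {..<r} \<and> (\<forall>i<r. Poly_Mapping.lookup t i \<in> base_change \<iota> (schur (fst (xs ! i))))" for t
    by (simp add: X_def schur_sum_def \<mu>s_def r_def)
  define E where "E t = (\<Sum>i<r. Ev scale (snd (xs ! i)) (Poly_Mapping.lookup t i))" for t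
  have E_add: "E (s + t) = E s + E t" for s t by (simp add: E_def lookup_add Ev_add sum.distrib)
  have E_smul: "E (sum_smul a t) = scale a (E t)" for a t by (simp add: E_def Ev_smul scale_sum_right)
  note sb = T.subspace_0[OF subspace_base_change] T.subspace_add[OF subspace_base_change] T.subspace_scale[OF subspace_base_change]
  have X0: "0 \<in> X" by (simp add: X sb)
  have XD: "Poly_Mapping.lookup t i = 0" if "t \<in> X" "r \<le> i" for t i
    using that unfolding X by (meson in_keys_iff lessThan_iff not_less subsetD)
  have XI: "t \<in> X" if "\<And>i. r \<le> i \<Longrightarrow> Poly_Mapping.lookup t i = 0"
    "\<And>i. i < r \<Longrightarrow> Poly_Mapping.lookup t i \<in> base_change \<iota> (schur (fst (xs ! i)))" for t
    using that unfolding X by (metis in_keys_iff lessThan_iff not_less subsetI)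
  have XB: "Poly_Mapping.lookup t i \<in> base_change \<iota> (schur (fst (xs ! i)))" if "t \<in> X" "i < r" for t i
    using that unfolding X by blast
  have X_add: "s + t \<in> X" if "s \<in> X" "t \<in> X" for s t
    using that XD XB by (intro XI) (simp_all add: lookup_add sb)
  have X_smul: "sum_smul a t \<in> X" if "t \<in> X" for a t
    using that XD XB by (intro XI) (simp_all add: sb)
  have X_act: "sum_act \<iota> \<sigma> g t \<in> X" if "g \<in> GL" "t \<in> X" for g t
    using that XD XB pm(1) xG by (intro XI) (simp_all add: base_change_schur_act)
  have E_act: "E (sum_act \<iota> \<sigma> g t) = \<rho> g (E t)" if g: "g \<in> GL" and t: "t \<in> X" for g t
    unfolding E_def M.act_sum[OF g] lookup_sum_act
  proof (rule sum.cong[OF refl])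
    fix i assume "i \<in> {..<r}"
    then have i: "i < r" by simp
    have "Poly_Mapping.lookup t i \<in> tensor_power (sum_list (fst (xs ! i)))"
      using XB[OF t i] base_change_schur_iff[OF pm(1)[OF xG[OF i]]] by blast
    then show "Ev scale (snd (xs ! i)) (tensor_act \<iota> (\<sigma> g) g (Poly_Mapping.lookup t i)) =
      \<rho> g (Ev scale (snd (xs ! i)) (Poly_Mapping.lookup t i))"
      using mcovD(1)[OF pm(2)[OF xG[OF i]]] g by (intro Ev_act)
  qed
  have ker: "t = 0" if t: "t \<in> X" and E0: "E t = 0" for t
  proof -
    \<comment> \<open>Freeness indexes coefficients by generators, a tensor by positions in
      \<open>xs\<close>; as \<open>xs\<close> is distinct, the position can be recovered from the
      generator.\<close>
    define idx where "idx = inv_into {..<r} ((!) xs)"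
    have bij: "bij_betw ((!) xs) {..<r} G" unfolding r_def xs(1)[symmetric] by (rule bij_betw_nth[OF xs(2)]) simp_all
    then have idx: "idx (xs ! i) = i" if "i < r" for i
      unfolding idx_def using that by (intro inv_into_f_f) (auto simp: bij_betw_def)
    have tp: "Poly_Mapping.lookup t i \<in> tensor_power (sum_list (fst (xs ! i)))"
      "\<And>ks. length ks = sum_list (fst (xs ! i)) \<Longrightarrow> rmult (fst (xs ! i)) (Poly_Mapping.lookup (Poly_Mapping.lookup t i)) ks =
         hook (fst (xs ! i)) * Poly_Mapping.lookup (Poly_Mapping.lookup t i) ks" if i: "i < r" for i
      using XB[OF t i] base_change_schur_iff[OF pm(1)[OF xG[OF i]]] by blast+
    have "\<exists>C. \<forall>i<r. \<forall>js\<in>Poly_Mapping.keys (Poly_Mapping.lookup t i). set js \<subseteq> {..<C}"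
    proof -
      have "finite (\<Union>i<r. \<Union>js\<in>Poly_Mapping.keys (Poly_Mapping.lookup t i). set js)" by simp
      then obtain C where C: "(\<Union>i<r. \<Union>js\<in>Poly_Mapping.keys (Poly_Mapping.lookup t i). set js) \<subseteq> {..<C}" using finite_nat_iff_bounded by blast
      show ?thesis by (intro exI[of _ C] allI impI ballI subsetI) (use C in blast)
    qed
    then obtain C where C: "\<forall>i<r. \<forall>js\<in>Poly_Mapping.keys (Poly_Mapping.lookup t i). set js \<subseteq> {..<C}" ..
    have keys: "Poly_Mapping.keys (Poly_Mapping.lookup t i) \<subseteq> words C (sum_list (fst (xs ! i)))" if "i < r" for i
      using C tp(1)[OF that] that by (auto simp: words_def tensor_power_def)
    define b where "b x = Poly_Mapping.lookup (Poly_Mapping.lookup t (idx x))" for x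
    have "E t = (\<Sum>i<r. \<Sum>js\<in>words C (sum_list (fst (xs ! i))). scale (b (xs ! i) js) (snd (xs ! i) js))"
      unfolding E_def by (rule sum.cong[OF refl]) (simp add: Ev_superset[OF finite_words keys] b_def idx)
    also have "\<dots> = (\<Sum>x\<in>G. \<Sum>js\<in>words C (sum_list (fst x)). scale (b x js) (snd x js))"
      by (rule sum.reindex_bij_betw[OF bij])
    finally have "(\<Sum>x\<in>G. \<Sum>js\<in>words C (sum_list (fst x)). scale (b x js) (snd x js)) \<in> {0}" using E0 by simp
    note free = free_modD[OF G(2) this]
    have "Poly_Mapping.lookup t i = 0" for i
    proof (cases "i < r")
      case True
      show ?thesis
      proof (rule ccontr)
        assume "Poly_Mapping.lookup t i \<noteq> 0"
        then obtain ks where ks: "ks \<in> Poly_Mapping.keys (Poly_Mapping.lookup t i)" by (metis all_not_in_conv keys_eq_empty)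
        then have kw: "ks \<in> words C (sum_list (fst (xs ! i)))" using keys[OF True] by blast
        have "hook (fst (xs ! i)) * Poly_Mapping.lookup (Poly_Mapping.lookup t i) ks = 0"
          using free[OF xG[OF True] kw] tp(2)[OF True words_length[OF kw]] by (simp add: b_def idx[OF True])
        then show False using hook_neq_zero[OF pm(1)[OF xG[OF True]]] ks by (simp add: in_keys_iff)
      qed
    qed (use XD[OF t] in simp)
    then show "t = 0" by (intro poly_mapping_eqI) simp
  qed
  have inj: "inj_on E X"
  proof (rule inj_onI)
    fix s t assume st: "s \<in> X" "t \<in> X" "E s = E t"
    have d: "s - t = s + sum_smul (- 1) t" by (intro poly_mapping_eqI) (simp add: lookup_add lookup_minus)
    have "s - t \<in> X" unfolding d by (intro X_add X_smul st)
    moreover have "E (s - t) = 0" unfolding d E_add E_smul using st(3) by simp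
    ultimately show "s = t" using ker by fastforce
  qed
  have surj: "E ` X = UNIV"
  proof -
    have "subspace (E ` X)"
      unfolding subspace_def
    proof (intro conjI ballI allI)
      have "E 0 = 0" by (simp add: E_def Ev_zero)
      then show "0 \<in> E ` X" using X0 by (metis image_eqI)
      show "x + y \<in> E ` X" if "x \<in> E ` X" "y \<in> E ` X" for x y using that X_add E_add by (auto simp flip: E_add)
      show "scale c x \<in> E ` X" if "x \<in> E ` X" for c x using that X_smul by (auto simp flip: E_smul)
    qed
    moreover have "fvals G \<subseteq> E ` X"
    proof
      fix v assume "v \<in> fvals G"
      then obtain x js where x: "x \<in> G" "length js = sum_list (fst x)" "v = snd x js" by (force simp: fvals_def)
      obtain i where i: "i < r" "xs ! i = x" using x(1) xs(1) by (auto simp: in_set_conv_nth r_def)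
      define s where "s = smul (inverse (hook (fst x))) (Poly_Mapping.map \<iota> (young_symmetrizer (fst x) (Poly_Mapping.single js 1)))"
      have "Poly_Mapping.single js (1::'k) \<in> tensor_power (sum_list (fst x))" using x(2) by (auto simp: tensor_power_def)
      then have s: "s \<in> base_change \<iota> (schur (fst x))"
        unfolding s_def base_change_def schur_def by (intro T.span_scale T.span_base imageI)
      have "Poly_Mapping.single i s \<in> X"
        using s i by (intro XI) (auto simp: lookup_single when_def sb)
      moreover have "E (Poly_Mapping.single i s) = (\<Sum>j<r. if j = i then Ev scale (snd x) s else 0)"
        unfolding E_def using i by (intro sum.cong refl) (simp add: lookup_single when_def Ev_zero)
      then have "E (Poly_Mapping.single i s) = v"
        using i Ev_young_symmetrizer[OF pm[OF x(1)] x(2)] x(3) by (simp add: s_def)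
      ultimately show "v \<in> E ` X" by blast
    qed
    ultimately have "span (fvals G) \<subseteq> E ` X" by (rule span_minimal[rotated])
    then show ?thesis using G(3) by blast
  qed
  define \<phi> where "\<phi> = inv_into X E"
  have \<phi>X: "\<phi> v \<in> X" and E\<phi>: "E (\<phi> v) = v" for v
    using surj inv_into_into[of v E X] f_inv_into_f[of v E X] by (auto simp: \<phi>_def)
  have \<phi>I: "\<phi> v = t" if "t \<in> X" "E t = v" for v t
    using inv_into_f_f[OF inj that(1)] that(2) by (simp add: \<phi>_def)
  have "hom_on scale \<rho> UNIV sum_smul (sum_act \<iota> \<sigma>) \<phi>"
    unfolding hom_on_def
    by (intro conjI ballI allI; rule \<phi>I) (simp_all add: X_add X_smul X_act E_add E_smul E_act \<phi>X E\<phi>)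
  moreover have "bij_betw \<phi> UNIV X"
    unfolding \<phi>_def using bij_betw_inv_into[of E X UNIV] inj surj by (simp add: bij_betw_def)
  moreover have "\<forall>\<mu>\<in>set \<mu>s. is_partition \<mu>" using pm(1) xs(1) by (auto simp: \<mu>s_def)
  ultimately show ?thesis unfolding X_def by blast
qed

end

theorem theorem1p1:
  fixes \<iota> :: "'k::field_char_0 \<Rightarrow> 'K::field"
    and \<sigma> :: "'k mtx \<Rightarrow> 'K \<Rightarrow> 'K"
    and scale :: "'K \<Rightarrow> 'm::ab_group_add \<Rightarrow> 'm"
    and \<rho> :: "'k mtx \<Rightarrow> 'm \<Rightarrow> 'm"
  assumes "GL_field \<iota> \<sigma>"
    and "GL_module \<iota> \<sigma> scale \<rho>"
    and "finitely_generated scale \<rho>"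
  shows "\<exists>(n::nat) (\<mu>s :: nat list list) \<phi>.
           (\<forall>\<mu> \<in> set \<mu>s. is_partition \<mu>) \<and>
           hom_on scale (Sh n \<rho>) UNIV sum_smul (sum_act \<iota> (Sh n \<sigma>)) \<phi> \<and>
           bij_betw \<phi> UNIV (schur_sum \<iota> \<mu>s)"
proof -
  interpret A: GL_module \<iota> \<sigma> scale \<rho> by (rule assms(2))
  interpret R: semilinear_rep scale \<iota> \<sigma> \<rho>
    by unfold_locales
      (simp_all add: A.embed_one A.embed_add A.embed_mult A.act_add A.act_mult A.act_embed A.module_act_add A.module_act_scale)
  have fr: "cov_fractions \<iota> \<sigma>"
    unfolding cov_fractions_def Let_def
  proof
    fix a
    obtain r s where "r \<in> pol_part (\<lambda>c x. \<iota> c * x) \<sigma>" "s \<in> pol_part (\<lambda>c x. \<iota> c * x) \<sigma>" "s \<noteq> 0" "a = r / s"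
      using A.fraction_pol[of a] by blast
    then show "\<exists>r\<in>R.P. \<exists>s\<in>R.P. s \<noteq> 0 \<and> a = r / s" using R.K.pol_part_subset_span by blast
  qed
  obtain F where F: "finite F" "A.span {\<rho> g x | g x. g \<in> GL \<and> x \<in> F} = UNIV"
    using assms(3) by (auto simp: finitely_generated_def)
  \<comment> \<open>\<open>x\<close> is a multiple of a polynomial element, and \<open>g\<close>
    carries the scalar to another scalar of \<open>K\<close>. So it suffices to follow the orbit of
    the polynomial element.\<close>
  have "\<exists>H. mfamily (\<lambda>c. scale (\<iota> c)) \<rho> H \<and> (\<forall>g\<in>GL. \<rho> g x \<in> A.span (fvals H))" for x
  proof -
    obtain a y where y: "y \<in> pol_part (\<lambda>c. scale (\<iota> c)) \<rho>" "x = scale a y" using A.multiple_pol[of x] by blast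
    then have "y \<in> R.M.span (cov_values (\<lambda>c. scale (\<iota> c)) \<rho> UNIV)" using R.M.pol_part_subset_span by blast
    from R.M.orbit_in_family_span[OF this] obtain H where
      H: "mfamily (\<lambda>c. scale (\<iota> c)) \<rho> H" "\<forall>g\<in>GL. \<rho> g y \<in> R.M.span (fvals H)" by blast
    have "\<rho> g x \<in> A.span (fvals H)" if g: "g \<in> GL" for g
      unfolding y(2) A.module_act_scale[OF g] using H(2) g R.kspan_subset_span by (intro A.span_scale) blast
    then show ?thesis using H(1) by blast
  qed
  then obtain H where H: "\<And>x. mfamily (\<lambda>c. scale (\<iota> c)) \<rho> (H x)" "\<And>x g. g \<in> GL \<Longrightarrow> \<rho> g x \<in> A.span (fvals (H x))"
    by metis
  define H' where "H' = (\<Union>x\<in>F. H x)"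
  have mH: "mfamily (\<lambda>c. scale (\<iota> c)) \<rho> H'" using H(1) F(1) by (auto simp: H'_def mfamily_def)
  have "\<rho> g x \<in> A.span (fvals H')" if "g \<in> GL" "x \<in> F" for g x
  proof (rule A.span_mono_in[OF H(2)[OF that(1)]])
    show "fvals (H x) \<subseteq> fvals H'" using that(2) by (intro fvals_mono) (auto simp: H'_def)
  qed
  then have "{\<rho> g x | g x. g \<in> GL \<and> x \<in> F} \<subseteq> A.span (fvals H')" by blast
  from A.span_minimal[OF this A.subspace_span] have spH: "A.span (fvals H') = UNIV" using F(2) by blast
  have "finite ((\<lambda>x. sum_list (fst x)) ` H')" using mH by (simp add: mfamily_def)
  then obtain D where D: "\<And>x. x \<in> H' \<Longrightarrow> sum_list (fst x) < D"
    unfolding finite_nat_set_iff_bounded by blast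
  obtain n G where G: "mfamily (\<lambda>c. scale (\<iota> c)) (Sh n \<rho>) G" "A.span (fvals G) = A.span (fvals H')" "free_mod scale {0} G"
    using free_family[OF R.semilinear_rep_axioms fr mH D] by blast
  show ?thesis
    using semilinear_rep.isomorphic_schur_sum[OF R.semilinear_rep_Sh G(1,3)] G(2) spH by simp blast
qed

end
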